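(* Let $\alpha>0$, $H\in(1/2,1)$, and let $\nu$ be the fractional Ornstein-Uhlenbeck measure on $\Omega$ with parameters $\alpha,H$. Let $C_1$ be a constant such that $$|K(s,t)|\le C_1t^{\frac12-H}\qquad(0<t\le s\le1),$$ and let $C_2$ be the constant such that $$\int_0^s\frac{s^{\frac12-H}-u^{\frac12-H}}{(s-u)^{\frac12+H}}\,du=C_2s^{1-2H}\qquad(0<s\le1).$$ Then for every $F\in Dom(D)$, $$\mathbb{E}_\nu[F^2\ln F^2]\le4\left(1+\frac{4\alpha^4e^{2\alpha}C_1^2(1+\alpha^2)C}{2-2H}+\frac{2\alpha^2\widehat{C}}{2-2H}\right)\langle DF,DF\rangle_{\mathcal{H}_H}+\mathbb{E}_\nu[F^2]\ln\mathbb{E}_\nu[F^2],$$ where $$C=\frac{1}{\Gamma^2(\frac32-H)(2-2H)}+\frac{4}{\Gamma^2(\frac32-H)(2-2H)}+\frac{C_2^2(H-\frac12)^2}{\Gamma^2(\frac32-H)(2-2H)},$$ $$\widehat{C}=\frac{C_1^2}{\Gamma^2(\frac32-H)(2-2H)}+\frac{4C_1^2}{\Gamma^2(\frac32-H)(2-2H)}+\frac{2c_H^2\left(\left(B(H-\frac12,\frac32-H)\right)^2+\frac{1}{(H-\frac12)^2}\right)}{\Gamma^2(\frac32-H)}+\frac{C_1^2C_2^2(H-\frac12)^2}{\Gamma^2(\frac32-H)(2-2H)},$$ and $B(\cdot,\cdot)$ is the beta function.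
   Context: $\Omega$ is the space of $\mathbb{R}^n$-valued continuous functions on $[0,1]$ with initial value zero, with the topology of local uniform convergence. $\nu$ is the fractional Ornstein-Uhlenbeck measure on $\Omega$, i.e. the probability measure under which the coordinate process $X_t(\omega)=\omega_t$ satisfies $dX_t=-\alpha X_t\,dt+dB^H_t$, $X_0=0$, where $(B^H_t)_{0\le t\le1}$ is an $n$-dimensional fractional Brownian motion with Hurst parameter $H\in(1/2,1)$. $\mathcal F$ is the $\nu$-completion of the Borel $\sigma$-algebra of $\Omega$ and $(\mathcal F_t)$ is the $\nu$-completed natural filtration of $\omega$. For $F:\Omega\to\mathbb{R}$, $F\in L^2(\Omega;\nu)$ means $\mathbb{E}_\nu|F|^2<\infty$; for an $\mathbb{R}^n$-valued process $h=(h_t)_{0\le t\le1}$, $h\in L^2(\Omega;\nu)$ means $\mathbb{E}_\nu[\int_0^1|h_t|^2dt]<\infty$. The convention $0\ln0=0$ is used. $\Gamma$ is the Gamma function. The operator $K$ is $(Kh)_t=\int_0^tK(t,s)h_s\,ds$ with kernel $$K(t,s)=c_H s^{\frac12-H}\int_s^t u^{H-\frac12}(u-s)^{H-\frac32}\,du\; I_{[0,t]}(s),\qquad c_H=\sqrt{\frac{H(2H-1)}{B(2-2H,H-\frac12)}},$$ where $B(\cdot,\cdot)$ is the beta function and $I_{[0,t]}$ is the indicator function of $[0,t]$. $K$ is an isomorphism from $L^2$ onto its image $I_{0+}^{H+1/2}(L^2)$ (left-sided Riemann-Liouville fractional integrals of order $H+\frac12$), and $K^{-1}$ is its inverse. $\mathcal{H}_H=\{Kh\mid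 h\text{ is an adapted process and }h\in L^2(\Omega;\nu)\}$, with scalar product $\langle Kh,Kg\rangle_{\mathcal{H}_H}=\mathbb{E}_\nu[\int_0^1\langle h_t,g_t\rangle dt]$; the same formula is used for $DF$, so $\langle DF,DF\rangle_{\mathcal{H}_H}=\mathbb{E}_\nu[\int_0^1|(K^{-1}DF)_t|^2dt]$. The directional derivative of $F$ along $Kh$ is $D_hF(\omega)=\lim_{\delta\to0}\frac1\delta\left(F(\omega+\delta (Kh))-F(\omega)\right)$. The smooth cylindrical functions are $F(\omega)=f(\omega_{t_1},\dots,\omega_{t_m})$ with $0<t_1\le\dots\le t_m\le1$ and $f\in C^\infty((\mathbb{R}^n)^m)$; for these, $D_hF(\omega)=\sum_{i=1}^m\langle\nabla^if(\omega_{t_1},\dots,\omega_{t_m}),(Kh)_{t_i}\rangle_{\mathbb{R}^n}$, where $\nabla^i$ is the gradient in the $i$-th variable. The gradient $DF$ is determined, $\omega$ by $\omega$, by $DF(\omega)\in K(L^2([0,1];\mathbb{R}^n))$ and $D_hF=\int_0^1\langle(K^{-1}DF)_t,h_t\rangle dt$. $D$ is closable, and $Dom(D)$ is the domain of its closure in $L^2(\Omega;\nu)$. *)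

theory Defs
  imports "HOL-Probability.Probability"
begin

section \<open>Path space\<close>

text \<open>A continuous path on \<open>[0,1]\<close> is represented by its constant extension to the real line, so
  that the norm of \<^typ>\<open>real \<Rightarrow>\<^sub>C (real^'n)\<close> restricts to the supremum norm on \<open>[0,1]\<close>, and the
  topology of \<open>\<Omega>\<close> is the one of uniform convergence on \<open>[0,1]\<close>.\<close>

definition path_space :: "(real \<Rightarrow>\<^sub>C (real^'n)) set" where
  "path_space = {\<omega>. apply_bcontfun \<omega> 0 = 0 \<and>
     (\<forall>t. apply_bcontfun \<omega> t = apply_bcontfun \<omega> (clamp 0 1 t))}"


section \<open>The fractional Ornstein-Uhlenbeck measure\<close>

text \<open>Constants count as (degenerate) Gaussian random variables.\<close>

definition gaussian_rv :: "'w measure \<Rightarrow> ('w \<Rightarrow> real) \<Rightarrow> bool" where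
  "gaussian_rv M X \<longleftrightarrow> X \<in> borel_measurable M \<and>
     (\<exists>\<mu>. (AE \<omega> in M. X \<omega> = \<mu>) \<or> (\<exists>\<sigma>>0. distributed M lborel X (normal_density \<mu> \<sigma>)))"

definition fractional_BM :: "'w measure \<Rightarrow> real \<Rightarrow> (real \<Rightarrow> 'w \<Rightarrow> real^'n) \<Rightarrow> bool" where
  "fractional_BM M H B \<longleftrightarrow>
     (\<forall>t\<in>{0..1}. B t \<in> borel_measurable M) \<and>
     (AE \<omega> in M. continuous_on {0..1} (\<lambda>t. B t \<omega>)) \<and>
     (\<forall>m (a :: nat \<Rightarrow> real^'n) t. (\<forall>i<m. t i \<in> {0..1}) \<longrightarrow>
        gaussian_rv M (\<lambda>\<omega>. \<Sum>i<m. a i \<bullet> B (t i) \<omega>)) \<and>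
     (\<forall>t\<in>{0..1}. (LINT \<omega>|M. B t \<omega>) = 0) \<and>
     (\<forall>s\<in>{0..1}. \<forall>t\<in>{0..1}. \<forall>i j. (LINT \<omega>|M. B s \<omega> $ i * B t \<omega> $ j) =
        (if i = j then (s powr (2*H) + t powr (2*H) - \<bar>t - s\<bar> powr (2*H)) / 2 else 0))"

definition fractional_OU_measure ::
    "real \<Rightarrow> real \<Rightarrow> (real \<Rightarrow>\<^sub>C (real^'n)) measure \<Rightarrow> bool" where
  "fractional_OU_measure \<alpha> H \<nu> \<longleftrightarrow>
     prob_space \<nu> \<and> sets \<nu> = sets (restrict_space borel path_space) \<and>
     (\<exists>B. fractional_BM \<nu> H B \<and>
        (AE \<omega> in \<nu>. \<forall>t\<in>{0..1}. apply_bcontfun \<omega> t =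
           - \<alpha> *\<^sub>R (LINT s:{0..t}|lebesgue. apply_bcontfun \<omega> s) + B t \<omega>))"


section \<open>The operator \<open>K\<close>\<close>

definition c_const :: "real \<Rightarrow> real" where
  "c_const H = sqrt (H * (2*H - 1) / Beta (2 - 2*H) (H - 1/2))"

definition K_kernel :: "real \<Rightarrow> real \<Rightarrow> real \<Rightarrow> real" where
  "K_kernel H t s = c_const H * s powr (1/2 - H) *
     (LINT u:{s..t}|lebesgue. u powr (H - 1/2) * (u - s) powr (H - 3/2)) * indicator {0..t} s"

definition L2_time :: "(real \<Rightarrow> real^'n) set" where
  "L2_time = {h \<in> borel_measurable (lebesgue_on {0..1}).
     integrable (lebesgue_on {0..1}) (\<lambda>t. (norm (h t))\<^sup>2)}"

text \<open>\<open>K h\<close> is a continuous path for \<open>h\<close> in \<^const>\<open>L2_time\<close>, so \<^const>\<open>Bcontfun\<close> is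
  applied inside its domain there; elsewhere the value is irrelevant.\<close>

definition K_op :: "real \<Rightarrow> (real \<Rightarrow> real^'n) \<Rightarrow> (real \<Rightarrow>\<^sub>C (real^'n))" where
  "K_op H h = Bcontfun (ext_cont (\<lambda>t. LINT s:{0..t}|lebesgue. K_kernel H t s *\<^sub>R h s) 0 1)"

text \<open>\<open>K\<close> is injective modulo equality almost everywhere; the inverse picks a representative.\<close>

definition K_inv :: "real \<Rightarrow> (real \<Rightarrow>\<^sub>C (real^'n)) \<Rightarrow> real \<Rightarrow> real^'n" where
  "K_inv H g = (SOME h. h \<in> L2_time \<and> K_op H h = g)"


section \<open>Square integrable functionals and gradients\<close>

definition L2_fun :: "(real \<Rightarrow>\<^sub>C (real^'n)) measure \<Rightarrow> ((real \<Rightarrow>\<^sub>C (real^'n)) \<Rightarrow> real) set" where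
  "L2_fun \<nu> = {F \<in> borel_measurable (completion \<nu>). integrable (completion \<nu>) (\<lambda>\<omega>. (F \<omega>)\<^sup>2)}"

definition L2_process ::
    "(real \<Rightarrow>\<^sub>C (real^'n)) measure \<Rightarrow> ((real \<Rightarrow>\<^sub>C (real^'n)) \<Rightarrow> real \<Rightarrow> real^'n) set" where
  "L2_process \<nu> = {u.
     case_prod u \<in> borel_measurable (completion \<nu> \<Otimes>\<^sub>M lebesgue_on {0..1}) \<and>
     integrable (completion \<nu> \<Otimes>\<^sub>M lebesgue_on {0..1}) (\<lambda>(\<omega>, t). (norm (u \<omega> t))\<^sup>2)}"

text \<open>The Hilbert space in which gradients live, with no adaptedness (the gradient of a cylindrical
  function is in general not adapted).\<close>

definition gradient_space ::
    "real \<Rightarrow> (real \<Rightarrow>\<^sub>C (real^'n)) measure \<Rightarrow> ((real \<Rightarrow>\<^sub>C (real^'n)) \<Rightarrow> (real \<Rightarrow>\<^sub>C (real^'n))) set" where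
  "gradient_space H \<nu> = {G. \<exists>u\<in>L2_process \<nu>. AE \<omega> in completion \<nu>. G \<omega> = K_op H (u \<omega>)}"

text \<open>An iterated integral: it does not depend on the representatives picked by \<^const>\<open>K_inv\<close>,
  which need not be jointly measurable in \<open>(\<omega>, t)\<close>.\<close>

definition HH_inner :: "real \<Rightarrow> (real \<Rightarrow>\<^sub>C (real^'n)) measure \<Rightarrow>
    ((real \<Rightarrow>\<^sub>C (real^'n)) \<Rightarrow> (real \<Rightarrow>\<^sub>C (real^'n))) \<Rightarrow>
    ((real \<Rightarrow>\<^sub>C (real^'n)) \<Rightarrow> (real \<Rightarrow>\<^sub>C (real^'n))) \<Rightarrow> real" where
  "HH_inner H \<nu> G G' =
     (LINT \<omega>|completion \<nu>. LINT t|lebesgue_on {0..1}. K_inv H (G \<omega>) t \<bullet> K_inv H (G' \<omega>) t)"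


section \<open>Smooth cylindrical functions and the closed gradient\<close>

text \<open>A function on \<open>(real^'n)^m\<close> is a function of sequences that depends on the first \<open>m\<close> entries
  only; its continuity then is continuity for the product topology on sequences.\<close>

primrec C_k :: "nat \<Rightarrow> nat \<Rightarrow> ((nat \<Rightarrow> real^'n) \<Rightarrow> real) \<Rightarrow> bool" where
  "C_k m 0 f \<longleftrightarrow> continuous_on UNIV f"
| "C_k m (Suc k) f \<longleftrightarrow> continuous_on UNIV f \<and>
     (\<forall>i<m. \<forall>j. \<exists>g. (\<forall>x. ((\<lambda>r. f (x(i := x i + r *\<^sub>R axis j 1))) has_real_derivative g x) (at 0)) \<and>
        C_k m k g)"

definition C_infinity :: "nat \<Rightarrow> ((nat \<Rightarrow> real^'n) \<Rightarrow> real) \<Rightarrow> bool" where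
  "C_infinity m f \<longleftrightarrow> (\<forall>x y. (\<forall>i<m. x i = y i) \<longrightarrow> f x = f y) \<and> (\<forall>k. C_k m k f)"

definition smooth_cylindrical :: "((real \<Rightarrow>\<^sub>C (real^'n)) \<Rightarrow> real) \<Rightarrow> bool" where
  "smooth_cylindrical F \<longleftrightarrow> (\<exists>m t f. (\<forall>i<m. 0 < t i \<and> t i \<le> 1) \<and> mono_on {..<m} t \<and>
     C_infinity m f \<and> (\<forall>\<omega>\<in>path_space. F \<omega> = f (\<lambda>i. apply_bcontfun \<omega> (t i))))"

definition is_gradient :: "real \<Rightarrow> ((real \<Rightarrow>\<^sub>C (real^'n)) \<Rightarrow> real) \<Rightarrow>
    ((real \<Rightarrow>\<^sub>C (real^'n)) \<Rightarrow> (real \<Rightarrow>\<^sub>C (real^'n))) \<Rightarrow> bool" where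
  "is_gradient H F DF \<longleftrightarrow> (\<forall>\<omega>\<in>path_space. DF \<omega> \<in> K_op H ` L2_time \<and>
     (\<forall>h\<in>L2_time. ((\<lambda>\<delta>. (F (\<omega> + \<delta> *\<^sub>R K_op H h) - F \<omega>) / \<delta>) \<longlongrightarrow>
        (LINT t|lebesgue_on {0..1}. K_inv H (DF \<omega>) t \<bullet> h t)) (at 0)))"

definition gradient_graph :: "real \<Rightarrow> (real \<Rightarrow>\<^sub>C (real^'n)) measure \<Rightarrow>
    (((real \<Rightarrow>\<^sub>C (real^'n)) \<Rightarrow> real) \<times> ((real \<Rightarrow>\<^sub>C (real^'n)) \<Rightarrow> (real \<Rightarrow>\<^sub>C (real^'n)))) set" where
  "gradient_graph H \<nu> = {(F, DF). smooth_cylindrical F \<and> F \<in> L2_fun \<nu> \<and>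
     is_gradient H F DF \<and> DF \<in> gradient_space H \<nu>}"

text \<open>The graph of the closure of \<open>D\<close>: \<open>(F, DF)\<close> belongs to it iff \<open>F\<close> is in \<open>Dom(D)\<close> and
  \<open>DF\<close> is (a version of) its gradient.\<close>

definition closed_gradient_graph :: "real \<Rightarrow> (real \<Rightarrow>\<^sub>C (real^'n)) measure \<Rightarrow>
    (((real \<Rightarrow>\<^sub>C (real^'n)) \<Rightarrow> real) \<times> ((real \<Rightarrow>\<^sub>C (real^'n)) \<Rightarrow> (real \<Rightarrow>\<^sub>C (real^'n)))) set" where
  "closed_gradient_graph H \<nu> = {(F, DF). F \<in> L2_fun \<nu> \<and> DF \<in> gradient_space H \<nu> \<and>
     (\<exists>Fk DFk. (\<forall>k. (Fk k, DFk k) \<in> gradient_graph H \<nu>) \<and>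
        (\<lambda>k. LINT \<omega>|completion \<nu>. (Fk k \<omega> - F \<omega>)\<^sup>2) \<longlonglongrightarrow> 0 \<and>
        (\<lambda>k::nat. HH_inner H \<nu> (\<lambda>\<omega>. DFk k \<omega> - DF \<omega>) (\<lambda>\<omega>. DFk k \<omega> - DF \<omega>)) \<longlonglongrightarrow> 0)}"

end

theory Submission
  imports Defs
begin

text \<open>Under \<open>\<nu>\<close> the path \<open>\<omega>\<close> is Gaussian: its components behave like Wiener integrals of the kernels
  \<open>\<rho>\<^sub>t = K(t, \<cdot>) - \<alpha> \<integral>\<^sub>0\<^sup>t exp (-\<alpha>(t - s)) K(s, \<cdot>) ds\<close>. For a cylindrical \<open>F = f(\<omega>(t\<^sub>1), \<dots>, \<omega>(t\<^sub>m))\<close> the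
  Gaussian logarithmic Sobolev inequality therefore bounds the entropy of \<open>F\<^sup>2\<close> by twice the mean of
  \<open>\<parallel>\<Sum>\<^sub>i \<nabla>\<^sub>i f \<rho>(t\<^sub>i)\<parallel>\<^sup>2\<close>, whereas the energy of \<open>DF\<close> is the mean of \<open>\<parallel>\<Sum>\<^sub>i \<nabla>\<^sub>i f K(t\<^sub>i, \<cdot>)\<parallel>\<^sup>2\<close>. The second part of
  \<open>\<rho>\<^sub>t\<close> is the image of \<open>K(t, \<cdot>)\<close> under an integral operator, explicit by Abel inversion, whose squared
  Hilbert-Schmidt norm is at most \<open>(1 + \<alpha>)\<^sup>2 / (2 - 2H)\<close>. This gives the inequality with
  the factor \<open>4(1 + \<alpha>\<^sup>2(1 + \<alpha>)\<^sup>2 / (2 - 2H))\<close>, which the lower bound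
  \<open>5 C\<^sub>1\<^sup>2 \<ge> \<Gamma>(3/2 - H)\<^sup>2 (2 - 2H)\<close> shows to be at most the asserted one. The
  closure is reached by applying everything to the bounded positive substitutes
  \<open>(F\<^sup>2 + \<eta>) / (1 + \<eta>F\<^sup>2)\<close> of \<open>F\<^sup>2\<close>, with Fatou's lemma for \<open>\<eta> \<longlonglongrightarrow> 0\<close>.\<close>

section \<open>The Gaussian logarithmic Sobolev inequality\<close>

text \<open>No Wiener process is built: \<open>fractional_BM\<close> prescribes only the laws of
  finite linear combinations of \<open>B\<close>. Kernels therefore enter through covariances alone,
  \<omega> is expressed through \<open>B\<close> by variation of constants, and the law of finitely
  many coordinates of \<omega> is identified by characteristic functions of Riemann sums. The factor
  4 is the 2 of the Gaussian inequality times the 2 of (a - b)^2 <= 2 a^2 + 2 b^2, applied to the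
  two parts of \<rho>. The Abel inversion is forced by the coefficients: the second part has to be
  bounded by the norm of the combination sum a_i K(t_i, .), which does not control the individual
  a_i when the times are close. Writing the second part as an operator applied to that combination
  gives a bound that respects the cancellations. The lower bound on \<open>C\<^sub>1\<close> is
  there because \<open>C\<^sub>1\<close> may be any admissible constant, while the asserted factor
  increases with it.\<close>

text \<open>Monotone transport between the weighted and the plain Gaussian measure on \<open>[-R, R]\<close>; since the
  transport map fixes the end points, integration by parts leaves no boundary terms.\<close>

lemma transport_interval_log_sobolev:
  fixes w w' :: "real \<Rightarrow> real" and R :: real
  defines "\<phi> \<equiv> std_normal_density"
  defines "Z \<equiv> integral {-R..R} \<phi>" and "W \<equiv> integral {-R..R} (\<lambda>x. w x * \<phi> x)"
  assumes R: "0 < R" and pos: "\<And>x. 0 < w x"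
    and deriv: "\<And>x. (w has_real_derivative w' x) (at x)" and cont: "continuous_on UNIV w'"
  shows "integral {-R..R} (\<lambda>x. w x * ln (w x) * \<phi> x) - W * ln (W / Z)
           \<le> integral {-R..R} (\<lambda>x. (w' x)\<^sup>2 / (2 * w x) * \<phi> x)"
proof -
  have \<phi>_pos: "0 < \<phi> x" for x by (simp add: \<phi>_def normal_density_pos)
  have \<phi>_deriv: "(\<phi> has_real_derivative - x * \<phi> x) (at x)" for x
    unfolding \<phi>_def std_normal_density_def
    by (auto intro!: derivative_eq_intros simp: field_simps)
  have \<phi>_cont: "continuous_on S \<phi>" for S
    by (rule continuous_at_imp_continuous_on) (use \<phi>_deriv DERIV_isCont in blast)
  have w_cont: "continuous_on S w" for S
    by (rule continuous_at_imp_continuous_on) (use deriv DERIV_isCont in blast)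
  have w'_cont: "continuous_on S w'" for S
    using cont continuous_on_subset by blast
  \<comment> \<open>Distribution functions of the plain and of the weighted measure, not normalised:
    their total masses are Z and W.\<close>
  define P where "P y = integral {-R..y} \<phi>" for y
  define Q where "Q y = integral {-R..y} (\<lambda>x. w x * \<phi> x)" for y
  have P_deriv: "(P has_real_derivative \<phi> y) (at y within {-R..R})" if "y \<in> {-R..R}" for y
    unfolding P_def has_real_derivative_iff_has_vector_derivative
    by (rule integral_has_vector_derivative[OF \<phi>_cont that])
  have Q_deriv: "(Q has_real_derivative w y * \<phi> y) (at y within {-R..R})" if "y \<in> {-R..R}" for y
    unfolding Q_def has_real_derivative_iff_has_vector_derivative
    by (rule integral_has_vector_derivative[OF _ that]) (intro continuous_intros w_cont \<phi>_cont)
  have P_cont: "continuous_on {-R..R} P" and Q_cont: "continuous_on {-R..R} Q"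
    by (rule DERIV_continuous_on, erule P_deriv, rule DERIV_continuous_on, erule Q_deriv)
  have interior: "at x within {-R..R} = at x" if "x \<in> {-R<..<R}" for x
    using that by (intro at_within_interior) (auto simp: interior_atLeastAtMost_real)
  have P_less: "P x < P y" if "-R \<le> x" "x < y" "y \<le> R" for x y
  proof (rule DERIV_pos_imp_increasing_open[OF that(2)])
    fix z assume "x < z" "z < y"
    then show "\<exists>D. (P has_real_derivative D) (at z) \<and> 0 < D"
      using P_deriv[of z] interior[of z] that \<phi>_pos[of z] by auto
  next
    show "continuous_on {x..y} P" by (rule continuous_on_subset[OF P_cont]) (use that in auto)
  qed
  have Q_less: "Q x < Q y" if "-R \<le> x" "x < y" "y \<le> R" for x y
  proof (rule DERIV_pos_imp_increasing_open[OF that(2)])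
    fix z assume "x < z" "z < y"
    then show "\<exists>D. (Q has_real_derivative D) (at z) \<and> 0 < D"
      using Q_deriv[of z] interior[of z] that \<phi>_pos[of z] pos[of z] by (auto intro!: exI mult_pos_pos)
  next
    show "continuous_on {x..y} Q" by (rule continuous_on_subset[OF Q_cont]) (use that in auto)
  qed
  have P_mono: "P x \<le> P y" and Q_mono: "Q x \<le> Q y" if "-R \<le> x" "x \<le> y" "y \<le> R" for x y
    using P_less[of x y] Q_less[of x y] that by (cases "x = y"; simp)+
  have P0: "P (-R) = 0" "Q (-R) = 0" by (simp_all add: P_def Q_def)
  have PZ: "P R = Z" "Q R = W" by (simp_all add: P_def Q_def Z_def W_def)
  have Z_pos: "0 < Z" and W_pos: "0 < W"
    using P_less[of "-R" R] Q_less[of "-R" R] R P0 PZ by auto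
  have P_inj: "inj_on P {-R..R}"
    by (rule linorder_inj_onI) (use P_less in force)+
  have P_image: "P ` {-R..R} = {0..Z}"
  proof
    show "P ` {-R..R} \<subseteq> {0..Z}"
    proof safe
      fix x assume "x \<in> {-R..R}"
      then show "P x \<in> {0..Z}"
        using P_mono[of "-R" x] P_mono[of x R] P0 PZ by auto
    qed
    show "{0..Z} \<subseteq> P ` {-R..R}"
    proof
      fix y assume "y \<in> {0..Z}"
      then have "\<exists>x\<ge>-R. x \<le> R \<and> P x = y"
        using P0 PZ R P_cont by (intro IVT') auto
      then show "y \<in> P ` {-R..R}" by auto
    qed
  qed
  define S where "S = inv_into {-R..R} P"
  have S_cont: "continuous_on {0..Z} S"
    unfolding S_def P_image[symmetric] by (rule continuous_on_inv[OF P_cont]) (use P_inj in \<open>auto simp: inv_into_f_f\<close>)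
  have PS: "P (S y) = y" "S y \<in> {-R..R}" if "y \<in> {0..Z}" for y
    using that unfolding S_def P_image[symmetric] by (rule f_inv_into_f, rule inv_into_into)
  \<comment> \<open>The increasing rearrangement that carries the normalised weighted measure to the
    normalised Gaussian one. Both live on the same interval, so the end points are fixed.\<close>
  define T where "T x = S (Z / W * Q x)" for x
  have Q_range: "Z / W * Q x \<in> {0..Z}" if "x \<in> {-R..R}" for x
  proof -
    have "0 \<le> Q x" "Q x \<le> W"
      using Q_mono[of "-R" x] Q_mono[of x R] that P0 PZ by auto
    with Z_pos W_pos show ?thesis by (simp add: divide_le_eq)
  qed
  have Q_range': "Z / W * Q x \<in> {0<..<Z}" if "x \<in> {-R<..<R}" for x
  proof -
    have "0 < Q x" "Q x < W"
      using Q_less[of "-R" x] Q_less[of x R] that P0 PZ by auto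
    with Z_pos W_pos show ?thesis by (simp add: divide_less_eq)
  qed
  have T_cont: "continuous_on {-R..R} T"
    unfolding T_def
    by (rule continuous_on_compose2[OF S_cont]) (intro continuous_intros Q_cont, use Q_range in blast)
  have SP: "S (P x) = x" if "x \<in> {-R..R}" for x
    unfolding S_def by (rule inv_into_f_f[OF P_inj that])
  have T_ends: "T (-R) = -R" "T R = R"
    using SP[of "-R"] SP[of R] P0 PZ W_pos R by (auto simp: T_def)
  have T_deriv: "(T has_real_derivative (Z / W * (w x * \<phi> x)) / \<phi> (T x)) (at x)"
    if x: "x \<in> {-R<..<R}" for x
  proof -
    let ?y = "Z / W * Q x"
    have y: "?y \<in> {0<..<Z}" by (rule Q_range'[OF x])
    have Ty: "T x \<in> {-R<..<R}"
    proof -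
      have "T x \<in> {-R..R}" "P (T x) = ?y" using PS[of ?y] y by (auto simp: T_def)
      moreover from this y P0 PZ have "T x \<noteq> -R" "T x \<noteq> R" by auto
      ultimately show ?thesis by auto
    qed
    have "(S has_real_derivative inverse (\<phi> (T x))) (at ?y)"
    proof (rule DERIV_inverse_function[where f=P and a=0 and b=Z])
      show "(P has_real_derivative \<phi> (T x)) (at (S ?y))"
        using P_deriv[of "T x"] interior[OF Ty] Ty by (auto simp: T_def)
      show "isCont S ?y"
        using continuous_on_interior[OF S_cont, of ?y] y by (simp add: interior_atLeastAtMost_real)
    qed (use y PS \<phi>_pos[of "T x"] in auto)
    moreover have "((\<lambda>x. Z / W * Q x) has_real_derivative Z / W * (w x * \<phi> x)) (at x)"
      using Q_deriv[of x] interior[OF x] x by (intro DERIV_cmult) auto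
    ultimately have "(T has_real_derivative inverse (\<phi> (T x)) * (Z / W * (w x * \<phi> x))) (at x)"
      unfolding T_def by (rule DERIV_chain2)
    then show ?thesis by (simp add: divide_inverse mult.commute)
  qed
  define \<theta> where "\<theta> x = T x - x" for x
  define T' where "T' x = (Z / W * (w x * \<phi> x)) / \<phi> (T x)" for x
  \<comment> \<open>The derivative of w * \<phi> * \<theta>. The displacement \<theta> vanishes at
    both end points, hence g integrates to 0.\<close>
  define g where "g x = w' x * \<phi> x * \<theta> x + w x * \<phi> x * ((T' x - 1) - x * \<theta> x)" for x
  have g_int: "(g has_integral (w R * \<phi> R * \<theta> R - w (-R) * \<phi> (-R) * \<theta> (-R))) {-R..R}"
  proof (rule fundamental_theorem_of_calculus_interior)
    show "continuous_on {-R..R} (\<lambda>x. w x * \<phi> x * \<theta> x)"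
      unfolding \<theta>_def by (intro continuous_intros w_cont \<phi>_cont T_cont)
    fix x assume x: "x \<in> {-R<..<R}"
    have "((\<lambda>x. w x * \<phi> x * \<theta> x) has_real_derivative g x) (at x)"
      unfolding \<theta>_def
      by (rule derivative_eq_intros deriv \<phi>_deriv T_deriv[OF x] refl)+
        (simp add: g_def \<theta>_def T'_def algebra_simps)
    then show "((\<lambda>x. w x * \<phi> x * \<theta> x) has_vector_derivative g x) (at x)"
      by (simp add: has_real_derivative_iff_has_vector_derivative)
  qed (use R in simp)
  then have g_int: "(g has_integral 0) {-R..R}" by (simp add: \<theta>_def T_ends)
  \<comment> \<open>The transport equation w \<phi> = (W / Z) T' \<phi>(T) gives ln w = ln (W / Z) +
    ln T' + (x^2 - T^2) / 2. With ln T' <= T' - 1 everything except w' \<theta> + w \<theta>^2 / 2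
    is collected in g, and completing the square in \<theta> bounds that remainder by the Fisher
    term.\<close>
  have pointwise: "w x * ln (w x) * \<phi> x \<le> ln (W / Z) * (w x * \<phi> x) + g x + (w' x)\<^sup>2 / (2 * w x) * \<phi> x" for x
  proof -
    have T'_pos: "0 < T' x" unfolding T'_def using pos \<phi>_pos Z_pos W_pos by auto
    have "exp (- x\<^sup>2 / 2) = exp (- (T x)\<^sup>2 / 2) * exp ((T x)\<^sup>2 / 2 - x\<^sup>2 / 2)"
      by (simp add: mult_exp_exp)
    then have "\<phi> x / \<phi> (T x) = exp ((T x)\<^sup>2 / 2 - x\<^sup>2 / 2)"
      by (simp add: \<phi>_def std_normal_density_def)
    then have T'_eq: "T' x = Z / W * w x * exp ((T x)\<^sup>2 / 2 - x\<^sup>2 / 2)"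
      unfolding T'_def by (metis mult.assoc times_divide_eq_right)
    have "exp ((T x)\<^sup>2 / 2 - x\<^sup>2 / 2) * exp (x\<^sup>2 / 2 - (T x)\<^sup>2 / 2) = 1"
      by (simp add: mult_exp_exp)
    then have w_eq: "w x = (W / Z) * T' x * exp (x\<^sup>2 / 2 - (T x)\<^sup>2 / 2)"
      unfolding T'_eq using Z_pos W_pos by (simp add: mult.assoc)
    have "0 < W / Z" using Z_pos W_pos by simp
    then have "ln (w x) = ln (W / Z) + ln (T' x) + (x\<^sup>2 / 2 - (T x)\<^sup>2 / 2)"
      unfolding w_eq using T'_pos by (simp only: ln_mult_pos mult_pos_pos exp_gt_zero ln_exp)
    also have "ln (T' x) \<le> T' x - 1" using T'_pos by (rule ln_le_minus_one)
    also have "x\<^sup>2 / 2 - (T x)\<^sup>2 / 2 = - x * \<theta> x - (\<theta> x)\<^sup>2 / 2"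
      by (simp add: \<theta>_def power2_eq_square field_simps)
    finally have ln_w: "ln (w x) \<le> ln (W / Z) + (T' x - 1) - x * \<theta> x - (\<theta> x)\<^sup>2 / 2" by simp
    have sq: "0 \<le> (w' x)\<^sup>2 / (2 * w x) + w' x * \<theta> x + w x * (\<theta> x)\<^sup>2 / 2"
    proof -
      have "(w' x)\<^sup>2 / (2 * w x) + w' x * \<theta> x + w x * (\<theta> x)\<^sup>2 / 2 = (w' x + w x * \<theta> x)\<^sup>2 / (2 * w x)"
        using pos[of x] by (simp add: power2_eq_square field_simps)
      also have "\<dots> \<ge> 0" using pos[of x] by simp
      finally show ?thesis .
    qed
    have "w x * ln (w x) \<le> w x * (ln (W / Z) + (T' x - 1) - x * \<theta> x - (\<theta> x)\<^sup>2 / 2)"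
      using ln_w pos[of x] by (intro mult_left_mono) auto
    also have "\<dots> \<le> ln (W / Z) * w x + (w' x * \<theta> x + w x * ((T' x - 1) - x * \<theta> x)) + (w' x)\<^sup>2 / (2 * w x)"
      using sq by (simp add: algebra_simps)
    finally have "w x * ln (w x) * \<phi> x \<le> (ln (W / Z) * w x + (w' x * \<theta> x + w x * ((T' x - 1) - x * \<theta> x)) + (w' x)\<^sup>2 / (2 * w x)) * \<phi> x"
      using \<phi>_pos[of x] by (intro mult_right_mono) auto
    then show ?thesis by (simp add: g_def algebra_simps)
  qed
  have w_nz: "w x \<noteq> 0" for x using pos[of x] by simp
  have i1: "(\<lambda>x. w x * ln (w x) * \<phi> x) integrable_on {-R..R}"
    by (intro integrable_continuous_real continuous_intros w_cont \<phi>_cont) (simp add: w_nz)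
  have i2: "(\<lambda>x. w x * \<phi> x) integrable_on {-R..R}"
    by (intro integrable_continuous_real continuous_intros w_cont \<phi>_cont)
  have i3: "(\<lambda>x. (w' x)\<^sup>2 / (2 * w x) * \<phi> x) integrable_on {-R..R}"
    by (intro integrable_continuous_real continuous_intros w_cont \<phi>_cont w'_cont) (simp add: w_nz)
  have h2: "((\<lambda>x. ln (W / Z) * (w x * \<phi> x)) has_integral (ln (W / Z) * W)) {-R..R}"
    unfolding W_def by (rule has_integral_mult_right[OF integrable_integral[OF i2]])
  have "((\<lambda>x. ln (W / Z) * (w x * \<phi> x) + g x + (w' x)\<^sup>2 / (2 * w x) * \<phi> x)
      has_integral (ln (W / Z) * W + 0 + integral {-R..R} (\<lambda>x. (w' x)\<^sup>2 / (2 * w x) * \<phi> x))) {-R..R}"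
    by (intro has_integral_add h2 g_int integrable_integral i3)
  from has_integral_le[OF integrable_integral[OF i1] this] pointwise
  show ?thesis by (simp add: mult.commute)
qed

section \<open>Entropy: variational bound and subadditivity\<close>

definition ent :: "'a measure \<Rightarrow> ('a \<Rightarrow> real) \<Rightarrow> real" where
  "ent M f = (LINT x|M. f x * ln (f x)) - (LINT x|M. f x) * ln (LINT x|M. f x)"

text \<open>No integrability is assumed, because the Bochner integral of a non-integrable function
  is 0. In the tensorization this spares the integrability of the entropies of sections.\<close>

lemma ennreal_integral_le_nn_integral:
  "ennreal (integral\<^sup>L M f) \<le> (\<integral>\<^sup>+x. ennreal (f x) \<partial>M)" for f :: "'a \<Rightarrow> real"
proof (cases "integrable M f")
  case True
  then have "integral\<^sup>L M f \<le> (LINT x|M. max 0 (f x))"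
    by (intro integral_mono) auto
  moreover have "ennreal (LINT x|M. max 0 (f x)) = (\<integral>\<^sup>+x. ennreal (max 0 (f x)) \<partial>M)"
    using True by (intro nn_integral_eq_integral[symmetric]) auto
  ultimately show ?thesis
    using ennreal_leI by (fastforce simp: ennreal_max_0')
next
  case False
  then show ?thesis by (simp add: not_integrable_integral_eq)
qed

lemma ennreal_add_le: "ennreal (a + b) \<le> ennreal a + ennreal b"
  by (auto simp: ennreal_plus_if intro!: ennreal_leI)

lemma abs_mult_ln_le:
  fixes x c C :: real
  assumes "0 < c" "c \<le> x" "x \<le> C"
  shows "\<bar>x * ln x\<bar> \<le> C * (\<bar>ln c\<bar> + \<bar>ln C\<bar>)"
proof -
  have "ln c \<le> ln x" "ln x \<le> ln C" using assms by auto
  then have "\<bar>ln x\<bar> \<le> \<bar>ln c\<bar> + \<bar>ln C\<bar>" by linarith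
  then show ?thesis unfolding abs_mult using assms by (intro mult_mono) auto
qed

lemma (in prob_space) bounds_integral:
  fixes f :: "'a \<Rightarrow> real"
  assumes "f \<in> borel_measurable M" "\<And>x. c \<le> f x" "\<And>x. f x \<le> C"
  shows "integrable M f" "c \<le> integral\<^sup>L M f" "integral\<^sup>L M f \<le> C"
proof -
  show int: "integrable M f"
    by (rule integrable_const_bound[where B="\<bar>c\<bar> + \<bar>C\<bar>"])
      (use assms in \<open>auto simp: abs_le_iff intro!: AE_I2, (smt (verit))+\<close>)
  show "c \<le> integral\<^sup>L M f" "integral\<^sup>L M f \<le> C"
    using int assms by (auto intro!: integral_ge_const integral_le_const)
qed

lemma (in prob_space) integrable_mult_ln:
  fixes f :: "'a \<Rightarrow> real"
  assumes "f \<in> borel_measurable M" "0 < c" "\<And>x. c \<le> f x" "\<And>x. f x \<le> C"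
  shows "integrable M (\<lambda>x. f x * ln (f x))"
  by (rule integrable_const_bound[where B="C * (\<bar>ln c\<bar> + \<bar>ln C\<bar>)"])
    (use assms in \<open>auto intro!: AE_I2 abs_mult_ln_le\<close>)

text \<open>The easy half of the variational formula for entropy: \<open>\<integral> f G \<le> ent f\<close> whenever \<open>\<integral> exp G \<le> 1\<close>;
  here \<open>G = ln (g / \<integral> g)\<close>.\<close>

lemma (in prob_space) integral_mult_ln_le_ent:
  fixes f g :: "'a \<Rightarrow> real"
  assumes f[measurable]: "f \<in> borel_measurable M" and g[measurable]: "g \<in> borel_measurable M"
    and c: "0 < c" and fb: "\<And>x. c \<le> f x" "\<And>x. f x \<le> C" and gb: "\<And>x. c \<le> g x" "\<And>x. g x \<le> C"
  shows "(LINT x|M. f x * ln (g x / integral\<^sup>L M g)) \<le> ent M f"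
proof -
  define h m where "h = integral\<^sup>L M f" and "m = integral\<^sup>L M g"
  note intf = bounds_integral[OF f fb] and intg = bounds_integral[OF g gb]
  have h: "c \<le> h" "h \<le> C" and m: "c \<le> m" "m \<le> C" unfolding h_def m_def using intf intg by auto
  have fpos: "0 < f x" and gpos: "0 < g x" for x
    using c fb[of x] gb[of x] by auto
  have mult_bound: "integrable M (\<lambda>x. f x * ln (g x))"
  proof (rule integrable_const_bound[where B="C * (\<bar>ln c\<bar> + \<bar>ln C\<bar>)"])
    have "\<bar>f x * ln (g x)\<bar> \<le> C * (\<bar>ln c\<bar> + \<bar>ln C\<bar>)" for x
    proof -
      have "ln c \<le> ln (g x)" "ln (g x) \<le> ln C"
        using c gpos[of x] gb[of x] by (auto simp: less_le_trans[OF gpos[of x]])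
      then have "\<bar>ln (g x)\<bar> \<le> \<bar>ln c\<bar> + \<bar>ln C\<bar>" by linarith
      moreover have "\<bar>f x\<bar> \<le> C" using fpos[of x] fb(2)[of x] by simp
      ultimately show ?thesis
        unfolding abs_mult using fpos[of x] fb(2)[of x] by (intro mult_mono) linarith+
    qed
    then show "AE x in M. norm (f x * ln (g x)) \<le> C * (\<bar>ln c\<bar> + \<bar>ln C\<bar>)" by simp
  qed simp
  have int1: "integrable M (\<lambda>x. f x * ln (g x) - f x * ln m)"
    using mult_bound intf by auto
  have "(LINT x|M. f x * ln (g x / m)) = (LINT x|M. f x * ln (g x) - f x * ln m)"
    using gpos less_le_trans[OF c m(1)]
    by (intro Bochner_Integration.integral_cong) (simp_all add: ln_divide_pos right_diff_distrib)
  also have "\<dots> \<le> (LINT x|M. f x * ln (f x) - f x * ln h + (h / m * g x - f x))"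
  proof (rule integral_mono[OF int1])
    show "integrable M (\<lambda>x. f x * ln (f x) - f x * ln h + (h / m * g x - f x))"
      using integrable_mult_ln[OF f c fb] intf intg by auto
    fix x assume "x \<in> space M"
    \<comment> \<open>Both f / h and g / m have mean 1. Applying ln y <= y - 1 to their quotient
      leaves the error (h / m) g - f, whose mean is 0.\<close>
    have "ln (g x * h / (m * f x)) \<le> g x * h / (m * f x) - 1"
      using fpos[of x] gpos[of x] h m c by (intro ln_le_minus_one) auto
    then have "f x * ln (g x * h / (m * f x)) \<le> f x * (g x * h / (m * f x) - 1)"
      using fpos[of x] by (intro mult_left_mono) auto
    also have "\<dots> = h / m * g x - f x" using fpos[of x] m c by (simp add: field_simps)
    also have "ln (g x * h / (m * f x)) = ln (g x) + ln h - ln m - ln (f x)"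
      using fpos[of x] gpos[of x] h m c by (simp add: ln_div ln_mult)
    finally show "f x * ln (g x) - f x * ln m \<le> f x * ln (f x) - f x * ln h + (h / m * g x - f x)"
      by (simp add: algebra_simps)
  qed
  also have "\<dots> = (LINT x|M. f x * ln (f x)) - h * ln h + (h / m * m - h)"
    using integrable_mult_ln[OF f c fb] intf intg by (simp add: h_def m_def)
  also have "h / m * m - h = 0" using m c by simp
  finally show ?thesis by (simp add: ent_def h_def m_def)
qed

text \<open>By the chain rule the entropy of f is the mean entropy in the first variable plus the
  entropy of the marginal over the second. The marginal, used as one test function for all sections
  f (x, .), bounds its own entropy by the mean entropy in the second variable.\<close>

lemma ent_pair_le:
  fixes f :: "'a \<times> 'b \<Rightarrow> real"
  assumes "prob_space M1" "prob_space M2"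
    and f[measurable]: "f \<in> borel_measurable (M1 \<Otimes>\<^sub>M M2)"
    and c: "0 < c" and fb: "\<And>z. c \<le> f z" "\<And>z. f z \<le> C"
  shows "ent (M1 \<Otimes>\<^sub>M M2) f \<le> (LINT y|M2. ent M1 (\<lambda>x. f (x, y))) + (LINT x|M1. ent M2 (\<lambda>y. f (x, y)))"
proof -
  interpret M1: prob_space M1 by fact
  interpret M2: prob_space M2 by fact
  interpret P: pair_prob_space M1 M2 ..
  have sec1: "x \<in> space M1 \<Longrightarrow> (\<lambda>y. f (x, y)) \<in> borel_measurable M2" for x by simp
  have sec2: "y \<in> space M2 \<Longrightarrow> (\<lambda>x. f (x, y)) \<in> borel_measurable M1" for y by simp
  define g where "g y = (LINT x|M1. f (x, y))" for y
  \<comment> \<open>Off the space of \<open>M2\<close> the integral g need not lie in [c, C]. The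
    value c there restores the bounds at every point, which the lemmas on bounded functions ask
    for.\<close>
  define g' where "g' y = (if y \<in> space M2 then g y else c)" for y
  define m where "m = (LINT y|M2. g' y)"
  have g'[measurable]: "g' \<in> borel_measurable M2"
    unfolding g'_def g_def by measurable
  have cC: "c \<le> C" using fb[of undefined] by linarith
  have g'b: "c \<le> g' y" "g' y \<le> C" for y
    using M1.bounds_integral[OF sec2 fb] cC by (auto simp: g'_def g_def)
  have m: "c \<le> m" "m \<le> C" unfolding m_def using M2.bounds_integral[OF g' g'b] by auto
  have intf: "integrable (M1 \<Otimes>\<^sub>M M2) f" and intfl: "integrable (M1 \<Otimes>\<^sub>M M2) (\<lambda>z. f z * ln (f z))"
    using P.bounds_integral[OF f fb] P.integrable_mult_ln[OF f c fb] by auto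
  have intfl': "integrable (M1 \<Otimes>\<^sub>M M2) (\<lambda>(x, y). f (x, y) * ln (f (x, y)))"
    and intf': "integrable (M1 \<Otimes>\<^sub>M M2) (\<lambda>(x, y). f (x, y))"
    using intf intfl by (auto simp: case_prod_beta')
  have intfg: "integrable (M1 \<Otimes>\<^sub>M M2) (\<lambda>(x, y). f (x, y) * ln (g' y / m))"
  proof (rule P.integrable_const_bound[where B="C * (\<bar>ln (c / C)\<bar> + \<bar>ln (C / c)\<bar>)"])
    have "\<bar>f z * ln (g' y / m)\<bar> \<le> C * (\<bar>ln (c / C)\<bar> + \<bar>ln (C / c)\<bar>)" for z y
    proof -
      have "c / C \<le> g' y / m" "g' y / m \<le> C / c" using g'b[of y] m c cC by (auto intro!: frac_le)
      then have "ln (c / C) \<le> ln (g' y / m)" "ln (g' y / m) \<le> ln (C / c)"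
        using c cC g'b[of y] m by (auto simp del: ln_div intro!: ln_mono divide_pos_pos)
      then have "\<bar>ln (g' y / m)\<bar> \<le> \<bar>ln (c / C)\<bar> + \<bar>ln (C / c)\<bar>" by linarith
      then show ?thesis
        unfolding abs_mult using c fb[of z] by (intro mult_mono) auto
    qed
    then show "AE z in M1 \<Otimes>\<^sub>M M2. norm (case z of (x, y) \<Rightarrow> f (x, y) * ln (g' y / m)) \<le> C * (\<bar>ln (c / C)\<bar> + \<bar>ln (C / c)\<bar>)"
      by (auto simp: split_beta')
  qed measurable
  have eqm: "integral\<^sup>L (M1 \<Otimes>\<^sub>M M2) f = m"
  proof -
    have "(LINT y|M2. g y) = integral\<^sup>L (M1 \<Otimes>\<^sub>M M2) (\<lambda>(x, y). f (x, y))"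
      unfolding g_def by (rule P.integral_snd[OF intf'])
    moreover have "(LINT y|M2. g y) = m" unfolding m_def
      by (rule Bochner_Integration.integral_cong) (auto simp: g'_def)
    ultimately show ?thesis by (simp add: case_prod_beta')
  qed
  have intgl: "integrable M2 (\<lambda>y. g' y * ln (g' y))" and intg: "integrable M2 g'"
    using M2.integrable_mult_ln[OF g' c g'b] M2.bounds_integral[OF g' g'b] by auto
  \<comment> \<open>Chain rule: subtracting this average from the entropy of f leaves the entropy of
    the marginal \<open>g'\<close>.\<close>
  have ent1: "(LINT y|M2. ent M1 (\<lambda>x. f (x, y))) = integral\<^sup>L (M1 \<Otimes>\<^sub>M M2) (\<lambda>z. f z * ln (f z)) - (LINT y|M2. g' y * ln (g' y))"
  proof -
    have eq: "ent M1 (\<lambda>x. f (x, y)) = (LINT x|M1. f (x, y) * ln (f (x, y))) - g' y * ln (g' y)"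
      if "y \<in> space M2" for y using that by (simp add: ent_def g'_def g_def)
    have i: "integrable M2 (\<lambda>y. LINT x|M1. f (x, y) * ln (f (x, y)))"
      by (rule P.integrable_snd[OF intfl'])
    have "(LINT y|M2. ent M1 (\<lambda>x. f (x, y))) = (LINT y|M2. (LINT x|M1. f (x, y) * ln (f (x, y))) - g' y * ln (g' y))"
      by (rule Bochner_Integration.integral_cong[OF refl eq])
    also have "\<dots> = (LINT y|M2. (LINT x|M1. f (x, y) * ln (f (x, y)))) - (LINT y|M2. g' y * ln (g' y))"
      by (rule Bochner_Integration.integral_diff[OF i intgl])
    also have "(LINT y|M2. (LINT x|M1. f (x, y) * ln (f (x, y)))) = integral\<^sup>L (M1 \<Otimes>\<^sub>M M2) (\<lambda>z. f z * ln (f z))"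
      by (subst P.integral_snd[OF intfl']) (simp add: case_prod_beta')
    finally show "(LINT y|M2. ent M1 (\<lambda>x. f (x, y))) = integral\<^sup>L (M1 \<Otimes>\<^sub>M M2) (\<lambda>z. f z * ln (f z)) - (LINT y|M2. g' y * ln (g' y))" .
  qed
  have int_ent2: "integrable M1 (\<lambda>x. ent M2 (\<lambda>y. f (x, y)))"
  proof (rule M1.integrable_const_bound[where B="C * (\<bar>ln c\<bar> + \<bar>ln C\<bar>) + C * (\<bar>ln c\<bar> + \<bar>ln C\<bar>)"])
    show "AE x in M1. norm (ent M2 (\<lambda>y. f (x, y))) \<le> C * (\<bar>ln c\<bar> + \<bar>ln C\<bar>) + C * (\<bar>ln c\<bar> + \<bar>ln C\<bar>)"
    proof (rule AE_I2)
      fix x assume x: "x \<in> space M1"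
      note b = M2.bounds_integral[OF sec1[OF x] fb]
      have "\<bar>LINT y|M2. f (x, y) * ln (f (x, y))\<bar> \<le> (LINT y|M2. \<bar>f (x, y) * ln (f (x, y))\<bar>)"
        by (rule integral_abs_bound)
      also have "\<dots> \<le> (LINT y|M2. C * (\<bar>ln c\<bar> + \<bar>ln C\<bar>))"
        using M2.integrable_mult_ln[OF sec1[OF x] c fb] abs_mult_ln_le[OF c fb]
        by (intro integral_mono) auto
      also have "\<dots> = C * (\<bar>ln c\<bar> + \<bar>ln C\<bar>)" by (simp add: M2.prob_space)
      finally show "norm (ent M2 (\<lambda>y. f (x, y))) \<le> C * (\<bar>ln c\<bar> + \<bar>ln C\<bar>) + C * (\<bar>ln c\<bar> + \<bar>ln C\<bar>)"
        using abs_mult_ln_le[OF c b(2,3)] unfolding ent_def real_norm_def by linarith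
    qed
    show "(\<lambda>x. ent M2 (\<lambda>y. f (x, y))) \<in> borel_measurable M1"
      unfolding ent_def by measurable
  qed
  \<comment> \<open>The test function does not depend on x, so the left side can also be integrated
    in x first, which turns it into the entropy of \<open>g'\<close>.\<close>
  have "(LINT x|M1. (LINT y|M2. f (x, y) * ln (g' y / m))) \<le> (LINT x|M1. ent M2 (\<lambda>y. f (x, y)))"
  proof (rule integral_mono[OF P.integrable_fst[OF intfg] int_ent2])
    fix x assume x: "x \<in> space M1"
    show "(LINT y|M2. f (x, y) * ln (g' y / m)) \<le> ent M2 (\<lambda>y. f (x, y))"
      unfolding m_def by (rule M2.integral_mult_ln_le_ent[OF sec1[OF x] g' c fb g'b])
  qed
  moreover have "(LINT x|M1. (LINT y|M2. f (x, y) * ln (g' y / m))) = (LINT y|M2. g' y * ln (g' y)) - m * ln m"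
  proof -
    have "(LINT x|M1. (LINT y|M2. f (x, y) * ln (g' y / m))) = (LINT y|M2. (LINT x|M1. f (x, y) * ln (g' y / m)))"
      by (rule P.Fubini_integral[OF intfg, symmetric])
    also have "\<dots> = (LINT y|M2. g' y * ln (g' y) - g' y * ln m)"
    proof (rule Bochner_Integration.integral_cong[OF refl])
      fix y assume y: "y \<in> space M2"
      have "0 < g' y" "0 < m" using g'b[of y] c m by auto
      then have "ln (g' y / m) = ln (g' y) - ln m" by (rule ln_divide_pos)
      moreover have "(LINT x|M1. f (x, y) * ln (g' y / m)) = g' y * ln (g' y / m)"
        using y by (simp add: g'_def g_def)
      ultimately show "(LINT x|M1. f (x, y) * ln (g' y / m)) = g' y * ln (g' y) - g' y * ln m"
        by (simp add: right_diff_distrib)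
    qed
    also have "\<dots> = (LINT y|M2. g' y * ln (g' y)) - m * ln m"
      using intgl intg by (simp add: m_def)
    finally show ?thesis .
  qed
  ultimately show ?thesis unfolding ent1 by (simp add: ent_def eqm)
qed

section \<open>The inequality for standard Gaussian measures\<close>

lemma integral_interval_tendsto_lborel:
  fixes g :: "real \<Rightarrow> real"
  assumes g: "continuous_on UNIV g" and int: "integrable lborel g"
  shows "(\<lambda>n. integral {-real n..real n} g) \<longlonglongrightarrow> (LINT x|lborel. g x)"
proof -
  have meas[measurable]: "g \<in> borel_measurable borel" by (rule borel_measurable_continuous_onI[OF g])
  have eq: "integral {-real n..real n} g = (LINT x|lborel. indicator {-real n..real n} x * g x)" for n
  proof -
    have "set_integrable lborel {-real n..real n} g"
      unfolding set_integrable_def by (rule integrable_mult_indicator) (use int in auto)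
    from set_borel_integral_eq_integral(2)[OF this] show ?thesis
      by (simp add: set_lebesgue_integral_def)
  qed
  show ?thesis unfolding eq
  proof (rule integral_dominated_convergence[where w="\<lambda>x. \<bar>g x\<bar>"])
    show "AE x in lborel. (\<lambda>n. indicator {-real n..real n} x * g x) \<longlonglongrightarrow> g x"
    proof (rule AE_I2)
      fix x :: real
      obtain N :: nat where N: "\<bar>x\<bar> \<le> real N" using real_arch_simple by blast
      have "\<forall>\<^sub>F n in sequentially. indicator {-real n..real n} x * g x = g x"
        using eventually_ge_at_top[of N] by eventually_elim (use N in \<open>auto simp: indicator_def\<close>)
      then show "(\<lambda>n. indicator {-real n..real n} x * g x) \<longlonglongrightarrow> g x" by (rule tendsto_eventually)
    qed
  qed (use int in \<open>auto simp: indicator_def\<close>)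
qed

text \<open>The interval inequality with R tending to infinity; the Gaussian mass Z of the interval
  tends to 1. The right side is a nonnegative integral and may be infinite, so w' is only asked to
  be continuous.\<close>

lemma std_normal_log_sobolev:
  fixes w w' :: "real \<Rightarrow> real"
  assumes c: "0 < c" and wb: "\<And>x. c \<le> w x" "\<And>x. w x \<le> C"
    and deriv: "\<And>x. (w has_real_derivative w' x) (at x)" and cont: "continuous_on UNIV w'"
  shows "ennreal (ent std_normal_distribution w) \<le> (\<integral>\<^sup>+x. ennreal ((w' x)\<^sup>2 / (2 * w x)) \<partial>std_normal_distribution)"
proof -
  let ?N = std_normal_distribution and ?\<phi> = std_normal_density
  interpret N: real_distribution ?N by (rule real_dist_normal_dist)
  have pos: "0 < w x" for x using c wb(1)[of x] by simp
  have w_nz: "w x \<noteq> 0" for x using pos[of x] by simp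
  have w_cont: "continuous_on UNIV w"
    by (rule continuous_at_imp_continuous_on) (use deriv DERIV_isCont in blast)
  have \<phi>_cont: "continuous_on UNIV ?\<phi>"
    unfolding std_normal_density_def by (intro continuous_intros) auto
  have w_meas[measurable]: "w \<in> borel_measurable borel" and w'_meas[measurable]: "w' \<in> borel_measurable borel"
    using w_cont cont by (auto intro: borel_measurable_continuous_onI)
  have wN: "w \<in> borel_measurable ?N" by simp
  have LN: "(LINT x|?N. f x) = (LINT x|lborel. f x * ?\<phi> x)" if "f \<in> borel_measurable borel" for f :: "real \<Rightarrow> real"
    using that by (subst integral_density) (auto simp: mult.commute)
  have iN: "integrable lborel (\<lambda>x. f x * ?\<phi> x)" if "f \<in> borel_measurable borel" "integrable ?N f" for f :: "real \<Rightarrow> real"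
    using that by (subst (asm) integrable_density) (auto simp: mult.commute)
  define RHS where "RHS = (\<integral>\<^sup>+x. ennreal ((w' x)\<^sup>2 / (2 * w x)) \<partial>?N)"
  let ?W = "\<lambda>n::nat. integral {-real n..real n} (\<lambda>x. w x * ?\<phi> x)"
  let ?Z = "\<lambda>n::nat. integral {-real n..real n} ?\<phi>"
  let ?L = "\<lambda>n::nat. integral {-real n..real n} (\<lambda>x. w x * ln (w x) * ?\<phi> x) - ?W n * ln (?W n / ?Z n)"
  have bound: "ennreal (?L n) \<le> RHS" if "1 \<le> n" for n
  proof -
    let ?g = "\<lambda>x. (w' x)\<^sup>2 / (2 * w x) * ?\<phi> x"
    have g_cont: "continuous_on {-real n..real n} ?g"
      by (intro continuous_intros continuous_on_subset[OF w_cont] continuous_on_subset[OF cont] continuous_on_subset[OF \<phi>_cont])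
        (auto simp: w_nz)
    have g_nonneg: "0 \<le> ?g x" for x using pos[of x] by (auto intro!: mult_nonneg_nonneg)
    have "?L n \<le> integral {-real n..real n} ?g"
      by (rule transport_interval_log_sobolev[OF _ pos deriv cont]) (use that in simp)
    also have "ennreal (integral {-real n..real n} ?g) = (\<integral>\<^sup>+x. ennreal (?g x) * indicator {-real n..real n} x \<partial>lborel)"
    proof (rule nn_integral_has_integral_lebesgue'[symmetric])
      show "(?g has_integral integral {-real n..real n} ?g) {-real n..real n}"
        by (rule integrable_integral[OF integrable_continuous_real[OF g_cont]])
    qed (use g_nonneg in auto)
    also have "\<dots> \<le> (\<integral>\<^sup>+x. ennreal (?g x) \<partial>lborel)"
      by (intro nn_integral_mono) (auto simp: indicator_def)
    also have "\<dots> = RHS" unfolding RHS_def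
      using pos by (subst nn_integral_density) (auto intro!: nn_integral_cong simp: mult.commute ennreal_mult'[symmetric])
    finally show ?thesis by (simp add: ennreal_leI)
  qed
  have W_lim: "?W \<longlonglongrightarrow> (LINT x|?N. w x)"
    unfolding LN[OF w_meas]
    by (intro integral_interval_tendsto_lborel continuous_intros w_cont \<phi>_cont iN w_meas N.bounds_integral[OF wN wb])
  have Z_lim: "?Z \<longlonglongrightarrow> 1"
  proof -
    have "?Z \<longlonglongrightarrow> (LINT x|lborel. ?\<phi> x)"
      by (intro integral_interval_tendsto_lborel \<phi>_cont) simp
    then show ?thesis by simp
  qed
  have E_lim: "(\<lambda>n::nat. integral {-real n..real n} (\<lambda>x. w x * ln (w x) * ?\<phi> x)) \<longlonglongrightarrow> (LINT x|?N. w x * ln (w x))"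
  proof -
    have m: "(\<lambda>x. w x * ln (w x)) \<in> borel_measurable borel" by measurable
    show ?thesis unfolding LN[OF m]
      by (intro integral_interval_tendsto_lborel continuous_intros w_cont \<phi>_cont iN m N.integrable_mult_ln[OF wN c wb])
        (simp add: w_nz)
  qed
  have "0 < (LINT x|?N. w x)" using c N.bounds_integral(2)[OF wN wb] by simp
  then have "?L \<longlonglongrightarrow> (LINT x|?N. w x * ln (w x)) - (LINT x|?N. w x) * ln ((LINT x|?N. w x) / 1)"
    by (intro tendsto_intros W_lim Z_lim E_lim) auto
  then have "(\<lambda>n. ennreal (?L n)) \<longlonglongrightarrow> ennreal (ent ?N w)"
    by (intro tendsto_ennrealI) (simp add: ent_def)
  then have "ennreal (ent ?N w) \<le> RHS"
    by (rule LIMSEQ_le_const2) (use bound in blast)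
  then show ?thesis by (simp add: RHS_def)
qed

lemma ent_distr:
  assumes [measurable]: "g \<in> measurable M N" "f \<in> borel_measurable N"
  shows "ent (distr M N g) f = ent M (\<lambda>x. f (g x))"
  by (simp add: ent_def integral_distr)

text \<open>The constant does not depend on the dimension because entropy is subadditive over
  products: one coordinate is split off at a time. The induction varies w and D, since it is applied
  to the sections of w with the new coordinate frozen.\<close>

lemma PiM_std_normal_log_sobolev:
  fixes w :: "('i \<Rightarrow> real) \<Rightarrow> real" and D :: "'i \<Rightarrow> ('i \<Rightarrow> real) \<Rightarrow> real"
  assumes "finite I" and c: "0 < c" and "\<And>x. c \<le> w x" "\<And>x. w x \<le> C"
    and "w \<in> borel_measurable (PiM I (\<lambda>_. std_normal_distribution))"
    and "\<And>i. i \<in> I \<Longrightarrow> D i \<in> borel_measurable (PiM I (\<lambda>_. std_normal_distribution))"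
    and "\<And>i x r. i \<in> I \<Longrightarrow> ((\<lambda>r. w (x(i := r))) has_real_derivative D i (x(i := r))) (at r)"
    and "\<And>i x. i \<in> I \<Longrightarrow> continuous_on UNIV (\<lambda>r. D i (x(i := r)))"
  shows "ennreal (ent (PiM I (\<lambda>_. std_normal_distribution)) w)
    \<le> (\<integral>\<^sup>+x. (\<Sum>i\<in>I. ennreal ((D i x)\<^sup>2 / (2 * w x))) \<partial>PiM I (\<lambda>_. std_normal_distribution))"
  using assms(1,3-)
proof (induction I arbitrary: w D rule: finite_induct)
  case empty
  show ?case by (simp add: ent_def PiM_empty lebesgue_integral_count_space_finite)
next
  case (insert i I)
  let ?N = std_normal_distribution
  let ?P = "\<lambda>I. PiM I (\<lambda>_. ?N)"
  have pN: "prob_space ?N" by (rule real_distribution.axioms(1)[OF real_dist_normal_dist])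
  interpret N: prob_space ?N by (rule pN)
  interpret product_sigma_finite "\<lambda>_::'i. ?N" by unfold_locales
  interpret PI: prob_space "?P I" by (intro prob_space_PiM pN)
  note w_meas[measurable] = insert.prems(3)
  have D_meas[measurable]: "D j \<in> borel_measurable (?P (insert i I))" if "j \<in> insert i I" for j
    by (rule insert.prems(4)[OF that])
  \<comment> \<open>\<open>measurable_add_dim\<close> takes the pair in the opposite order, hence
    the exchange of components.\<close>
  have upd[measurable]: "(\<lambda>(x, X). X(i := x)) \<in> ?N \<Otimes>\<^sub>M ?P I \<rightarrow>\<^sub>M ?P (insert i I)"
  proof -
    have "(\<lambda>z. (fst (snd z, fst z))(i := snd (snd z, fst z))) \<in> ?N \<Otimes>\<^sub>M ?P I \<rightarrow>\<^sub>M ?P (insert i I)"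
      using measurable_compose[OF measurable_Pair[OF measurable_snd measurable_fst] measurable_add_dim[of i I "\<lambda>_. ?N"]]
      by (simp add: case_prod_beta')
    then show ?thesis by (simp add: case_prod_beta')
  qed
  have upd1: "(\<lambda>X. X(i := x)) \<in> ?P I \<rightarrow>\<^sub>M ?P (insert i I)" for x
    using measurable_compose[OF measurable_Pair1'[of x ?N] upd] by (simp add: comp_def)
  define G where "G j x = ennreal ((D j x)\<^sup>2 / (2 * w x))" for j x
  have G_meas[measurable]: "G j \<in> borel_measurable (?P (insert i I))" if "j \<in> insert i I" for j
    using D_meas[OF that] unfolding G_def by measurable
  have "ent (?P (insert i I)) w = ent (distr (?N \<Otimes>\<^sub>M ?P I) (?P (insert i I)) (\<lambda>(x, X). X(i := x))) w"
    by (subst distr_pair_PiM_eq_PiM[of I "\<lambda>_. ?N" i]) (auto simp: pN)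
  also have "\<dots> = ent (?N \<Otimes>\<^sub>M ?P I) (\<lambda>z. w ((\<lambda>(x, X). X(i := x)) z))"
    by (rule ent_distr) measurable
  also have "\<dots> \<le> (LINT X|?P I. ent ?N (\<lambda>x. w (X(i := x)))) + (LINT x|?N. ent (?P I) (\<lambda>X. w (X(i := x))))"
    using ent_pair_le[OF pN PI.prob_space_axioms, of "\<lambda>z. w ((\<lambda>(x, X). X(i := x)) z)" c C] c insert.prems(1,2)
    by simp
  finally have "ennreal (ent (?P (insert i I)) w) \<le>
      ennreal (LINT X|?P I. ent ?N (\<lambda>x. w (X(i := x)))) + ennreal (LINT x|?N. ent (?P I) (\<lambda>X. w (X(i := x))))"
    by (meson ennreal_leI ennreal_add_le order_trans)
  also have "\<dots> \<le> (\<integral>\<^sup>+X. ennreal (ent ?N (\<lambda>x. w (X(i := x)))) \<partial>?P I) + (\<integral>\<^sup>+x. ennreal (ent (?P I) (\<lambda>X. w (X(i := x)))) \<partial>?N)"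
    by (intro add_mono ennreal_integral_le_nn_integral)
  also have "(\<integral>\<^sup>+X. ennreal (ent ?N (\<lambda>x. w (X(i := x)))) \<partial>?P I) \<le> (\<integral>\<^sup>+X. (\<integral>\<^sup>+x. G i (X(i := x)) \<partial>?N) \<partial>?P I)"
    unfolding G_def
    by (intro nn_integral_mono std_normal_log_sobolev[where c=c and C=C] c insert.prems) simp_all
  also have "(\<integral>\<^sup>+X. (\<integral>\<^sup>+x. G i (X(i := x)) \<partial>?N) \<partial>?P I) = (\<integral>\<^sup>+x. G i x \<partial>?P (insert i I))"
    by (rule product_nn_integral_insert[symmetric, OF insert.hyps(1,2)]) simp
  also have "(\<integral>\<^sup>+x. ennreal (ent (?P I) (\<lambda>X. w (X(i := x)))) \<partial>?N) \<le> (\<integral>\<^sup>+x. (\<integral>\<^sup>+X. (\<Sum>j\<in>I. G j (X(i := x))) \<partial>?P I) \<partial>?N)"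
  proof (rule nn_integral_mono)
    fix x :: real
    have ne: "j \<noteq> i" if "j \<in> I" for j using that insert.hyps(2) by auto
    show "ennreal (ent (?P I) (\<lambda>X. w (X(i := x)))) \<le> (\<integral>\<^sup>+X. (\<Sum>j\<in>I. G j (X(i := x))) \<partial>?P I)"
      unfolding G_def
    proof (rule insert.IH)
      show "(\<lambda>X. w (X(i := x))) \<in> borel_measurable (?P I)"
        by (rule measurable_compose[OF upd1 w_meas])
      show "(\<lambda>X. D j (X(i := x))) \<in> borel_measurable (?P I)" if "j \<in> I" for j
        by (rule measurable_compose[OF upd1 D_meas]) (use that in simp)
      show "((\<lambda>r. w (X(j := r, i := x))) has_real_derivative D j (X(j := r, i := x))) (at r)" if "j \<in> I" for j X r
        unfolding fun_upd_twist[OF ne[OF that]] by (rule insert.prems(5)) (use that in simp)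
      show "continuous_on UNIV (\<lambda>r. D j (X(j := r, i := x)))" if "j \<in> I" for j X
        unfolding fun_upd_twist[OF ne[OF that]] by (rule insert.prems(6)) (use that in simp)
    qed (use insert.prems in auto)
  qed
  also have "(\<integral>\<^sup>+x. (\<integral>\<^sup>+X. (\<Sum>j\<in>I. G j (X(i := x))) \<partial>?P I) \<partial>?N) = (\<integral>\<^sup>+x. (\<Sum>j\<in>I. G j x) \<partial>?P (insert i I))"
    by (rule product_nn_integral_insert_rev[symmetric, OF insert.hyps(1,2)]) simp
  also have "(\<integral>\<^sup>+x. G i x \<partial>?P (insert i I)) + (\<integral>\<^sup>+x. (\<Sum>j\<in>I. G j x) \<partial>?P (insert i I)) = (\<integral>\<^sup>+x. (\<Sum>j\<in>insert i I. G j x) \<partial>?P (insert i I))"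
    using insert.hyps by (subst nn_integral_add[symmetric]) simp_all
  finally show ?case by (simp add: G_def)
qed

section \<open>Characteristic functions of finite families\<close>

lemma (in prob_space) integrable_bounded_mult_cos:
  fixes u X :: "'a \<Rightarrow> real"
  assumes [measurable]: "u \<in> borel_measurable M" "X \<in> borel_measurable M" and "\<And>x. \<bar>u x\<bar> \<le> C"
  shows "integrable M (\<lambda>x. u x * cos (X x))"
proof (rule integrable_const_bound[where B=C])
  have "\<bar>u x * cos (X x)\<bar> \<le> C * 1" for x
    unfolding abs_mult using assms(3)[of x] by (intro mult_mono) auto
  then show "AE x in M. norm (u x * cos (X x)) \<le> C" by simp
qed simp

text \<open>Levy uniqueness for the images of two measures with bounded densities. Cosines with an
  arbitrary phase s carry the whole characteristic function, and stay within real integrals.\<close>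

lemma weighted_char_unique:
  fixes u X :: "'a \<Rightarrow> real" and v Y :: "'b \<Rightarrow> real"
  assumes "prob_space M" "prob_space N"
    and [measurable]: "u \<in> borel_measurable M" "X \<in> borel_measurable M" "v \<in> borel_measurable N" "Y \<in> borel_measurable N"
    and u: "\<And>x. 0 \<le> u x" "\<And>x. u x \<le> C" and v: "\<And>x. 0 \<le> v x" "\<And>x. v x \<le> C"
    and eq: "\<And>t s. (LINT x|M. u x * cos (t * X x + s)) = (LINT x|N. v x * cos (t * Y x + s))"
    and A[measurable]: "A \<in> sets borel"
  shows "(LINT x|M. u x * indicator A (X x)) = (LINT x|N. v x * indicator A (Y x))"
proof -
  interpret M: prob_space M by fact
  interpret N: prob_space N by fact
  have intu: "integrable M u"
    using M.integrable_bounded_mult_cos[of u "\<lambda>_. 0" C] u by (simp add: abs_of_nonneg)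
  have intv: "integrable N v"
    using N.integrable_bounded_mult_cos[of v "\<lambda>_. 0" C] v by (simp add: abs_of_nonneg)
  define W where "W = integral\<^sup>L M u"
  have W': "integral\<^sup>L N v = W" unfolding W_def using eq[of 0 0] by simp
  show ?thesis
  proof (cases "W = 0")
    case True
    then have "AE x in M. u x = 0" "AE x in N. v x = 0"
      using integral_nonneg_eq_0_iff_AE[OF intu] integral_nonneg_eq_0_iff_AE[OF intv] u v W' by (auto simp: W_def)
    then have "(LINT x|M. u x * indicator A (X x)) = 0" "(LINT x|N. v x * indicator A (Y x)) = 0"
      by (auto intro!: integral_eq_zero_AE elim: eventually_mono)
    then show ?thesis by simp
  next
    case False
    then have W: "0 < W" using u Bochner_Integration.integral_nonneg[of M u] by (simp add: W_def less_le)
    \<comment> \<open>At t = s = 0 the hypothesis says that both weights have the same mass W, so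
      the same division makes both into probability densities.\<close>
    define DM where "DM = density M (\<lambda>x. ennreal (u x / W))"
    define DN where "DN = density N (\<lambda>x. ennreal (v x / W))"
    have "emeasure DM (space DM) = 1"
    proof -
      have "emeasure DM (space DM) = (\<integral>\<^sup>+x. ennreal (u x / W) \<partial>M)"
        unfolding DM_def by (auto simp: emeasure_density intro!: nn_integral_cong)
      also have "\<dots> = ennreal (LINT x|M. u x / W)"
        using intu u W by (intro nn_integral_eq_integral) auto
      also have "\<dots> = 1" using W by (simp add: W_def)
      finally show ?thesis .
    qed
    then interpret DM: prob_space DM by (rule prob_spaceI)
    have "emeasure DN (space DN) = 1"
    proof -
      have "emeasure DN (space DN) = (\<integral>\<^sup>+x. ennreal (v x / W) \<partial>N)"
        unfolding DN_def by (auto simp: emeasure_density intro!: nn_integral_cong)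
      also have "\<dots> = ennreal (LINT x|N. v x / W)"
        using intv v W by (intro nn_integral_eq_integral) auto
      also have "\<dots> = 1" using W W' by simp
      finally show ?thesis .
    qed
    then interpret DN: prob_space DN by (rule prob_spaceI)
    have [measurable]: "X \<in> borel_measurable DM" "Y \<in> borel_measurable DN"
      by (simp_all add: DM_def DN_def)
    have LM: "(LINT x|DM. f x) = (LINT x|M. u x * f x) / W" if "f \<in> borel_measurable M" for f :: "'a \<Rightarrow> real"
      using that u W unfolding DM_def by (subst integral_density) auto
    have LN: "(LINT x|DN. f x) = (LINT x|N. v x * f x) / W" if "f \<in> borel_measurable N" for f :: "'b \<Rightarrow> real"
      using that v W unfolding DN_def by (subst integral_density) auto
    have "char (distr DM borel X) t = char (distr DN borel Y) t" for t
    proof -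
      have M: "char (distr DM borel X) t = (CLINT x|DM. iexp (t * X x))"
        and N: "char (distr DN borel Y) t = (CLINT x|DN. iexp (t * Y x))"
        unfolding char_def by (subst integral_distr; simp)+
      have iM: "complex_integrable DM (\<lambda>x. iexp (t * X x))"
        by (rule DM.integrable_const_bound[where B=1]) auto
      have iN: "complex_integrable DN (\<lambda>x. iexp (t * Y x))"
        by (rule DN.integrable_const_bound[where B=1]) auto
      have c: "(LINT x|DM. cos (t * X x + s)) = (LINT x|DN. cos (t * Y x + s))" for s
        by (simp add: LM LN eq)
      show ?thesis unfolding M N
      proof (rule complex_eqI)
        show "Re (CLINT x|DM. iexp (t * X x)) = Re (CLINT x|DN. iexp (t * Y x))"
          using iM iN c[of 0] by (simp add: integral_Re[symmetric] Re_exp del: integral_Re)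
        \<comment> \<open>The phase -pi/2 turns the hypothesis on cosines into the one on
          sines.\<close>
        have "sin y = cos (y + - (pi/2))" for y :: real by (simp add: cos_diff)
        then show "Im (CLINT x|DM. iexp (t * X x)) = Im (CLINT x|DN. iexp (t * Y x))"
          using iM iN c[of "- (pi/2)"] by (simp add: integral_Im[symmetric] Im_exp del: integral_Im)
      qed
    qed
    then have D: "distr DM borel X = distr DN borel Y"
      by (intro Levy_uniqueness DM.real_distribution_distr DN.real_distribution_distr ext) simp_all
    have "(LINT x|DM. indicator A (X x)) = (LINT y|distr DM borel X. indicator A y :: real)"
      by (subst integral_distr) auto
    also have "\<dots> = (LINT x|DN. indicator A (Y x))"
      unfolding D by (subst integral_distr) auto
    finally show ?thesis using W by (simp add: LM LN)
  qed
qed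

lemma integral_add_halves:
  fixes f g h :: "'a \<Rightarrow> real"
  assumes "integrable M f" "integrable M g" "integrable M h"
  shows "(LINT x|M. f x + (g x / 2 + h x / 2)) = integral\<^sup>L M f + (integral\<^sup>L M g / 2 + integral\<^sup>L M h / 2)"
  using assms by simp

text \<open>Indicators replace the trigonometric factors one coordinate at a time: the weight
  \<open>1 + cos \<theta>\<close> is nonnegative, so the one-dimensional uniqueness theorem applies to it.\<close>

lemma PiM_char_partial:
  fixes M N :: "('i \<Rightarrow> real) measure"
  assumes I: "finite I" and "prob_space M" "prob_space N"
    and sets: "sets M = sets (PiM I (\<lambda>_. borel))" "sets N = sets (PiM I (\<lambda>_. borel))"
    and eq: "\<And>a b. (LINT x|M. cos ((\<Sum>i\<in>I. a i * x i) + b)) = (LINT x|N. cos ((\<Sum>i\<in>I. a i * x i) + b))"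
    and J: "J \<subseteq> I" and A: "\<And>j. A j \<in> sets borel"
  shows "(LINT x|M. (\<Prod>j\<in>J. indicator (A j) (x j)) * cos ((\<Sum>i\<in>I - J. a i * x i) + b))
       = (LINT x|N. (\<Prod>j\<in>J. indicator (A j) (x j)) * cos ((\<Sum>i\<in>I - J. a i * x i) + b))"
proof -
  interpret M: prob_space M by fact
  interpret N: prob_space N by fact
  note [measurable_cong] = sets
  note A[measurable]
  have "finite J" using J I finite_subset by blast
  then show ?thesis using J
  proof (induction J arbitrary: a b rule: finite_induct)
    case empty
    show ?case by (simp add: eq)
  next
    case (insert j J)
    have j: "j \<in> I" and JI: "J \<subseteq> I" using insert.prems by auto
    have Ij: "I - J = insert j (I - insert j J)" using j insert.hyps(2) by auto
    have finIJ: "finite (I - insert j J)" using I by simp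
    have comp[measurable]: "(\<lambda>x. x i) \<in> borel_measurable M" "(\<lambda>x. x i) \<in> borel_measurable N" if "i \<in> I" for i
      using that by measurable
    define p where "p x = (\<Prod>j\<in>J. indicator (A j) (x j) :: real)" for x :: "'i \<Rightarrow> real"
    have p01: "0 \<le> p x" "p x \<le> 1" for x
      unfolding p_def by (auto intro!: prod_nonneg prod_le_1)
    have p_abs: "\<bar>p x\<bar> \<le> 1" for x using p01[of x] by simp
    have p_meas[measurable]: "p \<in> borel_measurable M" "p \<in> borel_measurable N"
      unfolding p_def using JI comp by (auto intro!: borel_measurable_prod borel_measurable_indicator' simp: subset_iff)
    have ind_meas[measurable]: "(\<lambda>x. indicator (A j) (x j) :: real) \<in> borel_measurable M"
      "(\<lambda>x. indicator (A j) (x j) :: real) \<in> borel_measurable N"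
      using comp[OF j] by measurable
    define \<theta> where "\<theta> a x = (\<Sum>i\<in>I - insert j J. a i * x i)" for a and x :: "'i \<Rightarrow> real"
    have \<theta>_meas[measurable]: "\<theta> a \<in> borel_measurable M" "\<theta> a \<in> borel_measurable N" for a
      unfolding \<theta>_def using comp by (auto intro!: borel_measurable_sum)
    \<comment> \<open>Coordinate j receives its own frequency t, while \<theta> keeps the
      coordinates that remain trigonometric.\<close>
    have split: "(\<Sum>i\<in>I - J. (a(j := t)) i * x i) = t * x j + \<theta> a x" for a t x
      unfolding Ij \<theta>_def using finIJ by (subst sum.insert) (auto intro!: sum.cong)
    have IH: "(LINT x|M. p x * cos (t * x j + \<theta> a x + b)) = (LINT x|N. p x * cos (t * x j + \<theta> a x + b))" for a t b
      using insert.IH[OF JI, of "a(j := t)" b] unfolding split p_def .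
    have w: "(LINT x|M. p x * (1 + cos (\<theta> a x + b)) * indicator (A j) (x j))
           = (LINT x|N. p x * (1 + cos (\<theta> a x + b)) * indicator (A j) (x j))" for a b
    proof (rule weighted_char_unique[where C=2])
      show "0 \<le> p x * (1 + cos (\<theta> a x + b))" for x
        using p01[of x] cos_ge_minus_one[of "\<theta> a x + b"] by (intro mult_nonneg_nonneg) linarith+
      show "p x * (1 + cos (\<theta> a x + b)) \<le> 2" for x
      proof -
        have "p x * (1 + cos (\<theta> a x + b)) \<le> 1 * 2"
          using p01[of x] cos_ge_minus_one[of "\<theta> a x + b"] cos_le_one[of "\<theta> a x + b"]
          by (intro mult_mono) linarith+
        then show ?thesis by simp
      qed
      show "0 \<le> p x * (1 + cos (\<theta> a x + b))" for x
        using p01[of x] cos_ge_minus_one[of "\<theta> a x + b"] by (intro mult_nonneg_nonneg) linarith+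
      show "p x * (1 + cos (\<theta> a x + b)) \<le> 2" for x
      proof -
        have "p x * (1 + cos (\<theta> a x + b)) \<le> 1 * 2"
          using p01[of x] cos_ge_minus_one[of "\<theta> a x + b"] cos_le_one[of "\<theta> a x + b"]
          by (intro mult_mono) linarith+
        then show ?thesis by simp
      qed
      fix t s :: real
      \<comment> \<open>The weight p (1 + cos) times a cosine is, by the product formula, a
        combination of three terms of the shape covered by the induction hypothesis.\<close>
      have expand: "p x * (1 + cos (\<theta> a x + b)) * cos (t * x j + s) =
          p x * cos (t * x j + \<theta> (\<lambda>_. 0) x + s) + (p x * cos (t * x j + \<theta> a x + (s + b)) / 2
            + p x * cos ((-t) * x j + \<theta> a x + (b - s)) / 2)" for x
      proof -
        have "cos (\<theta> a x + b) * cos (t * x j + s) = (cos (t * x j + \<theta> a x + (s + b)) + cos ((-t) * x j + \<theta> a x + (b - s))) / 2"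
          by (subst cos_times_cos) (simp add: algebra_simps)
        moreover have "\<theta> (\<lambda>_. 0) x = 0" by (simp add: \<theta>_def)
        ultimately show ?thesis by (simp add: algebra_simps add_divide_distrib)
      qed
      have iM: "integrable M (\<lambda>x. p x * cos (t * x j + \<theta> a x + s))" for t s a
        by (rule M.integrable_bounded_mult_cos[where C=1]) (use p_abs comp[OF j] in measurable)
      have iN: "integrable N (\<lambda>x. p x * cos (t * x j + \<theta> a x + s))" for t s a
        by (rule N.integrable_bounded_mult_cos[where C=1]) (use p_abs comp[OF j] in measurable)
      show "(LINT x|M. p x * (1 + cos (\<theta> a x + b)) * cos (t * x j + s)) = (LINT x|N. p x * (1 + cos (\<theta> a x + b)) * cos (t * x j + s))"
        unfolding expand integral_add_halves[OF iM iM iM] integral_add_halves[OF iN iN iN] IH ..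
    qed (use comp[OF j] M.prob_space_axioms N.prob_space_axioms A in measurable)
    have iM: "integrable M (\<lambda>x. p x * indicator (A j) (x j) * cos (\<theta> a x + b))" for a b
    proof (rule M.integrable_bounded_mult_cos[where C=1])
      show "(\<lambda>x. p x * indicator (A j) (x j)) \<in> borel_measurable M" by measurable
      show "\<bar>p x * indicator (A j) (x j)\<bar> \<le> 1" for x using p01[of x] by (auto simp: indicator_def)
    qed measurable
    have iN: "integrable N (\<lambda>x. p x * indicator (A j) (x j) * cos (\<theta> a x + b))" for a b
    proof (rule N.integrable_bounded_mult_cos[where C=1])
      show "(\<lambda>x. p x * indicator (A j) (x j)) \<in> borel_measurable N" by measurable
      show "\<bar>p x * indicator (A j) (x j)\<bar> \<le> 1" for x using p01[of x] by (auto simp: indicator_def)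
    qed measurable
    have iM0: "integrable M (\<lambda>x. p x * indicator (A j) (x j))" and iN0: "integrable N (\<lambda>x. p x * indicator (A j) (x j))"
      using iM[of "\<lambda>_. 0" 0] iN[of "\<lambda>_. 0" 0] by (simp_all add: \<theta>_def)
    \<comment> \<open>Zero frequencies and phase make the weight 2 p. This isolates the part without
      cosine, which is then subtracted from the general identity.\<close>
    have "(LINT x|M. 2 * (p x * indicator (A j) (x j))) = (LINT x|N. 2 * (p x * indicator (A j) (x j)))"
      using w[of "\<lambda>_. 0" 0] by (simp add: \<theta>_def mult_ac)
    then have one: "(LINT x|M. p x * indicator (A j) (x j)) = (LINT x|N. p x * indicator (A j) (x j))"
      by simp
    have "(LINT x|M. p x * indicator (A j) (x j) + p x * indicator (A j) (x j) * cos (\<theta> a x + b))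
       = (LINT x|N. p x * indicator (A j) (x j) + p x * indicator (A j) (x j) * cos (\<theta> a x + b))"
      using w[of a b] by (simp add: algebra_simps)
    then have "(LINT x|M. p x * indicator (A j) (x j) * cos (\<theta> a x + b)) = (LINT x|N. p x * indicator (A j) (x j) * cos (\<theta> a x + b))"
      using one by (simp add: iM iN iM0 iN0)
    then show ?case
      using insert.hyps unfolding p_def \<theta>_def by (simp add: mult_ac)
  qed
qed

text \<open>With J = I no trigonometric factor is left, so the two measures agree on boxes, and
  boxes generate the product sigma-algebra.\<close>

lemma PiM_char_unique:
  fixes M N :: "('i \<Rightarrow> real) measure"
  assumes I: "finite I" and "prob_space M" "prob_space N"
    and sets: "sets M = sets (PiM I (\<lambda>_. borel))" "sets N = sets (PiM I (\<lambda>_. borel))"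
    and eq: "\<And>a b. (LINT x|M. cos ((\<Sum>i\<in>I. a i * x i) + b)) = (LINT x|N. cos ((\<Sum>i\<in>I. a i * x i) + b))"
  shows "M = N"
proof -
  interpret M: prob_space M by fact
  interpret N: prob_space N by fact
  have sp: "space M = space (PiM I (\<lambda>_. borel))" "space N = space (PiM I (\<lambda>_. borel))"
    using sets by (auto dest: sets_eq_imp_space_eq)
  show ?thesis
  proof (rule measure_eqI_PiM_finite[OF I sets(1,2), where A="\<lambda>_. space (PiM I (\<lambda>_. borel))"])
    fix A :: "'i \<Rightarrow> real set" assume A: "\<And>i. i \<in> I \<Longrightarrow> A i \<in> sets borel"
    \<comment> \<open>Outside I the sets A i are arbitrary; the empty set there makes the whole
      family measurable, as \<open>PiM_char_partial\<close> demands.\<close>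
    define A' where "A' i = (if i \<in> I then A i else {})" for i
    have A': "A' i \<in> sets borel" for i using A by (simp add: A'_def)
    have PiE: "Pi\<^sub>E I A \<in> sets (PiM I (\<lambda>_. borel))" using A I by (intro sets_PiM_I_finite) auto
    have ind: "(\<Prod>j\<in>I. indicator (A' j) (x j)) = (indicator (Pi\<^sub>E I A) x :: real)" if "x \<in> space (PiM I (\<lambda>_. borel))" for x
    proof -
      have "x \<in> Pi\<^sub>E I A \<longleftrightarrow> (\<forall>i\<in>I. x i \<in> A i)" using that by (auto simp: space_PiM PiE_iff)
      moreover have "(\<Prod>j\<in>I. indicator (A' j) (x j)) = (\<Prod>j\<in>I. indicator (A j) (x j) :: real)"
        by (intro prod.cong) (auto simp: A'_def)
      ultimately show ?thesis using I by (auto simp: indicator_def)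
    qed
    have "(LINT x|M. (\<Prod>j\<in>I. (indicator (A' j) (x j) :: real))) = (LINT x|N. (\<Prod>j\<in>I. (indicator (A' j) (x j) :: real)))"
      using PiM_char_partial[OF assms subset_refl A', where a="\<lambda>_. 0" and b=0] by simp
    also have "(LINT x|M. (\<Prod>j\<in>I. (indicator (A' j) (x j) :: real))) = (LINT x|M. indicator (Pi\<^sub>E I A) x)"
      by (rule Bochner_Integration.integral_cong[OF refl ind]) (simp add: sp)
    also have "(LINT x|M. (indicator (Pi\<^sub>E I A) x :: real)) = measure M (Pi\<^sub>E I A)"
      using PiE sets by (simp add: sets.Int_space_eq2)
    also have "(LINT x|N. (\<Prod>j\<in>I. (indicator (A' j) (x j) :: real))) = (LINT x|N. indicator (Pi\<^sub>E I A) x)"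
      by (rule Bochner_Integration.integral_cong[OF refl ind]) (simp add: sp)
    also have "(LINT x|N. (indicator (Pi\<^sub>E I A) x :: real)) = measure N (Pi\<^sub>E I A)"
      using PiE sets by (simp add: sets.Int_space_eq2)
    finally show "emeasure M (Pi\<^sub>E I A) = emeasure N (Pi\<^sub>E I A)"
      by (simp add: M.emeasure_eq_measure N.emeasure_eq_measure)
  next
    show "range (\<lambda>_::nat. space (PiM I (\<lambda>_. borel))) \<subseteq> prod_algebra I (\<lambda>_. borel)"
      using prod_algebraI_finite[OF I, of "\<lambda>_. UNIV" "\<lambda>_. borel"] by (auto simp: space_PiM)
  qed (auto simp: M.emeasure_eq_measure sp)
qed

text \<open>Cholesky factorization by splitting off the last row. It also covers singular matrices,
  which occur as soon as two times coincide.\<close>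

lemma psd_gram_factorization:
  fixes G :: "nat \<Rightarrow> nat \<Rightarrow> real"
  assumes "\<And>i j. G i j = G j i" and "\<And>a. 0 \<le> (\<Sum>i<m. \<Sum>j<m. a i * a j * G i j)"
  shows "\<exists>c. \<forall>i<m. \<forall>j<m. G i j = (\<Sum>k<m. c i k * c j k)"
  using assms
proof (induction m arbitrary: G)
  case 0
  then show ?case by simp
next
  case (Suc m)
  note sym = Suc.prems(1)
  define g where "g = G m m"
  have expand: "(\<Sum>i<Suc m. \<Sum>j<Suc m. a i * a j * G i j) =
      (\<Sum>i<m. \<Sum>j<m. a i * a j * G i j) + 2 * a m * (\<Sum>i<m. a i * G i m) + (a m)\<^sup>2 * g" for a
  proof -
    have "(\<Sum>j<m. a m * a j * G m j) = a m * (\<Sum>i<m. a i * G i m)"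
      unfolding sum_distrib_left by (intro sum.cong refl) (metis mult.assoc sym)
    moreover have "(\<Sum>i<m. a i * a m * G i m) = a m * (\<Sum>i<m. a i * G i m)"
      by (simp add: sum_distrib_left mult_ac)
    ultimately show ?thesis by (simp add: sum.distrib g_def power2_eq_square)
  qed
  have psd: "0 \<le> (\<Sum>i<m. \<Sum>j<m. a i * a j * G i j) + 2 * r * (\<Sum>i<m. a i * G i m) + r\<^sup>2 * g" for a r
  proof -
    have "(\<Sum>i<m. \<Sum>j<m. (a(m := r)) i * (a(m := r)) j * G i j) = (\<Sum>i<m. \<Sum>j<m. a i * a j * G i j)"
      "(\<Sum>i<m. (a(m := r)) i * G i m) = (\<Sum>i<m. a i * G i m)"
      by (intro sum.cong; simp)+
    then show ?thesis using Suc.prems(2)[of "a(m := r)"] unfolding expand by simp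
  qed
  have g0: "0 \<le> g" using psd[of "\<lambda>_. 0" 1] by simp
  show ?case
  proof (cases "g = 0")
    case True
    \<comment> \<open>With g = 0 the quadratic polynomial in r is affine; being nonnegative on the
      whole line, it has slope 0.\<close>
    have Gim: "G i m = 0" if "i < m" for i
    proof (rule ccontr)
      assume ne: "G i m \<noteq> 0"
      have d: "(\<Sum>k<m. (if k = i then 1 else 0) * G k m) = G i m"
        "(\<Sum>k<m. \<Sum>j<m. (if k = i then 1 else 0) * (if j = i then 1 else 0) * G k j) = G i i"
        using that by (simp_all add: if_distrib[of "\<lambda>x. x * _"] sum.delta if_distrib[of "\<lambda>x. _ * x"] cong: if_cong)
      have "0 \<le> G i i + 2 * r * G i m" for r
        using psd[of "\<lambda>k. if k = i then 1 else 0" r] unfolding d True by simp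
      \<comment> \<open>For this r the expression equals -1.\<close>
      from this[of "- (G i i + 1) / (2 * G i m)"] show False using ne by (simp add: field_simps)
    qed
    have "0 \<le> (\<Sum>i<m. \<Sum>j<m. a i * a j * G i j)" for a using psd[of a 0] by simp
    from Suc.IH[OF sym this] obtain c where c: "\<forall>i<m. \<forall>j<m. G i j = (\<Sum>k<m. c i k * c j k)" by blast
    define c' where "c' i k = (if i < m \<and> k < m then c i k else 0)" for i k
    have "G i j = (\<Sum>k<Suc m. c' i k * c' j k)" if "i < Suc m" "j < Suc m" for i j
    proof -
      consider "i < m" "j < m" | "i = m" | "j = m" using \<open>i < Suc m\<close> \<open>j < Suc m\<close> by linarith
      then show ?thesis
      proof cases
        case 1 then show ?thesis using c by (simp add: c'_def)
      next
        case 2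
        then have "G i j = 0" using Gim[of j] sym[of m j] True g_def that by (cases "j = m") auto
        then show ?thesis using 2 by (simp add: c'_def)
      next
        case 3
        then have "G i j = 0" using Gim[of i] True g_def that by (cases "i = m") auto
        then show ?thesis using 3 by (simp add: c'_def)
      qed
    qed
    then show ?thesis by blast
  next
    case False
    with g0 have g: "0 < g" by simp
    \<comment> \<open>The Schur complement of the pivot g. It is the minimum over r of the quadratic
      form, attained at r = - s / g, and so remains positive semidefinite.\<close>
    define G' where "G' i j = G i j - G i m * G j m / g" for i j
    have "0 \<le> (\<Sum>i<m. \<Sum>j<m. a i * a j * G' i j)" for a
    proof -
      define s where "s = (\<Sum>i<m. a i * G i m)"
      have "(\<Sum>i<m. \<Sum>j<m. a i * a j * G' i j) = (\<Sum>i<m. \<Sum>j<m. a i * a j * G i j) - (\<Sum>i<m. \<Sum>j<m. (a i * G i m) * (a j * G j m)) / g"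
        by (simp add: G'_def right_diff_distrib sum_subtractf sum_divide_distrib mult_ac)
      also have "(\<Sum>i<m. \<Sum>j<m. (a i * G i m) * (a j * G j m)) = s * s"
        unfolding s_def by (rule sum_product[symmetric])
      also have "(\<Sum>i<m. \<Sum>j<m. a i * a j * G i j) - s * s / g = (\<Sum>i<m. \<Sum>j<m. a i * a j * G i j) + 2 * (- s / g) * s + (- s / g)\<^sup>2 * g"
        using g by (simp add: power2_eq_square field_simps)
      also have "\<dots> \<ge> 0" using psd[of a "- s / g"] by (simp add: s_def)
      finally show ?thesis .
    qed
    moreover have "G' i j = G' j i" for i j using sym[of i j] by (simp add: G'_def mult.commute)
    ultimately obtain c where c: "\<forall>i<m. \<forall>j<m. G' i j = (\<Sum>k<m. c i k * c j k)" using Suc.IH by blast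
    define c' where "c' i k = (if k = m then G i m / sqrt g else if i < m then c i k else 0)" for i k
    have "G i j = (\<Sum>k<Suc m. c' i k * c' j k)" if "i < Suc m" "j < Suc m" for i j
    proof -
      have "(\<Sum>k<Suc m. c' i k * c' j k) = (\<Sum>k<m. c' i k * c' j k) + G i m * G j m / g"
        using g by (simp add: c'_def)
      also have "(\<Sum>k<m. c' i k * c' j k) = G' i j"
      proof (cases "i < m \<and> j < m")
        case True
        then show ?thesis using c by (simp add: c'_def)
      next
        case False
        then have "i = m \<or> j = m" using that by linarith
        then have "G' i j = 0" using g sym[of m j] by (auto simp: G'_def g_def)
        moreover have "(\<Sum>k<m. c' i k * c' j k) = 0" using False by (intro sum.neutral) (auto simp: c'_def)
        ultimately show ?thesis by simp
      qed
      finally show ?thesis by (simp add: G'_def)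
    qed
    then show ?thesis by blast
  qed
qed

lemma PiM_std_normal_cos:
  assumes I: "finite I"
  shows "(LINT z|PiM I (\<lambda>_. std_normal_distribution). cos ((\<Sum>i\<in>I. a i * z i) + b)) = exp (- (\<Sum>i\<in>I. (a i)\<^sup>2) / 2) * cos b"
proof -
  let ?P = "PiM I (\<lambda>_. std_normal_distribution)"
  interpret N: real_distribution std_normal_distribution by (rule real_dist_normal_dist)
  interpret product_sigma_finite "\<lambda>_. std_normal_distribution" by unfold_locales
  interpret P: prob_space ?P by (intro prob_space_PiM N.prob_space_axioms)
  have comp[measurable]: "(\<lambda>x. x i) \<in> borel_measurable ?P" if "i \<in> I" for i
    using measurable_component_singleton[OF that, of "\<lambda>_. std_normal_distribution"] by simp
  have sum_meas[measurable]: "(\<lambda>z. \<Sum>i\<in>I. a i * z i) \<in> borel_measurable ?P"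
    using comp by (auto intro!: borel_measurable_sum)
  have int: "complex_integrable std_normal_distribution (\<lambda>x. iexp (a i * x))" for i
    by (rule N.integrable_const_bound[where B=1]) auto
  have "(CLINT z|?P. (\<Prod>i\<in>I. iexp (a i * z i))) = (\<Prod>i\<in>I. CLINT x|std_normal_distribution. iexp (a i * x))"
    by (rule product_integral_prod[OF I int])
  also have "\<dots> = (\<Prod>i\<in>I. complex_of_real (exp (- (a i)\<^sup>2 / 2)))"
    using char_std_normal_distribution by (simp add: char_def fun_eq_iff)
  also have "\<dots> = complex_of_real (exp (- (\<Sum>i\<in>I. (a i)\<^sup>2) / 2))"
    using I by (simp add: exp_sum[symmetric] sum_negf sum_divide_distrib flip: of_real_prod)
  finally have *: "(CLINT z|?P. (\<Prod>i\<in>I. iexp (a i * z i))) = complex_of_real (exp (- (\<Sum>i\<in>I. (a i)\<^sup>2) / 2))" .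
  have prod: "(\<Prod>i\<in>I. iexp (a i * z i)) = iexp (\<Sum>i\<in>I. a i * z i)" for z
    using I by (simp add: exp_sum[symmetric] sum_distrib_left)
  have i: "complex_integrable ?P (\<lambda>z. iexp ((\<Sum>i\<in>I. a i * z i) + b))"
    by (rule P.integrable_const_bound[where B=1]) auto
  have "(CLINT z|?P. iexp ((\<Sum>i\<in>I. a i * z i) + b)) = (CLINT z|?P. iexp b * (\<Prod>i\<in>I. iexp (a i * z i)))"
    unfolding prod by (simp add: exp_add ring_distribs mult.commute)
  also have "\<dots> = iexp b * complex_of_real (exp (- (\<Sum>i\<in>I. (a i)\<^sup>2) / 2))"
    by (subst integral_mult_right_zero) (simp only: *)
  finally have "Re (CLINT z|?P. iexp ((\<Sum>i\<in>I. a i * z i) + b)) = Re (iexp b * complex_of_real (exp (- (\<Sum>i\<in>I. (a i)\<^sup>2) / 2)))"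
    by simp
  then show ?thesis
    using i by (simp add: integral_Re[symmetric] Re_exp mult.commute del: integral_Re)
qed

section \<open>The Volterra kernel\<close>

text \<open>The affine change of variable s = x + (t - x) y reduces to the Beta integral on the unit
  interval. In this form the power of t - x disappears when p + q = 1, which is the mechanism of
  every Abel inversion below.\<close>

lemma nn_integral_beta_kernel:
  fixes p q x t :: real
  assumes p: "0 < p" and q: "0 < q" and xt: "x < t"
  shows "(\<integral>\<^sup>+s. ennreal ((s - x) powr (p - 1) * (t - s) powr (q - 1)) * indicator {x<..<t} s \<partial>lborel)
    = ennreal ((t - x) powr (p + q - 1) * Beta p q)"
proof -
  have base: "(\<integral>\<^sup>+y. ennreal (y powr (p - 1) * (1 - y) powr (q - 1)) * indicator {0..1} y \<partial>lborel) = ennreal (Beta p q)"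
    by (rule nn_integral_has_integral_lebesgue'[OF _ has_integral_Beta_real[OF p q]]) auto
  have eq: "ennreal ((x + (t - x) * y - x) powr (p - 1) * (t - (x + (t - x) * y)) powr (q - 1)) * indicator {x<..<t} (x + (t - x) * y)
      = ennreal ((t - x) powr (p + q - 2)) * (ennreal (y powr (p - 1) * (1 - y) powr (q - 1)) * indicator {0..1} y)" for y
  proof (cases "0 < y \<and> y < 1")
    case True
    have p: "0 < (t - x) * y" using True xt by simp
    have "(t - x) * y < (t - x) * 1" by (rule mult_strict_left_mono) (use True xt in auto)
    then have q: "(t - x) * y < t - x" by (simp only: mult_1_right)
    have "x + (t - x) * y \<in> {x<..<t}"
      using p q by (intro greaterThanLessThan_iff[THEN iffD2] conjI) linarith+
    moreover have "t - (x + (t - x) * y) = (t - x) * (1 - y)" by (simp add: algebra_simps)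
    moreover have "((t - x) * y) powr (p - 1) * ((t - x) * (1 - y)) powr (q - 1)
        = (t - x) powr (p + q - 2) * (y powr (p - 1) * (1 - y) powr (q - 1))"
    proof -
      have "(t - x) powr (p - 1) * (t - x) powr (q - 1) = (t - x) powr (p + q - 2)"
        by (simp add: powr_add[symmetric] algebra_simps)
      moreover have "((t - x) * y) powr (p - 1) * ((t - x) * (1 - y)) powr (q - 1)
        = ((t - x) powr (p - 1) * (t - x) powr (q - 1)) * (y powr (p - 1) * (1 - y) powr (q - 1))"
        using xt True by (simp add: powr_mult mult_ac)
      ultimately show ?thesis by simp
    qed
    ultimately show ?thesis using True by (simp add: ennreal_mult')
  next
    case False
    have "x + (t - x) * y \<notin> {x<..<t}"
    proof
      assume "x + (t - x) * y \<in> {x<..<t}"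
      then have a: "0 < (t - x) * y" and "(t - x) * y < t - x" by (simp, simp only: greaterThanLessThan_iff, linarith)
      then have b: "(t - x) * y < (t - x) * 1" by (simp only: mult_1_right)
      have tx: "0 < t - x" using xt by simp
      have "0 < y" using a tx by (simp add: zero_less_mult_iff)
      moreover have "y < 1" by (rule mult_less_cancel_left_pos[THEN iffD1, OF tx b])
      ultimately show False using False by simp
    qed
    \<comment> \<open>At y = 0 and y = 1 the closed indicator is 1 and the open one is 0; the values
      agree because \<open>0 powr a = 0\<close> for every a.\<close>
    moreover have "(y powr (p - 1) * (1 - y) powr (q - 1)) * indicator {0..1} y = 0"
      using False by (cases "y = 0 \<or> y = 1") (auto simp: indicator_def)
    then have "ennreal (y powr (p - 1) * (1 - y) powr (q - 1)) * indicator {0..1} y = 0"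
      by (auto simp: indicator_def split: if_splits)
    ultimately show ?thesis by simp
  qed
  have "(\<integral>\<^sup>+s. ennreal ((s - x) powr (p - 1) * (t - s) powr (q - 1)) * indicator {x<..<t} s \<partial>lborel)
      = ennreal (t - x) * (\<integral>\<^sup>+y. ennreal ((t - x) powr (p + q - 2)) * (ennreal (y powr (p - 1) * (1 - y) powr (q - 1)) * indicator {0..1} y) \<partial>lborel)"
    using xt by (subst nn_integral_real_affine[where c="t - x" and t=x]) (simp_all only: eq, simp_all)
  also have "\<dots> = ennreal ((t - x) * ((t - x) powr (p + q - 2) * Beta p q))"
    using xt by (subst nn_integral_cmult) (simp_all only: base, simp_all add: ennreal_mult')
  also have "(t - x) * ((t - x) powr (p + q - 2) * Beta p q) = (t - x) powr (p + q - 1) * Beta p q"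
    using xt powr_mult_base[of "t - x" "p + q - 2"] by (simp add: algebra_simps)
  finally show ?thesis .
qed

lemma Beta_1_right_real: "Beta p 1 = 1 / p" if "0 < p" for p :: real
proof -
  have "p \<notin> \<int>\<^sub>\<le>\<^sub>0" using that by (auto elim!: nonpos_Ints_cases)
  moreover have "Gamma p \<noteq> 0" using Gamma_real_pos[OF that] by simp
  ultimately show ?thesis using that by (simp add: Beta_def Gamma_plus1 del: Gamma_eq_zero_iff)
qed

lemma nn_integral_powr_left:
  fixes p x t :: real
  assumes "0 < p" "x < t"
  shows "(\<integral>\<^sup>+s. ennreal ((s - x) powr (p - 1)) * indicator {x<..<t} s \<partial>lborel) = ennreal ((t - x) powr p / p)"
proof -
  have "(\<integral>\<^sup>+s. ennreal ((s - x) powr (p - 1)) * indicator {x<..<t} s \<partial>lborel)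
    = (\<integral>\<^sup>+s. ennreal ((s - x) powr (p - 1) * (t - s) powr (1 - 1)) * indicator {x<..<t} s \<partial>lborel)"
    by (intro nn_integral_cong) (auto simp: indicator_def)
  also have "\<dots> = ennreal ((t - x) powr p / p)"
    using assms by (subst nn_integral_beta_kernel) (auto simp: Beta_1_right_real)
  finally show ?thesis .
qed

lemma nn_integral_powr_right:
  fixes p x t :: real
  assumes "0 < p" "x < t"
  shows "(\<integral>\<^sup>+s. ennreal ((t - s) powr (p - 1)) * indicator {x<..<t} s \<partial>lborel) = ennreal ((t - x) powr p / p)"
proof -
  have "(\<integral>\<^sup>+s. ennreal ((t - s) powr (p - 1)) * indicator {x<..<t} s \<partial>lborel)
    = (\<integral>\<^sup>+s. ennreal ((s - x) powr (1 - 1) * (t - s) powr (p - 1)) * indicator {x<..<t} s \<partial>lborel)"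
    by (intro nn_integral_cong) (auto simp: indicator_def)
  also have "\<dots> = ennreal ((t - x) powr p / p)"
    using assms by (subst nn_integral_beta_kernel) (auto simp: Beta_1_right_real Beta_commute[of 1])
  finally show ?thesis .
qed

locale hurst_parameter =
  fixes H :: real
  assumes H_gt: "1/2 < H" and H_lt: "H < 1"
begin

text \<open>The exponents of the kernel become - \<beta>, \<beta> and \<beta> - 1, and 2 - 2 H
  becomes 1 - 2 \<beta>, which is positive exactly because H < 1.\<close>

definition \<beta> :: real where "\<beta> = H - 1/2"

abbreviation cH :: real where "cH \<equiv> c_const H"

lemma \<beta>_pos: "0 < \<beta>" and \<beta>_lt: "\<beta> < 1/2"
  using H_gt H_lt by (auto simp: \<beta>_def)

lemma Beta_pos: "0 < p \<Longrightarrow> 0 < q \<Longrightarrow> 0 < Beta p q" for p q :: real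
  by (simp add: Beta_def Gamma_real_pos)

lemma cH_sq: "cH\<^sup>2 = (\<beta> + 1/2) * (2 * \<beta>) / Beta (1 - 2 * \<beta>) \<beta>" and cH_pos: "0 < cH"
proof -
  have "0 < Beta (1 - 2 * \<beta>) \<beta>" using \<beta>_pos \<beta>_lt by (intro Beta_pos) auto
  moreover have "cH = sqrt ((\<beta> + 1/2) * (2 * \<beta>) / Beta (1 - 2 * \<beta>) \<beta>)"
    unfolding c_const_def by (simp add: \<beta>_def algebra_simps)
  ultimately show "cH\<^sup>2 = (\<beta> + 1/2) * (2 * \<beta>) / Beta (1 - 2 * \<beta>) \<beta>" "0 < cH"
    using \<beta>_pos by auto
qed

text \<open>The derivative of K(u, r) in the time u, extended by 0 off 0 < r < u so that
  \<open>K_kernel\<close> is its integral over {..t} for all real arguments.\<close>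

definition dK :: "real \<Rightarrow> real \<Rightarrow> real" where
  "dK r u = indicator {0<..} r * indicator {r<..} u * (cH * r powr (- \<beta>) * u powr \<beta> * (u - r) powr (\<beta> - 1))"

lemma dK_nonneg: "0 \<le> dK r u"
  using cH_pos by (auto simp: dK_def indicator_def)

lemma dK_measurable2[measurable]: "(\<lambda>z. dK (fst z) (snd z)) \<in> borel_measurable (borel \<Otimes>\<^sub>M borel)"
proof -
  have eq: "(\<lambda>z. dK (fst z) (snd z)) = (\<lambda>z. if 0 < fst z \<and> fst z < snd z then cH * fst z powr (- \<beta>) * snd z powr \<beta> * (snd z - fst z) powr (\<beta> - 1) else 0)"
    by (auto simp: dK_def indicator_def fun_eq_iff)
  show ?thesis unfolding eq by measurable
qed

lemma dK_measurable[measurable (raw)]: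
  assumes "f \<in> borel_measurable M" "g \<in> borel_measurable M"
  shows "(\<lambda>x. dK (f x) (g x)) \<in> borel_measurable M"
  using measurable_compose[OF measurable_Pair[OF assms] dK_measurable2] by simp

lemma dK_zero: "r \<le> 0 \<or> u \<le> r \<Longrightarrow> dK r u = 0"
  by (auto simp: dK_def indicator_def)

lemma K_kernel_eq: "K_kernel H t r = (LINT u|lborel. indicator {..t} u * dK r u)"
proof (cases "0 < r \<and> r \<le> t")
  case True
  have "(LINT u:{r..t}|lebesgue. u powr (H - 1/2) * (u - r) powr (H - 3/2))
      = (LINT u|lborel. indicator {r..t} u * (u powr \<beta> * (u - r) powr (\<beta> - 1)))"
    unfolding set_lebesgue_integral_def by (subst integral_completion) (auto simp: \<beta>_def algebra_simps)
  then have "K_kernel H t r = (LINT u|lborel. cH * r powr (- \<beta>) * (indicator {r..t} u * (u powr \<beta> * (u - r) powr (\<beta> - 1))))"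
    unfolding K_kernel_def using True by (simp add: \<beta>_def)
  also have "\<dots> = (LINT u|lborel. indicator {..t} u * dK r u)"
  proof (rule Bochner_Integration.integral_cong[OF refl])
    fix u
    \<comment> \<open>At u = r the closed interval on the left meets the open one inside
      \<open>dK\<close>; both sides are 0 by the value of \<open>powr\<close> at 0.\<close>
    have "(0::real) powr (\<beta> - 1) = 0" by simp
    then show "cH * r powr (- \<beta>) * (indicator {r..t} u * (u powr \<beta> * (u - r) powr (\<beta> - 1))) = indicator {..t} u * dK r u"
      using True by (cases "u = r") (auto simp: dK_def indicator_def)
  qed
  finally show ?thesis .
next
  case False
  then have "r \<le> 0 \<or> t < r" by auto
  then show ?thesis
  proof
    assume "r \<le> 0"
    then have "dK r u = 0" for u by (rule dK_zero[OF disjI1])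
    then show ?thesis using \<open>r \<le> 0\<close> by (cases "r = 0") (auto simp: K_kernel_def indicator_def)
  next
    assume t: "t < r"
    then have "indicator {..t} u * dK r u = 0" for u by (auto simp: indicator_def dK_zero)
    then have "(LINT u|lborel. indicator {..t} u * dK r u) = 0" by (simp only: integral_zero)
    then show ?thesis using t by (simp add: K_kernel_def)
  qed
qed

lemma K_measurable2[measurable]: "(\<lambda>z. K_kernel H (fst z) (snd z)) \<in> borel_measurable (borel \<Otimes>\<^sub>M borel)"
proof -
  have m: "(\<lambda>w. (if snd w \<le> fst (fst w) then dK (snd (fst w)) (snd w) else 0)) \<in> borel_measurable ((borel \<Otimes>\<^sub>M borel) \<Otimes>\<^sub>M lborel)"
    by measurable
  have eq: "(\<lambda>z. K_kernel H (fst z) (snd z)) = (\<lambda>z. LINT u|lborel. (if u \<le> fst z then dK (snd z) u else 0))"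
    unfolding K_kernel_eq by (intro ext Bochner_Integration.integral_cong) (auto simp: indicator_def)
  show ?thesis unfolding eq
    by (rule lborel.borel_measurable_lebesgue_integral) (use m in \<open>simp add: case_prod_beta'\<close>)
qed

lemma K_measurable[measurable (raw)]:
  assumes "f \<in> borel_measurable M" "g \<in> borel_measurable M"
  shows "(\<lambda>x. K_kernel H (f x) (g x)) \<in> borel_measurable M"
  using measurable_compose[OF measurable_Pair[OF assms] K_measurable2] by simp

lemma nn_integral_dK_le:
  assumes r: "0 < r" "r < t"
  shows "(\<integral>\<^sup>+u. ennreal (indicator {..t} u * dK r u) \<partial>lborel) \<le> ennreal (cH / \<beta> * r powr (- \<beta>) * t powr \<beta> * (t - r) powr \<beta>)"
proof -
  \<comment> \<open>The majorant is set to infinity at the single point u = t, which the open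
    interval on the right misses.\<close>
  have "(\<integral>\<^sup>+u. ennreal (indicator {..t} u * dK r u) \<partial>lborel)
      \<le> (\<integral>\<^sup>+u. ennreal (cH * r powr (- \<beta>) * t powr \<beta>) * (ennreal ((u - r) powr (\<beta> - 1)) * indicator {r<..<t} u) + (if u = t then \<infinity> else 0) \<partial>lborel)"
  proof (rule nn_integral_mono)
    fix u
    show "ennreal (indicator {..t} u * dK r u) \<le> ennreal (cH * r powr (- \<beta>) * t powr \<beta>) * (ennreal ((u - r) powr (\<beta> - 1)) * indicator {r<..<t} u) + (if u = t then \<infinity> else 0)"
    proof (cases "r < u \<and> u < t")
      case True
      have "cH * r powr (- \<beta>) * u powr \<beta> * (u - r) powr (\<beta> - 1) \<le> cH * r powr (- \<beta>) * t powr \<beta> * (u - r) powr (\<beta> - 1)"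
        using True r cH_pos \<beta>_pos by (intro mult_right_mono mult_left_mono powr_mono2) auto
      then show ?thesis using True r cH_pos by (simp add: dK_def ennreal_mult'[symmetric] ennreal_leI)
    next
      case False
      then show ?thesis by (cases "u = t") (auto simp: dK_def indicator_def)
    qed
  qed
  also have "\<dots> = (\<integral>\<^sup>+u. ennreal (cH * r powr (- \<beta>) * t powr \<beta>) * (ennreal ((u - r) powr (\<beta> - 1)) * indicator {r<..<t} u) \<partial>lborel)"
  proof (rule nn_integral_cong_AE)
    show "AE u in lborel. ennreal (cH * r powr (- \<beta>) * t powr \<beta>) * (ennreal ((u - r) powr (\<beta> - 1)) * indicator {r<..<t} u) + (if u = t then \<infinity> else 0)
       = ennreal (cH * r powr (- \<beta>) * t powr \<beta>) * (ennreal ((u - r) powr (\<beta> - 1)) * indicator {r<..<t} u)"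
      using AE_lborel_singleton[of t] by eventually_elim auto
  qed
  also have "\<dots> = ennreal (cH * r powr (- \<beta>) * t powr \<beta>) * ennreal ((t - r) powr \<beta> / \<beta>)"
    using r \<beta>_pos by (subst nn_integral_cmult) (auto simp: nn_integral_powr_left)
  also have "\<dots> = ennreal (cH / \<beta> * r powr (- \<beta>) * t powr \<beta> * (t - r) powr \<beta>)"
    using cH_pos \<beta>_pos by (simp add: ennreal_mult'[symmetric] mult_ac)
  finally show ?thesis .
qed

lemma integrable_dK: "integrable lborel (\<lambda>u. indicator {..t} u * dK r u)"
proof (cases "0 < r \<and> r < t")
  case True
  show ?thesis
    by (rule integrableI_bounded)
      (use nn_integral_dK_le[of r t] True dK_nonneg in \<open>auto simp: abs_mult less_top[symmetric] top_unique\<close>)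
next
  case False
  then have "(\<lambda>u. indicator {..t} u * dK r u) = (\<lambda>u. 0)" by (auto simp: indicator_def dK_zero fun_eq_iff)
  then show ?thesis by simp
qed

lemma K_nn: "ennreal (K_kernel H t r) = (\<integral>\<^sup>+u. ennreal (indicator {..t} u * dK r u) \<partial>lborel)"
  unfolding K_kernel_eq using dK_nonneg by (intro nn_integral_eq_integral[symmetric] integrable_dK) auto

lemma K_nonneg: "0 \<le> K_kernel H t r"
  unfolding K_kernel_eq using dK_nonneg by (intro Bochner_Integration.integral_nonneg) auto

lemma K_zero: "r \<le> 0 \<or> t \<le> r \<Longrightarrow> K_kernel H t r = 0"
proof -
  assume "r \<le> 0 \<or> t \<le> r"
  then have "(\<lambda>u. indicator {..t} u * dK r u) = (\<lambda>u. 0)" by (auto simp: indicator_def dK_zero fun_eq_iff)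
  then show ?thesis by (simp add: K_kernel_eq)
qed

lemma K_le: "t \<le> 1 \<Longrightarrow> K_kernel H t r \<le> cH / \<beta> * indicator {0<..<1} r * r powr (- \<beta>)"
proof (cases "0 < r \<and> r < t")
  case True
  assume t: "t \<le> 1"
  have "ennreal (K_kernel H t r) \<le> ennreal (cH / \<beta> * r powr (- \<beta>) * t powr \<beta> * (t - r) powr \<beta>)"
    unfolding K_nn using True by (intro nn_integral_dK_le) auto
  then have "K_kernel H t r \<le> cH / \<beta> * r powr (- \<beta>) * t powr \<beta> * (t - r) powr \<beta>"
    using cH_pos \<beta>_pos by (subst (asm) ennreal_le_iff) auto
  also have "\<dots> \<le> cH / \<beta> * r powr (- \<beta>) * 1 * 1"
    using True t cH_pos \<beta>_pos by (intro mult_mono powr_le1) auto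
  finally show ?thesis using True t by simp
next
  case False
  then have "K_kernel H t r = 0" by (intro K_zero) auto
  then show ?thesis using cH_pos \<beta>_pos by (simp add: indicator_def)
qed

lemma K_continuous: "continuous_on {0..1} (\<lambda>t. K_kernel H t r)"
proof -
  have si: "set_integrable lborel {0..t} (dK r)" if "0 \<le> t" for t
    unfolding set_integrable_def
    by (rule Bochner_Integration.integrable_bound[OF integrable_dK[of t r]]) (auto simp: indicator_def)
  have eq: "K_kernel H t r = integral {0..t} (dK r)" if "0 \<le> t" for t
  proof -
    have "K_kernel H t r = (LINT u:{0..t}|lborel. dK r u)"
      unfolding K_kernel_eq set_lebesgue_integral_def
      by (rule Bochner_Integration.integral_cong) (auto simp: indicator_def dK_def)
    then show ?thesis using set_borel_integral_eq_integral(2)[OF si[OF that]] by simp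
  qed
  have "continuous_on {0..1} (\<lambda>t. integral {0..t} (dK r))"
    by (rule indefinite_integral_continuous_1) (use set_borel_integral_eq_integral(1)[OF si[of 1]] in simp)
  then show ?thesis
  proof (rule continuous_on_eq)
    fix t :: real assume "t \<in> {0..1}"
    then show "integral {0..t} (dK r) = K_kernel H t r" using eq[of t] by simp
  qed
qed

section \<open>Square integrability and the covariance of the kernel\<close>

lemma nn_integral_powr_2\<beta>: "(\<integral>\<^sup>+r. ennreal (indicator {0<..<1} r * r powr (- 2 * \<beta>)) \<partial>lborel) = ennreal (1 / (1 - 2 * \<beta>))"
proof -
  have "(\<integral>\<^sup>+r. ennreal (indicator {0<..<1} r * r powr (- 2 * \<beta>)) \<partial>lborel) = (\<integral>\<^sup>+r. ennreal ((r - 0) powr ((1 - 2 * \<beta>) - 1)) * indicator {0<..<1} r \<partial>lborel)"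
    by (intro nn_integral_cong) (auto simp: indicator_def)
  also have "\<dots> = ennreal (1 / (1 - 2 * \<beta>))"
    using \<beta>_lt by (subst nn_integral_powr_left) auto
  finally show ?thesis .
qed

lemma integrable_powr_2\<beta>: "integrable lborel (\<lambda>r. indicator {0<..<1} r * r powr (- 2 * \<beta>))"
  by (rule integrableI_bounded) (use nn_integral_powr_2\<beta> in \<open>simp_all add: abs_mult\<close>)

text \<open>One square integrable majorant for all kernels K(t, .) with t <= 1; it serves every
  dominated convergence argument.\<close>

definition K_dom :: "real \<Rightarrow> real" where "K_dom r = cH / \<beta> * indicator {0<..<1} r * r powr (- \<beta>)"

lemma K_dom_nonneg: "0 \<le> K_dom r" using cH_pos \<beta>_pos by (simp add: K_dom_def indicator_def)

lemma K_dom_measurable[measurable]: "K_dom \<in> borel_measurable borel" unfolding K_dom_def by measurable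

lemma K_le_K_dom: "t \<le> 1 \<Longrightarrow> K_kernel H t r \<le> K_dom r" unfolding K_dom_def by (rule K_le)

lemma K_dom_sq_integrable: "integrable lborel (\<lambda>r. (K_dom r)\<^sup>2)"
proof -
  have "(K_dom r)\<^sup>2 = (cH / \<beta>)\<^sup>2 * (indicator {0<..<1} r * r powr (- 2 * \<beta>))" for r
    by (auto simp: K_dom_def indicator_def power2_eq_square powr_add[symmetric])
  then show ?thesis using integrable_powr_2\<beta> by simp
qed

lemma K_sq_integrable:
  assumes "s \<le> 1" "t \<le> 1" shows "integrable lborel (\<lambda>r. K_kernel H s r * K_kernel H t r)"
proof (rule Bochner_Integration.integrable_bound[of _ "\<lambda>r. (cH / \<beta>)\<^sup>2 * (indicator {0<..<1} r * r powr (- 2 * \<beta>))"])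
  show "AE r in lborel. norm (K_kernel H s r * K_kernel H t r) \<le> norm ((cH / \<beta>)\<^sup>2 * (indicator {0<..<1} r * r powr (- 2 * \<beta>)))"
  proof (rule AE_I2)
    fix r :: real
    let ?k = "cH / \<beta> * indicator {0<..<1} r * r powr (- \<beta>)"
    have "K_kernel H s r * K_kernel H t r \<le> ?k * ?k"
      using K_le assms K_nonneg cH_pos \<beta>_pos by (intro mult_mono) (auto simp: indicator_def)
    also have "?k * ?k = (cH / \<beta>)\<^sup>2 * (indicator {0<..<1} r * r powr (- 2 * \<beta>))"
      by (auto simp: indicator_def power2_eq_square powr_add[symmetric])
    finally show "norm (K_kernel H s r * K_kernel H t r) \<le> norm ((cH / \<beta>)\<^sup>2 * (indicator {0<..<1} r * r powr (- 2 * \<beta>)))"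
      using K_nonneg by (simp add: abs_mult abs_of_nonneg)
  qed
qed (use integrable_powr_2\<beta> in auto)

text \<open>The mixed second derivative of the covariance of fractional Brownian motion, since 2
  \<beta> - 1 = 2 H - 2. The Beta function in c_H is exactly the value of the remaining
  integral.\<close>

lemma nn_integral_dK_dK:
  assumes uv: "0 < u" "u < v"
  shows "(\<integral>\<^sup>+r. ennreal (dK r u * dK r v) \<partial>lborel) = ennreal (H * (2 * H - 1) * (v - u) powr (2 * \<beta> - 1))"
proof -
  \<comment> \<open>A Moebius map of [0, 1] onto [0, u], with inverse x = r (v - u) / (u (v - r)).
    The three exponents - 2 \<beta>, \<beta> - 1, \<beta> - 1 add up to -2, so the powers of the
    denominator cancel against the Jacobian and a Beta integrand is left.\<close>
  define g where "g x = u * v * x / (v - u + u * x)" for x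
  define g' where "g' x = u * v * (v - u) / (v - u + u * x)\<^sup>2" for x
  define f where "f r = r powr (- 2 * \<beta>) * (u - r) powr (\<beta> - 1) * (v - r) powr (\<beta> - 1)" for r
  have D: "0 < v - u + u * x" if "0 \<le> x" for x using uv that by (simp add: add_pos_nonneg)
  have g01: "g 0 = 0" "g 1 = u" using uv by (simp_all add: g_def)
  have fm: "f \<in> borel_measurable borel" unfolding f_def by measurable
  have "(\<integral>\<^sup>+r. ennreal (f r * indicator {g 0..g 1} r) \<partial>lborel) = (\<integral>\<^sup>+x. ennreal (f (g x) * g' x * indicator {0..1} x) \<partial>lborel)"
  proof (rule nn_integral_substitution)
    show "set_borel_measurable borel {g 0..g 1} f"
      unfolding set_borel_measurable_def using fm by measurable
    fix x :: real assume x: "x \<in> {0..1}"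
    show "(g has_real_derivative g' x) (at x)"
      unfolding g_def g'_def using D[of x] x
      by (auto intro!: derivative_eq_intros simp: power2_eq_square field_simps)
    show "0 \<le> g' x" unfolding g'_def using uv by simp
  next
    show "continuous_on {0..1} g'" unfolding g'_def using D
      by (intro continuous_intros) (metis atLeastAtMost_iff less_irrefl power_eq_0_iff)
  qed simp
  also have "\<dots> = (\<integral>\<^sup>+x. ennreal ((u * v) powr (- \<beta>) * (v - u) powr (2 * \<beta> - 1)) * (ennreal ((x - 0) powr ((1 - 2 * \<beta>) - 1) * (1 - x) powr (\<beta> - 1)) * indicator {0<..<1} x) \<partial>lborel)"
  proof (rule nn_integral_cong)
    fix x :: real
    show "ennreal (f (g x) * g' x * indicator {0..1} x) = ennreal ((u * v) powr (- \<beta>) * (v - u) powr (2 * \<beta> - 1)) * (ennreal ((x - 0) powr ((1 - 2 * \<beta>) - 1) * (1 - x) powr (\<beta> - 1)) * indicator {0<..<1} x)"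
    proof (cases "0 < x \<and> x < 1")
      case True
      let ?D = "v - u + u * x"
      have D: "0 < ?D" using D True by simp
      have e1: "u - g x = u * (v - u) * (1 - x) / ?D" using D by (simp add: g_def field_simps)
      have e2: "v - g x = v * (v - u) / ?D" using D by (simp add: g_def field_simps)
      have pos: "0 < u" "0 < v" "0 < v - u" "0 < x" "0 < 1 - x" "0 < ?D" using uv True D by auto
      have e3: "exp (2 * ln ?D) = ?D\<^sup>2"
        using pos powr_numeral[of ?D "num.Bit0 num.One"] by (simp add: powr_def)
      have "g' x = exp (ln u + ln v + ln (v - u)) / exp (2 * ln ?D)"
        unfolding g'_def e3 using pos by (simp only: exp_add exp_ln)
      then have G0: "g' x = exp (ln u + ln v + ln (v - u) - 2 * ln ?D)"
        by (simp only: exp_diff)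
      have G1: "(g x) powr (- 2 * \<beta>) = exp (- 2 * \<beta> * (ln u + ln v + ln x - ln ?D))"
        using pos by (simp add: g_def powr_def ln_mult ln_divide_pos)
      have G2: "(u - g x) powr (\<beta> - 1) = exp ((\<beta> - 1) * (ln u + ln (v - u) + ln (1 - x) - ln ?D))"
        unfolding e1 using pos by (simp add: powr_def ln_mult ln_divide_pos)
      have G3: "(v - g x) powr (\<beta> - 1) = exp ((\<beta> - 1) * (ln v + ln (v - u) - ln ?D))"
        unfolding e2 using pos by (simp add: powr_def ln_mult ln_divide_pos)
      have G4: "(u * v) powr (- \<beta>) * (v - u) powr (2 * \<beta> - 1) * (x powr (- 2 * \<beta>) * (1 - x) powr (\<beta> - 1))
          = exp (- \<beta> * (ln u + ln v) + (2 * \<beta> - 1) * ln (v - u) + (- 2 * \<beta> * ln x + (\<beta> - 1) * ln (1 - x)))"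
        using pos by (simp add: powr_def ln_mult mult_exp_exp algebra_simps)
      have "f (g x) * g' x = exp (- 2 * \<beta> * (ln u + ln v + ln x - ln ?D)) * exp ((\<beta> - 1) * (ln u + ln (v - u) + ln (1 - x) - ln ?D))
          * exp ((\<beta> - 1) * (ln v + ln (v - u) - ln ?D)) * exp (ln u + ln v + ln (v - u) - 2 * ln ?D)"
        unfolding f_def G0 G1 G2 G3 ..
      \<comment> \<open>The coefficient of ln ?D is 2 \<beta> - (\<beta> - 1) - (\<beta> - 1) - 2 =
        0.\<close>
      also have "\<dots> = exp (- \<beta> * (ln u + ln v) + (2 * \<beta> - 1) * ln (v - u) + (- 2 * \<beta> * ln x + (\<beta> - 1) * ln (1 - x)))"
        unfolding mult_exp_exp by (rule arg_cong[where f=exp]) (simp add: algebra_simps)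
      finally have "f (g x) * g' x = (u * v) powr (- \<beta>) * (v - u) powr (2 * \<beta> - 1) * (x powr (- 2 * \<beta>) * (1 - x) powr (\<beta> - 1))"
        unfolding G4 .
      then show ?thesis using True by (simp add: ennreal_mult'[symmetric])
    next
      case False
      have "f (g x) * g' x * indicator {0..1} x = 0"
        using False g01 by (cases "x = 0 \<or> x = 1") (auto simp: indicator_def f_def)
      then show ?thesis using False by (auto simp: indicator_def)
    qed
  qed
  also have "\<dots> = ennreal ((u * v) powr (- \<beta>) * (v - u) powr (2 * \<beta> - 1)) * ennreal (Beta (1 - 2 * \<beta>) \<beta>)"
  proof -
    have "(\<integral>\<^sup>+x. ennreal ((x - 0) powr ((1 - 2 * \<beta>) - 1) * (1 - x) powr (\<beta> - 1)) * indicator {0<..<1} x \<partial>lborel)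
        = ennreal ((1 - 0) powr ((1 - 2 * \<beta>) + \<beta> - 1) * Beta (1 - 2 * \<beta>) \<beta>)"
      by (rule nn_integral_beta_kernel) (use \<beta>_pos \<beta>_lt in auto)
    then show ?thesis by (subst nn_integral_cmult) (simp_all del: diff_zero)
  qed
  finally have I: "(\<integral>\<^sup>+r. ennreal (f r * indicator {0..u} r) \<partial>lborel) = ennreal ((u * v) powr (- \<beta>) * (v - u) powr (2 * \<beta> - 1)) * ennreal (Beta (1 - 2 * \<beta>) \<beta>)"
    unfolding g01 .
  have "dK r u * dK r v = (cH\<^sup>2 * (u * v) powr \<beta>) * (f r * indicator {0..u} r)" for r
  proof (cases "0 < r \<and> r < u")
    case True
    have "r powr (- \<beta>) * r powr (- \<beta>) = r powr (- 2 * \<beta>)" by (simp add: powr_add[symmetric])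
    moreover have "(u * v) powr \<beta> = u powr \<beta> * v powr \<beta>" using uv by (simp add: powr_mult)
    ultimately show ?thesis using True uv by (simp add: dK_def f_def power2_eq_square mult_ac)
  next
    case False
    then show ?thesis by (cases "r = 0 \<or> r = u") (auto simp: dK_def f_def indicator_def)
  qed
  then have "(\<integral>\<^sup>+r. ennreal (dK r u * dK r v) \<partial>lborel) = (\<integral>\<^sup>+r. ennreal (cH\<^sup>2 * (u * v) powr \<beta>) * ennreal (f r * indicator {0..u} r) \<partial>lborel)"
    by (simp add: ennreal_mult')
  also have "\<dots> = ennreal (cH\<^sup>2 * (u * v) powr \<beta>) * (ennreal ((u * v) powr (- \<beta>) * (v - u) powr (2 * \<beta> - 1)) * ennreal (Beta (1 - 2 * \<beta>) \<beta>))"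
    using fm I by (subst nn_integral_cmult) auto
  also have "\<dots> = ennreal (cH\<^sup>2 * (u * v) powr \<beta> * ((u * v) powr (- \<beta>) * (v - u) powr (2 * \<beta> - 1) * Beta (1 - 2 * \<beta>) \<beta>))"
    using cH_pos by (simp add: ennreal_mult'[symmetric])
  also have "cH\<^sup>2 * (u * v) powr \<beta> * ((u * v) powr (- \<beta>) * (v - u) powr (2 * \<beta> - 1) * Beta (1 - 2 * \<beta>) \<beta>) = H * (2 * H - 1) * (v - u) powr (2 * \<beta> - 1)"
  proof -
    have U: "(u * v) powr \<beta> * (u * v) powr (- \<beta>) = 1" using uv by (simp add: powr_add[symmetric])
    have C: "cH\<^sup>2 * Beta (1 - 2 * \<beta>) \<beta> = H * (2 * H - 1)"
    proof -
      have "(\<beta> + 1/2) * (2 * \<beta>) = H * (2 * H - 1)" by (simp add: \<beta>_def algebra_simps)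
      then show ?thesis unfolding cH_sq using Beta_pos[of "1 - 2 * \<beta>" \<beta>] \<beta>_pos \<beta>_lt by simp
    qed
    have "cH\<^sup>2 * (u * v) powr \<beta> * ((u * v) powr (- \<beta>) * (v - u) powr (2 * \<beta> - 1) * Beta (1 - 2 * \<beta>) \<beta>)
      = (cH\<^sup>2 * Beta (1 - 2 * \<beta>) \<beta>) * ((u * v) powr \<beta> * (u * v) powr (- \<beta>)) * (v - u) powr (2 * \<beta> - 1)"
      by (simp only: mult_ac)
    then show ?thesis unfolding U C by simp
  qed
  finally show ?thesis .
qed

text \<open>This is why K represents fractional Brownian motion: the Gram matrix of the kernels is
  its covariance. Both kernels are written as time integrals of \<open>dK\<close>, and Tonelli moves
  the integral over r inside.\<close>

lemma nn_integral_K_K_aux: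
  assumes t: "0 \<le> t" and ts: "t \<le> s"
  shows "(\<integral>\<^sup>+r. ennreal (K_kernel H t r * K_kernel H s r) \<partial>lborel)
    = ennreal ((s powr (2 * H) + t powr (2 * H) - (s - t) powr (2 * H)) / 2)"
proof -
  let ?f = "\<lambda>u v. ennreal (H * (2 * H - 1) * \<bar>v - u\<bar> powr (2 * \<beta> - 1))"
  have H2: "2 * H - 1 = 2 * \<beta>" by (simp add: \<beta>_def)
  have nnK: "ennreal (K_kernel H t r * K_kernel H s r) = (\<integral>\<^sup>+u. \<integral>\<^sup>+v. ennreal (indicator {..t} u * dK r u) * ennreal (indicator {..s} v * dK r v) \<partial>lborel \<partial>lborel)" for r
    by (subst ennreal_mult'[OF K_nonneg]) (simp add: K_nn nn_integral_cmult nn_integral_multc)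
  have dd: "(\<integral>\<^sup>+r. ennreal (dK r u * dK r v) \<partial>lborel) = ?f u v" if "0 < u" "0 < v" "u \<noteq> v" for u v
  proof (cases "u < v")
    case True
    then show ?thesis using nn_integral_dK_dK[of u v] that by simp
  next
    case False
    then show ?thesis using nn_integral_dK_dK[of v u] that by (simp add: mult.commute)
  qed
  have "(\<integral>\<^sup>+r. ennreal (K_kernel H t r * K_kernel H s r) \<partial>lborel)
     = (\<integral>\<^sup>+u. \<integral>\<^sup>+r. \<integral>\<^sup>+v. ennreal (indicator {..t} u * dK r u) * ennreal (indicator {..s} v * dK r v) \<partial>lborel \<partial>lborel \<partial>lborel)"
    unfolding nnK by (rule lborel_pair.Fubini') measurable
  also have "\<dots> = (\<integral>\<^sup>+u. \<integral>\<^sup>+v. \<integral>\<^sup>+r. ennreal (indicator {..t} u * dK r u) * ennreal (indicator {..s} v * dK r v) \<partial>lborel \<partial>lborel \<partial>lborel)"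
    by (rule nn_integral_cong, rule lborel_pair.Fubini') measurable
  \<comment> \<open>The diagonal u = v, where the density is singular, and the end points t and s
    are null sets.\<close>
  also have "\<dots> = (\<integral>\<^sup>+u. \<integral>\<^sup>+v. ?f u v * indicator {0<..<s} v * indicator {0<..<t} u \<partial>lborel \<partial>lborel)"
  proof (rule nn_integral_cong_AE)
    show "AE u in lborel. (\<integral>\<^sup>+v. \<integral>\<^sup>+r. ennreal (indicator {..t} u * dK r u) * ennreal (indicator {..s} v * dK r v) \<partial>lborel \<partial>lborel)
        = (\<integral>\<^sup>+v. ?f u v * indicator {0<..<s} v * indicator {0<..<t} u \<partial>lborel)"
      using AE_lborel_singleton[of t]
    proof eventually_elim
      fix u assume ut: "u \<noteq> t"
      show "(\<integral>\<^sup>+v. \<integral>\<^sup>+r. ennreal (indicator {..t} u * dK r u) * ennreal (indicator {..s} v * dK r v) \<partial>lborel \<partial>lborel)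
        = (\<integral>\<^sup>+v. ?f u v * indicator {0<..<s} v * indicator {0<..<t} u \<partial>lborel)"
      proof (rule nn_integral_cong_AE)
        show "AE v in lborel. (\<integral>\<^sup>+r. ennreal (indicator {..t} u * dK r u) * ennreal (indicator {..s} v * dK r v) \<partial>lborel)
           = ?f u v * indicator {0<..<s} v * indicator {0<..<t} u"
          using AE_lborel_singleton[of s] AE_lborel_singleton[of u]
        proof eventually_elim
          fix v assume v: "v \<noteq> s" "v \<noteq> u"
          have z: "dK r u = 0" if "u \<le> 0" for r u using that by (auto simp: dK_def indicator_def)
          show "(\<integral>\<^sup>+r. ennreal (indicator {..t} u * dK r u) * ennreal (indicator {..s} v * dK r v) \<partial>lborel)
           = ?f u v * indicator {0<..<s} v * indicator {0<..<t} u"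
          proof (cases "0 < u \<and> u < t \<and> 0 < v \<and> v < s")
            case True
            then show ?thesis using dd[of u v] v by (simp add: ennreal_mult'[OF dK_nonneg] dK_nonneg)
          next
            case False
            then have z: "ennreal (indicator {..t} u * dK r u) * ennreal (indicator {..s} v * dK r v) = 0" for r
              using v ut by (auto simp: indicator_def z not_less)
            have zz: "indicator {0<..<s} v * indicator {0<..<t} u = (0::ennreal)" using False by (auto simp: indicator_def)
            show ?thesis unfolding z mult.assoc zz by simp
          qed
        qed
      qed
    qed
  qed
  also have "\<dots> = (\<integral>\<^sup>+u. ennreal (H * (u powr (2 * \<beta>) + (s - u) powr (2 * \<beta>))) * indicator {0<..<t} u \<partial>lborel)"
  proof (rule nn_integral_cong)
    fix u
    show "(\<integral>\<^sup>+v. ?f u v * indicator {0<..<s} v * indicator {0<..<t} u \<partial>lborel) = ennreal (H * (u powr (2 * \<beta>) + (s - u) powr (2 * \<beta>))) * indicator {0<..<t} u"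
    proof (cases "0 < u \<and> u < t")
      case True
      have "(\<integral>\<^sup>+v. ?f u v * indicator {0<..<s} v \<partial>lborel) = (\<integral>\<^sup>+v. ennreal (H * (2 * H - 1)) * (ennreal ((u - v) powr (2 * \<beta> - 1)) * indicator {0<..<u} v)
          + ennreal (H * (2 * H - 1)) * (ennreal ((v - u) powr (2 * \<beta> - 1)) * indicator {u<..<s} v) \<partial>lborel)"
      proof (rule nn_integral_cong)
        fix v
        have "0 \<le> H * (2 * H - 1)" using H_gt by simp
        then show "?f u v * indicator {0<..<s} v = ennreal (H * (2 * H - 1)) * (ennreal ((u - v) powr (2 * \<beta> - 1)) * indicator {0<..<u} v)
          + ennreal (H * (2 * H - 1)) * (ennreal ((v - u) powr (2 * \<beta> - 1)) * indicator {u<..<s} v)"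
          using True ts by (cases "v = u"; cases "v < u") (auto simp: indicator_def ennreal_mult')
      qed
      also have "\<dots> = ennreal (H * (2 * H - 1)) * ennreal ((u - 0) powr (2 * \<beta>) / (2 * \<beta>)) + ennreal (H * (2 * H - 1)) * ennreal ((s - u) powr (2 * \<beta>) / (2 * \<beta>))"
        using True ts \<beta>_pos by (simp add: nn_integral_add nn_integral_cmult nn_integral_powr_left nn_integral_powr_right)
      also have "\<dots> = ennreal (H * (2 * H - 1) * ((u - 0) powr (2 * \<beta>) / (2 * \<beta>)) + H * (2 * H - 1) * ((s - u) powr (2 * \<beta>) / (2 * \<beta>)))"
        using H_gt \<beta>_pos by (simp add: ennreal_mult'[symmetric] ennreal_plus[symmetric] del: ennreal_plus)
      also have "H * (2 * H - 1) * ((u - 0) powr (2 * \<beta>) / (2 * \<beta>)) + H * (2 * H - 1) * ((s - u) powr (2 * \<beta>) / (2 * \<beta>)) = H * (u powr (2 * \<beta>) + (s - u) powr (2 * \<beta>))"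
        unfolding H2 using \<beta>_pos by (simp add: field_simps)
      finally have *: "(\<integral>\<^sup>+v. ?f u v * indicator {0<..<s} v \<partial>lborel) = ennreal (H * (u powr (2 * \<beta>) + (s - u) powr (2 * \<beta>)))" .
      have ind: "indicator {0<..<t} u = (1::ennreal)" using True by simp
      show ?thesis unfolding ind mult_1_right by (rule *)
    next
      case False
      then have "indicator {0<..<t} u = (0::ennreal)" by (auto simp: indicator_def)
      then show ?thesis by simp
    qed
  qed
  also have "\<dots> = ennreal ((s powr (2 * H) + t powr (2 * H) - (s - t) powr (2 * H)) / 2)"
  proof (cases "t = 0")
    case True
    then show ?thesis by simp
  next
    case False
    with t have t0: "0 < t" by simp
    let ?p = "2 * \<beta> + 1"
    have p: "0 < ?p" "?p - 1 = 2 * \<beta>" "?p = 2 * H" using \<beta>_pos by (auto simp: \<beta>_def)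
    have a1: "(\<integral>\<^sup>+u. ennreal (u powr (2 * \<beta>)) * indicator {0<..<t} u \<partial>lborel) = ennreal (t powr (2 * H) / (2 * H))"
      using nn_integral_powr_left[OF p(1) t0] unfolding p(3) H2 by simp
    \<comment> \<open>The integral over (0, s) minus the one over (t, s); both are finite, so the
      subtraction is legitimate among extended reals.\<close>
    have a2: "(\<integral>\<^sup>+u. ennreal ((s - u) powr (2 * \<beta>)) * indicator {0<..<t} u \<partial>lborel) = ennreal ((s powr (2 * H) - (s - t) powr (2 * H)) / (2 * H))"
    proof (cases "t = s")
      case True
      have "s powr (2 * H) - (s - t) powr (2 * H) = t powr (2 * H)" using True by simp
      then show ?thesis using nn_integral_powr_right[OF p(1) t0] True unfolding p(3) H2 by simp
    next
      case False
      with ts have ts: "t < s" by simp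
      have "ennreal (s powr (2 * H) / (2 * H)) = (\<integral>\<^sup>+u. ennreal ((s - u) powr (2 * \<beta>)) * indicator {0<..<s} u \<partial>lborel)"
        using nn_integral_powr_right[OF p(1) less_trans[OF t0 ts]] unfolding p(3) H2 by simp
      also have "\<dots> = (\<integral>\<^sup>+u. ennreal ((s - u) powr (2 * \<beta>)) * indicator {0<..<t} u + ennreal ((s - u) powr (2 * \<beta>)) * indicator {t<..<s} u \<partial>lborel)"
      proof (rule nn_integral_cong_AE)
        show "AE u in lborel. ennreal ((s - u) powr (2 * \<beta>)) * indicator {0<..<s} u = ennreal ((s - u) powr (2 * \<beta>)) * indicator {0<..<t} u + ennreal ((s - u) powr (2 * \<beta>)) * indicator {t<..<s} u"
          using AE_lborel_singleton[of t] by eventually_elim (use ts t0 in \<open>auto simp: indicator_def\<close>)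
      qed
      also have "\<dots> = (\<integral>\<^sup>+u. ennreal ((s - u) powr (2 * \<beta>)) * indicator {0<..<t} u \<partial>lborel) + ennreal ((s - t) powr (2 * H) / (2 * H))"
        using nn_integral_powr_right[OF p(1) ts] unfolding p(3) H2 by (subst nn_integral_add) auto
      finally have "(\<integral>\<^sup>+u. ennreal ((s - u) powr (2 * \<beta>)) * indicator {0<..<t} u \<partial>lborel) = ennreal (s powr (2 * H) / (2 * H)) - ennreal ((s - t) powr (2 * H) / (2 * H))"
        by (metis ennreal_add_diff_cancel_right ennreal_neq_top)
      also have "\<dots> = ennreal ((s powr (2 * H) - (s - t) powr (2 * H)) / (2 * H))"
        using H_gt by (subst ennreal_minus) (auto simp: diff_divide_distrib)
      finally show ?thesis .
    qed
    have mono: "(s - t) powr (2 * H) \<le> s powr (2 * H)" using H_gt t ts by (intro powr_mono2) auto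
    have "(\<integral>\<^sup>+u. ennreal (H * (u powr (2 * \<beta>) + (s - u) powr (2 * \<beta>))) * indicator {0<..<t} u \<partial>lborel)
      = (\<integral>\<^sup>+u. ennreal H * (ennreal (u powr (2 * \<beta>)) * indicator {0<..<t} u) + ennreal H * (ennreal ((s - u) powr (2 * \<beta>)) * indicator {0<..<t} u) \<partial>lborel)"
      using H_gt by (intro nn_integral_cong) (auto simp: indicator_def ennreal_mult'[symmetric] ring_distribs)
    also have "\<dots> = ennreal H * ennreal (t powr (2 * H) / (2 * H)) + ennreal H * ennreal ((s powr (2 * H) - (s - t) powr (2 * H)) / (2 * H))"
      by (simp add: nn_integral_add nn_integral_cmult a1 a2)
    also have "\<dots> = ennreal (H * (t powr (2 * H) / (2 * H)) + H * ((s powr (2 * H) - (s - t) powr (2 * H)) / (2 * H)))"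
      using H_gt mono by (simp add: ennreal_mult'[symmetric] ennreal_plus[symmetric] del: ennreal_plus)
    also have "H * (t powr (2 * H) / (2 * H)) + H * ((s powr (2 * H) - (s - t) powr (2 * H)) / (2 * H)) = (s powr (2 * H) + t powr (2 * H) - (s - t) powr (2 * H)) / 2"
      using H_gt by (simp add: field_simps)
    finally show ?thesis .
  qed
  finally show ?thesis .
qed

lemma integral_K_K:
  assumes "0 \<le> t" "0 \<le> s" "t \<le> 1" "s \<le> 1"
  shows "(LINT r|lborel. K_kernel H t r * K_kernel H s r)
    = (s powr (2 * H) + t powr (2 * H) - \<bar>t - s\<bar> powr (2 * H)) / 2"
proof -
  have *: "(LINT r|lborel. K_kernel H t r * K_kernel H s r) = (s powr (2 * H) + t powr (2 * H) - (s - t) powr (2 * H)) / 2"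
    if "0 \<le> t" "t \<le> s" for s t
  proof -
    have "(s - t) powr (2 * H) \<le> s powr (2 * H)" using H_gt that by (intro powr_mono2) auto
    then have nn: "0 \<le> (s powr (2 * H) + t powr (2 * H) - (s - t) powr (2 * H)) / 2"
      by (simp add: add_increasing2)
    have "(LINT r|lborel. K_kernel H t r * K_kernel H s r) = enn2real (\<integral>\<^sup>+r. ennreal (K_kernel H t r * K_kernel H s r) \<partial>lborel)"
      using K_nonneg by (intro integral_eq_nn_integral) auto
    also have "\<dots> = (s powr (2 * H) + t powr (2 * H) - (s - t) powr (2 * H)) / 2"
      unfolding nn_integral_K_K_aux[OF that] by (rule enn2real_ennreal[OF nn])
    finally show ?thesis .
  qed
  show ?thesis
  proof (cases "t \<le> s")
    case True
    then show ?thesis using *[of t s] assms by simp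
  next
    case False
    then show ?thesis using *[of s t] assms by (simp add: mult.commute add.commute)
  qed
qed

end

section \<open>The exponential average of the kernel\<close>

lemma lborel_integral_swap:
  fixes f :: "real \<Rightarrow> real \<Rightarrow> real"
  assumes m[measurable]: "(\<lambda>z. f (fst z) (snd z)) \<in> borel_measurable (borel \<Otimes>\<^sub>M borel)"
    and fin: "(\<integral>\<^sup>+x. \<integral>\<^sup>+y. ennreal \<bar>f x y\<bar> \<partial>lborel \<partial>lborel) < \<infinity>"
  shows "(LINT x|lborel. LINT y|lborel. f x y) = (LINT y|lborel. LINT x|lborel. f x y)"
proof -
  have m': "case_prod f \<in> borel_measurable (lborel \<Otimes>\<^sub>M lborel)"
    using m by (simp add: case_prod_beta')
  have "integrable (lborel \<Otimes>\<^sub>M lborel) (case_prod f)"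
  proof (rule integrableI_bounded[OF m'])
    have "(\<integral>\<^sup>+z. ennreal (norm (case_prod f z)) \<partial>(lborel \<Otimes>\<^sub>M lborel)) = (\<integral>\<^sup>+x. \<integral>\<^sup>+y. ennreal \<bar>f x y\<bar> \<partial>lborel \<partial>lborel)"
      using m' by (subst lborel.nn_integral_fst[symmetric]) (auto simp: case_prod_beta')
    then show "(\<integral>\<^sup>+z. ennreal (norm (case_prod f z)) \<partial>(lborel \<Otimes>\<^sub>M lborel)) < \<infinity>" using fin by simp
  qed
  then show ?thesis by (rule lborel_pair.Fubini_integral[symmetric])
qed

lemma ennreal_abs_integral_le: "ennreal \<bar>LINT x|M. f x\<bar> \<le> (\<integral>\<^sup>+x. ennreal \<bar>f x\<bar> \<partial>M)" for f :: "'a \<Rightarrow> real"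
  using integral_norm_bound_ennreal[of M f] by (cases "integrable M f") (auto simp: not_integrable_integral_eq)

text \<open>The integral on the left defaults to 0 and the right side may be infinite, so
  measurability suffices.\<close>

lemma integral_Cauchy_Schwarz_ennreal:
  fixes f g :: "'a \<Rightarrow> real"
  assumes [measurable]: "f \<in> borel_measurable M" "g \<in> borel_measurable M"
  shows "ennreal ((LINT x|M. f x * g x)\<^sup>2) \<le> (\<integral>\<^sup>+x. ennreal ((f x)\<^sup>2) \<partial>M) * (\<integral>\<^sup>+x. ennreal ((g x)\<^sup>2) \<partial>M)"
proof -
  have "ennreal ((LINT x|M. f x * g x)\<^sup>2) = (ennreal \<bar>LINT x|M. f x * g x\<bar>)\<^sup>2"
    by (simp add: ennreal_power)
  also have "\<dots> \<le> (\<integral>\<^sup>+x. ennreal \<bar>f x * g x\<bar> \<partial>M)\<^sup>2"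
    by (intro power_mono ennreal_abs_integral_le) simp
  also have "\<dots> = (\<integral>\<^sup>+x. ennreal \<bar>f x\<bar> * ennreal \<bar>g x\<bar> \<partial>M)\<^sup>2"
    by (simp add: abs_mult ennreal_mult')
  also have "\<dots> \<le> (\<integral>\<^sup>+x. (ennreal \<bar>f x\<bar>)\<^sup>2 \<partial>M) * (\<integral>\<^sup>+x. (ennreal \<bar>g x\<bar>)\<^sup>2 \<partial>M)"
    by (rule Cauchy_Schwarz_nn_integral) auto
  also have "\<dots> = (\<integral>\<^sup>+x. ennreal ((f x)\<^sup>2) \<partial>M) * (\<integral>\<^sup>+x. ennreal ((g x)\<^sup>2) \<partial>M)"
    by (simp add: ennreal_power)
  finally show ?thesis .
qed

context hurst_parameter
begin

text \<open>For fixed \<open>r\<close>, \<open>ellK \<alpha> \<cdot> r\<close> is the preimage under \<open>K\<close> of the path \<open>t \<mapsto> K_avg \<alpha> t r\<close>, whose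
  derivative is \<open>gK \<alpha> r\<close>: since \<open>\<theta>K \<alpha> r\<close> is the derivative of \<open>x \<mapsto> x\<^bsup>-\<beta>\<^esup> gK \<alpha> r x\<close>, that path is a
  superposition of the paths \<open>t \<mapsto> \<integral>\<^sub>x\<^sup>t u\<^sup>\<beta> du\<close>, and \<open>K\<close> can be inverted on the latter.\<close>

definition B\<^sub>0 :: real where "B\<^sub>0 = Beta \<beta> (1 - \<beta>)"

lemma B0_pos: "0 < B\<^sub>0" unfolding B\<^sub>0_def using \<beta>_pos \<beta>_lt by (intro Beta_pos) auto

definition gK :: "real \<Rightarrow> real \<Rightarrow> real \<Rightarrow> real" where
  "gK \<alpha> r u = (LINT \<sigma>|lborel. indicator {..u} \<sigma> * (exp (- \<alpha> * (u - \<sigma>)) * dK r \<sigma>))"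

definition \<theta>K :: "real \<Rightarrow> real \<Rightarrow> real \<Rightarrow> real" where
  "\<theta>K \<alpha> r x = indicator {0<..} r * indicator {r<..} x *
     (cH * r powr (- \<beta>) * (x - r) powr (\<beta> - 1) - (\<alpha> * x powr (- \<beta>) + \<beta> * x powr (- \<beta> - 1)) * gK \<alpha> r x)"

definition wK :: "real \<Rightarrow> real \<Rightarrow> real" where
  "wK x s = indicator {0<..} x * indicator {x<..} s * (s powr \<beta> * (s - x) powr (- \<beta>))"

definition ellK :: "real \<Rightarrow> real \<Rightarrow> real \<Rightarrow> real" where
  "ellK \<alpha> s r = (LINT x|lborel. \<theta>K \<alpha> r x * wK x s) / (cH * B\<^sub>0)"

definition K_avg :: "real \<Rightarrow> real \<Rightarrow> real \<Rightarrow> real" where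
  "K_avg \<alpha> t r = (LINT s|lborel. indicator {0..t} s * (exp (- \<alpha> * (t - s)) * K_kernel H s r))"

lemma gK_measurable2: "(\<lambda>z. gK \<alpha> (fst z) (snd z)) \<in> borel_measurable (borel \<Otimes>\<^sub>M borel)"
proof -
  have eq: "(\<lambda>z. gK \<alpha> (fst z) (snd z)) = (\<lambda>z. LINT \<sigma>|lborel. (if \<sigma> \<le> snd z then exp (- \<alpha> * (snd z - \<sigma>)) * dK (fst z) \<sigma> else 0))"
    unfolding gK_def by (intro ext Bochner_Integration.integral_cong) (auto simp: indicator_def)
  have m: "(\<lambda>w. (if snd w \<le> snd (fst w) then exp (- \<alpha> * (snd (fst w) - snd w)) * dK (fst (fst w)) (snd w) else 0)) \<in> borel_measurable ((borel \<Otimes>\<^sub>M borel) \<Otimes>\<^sub>M lborel)"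
    by measurable
  show ?thesis unfolding eq
    by (rule lborel.borel_measurable_lebesgue_integral) (use m in \<open>simp add: case_prod_beta'\<close>)
qed

lemma gK_measurable[measurable (raw)]:
  assumes "f \<in> borel_measurable M" "g \<in> borel_measurable M"
  shows "(\<lambda>x. gK \<alpha> (f x) (g x)) \<in> borel_measurable M"
  using measurable_compose[OF measurable_Pair[OF assms] gK_measurable2] by simp

lemma \<theta>K_measurable[measurable (raw)]:
  assumes [measurable]: "f \<in> borel_measurable M" "g \<in> borel_measurable M"
  shows "(\<lambda>x. \<theta>K \<alpha> (f x) (g x)) \<in> borel_measurable M"
proof -
  have eq: "(\<lambda>z. \<theta>K \<alpha> (f z) (g z)) = (\<lambda>z. if 0 < f z \<and> f z < g z then
     cH * f z powr (- \<beta>) * (g z - f z) powr (\<beta> - 1) - (\<alpha> * g z powr (- \<beta>) + \<beta> * g z powr (- \<beta> - 1)) * gK \<alpha> (f z) (g z) else 0)"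
    by (auto simp: \<theta>K_def indicator_def fun_eq_iff)
  show ?thesis unfolding eq by measurable
qed

lemma wK_measurable[measurable (raw)]:
  assumes [measurable]: "f \<in> borel_measurable M" "g \<in> borel_measurable M"
  shows "(\<lambda>x. wK (f x) (g x)) \<in> borel_measurable M"
proof -
  have eq: "(\<lambda>z. wK (f z) (g z)) = (\<lambda>z. if 0 < f z \<and> f z < g z then g z powr \<beta> * (g z - f z) powr (- \<beta>) else 0)"
    by (auto simp: wK_def indicator_def fun_eq_iff)
  show ?thesis unfolding eq by measurable
qed

lemma ellK_measurable[measurable (raw)]:
  assumes [measurable]: "f \<in> borel_measurable M" "g \<in> borel_measurable M"
  shows "(\<lambda>x. ellK \<alpha> (f x) (g x)) \<in> borel_measurable M"
proof -
  have m: "(\<lambda>w. \<theta>K \<alpha> (g (fst w)) (snd w) * wK (snd w) (f (fst w))) \<in> borel_measurable (M \<Otimes>\<^sub>M lborel)"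
    by measurable
  have "(\<lambda>z. LINT x|lborel. \<theta>K \<alpha> (g z) x * wK x (f z)) \<in> borel_measurable M"
    by (rule lborel.borel_measurable_lebesgue_integral) (use m in \<open>simp add: case_prod_beta'\<close>)
  then show ?thesis unfolding ellK_def by measurable
qed

lemma K_avg_measurable[measurable]: "K_avg \<alpha> t \<in> borel_measurable borel"
proof -
  have m: "(\<lambda>w. indicator {0..t} (snd w) * (exp (- \<alpha> * (t - snd w)) * K_kernel H (snd w) (fst w))) \<in> borel_measurable (borel \<Otimes>\<^sub>M lborel)"
    by measurable
  have "(\<lambda>r. LINT s|lborel. indicator {0..t} s * (exp (- \<alpha> * (t - s)) * K_kernel H s r)) \<in> borel_measurable borel"
    by (rule lborel.borel_measurable_lebesgue_integral) (use m in \<open>simp add: case_prod_beta'\<close>)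
  then show ?thesis unfolding K_avg_def .
qed

lemma wK_nonneg: "0 \<le> wK x s" by (simp add: wK_def indicator_def)

lemma integrable_gK:
  assumes "0 \<le> \<alpha>"
  shows "integrable lborel (\<lambda>\<sigma>. indicator {..u} \<sigma> * (exp (- \<alpha> * (u - \<sigma>)) * dK r \<sigma>))"
proof (rule Bochner_Integration.integrable_bound[OF integrable_dK[of u r]])
  show "AE \<sigma> in lborel. norm (indicator {..u} \<sigma> * (exp (- \<alpha> * (u - \<sigma>)) * dK r \<sigma>)) \<le> norm (indicator {..u} \<sigma> * dK r \<sigma>)"
  proof (rule AE_I2)
    fix \<sigma>
    have "exp (- \<alpha> * (u - \<sigma>)) * dK r \<sigma> \<le> 1 * dK r \<sigma>" if "\<sigma> \<le> u"
      using that assms dK_nonneg by (intro mult_right_mono) auto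
    then show "norm (indicator {..u} \<sigma> * (exp (- \<alpha> * (u - \<sigma>)) * dK r \<sigma>)) \<le> norm (indicator {..u} \<sigma> * dK r \<sigma>)"
      using dK_nonneg by (auto simp: indicator_def abs_mult)
  qed
qed measurable

lemma gK_nonneg: "0 \<le> gK \<alpha> r u"
  unfolding gK_def using dK_nonneg by (intro Bochner_Integration.integral_nonneg) auto

lemma gK_nn: "0 \<le> \<alpha> \<Longrightarrow> ennreal (gK \<alpha> r u) = (\<integral>\<^sup>+\<sigma>. ennreal (indicator {..u} \<sigma> * (exp (- \<alpha> * (u - \<sigma>)) * dK r \<sigma>)) \<partial>lborel)"
  unfolding gK_def using dK_nonneg by (intro nn_integral_eq_integral[symmetric] integrable_gK) auto

lemma gK_le_K: "0 \<le> \<alpha> \<Longrightarrow> gK \<alpha> r u \<le> K_kernel H u r"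
  unfolding gK_def K_kernel_eq using dK_nonneg
  by (intro integral_mono integrable_gK integrable_dK)
    (auto simp: indicator_def intro!: mult_left_le_one_le)

lemma gK_le:
  assumes \<alpha>: "0 \<le> \<alpha>" and r: "0 < r" "r < u"
  shows "gK \<alpha> r u \<le> cH / \<beta> * r powr (- \<beta>) * u powr \<beta> * (u - r) powr \<beta>"
proof -
  have "ennreal (K_kernel H u r) \<le> ennreal (cH / \<beta> * r powr (- \<beta>) * u powr \<beta> * (u - r) powr \<beta>)"
    unfolding K_nn using r by (intro nn_integral_dK_le) auto
  then have "K_kernel H u r \<le> cH / \<beta> * r powr (- \<beta>) * u powr \<beta> * (u - r) powr \<beta>"
    using cH_pos \<beta>_pos by (subst (asm) ennreal_le_iff) auto
  then show ?thesis using gK_le_K[OF \<alpha>, of r u] by linarith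
qed

lemma gK_zero: "u \<le> r \<or> r \<le> 0 \<Longrightarrow> gK \<alpha> r u = 0"
proof -
  assume "u \<le> r \<or> r \<le> 0"
  then have "(\<lambda>\<sigma>. indicator {..u} \<sigma> * (exp (- \<alpha> * (u - \<sigma>)) * dK r \<sigma>)) = (\<lambda>_. 0)"
    by (auto simp: fun_eq_iff indicator_def dK_zero)
  then show ?thesis by (simp add: gK_def)
qed

definition \<Theta>K :: "real \<Rightarrow> real \<Rightarrow> real \<Rightarrow> real" where
  "\<Theta>K \<alpha> r x = cH * r powr (- \<beta>) * ((x - r) powr (\<beta> - 1) + \<alpha> / \<beta> * (x - r) powr \<beta>)"

text \<open>The term with \<beta> x^(-\<beta> - 1) lies between 0 and the singular term from which
  it is subtracted, and hence adds nothing to the bound. Only the term with \<alpha> does; this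
  keeps the final constant at 1 + \<alpha>.\<close>

lemma abs_\<theta>K_le:
  assumes \<alpha>: "0 \<le> \<alpha>" and r: "0 < r" "r < x"
  shows "\<bar>\<theta>K \<alpha> r x\<bar> \<le> \<Theta>K \<alpha> r x"
proof -
  have x: "0 < x" using r by simp
  note g = gK_le[OF \<alpha> r]
  have xx: "x powr (- \<beta>) * x powr \<beta> = 1" using x by (simp add: powr_add[symmetric])
  have p1: "\<alpha> * x powr (- \<beta>) * gK \<alpha> r x \<le> cH * r powr (- \<beta>) * (\<alpha> / \<beta> * (x - r) powr \<beta>)"
  proof -
    have "\<alpha> * x powr (- \<beta>) * gK \<alpha> r x \<le> \<alpha> * x powr (- \<beta>) * (cH / \<beta> * r powr (- \<beta>) * x powr \<beta> * (x - r) powr \<beta>)"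
      using g \<alpha> by (intro mult_left_mono) auto
    also have "\<dots> = (x powr (- \<beta>) * x powr \<beta>) * (cH * r powr (- \<beta>) * (\<alpha> / \<beta> * (x - r) powr \<beta>))" by simp
    finally show ?thesis unfolding xx by simp
  qed
  have p2: "\<beta> * x powr (- \<beta> - 1) * gK \<alpha> r x \<le> cH * r powr (- \<beta>) * (x - r) powr (\<beta> - 1)"
  proof -
    have "\<beta> * x powr (- \<beta> - 1) * gK \<alpha> r x \<le> \<beta> * x powr (- \<beta> - 1) * (cH / \<beta> * r powr (- \<beta>) * x powr \<beta> * (x - r) powr \<beta>)"
      using g \<beta>_pos by (intro mult_left_mono) auto
    also have "\<dots> = (x powr (- \<beta> - 1) * x powr \<beta>) * (cH * r powr (- \<beta>) * (x - r) powr \<beta>)" using \<beta>_pos by simp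
    also have "x powr (- \<beta> - 1) * x powr \<beta> = x powr (- 1)" by (simp add: powr_add[symmetric])
    \<comment> \<open>Lowering x to x - r produces the exponent \<beta> - 1 of the singular
      term.\<close>
    also have "x powr (-1) * (cH * r powr (- \<beta>) * (x - r) powr \<beta>) \<le> (x - r) powr (-1) * (cH * r powr (- \<beta>) * (x - r) powr \<beta>)"
      using r x cH_pos by (intro mult_right_mono) (auto simp: powr_minus_divide intro!: divide_left_mono)
    also have "\<dots> = cH * r powr (- \<beta>) * ((x - r) powr (-1) * (x - r) powr \<beta>)" by simp
    also have "(x - r) powr (-1) * (x - r) powr \<beta> = (x - r) powr (\<beta> - 1)" unfolding powr_add[symmetric] by simp
    finally show ?thesis .
  qed
  have n1: "0 \<le> \<alpha> * x powr (- \<beta>) * gK \<alpha> r x" and n2: "0 \<le> \<beta> * x powr (- \<beta> - 1) * gK \<alpha> r x"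
    and n3: "0 \<le> cH * r powr (- \<beta>) * (x - r) powr (\<beta> - 1)"
    using gK_nonneg \<alpha> \<beta>_pos cH_pos by auto
  have "\<theta>K \<alpha> r x = cH * r powr (- \<beta>) * (x - r) powr (\<beta> - 1) - \<alpha> * x powr (- \<beta>) * gK \<alpha> r x - \<beta> * x powr (- \<beta> - 1) * gK \<alpha> r x"
    using r by (simp add: \<theta>K_def algebra_simps)
  then show ?thesis using p1 p2 n1 n2 n3 unfolding \<Theta>K_def by (simp add: ring_distribs)
qed

lemma \<theta>K_zero: "r \<le> 0 \<or> x \<le> r \<Longrightarrow> \<theta>K \<alpha> r x = 0"
  by (auto simp: \<theta>K_def)

lemma nn_integral_\<theta>K_finite:
  assumes \<alpha>: "0 \<le> \<alpha>"
  shows "(\<integral>\<^sup>+x. ennreal \<bar>indicator {..u} x * \<theta>K \<alpha> r x\<bar> \<partial>lborel) < \<infinity>"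
proof (cases "0 < r \<and> r < u")
  case True
  have "(\<integral>\<^sup>+x. ennreal \<bar>indicator {..u} x * \<theta>K \<alpha> r x\<bar> \<partial>lborel)
     \<le> (\<integral>\<^sup>+x. ennreal (cH * r powr (- \<beta>)) * (ennreal ((x - r) powr (\<beta> - 1)) * indicator {r<..<u} x)
        + ennreal (cH * r powr (- \<beta>) * (\<alpha> / \<beta>)) * (ennreal ((x - r) powr ((\<beta> + 1) - 1)) * indicator {r<..<u} x) \<partial>lborel)"
  proof (rule nn_integral_mono_AE)
    show "AE x in lborel. ennreal \<bar>indicator {..u} x * \<theta>K \<alpha> r x\<bar> \<le> ennreal (cH * r powr (- \<beta>)) * (ennreal ((x - r) powr (\<beta> - 1)) * indicator {r<..<u} x)
        + ennreal (cH * r powr (- \<beta>) * (\<alpha> / \<beta>)) * (ennreal ((x - r) powr ((\<beta> + 1) - 1)) * indicator {r<..<u} x)"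
      using AE_lborel_singleton[of u]
    proof eventually_elim
      fix x assume "x \<noteq> u"
      show "ennreal \<bar>indicator {..u} x * \<theta>K \<alpha> r x\<bar> \<le> ennreal (cH * r powr (- \<beta>)) * (ennreal ((x - r) powr (\<beta> - 1)) * indicator {r<..<u} x)
        + ennreal (cH * r powr (- \<beta>) * (\<alpha> / \<beta>)) * (ennreal ((x - r) powr ((\<beta> + 1) - 1)) * indicator {r<..<u} x)"
      proof (cases "r < x \<and> x < u")
        case T: True
        have "ennreal \<bar>\<theta>K \<alpha> r x\<bar> \<le> ennreal (cH * r powr (- \<beta>) * (x - r) powr (\<beta> - 1) + cH * r powr (- \<beta>) * (\<alpha> / \<beta>) * (x - r) powr \<beta>)"
          using abs_\<theta>K_le[OF \<alpha>, of r x] True T by (intro ennreal_leI) (simp add: \<Theta>K_def algebra_simps)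
        also have "\<dots> = ennreal (cH * r powr (- \<beta>) * (x - r) powr (\<beta> - 1)) + ennreal (cH * r powr (- \<beta>) * (\<alpha> / \<beta>) * (x - r) powr \<beta>)"
          using cH_pos \<beta>_pos \<alpha> by (intro ennreal_plus) auto
        finally show ?thesis using T cH_pos \<beta>_pos \<alpha> by (simp add: ennreal_mult'[symmetric])
      next
        case False
        then show ?thesis using \<open>x \<noteq> u\<close> by (auto simp: indicator_def \<theta>K_zero not_less)
      qed
    qed
  qed
  also have "\<dots> < \<infinity>"
    using True \<beta>_pos nn_integral_powr_left[of \<beta> r u] nn_integral_powr_left[of "\<beta> + 1" r u]
    by (simp add: nn_integral_add nn_integral_cmult ennreal_mult_less_top)
  finally show ?thesis .
next
  case False
  then have z: "indicator {..u} x * \<theta>K \<alpha> r x = 0" for x by (auto simp: indicator_def \<theta>K_zero)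
  show ?thesis unfolding z by simp
qed

lemma integral_\<theta>K:
  assumes \<alpha>: "0 \<le> \<alpha>" and r: "0 < r" "r < u"
  shows "(LINT x|lborel. indicator {..u} x * \<theta>K \<alpha> r x) = u powr (- \<beta>) * gK \<alpha> r u"
proof -
  \<comment> \<open>Splitting the exponential removes the upper limit from the integrand:
    \<open>gK \<alpha> r x\<close> becomes exp(- \<alpha> x) times an indefinite integral, which can
    be differentiated.\<close>
  define G where "G x = integral {r..x} (\<lambda>\<sigma>. exp (\<alpha> * \<sigma>) * dK r \<sigma>)" for x
  have si: "set_integrable lborel {r..x} (\<lambda>\<sigma>. exp (\<alpha> * \<sigma>) * dK r \<sigma>)" for x
    unfolding set_integrable_def
  proof (rule Bochner_Integration.integrable_bound[where f="\<lambda>\<sigma>. exp (\<alpha> * x) * (indicator {..x} \<sigma> * dK r \<sigma>)"])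
    show "AE \<sigma> in lborel. norm (indicator {r..x} \<sigma> *\<^sub>R (exp (\<alpha> * \<sigma>) * dK r \<sigma>)) \<le> norm (exp (\<alpha> * x) * (indicator {..x} \<sigma> * dK r \<sigma>))"
    proof (rule AE_I2)
      fix \<sigma>
      have "exp (\<alpha> * \<sigma>) * dK r \<sigma> \<le> exp (\<alpha> * x) * dK r \<sigma>" if "\<sigma> \<le> x"
        using that \<alpha> dK_nonneg by (intro mult_right_mono) (auto intro: mult_left_mono)
      then show "norm (indicator {r..x} \<sigma> *\<^sub>R (exp (\<alpha> * \<sigma>) * dK r \<sigma>)) \<le> norm (exp (\<alpha> * x) * (indicator {..x} \<sigma> * dK r \<sigma>))"
        using dK_nonneg by (auto simp: indicator_def abs_mult)
    qed
  qed (use integrable_dK in auto)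
  have int: "(\<lambda>\<sigma>. exp (\<alpha> * \<sigma>) * dK r \<sigma>) integrable_on {r..x}" for x
    by (rule set_borel_integral_eq_integral(1)[OF si])
  have gG: "gK \<alpha> r x = exp (- \<alpha> * x) * G x" for x
  proof -
    have "G x = (LINT \<sigma>:{r..x}|lborel. exp (\<alpha> * \<sigma>) * dK r \<sigma>)"
      unfolding G_def by (rule set_borel_integral_eq_integral(2)[OF si, symmetric])
    then have "exp (- \<alpha> * x) * G x = (LINT \<sigma>|lborel. exp (- \<alpha> * x) * (indicator {r..x} \<sigma> * (exp (\<alpha> * \<sigma>) * dK r \<sigma>)))"
      by (simp add: set_lebesgue_integral_def)
    also have "\<dots> = gK \<alpha> r x" unfolding gK_def
    proof (rule Bochner_Integration.integral_cong[OF refl])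
      fix \<sigma>
      have "exp (- \<alpha> * x) * exp (\<alpha> * \<sigma>) = exp (- \<alpha> * (x - \<sigma>))" by (simp add: mult_exp_exp algebra_simps)
      then show "exp (- \<alpha> * x) * (indicator {r..x} \<sigma> * (exp (\<alpha> * \<sigma>) * dK r \<sigma>)) = indicator {..x} \<sigma> * (exp (- \<alpha> * (x - \<sigma>)) * dK r \<sigma>)"
        by (auto simp: indicator_def dK_zero)
    qed
    finally show ?thesis by simp
  qed
  have G_cont: "continuous_on {r..u} G"
    unfolding G_def by (rule indefinite_integral_continuous_1[OF int])
  have G_deriv: "(G has_real_derivative exp (\<alpha> * x) * dK r x) (at x)" if x: "x \<in> {r<..<u}" for x
  proof -
    have op: "at x within {r..u} = at x" using x by (intro at_within_interior) (auto simp: interior_atLeastAtMost_real)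
    have "isCont (\<lambda>\<sigma>. exp (\<alpha> * \<sigma>) * (cH * r powr (- \<beta>) * \<sigma> powr \<beta> * (\<sigma> - r) powr (\<beta> - 1))) x"
      using x r by (intro continuous_intros) auto
    moreover have "\<forall>\<^sub>F \<sigma> in nhds x. exp (\<alpha> * \<sigma>) * dK r \<sigma> = exp (\<alpha> * \<sigma>) * (cH * r powr (- \<beta>) * \<sigma> powr \<beta> * (\<sigma> - r) powr (\<beta> - 1))"
    proof (rule eventually_mono)
      show "\<forall>\<^sub>F \<sigma> in nhds x. \<sigma> \<in> {r<..}" using x by (intro eventually_nhds_in_open) auto
    qed (use r in \<open>simp add: dK_def\<close>)
    ultimately have "isCont (\<lambda>\<sigma>. exp (\<alpha> * \<sigma>) * dK r \<sigma>) x"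
      using isCont_cong by fast
    then have "(G has_vector_derivative exp (\<alpha> * x) * dK r x) (at x within ({r..u} - {}))"
      unfolding G_def using x
      by (intro integral_has_vector_derivative_continuous_at[OF int]) (auto simp: op intro: continuous_at_imp_continuous_at_within)
    then show ?thesis by (simp add: op has_real_derivative_iff_has_vector_derivative)
  qed
  \<comment> \<open>The derivative is unbounded at r, so the fundamental theorem is used with
    differentiability in the interior and continuity up to the end points; \<open>gK\<close>
    vanishes at r.\<close>
  have "(\<theta>K \<alpha> r has_integral (u powr (- \<beta>) * gK \<alpha> r u - r powr (- \<beta>) * gK \<alpha> r r)) {r..u}"
  proof (rule fundamental_theorem_of_calculus_interior)
    show "continuous_on {r..u} (\<lambda>x. x powr (- \<beta>) * gK \<alpha> r x)"
      unfolding gG using r by (intro continuous_intros G_cont) auto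
    fix x assume x: "x \<in> {r<..<u}"
    then have x0: "0 < x" using r by simp
    have "((\<lambda>x. x powr (- \<beta>) * (exp (- \<alpha> * x) * G x)) has_real_derivative
        (- \<beta> * x powr (- \<beta> - 1)) * (exp (- \<alpha> * x) * G x) + ((- \<alpha> * exp (- \<alpha> * x)) * G x + (exp (\<alpha> * x) * dK r x) * exp (- \<alpha> * x)) * x powr (- \<beta>)) (at x)"
      using x0 by (intro DERIV_mult G_deriv[OF x]) (auto intro!: derivative_eq_intros)
    moreover have "(- \<beta> * x powr (- \<beta> - 1)) * (exp (- \<alpha> * x) * G x) + ((- \<alpha> * exp (- \<alpha> * x)) * G x + (exp (\<alpha> * x) * dK r x) * exp (- \<alpha> * x)) * x powr (- \<beta>) = \<theta>K \<alpha> r x"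
    proof -
      have e: "exp (\<alpha> * x) * exp (- \<alpha> * x) = 1" by (simp add: mult_exp_exp)
      have "x powr (- \<beta>) * x powr \<beta> = 1" using x0 by (simp add: powr_add[symmetric])
      then have d: "dK r x * x powr (- \<beta>) = cH * r powr (- \<beta>) * (x - r) powr (\<beta> - 1)"
        using x r by (simp add: dK_def mult_ac)
      have "(exp (\<alpha> * x) * dK r x) * exp (- \<alpha> * x) * x powr (- \<beta>) = (exp (\<alpha> * x) * exp (- \<alpha> * x)) * (dK r x * x powr (- \<beta>))" by simp
      also have "\<dots> = cH * r powr (- \<beta>) * (x - r) powr (\<beta> - 1)" unfolding e d by simp
      finally show ?thesis using x r unfolding \<theta>K_def gG by (simp add: algebra_simps)
    qed
    ultimately show "((\<lambda>x. x powr (- \<beta>) * gK \<alpha> r x) has_vector_derivative \<theta>K \<alpha> r x) (at x)"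
      unfolding gG by (simp add: has_real_derivative_iff_has_vector_derivative)
  qed (use r in simp)
  then have hi: "(\<theta>K \<alpha> r has_integral (u powr (- \<beta>) * gK \<alpha> r u)) {r..u}"
    by (simp add: gK_zero)
  have "set_integrable lborel {r..u} (\<theta>K \<alpha> r)"
    unfolding set_integrable_def
  proof (rule integrableI_bounded)
    have "(\<integral>\<^sup>+x. ennreal (norm (indicator {r..u} x *\<^sub>R \<theta>K \<alpha> r x)) \<partial>lborel) = (\<integral>\<^sup>+x. ennreal \<bar>indicator {..u} x * \<theta>K \<alpha> r x\<bar> \<partial>lborel)"
      by (intro nn_integral_cong) (auto simp: indicator_def \<theta>K_zero)
    then show "(\<integral>\<^sup>+x. ennreal (norm (indicator {r..u} x *\<^sub>R \<theta>K \<alpha> r x)) \<partial>lborel) < \<infinity>"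
      using nn_integral_\<theta>K_finite[OF \<alpha>, of u r] by simp
  qed measurable
  from set_borel_integral_eq_integral(2)[OF this] integral_unique[OF hi]
  have "(LINT x:{r..u}|lborel. \<theta>K \<alpha> r x) = u powr (- \<beta>) * gK \<alpha> r u" by simp
  then show ?thesis unfolding set_lebesgue_integral_def
    by (subst Bochner_Integration.integral_cong[OF refl, where g="\<lambda>x. indicator {r..u} x *\<^sub>R \<theta>K \<alpha> r x"])
      (auto simp: indicator_def \<theta>K_zero)
qed

lemma K_avg_bounds:
  assumes \<alpha>: "0 \<le> \<alpha>" and t: "0 \<le> t" "t \<le> 1"
  shows "integrable lborel (\<lambda>s. indicator {0..t} s * (exp (- \<alpha> * (t - s)) * K_kernel H s r))"
    and "0 \<le> K_avg \<alpha> t r" and "K_avg \<alpha> t r \<le> cH / \<beta> * indicator {0<..<1} r * r powr (- \<beta>)"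
proof -
  let ?k = "cH / \<beta> * indicator {0<..<1} r * r powr (- \<beta>)"
  have k: "0 \<le> ?k" using cH_pos \<beta>_pos by (simp add: indicator_def)
  have b: "indicator {0..t} s * (exp (- \<alpha> * (t - s)) * K_kernel H s r) \<le> ?k * indicator {0..t} s" for s
  proof (cases "s \<in> {0..t}")
    case True
    then have "exp (- \<alpha> * (t - s)) * K_kernel H s r \<le> 1 * ?k"
      using K_le[of s r] t \<alpha> K_nonneg[of s r] by (intro mult_mono) auto
    then show ?thesis using True by simp
  qed simp
  have nn: "0 \<le> indicator {0..t} s * (exp (- \<alpha> * (t - s)) * K_kernel H s r)" for s
    using K_nonneg by auto
  have i2: "integrable lborel (\<lambda>s. ?k * indicator {0..t} s)"
    by (rule integrable_mult_right, rule integrable_real_indicator) (simp_all add: emeasure_lborel_Icc_eq)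
  show i1: "integrable lborel (\<lambda>s. indicator {0..t} s * (exp (- \<alpha> * (t - s)) * K_kernel H s r))"
  proof (rule Bochner_Integration.integrable_bound[OF i2])
    show "AE s in lborel. norm (indicator {0..t} s * (exp (- \<alpha> * (t - s)) * K_kernel H s r)) \<le> norm (?k * indicator {0..t} s)"
    proof (rule AE_I2)
      fix s
      show "norm (indicator {0..t} s * (exp (- \<alpha> * (t - s)) * K_kernel H s r)) \<le> norm (?k * indicator {0..t} s)"
        unfolding real_norm_def using b[of s] nn[of s] by linarith
    qed
  qed measurable
  show "0 \<le> K_avg \<alpha> t r" unfolding K_avg_def using nn by (intro Bochner_Integration.integral_nonneg) auto
  have "K_avg \<alpha> t r \<le> (LINT s|lborel. ?k * indicator {0..t} s)"
    unfolding K_avg_def by (intro integral_mono i1 i2 b)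
  also have "\<dots> = ?k * t" using t by simp
  also have "?k * t \<le> ?k * 1" by (rule mult_left_mono[OF t(2) k])
  also have "\<dots> = ?k" by (rule mult_1_right)
  finally show "K_avg \<alpha> t r \<le> ?k" .
qed

text \<open>Both sides are the convolution of \<open>dK r\<close>, the exponential and the unit
  step, bracketed in two ways: the step first gives K, the exponential first gives
  \<open>gK\<close>.\<close>

lemma K_avg_eq_integral_gK:
  assumes \<alpha>: "0 \<le> \<alpha>" and t: "0 \<le> t" "t \<le> 1"
  shows "ennreal (K_avg \<alpha> t r) = (\<integral>\<^sup>+\<sigma>. ennreal (indicator {..t} \<sigma> * gK \<alpha> r \<sigma>) \<partial>lborel)"
proof -
  have dK0: "dK r u = 0" if "u \<le> 0" for u using that by (auto simp: dK_def indicator_def)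
  have "ennreal (K_avg \<alpha> t r) = (\<integral>\<^sup>+s. ennreal (indicator {0..t} s * (exp (- \<alpha> * (t - s)) * K_kernel H s r)) \<partial>lborel)"
    unfolding K_avg_def using K_nonneg by (intro nn_integral_eq_integral[symmetric] K_avg_bounds[OF assms]) auto
  also have "\<dots> = (\<integral>\<^sup>+s. \<integral>\<^sup>+u. ennreal (dK r u) * ennreal (exp (- \<alpha> * (t - s)) * indicator {u..t} s) \<partial>lborel \<partial>lborel)"
  proof (rule nn_integral_cong)
    fix s
    have "ennreal (indicator {0..t} s * (exp (- \<alpha> * (t - s)) * K_kernel H s r))
      = ennreal (indicator {0..t} s * exp (- \<alpha> * (t - s))) * ennreal (K_kernel H s r)"
      unfolding mult.assoc[symmetric] by (rule ennreal_mult) (auto simp: K_nonneg)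
    also have "\<dots> = (\<integral>\<^sup>+u. ennreal (indicator {0..t} s * exp (- \<alpha> * (t - s))) * ennreal (indicator {..s} u * dK r u) \<partial>lborel)"
      unfolding K_nn by (rule nn_integral_cmult[symmetric]) measurable
    also have "\<dots> = (\<integral>\<^sup>+u. ennreal (dK r u) * ennreal (exp (- \<alpha> * (t - s)) * indicator {u..t} s) \<partial>lborel)"
    proof (rule nn_integral_cong)
      fix u
      have "indicator {0..t} s * exp (- \<alpha> * (t - s)) * (indicator {..s} u * dK r u) = dK r u * (exp (- \<alpha> * (t - s)) * indicator {u..t} s)"
        by (cases "u \<le> 0") (auto simp: dK0 indicator_def)
      then show "ennreal (indicator {0..t} s * exp (- \<alpha> * (t - s))) * ennreal (indicator {..s} u * dK r u) = ennreal (dK r u) * ennreal (exp (- \<alpha> * (t - s)) * indicator {u..t} s)"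
        using dK_nonneg by (simp add: ennreal_mult''[symmetric] ennreal_mult'[symmetric])
    qed
    finally show "ennreal (indicator {0..t} s * (exp (- \<alpha> * (t - s)) * K_kernel H s r)) = (\<integral>\<^sup>+u. ennreal (dK r u) * ennreal (exp (- \<alpha> * (t - s)) * indicator {u..t} s) \<partial>lborel)" .
  qed
  also have "\<dots> = (\<integral>\<^sup>+u. \<integral>\<^sup>+s. ennreal (dK r u) * ennreal (exp (- \<alpha> * (t - s)) * indicator {u..t} s) \<partial>lborel \<partial>lborel)"
  proof (rule lborel_pair.Fubini')
    have "(\<lambda>z. ennreal (dK r (fst z)) * ennreal (exp (- \<alpha> * (t - snd z)) * (if fst z \<le> snd z \<and> snd z \<le> t then 1 else 0))) \<in> borel_measurable (lborel \<Otimes>\<^sub>M lborel)"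
      by measurable
    then show "(\<lambda>(u, s). ennreal (dK r u) * ennreal (exp (- \<alpha> * (t - s)) * indicator {u..t} s)) \<in> borel_measurable (lborel \<Otimes>\<^sub>M lborel)"
      by (simp add: case_prod_beta' indicator_def)
  qed
  also have "\<dots> = (\<integral>\<^sup>+u. \<integral>\<^sup>+\<sigma>. ennreal (dK r u) * ennreal (exp (- \<alpha> * (\<sigma> - u)) * indicator {u..t} \<sigma>) \<partial>lborel \<partial>lborel)"
  proof (rule nn_integral_cong)
    fix u
    \<comment> \<open>The reflection s -> t + u - s of [u, t] exchanges the two
      exponentials.\<close>
    have "(\<integral>\<^sup>+s. ennreal (exp (- \<alpha> * (t - s)) * indicator {u..t} s) \<partial>lborel) = (\<integral>\<^sup>+\<sigma>. ennreal (exp (- \<alpha> * (\<sigma> - u)) * indicator {u..t} \<sigma>) \<partial>lborel)"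
    proof (subst nn_integral_real_affine[where c="-1" and t="t + u"])
      show "(\<lambda>s. ennreal (exp (- \<alpha> * (t - s)) * indicator {u..t} s)) \<in> borel_measurable borel" by measurable
      have "exp (- \<alpha> * (t - (t + u + - 1 * x))) * indicator {u..t} (t + u + - 1 * x) = exp (- \<alpha> * (x - u)) * indicator {u..t} x" for x
        by (auto simp: indicator_def)
      then show "ennreal \<bar>- 1\<bar> * (\<integral>\<^sup>+x. ennreal (exp (- \<alpha> * (t - (t + u + - 1 * x))) * indicator {u..t} (t + u + - 1 * x)) \<partial>lborel) = (\<integral>\<^sup>+\<sigma>. ennreal (exp (- \<alpha> * (\<sigma> - u)) * indicator {u..t} \<sigma>) \<partial>lborel)"
        by simp
    qed simp
    then show "(\<integral>\<^sup>+s. ennreal (dK r u) * ennreal (exp (- \<alpha> * (t - s)) * indicator {u..t} s) \<partial>lborel) = (\<integral>\<^sup>+\<sigma>. ennreal (dK r u) * ennreal (exp (- \<alpha> * (\<sigma> - u)) * indicator {u..t} \<sigma>) \<partial>lborel)"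
      by (simp add: nn_integral_cmult)
  qed
  also have "\<dots> = (\<integral>\<^sup>+\<sigma>. \<integral>\<^sup>+u. ennreal (dK r u) * ennreal (exp (- \<alpha> * (\<sigma> - u)) * indicator {u..t} \<sigma>) \<partial>lborel \<partial>lborel)"
  proof (rule lborel_pair.Fubini')
    have "(\<lambda>z. ennreal (dK r (snd z)) * ennreal (exp (- \<alpha> * (fst z - snd z)) * (if snd z \<le> fst z \<and> fst z \<le> t then 1 else 0))) \<in> borel_measurable (lborel \<Otimes>\<^sub>M lborel)"
      by measurable
    then show "(\<lambda>(\<sigma>, u). ennreal (dK r u) * ennreal (exp (- \<alpha> * (\<sigma> - u)) * indicator {u..t} \<sigma>)) \<in> borel_measurable (lborel \<Otimes>\<^sub>M lborel)"
      by (simp add: case_prod_beta' indicator_def)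
  qed
  also have "\<dots> = (\<integral>\<^sup>+\<sigma>. ennreal (indicator {..t} \<sigma> * gK \<alpha> r \<sigma>) \<partial>lborel)"
  proof (rule nn_integral_cong)
    fix \<sigma>
    have "ennreal (indicator {..t} \<sigma> * gK \<alpha> r \<sigma>) = ennreal (indicator {..t} \<sigma>) * ennreal (gK \<alpha> r \<sigma>)"
      by (simp add: ennreal_mult' gK_nonneg)
    also have "\<dots> = (\<integral>\<^sup>+u. ennreal (indicator {..t} \<sigma>) * ennreal (indicator {..\<sigma>} u * (exp (- \<alpha> * (\<sigma> - u)) * dK r u)) \<partial>lborel)"
      unfolding gK_nn[OF \<alpha>] by (rule nn_integral_cmult[symmetric]) measurable
    also have "\<dots> = (\<integral>\<^sup>+u. ennreal (dK r u) * ennreal (exp (- \<alpha> * (\<sigma> - u)) * indicator {u..t} \<sigma>) \<partial>lborel)"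
    proof (rule nn_integral_cong)
      fix u
      show "ennreal (indicator {..t} \<sigma>) * ennreal (indicator {..\<sigma>} u * (exp (- \<alpha> * (\<sigma> - u)) * dK r u)) = ennreal (dK r u) * ennreal (exp (- \<alpha> * (\<sigma> - u)) * indicator {u..t} \<sigma>)"
        using dK_nonneg by (auto simp: indicator_def ennreal_mult'[symmetric] mult.commute ennreal_mult''[symmetric])
    qed
    finally show "(\<integral>\<^sup>+u. ennreal (dK r u) * ennreal (exp (- \<alpha> * (\<sigma> - u)) * indicator {u..t} \<sigma>) \<partial>lborel) = ennreal (indicator {..t} \<sigma> * gK \<alpha> r \<sigma>)" by simp
  qed
  finally show ?thesis .
qed

lemma K_avg_eq_integral_gK':
  assumes \<alpha>: "0 \<le> \<alpha>" and t: "0 \<le> t" "t \<le> 1"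
  shows "K_avg \<alpha> t r = (LINT \<sigma>|lborel. indicator {..t} \<sigma> * gK \<alpha> r \<sigma>)"
  using K_avg_eq_integral_gK[OF assms, of r] K_avg_bounds(2)[OF assms, of r] gK_nonneg
  by (subst integral_eq_nn_integral) (auto simp flip: K_avg_eq_integral_gK[OF assms])

text \<open>The Abel identity behind the explicit inverse of \<open>K\<close>: up to a constant, \<^term>\<open>wK x\<close> is the
  preimage under \<open>K\<close> of the path with derivative \<open>u\<^sup>\<beta>\<close> on \<open>(x, 1]\<close>.\<close>

lemma nn_integral_K_wK:
  assumes x: "0 < x"
  shows "(\<integral>\<^sup>+s. ennreal (K_kernel H t s * wK x s) \<partial>lborel) = ennreal (cH * B\<^sub>0) * (\<integral>\<^sup>+u. ennreal (u powr \<beta> * indicator {x<..t} u) \<partial>lborel)"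
proof -
  have "(\<integral>\<^sup>+s. ennreal (K_kernel H t s * wK x s) \<partial>lborel) = (\<integral>\<^sup>+s. \<integral>\<^sup>+u. ennreal (indicator {..t} u * dK s u) * ennreal (wK x s) \<partial>lborel \<partial>lborel)"
    by (simp add: ennreal_mult'[OF K_nonneg] K_nn nn_integral_multc)
  also have "\<dots> = (\<integral>\<^sup>+u. \<integral>\<^sup>+s. ennreal (indicator {..t} u * dK s u) * ennreal (wK x s) \<partial>lborel \<partial>lborel)"
    by (rule lborel_pair.Fubini') measurable
  also have "\<dots> = (\<integral>\<^sup>+u. ennreal (cH * B\<^sub>0) * ennreal (u powr \<beta> * indicator {x<..t} u) \<partial>lborel)"
  proof (rule nn_integral_cong)
    fix u
    show "(\<integral>\<^sup>+s. ennreal (indicator {..t} u * dK s u) * ennreal (wK x s) \<partial>lborel) = ennreal (cH * B\<^sub>0) * ennreal (u powr \<beta> * indicator {x<..t} u)"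
    proof (cases "x < u \<and> u \<le> t")
      case True
      have "(\<integral>\<^sup>+s. ennreal (indicator {..t} u * dK s u) * ennreal (wK x s) \<partial>lborel)
        = (\<integral>\<^sup>+s. ennreal (cH * u powr \<beta>) * (ennreal ((s - x) powr ((1 - \<beta>) - 1) * (u - s) powr (\<beta> - 1)) * indicator {x<..<u} s) \<partial>lborel)"
      proof (rule nn_integral_cong)
        fix s
        show "ennreal (indicator {..t} u * dK s u) * ennreal (wK x s) = ennreal (cH * u powr \<beta>) * (ennreal ((s - x) powr ((1 - \<beta>) - 1) * (u - s) powr (\<beta> - 1)) * indicator {x<..<u} s)"
        proof (cases "x < s \<and> s < u")
          case T: True
          then have "s powr (- \<beta>) * s powr \<beta> = 1" using x by (simp add: powr_add[symmetric])
          then have "dK s u * wK x s = (cH * u powr \<beta>) * ((s - x) powr (- \<beta>) * (u - s) powr (\<beta> - 1))"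
            using T True x by (simp add: dK_def wK_def mult_ac)
          then show ?thesis using T True cH_pos by (simp add: ennreal_mult'[symmetric] dK_nonneg)
        next
          case False
          then show ?thesis by (auto simp: indicator_def dK_def wK_def)
        qed
      qed
      also have "\<dots> = ennreal (cH * u powr \<beta>) * (\<integral>\<^sup>+s. ennreal ((s - x) powr ((1 - \<beta>) - 1) * (u - s) powr (\<beta> - 1)) * indicator {x<..<u} s \<partial>lborel)"
        by (rule nn_integral_cmult) measurable
      \<comment> \<open>The exponents 1 - \<beta> and \<beta> add up to 1, so u - x enters with
        power 0 and the inner integral is a constant.\<close>
      also have "(\<integral>\<^sup>+s. ennreal ((s - x) powr ((1 - \<beta>) - 1) * (u - s) powr (\<beta> - 1)) * indicator {x<..<u} s \<partial>lborel)
        = ennreal ((u - x) powr ((1 - \<beta>) + \<beta> - 1) * Beta (1 - \<beta>) \<beta>)"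
        by (rule nn_integral_beta_kernel) (use True \<beta>_pos \<beta>_lt in auto)
      also have "ennreal (cH * u powr \<beta>) * ennreal ((u - x) powr ((1 - \<beta>) + \<beta> - 1) * Beta (1 - \<beta>) \<beta>)
          = ennreal (cH * B\<^sub>0) * ennreal (u powr \<beta> * indicator {x<..t} u)"
        using True cH_pos B0_pos by (simp add: B\<^sub>0_def Beta_commute[of \<beta>] ennreal_mult'[symmetric] mult_ac)
      finally show ?thesis .
    next
      case False
      then have "indicator {..t} u * dK s u * wK x s = 0" for s
        by (auto simp: indicator_def dK_def wK_def)
      then have z: "ennreal (indicator {..t} u * dK s u) * ennreal (wK x s) = 0" for s
        using dK_nonneg wK_nonneg by (simp add: ennreal_mult''[symmetric])
      have zz: "indicator {x<..t} u = (0::real)" using False by (auto simp: indicator_def)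
      show ?thesis unfolding z zz by simp
    qed
  qed
  also have "\<dots> = ennreal (cH * B\<^sub>0) * (\<integral>\<^sup>+u. ennreal (u powr \<beta> * indicator {x<..t} u) \<partial>lborel)"
    by (rule nn_integral_cmult) measurable
  finally show ?thesis .
qed

lemma nn_integral_powr_\<beta>_le:
  assumes "t \<le> 1" "0 < x"
  shows "(\<integral>\<^sup>+u. ennreal (u powr \<beta> * indicator {x<..t} u) \<partial>lborel) \<le> 1"
proof -
  have "(\<integral>\<^sup>+u. ennreal (u powr \<beta> * indicator {x<..t} u) \<partial>lborel) \<le> (\<integral>\<^sup>+u. indicator {0..1::real} u \<partial>lborel)"
    using assms \<beta>_pos by (intro nn_integral_mono) (auto simp: indicator_def intro!: powr_le1)
  then show ?thesis by simp
qed

lemma integral_K_wK: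
  assumes x: "0 < x" and t: "t \<le> 1"
  shows "(LINT s|lborel. K_kernel H t s * wK x s) = cH * B\<^sub>0 * (LINT u|lborel. u powr \<beta> * indicator {x<..t} u)"
proof -
  have "(LINT s|lborel. K_kernel H t s * wK x s) = enn2real (\<integral>\<^sup>+s. ennreal (K_kernel H t s * wK x s) \<partial>lborel)"
    using K_nonneg wK_nonneg by (intro integral_eq_nn_integral) auto
  also have "\<dots> = cH * B\<^sub>0 * enn2real (\<integral>\<^sup>+u. ennreal (u powr \<beta> * indicator {x<..t} u) \<partial>lborel)"
    unfolding nn_integral_K_wK[OF x] using cH_pos B0_pos by (simp add: enn2real_mult)
  also have "enn2real (\<integral>\<^sup>+u. ennreal (u powr \<beta> * indicator {x<..t} u) \<partial>lborel) = (LINT u|lborel. u powr \<beta> * indicator {x<..t} u)"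
    by (intro integral_eq_nn_integral[symmetric]) auto
  finally show ?thesis .
qed

text \<open>Two interchanges of integrals: one applies K to \<open>wK x\<close> under the integral
  over x, the other rebuilds \<open>gK\<close> from its derivative. Since the path of u^\<beta> has
  total increase at most 1 on [0, 1], both are justified by the integrability of
  \<open>\<theta>K\<close> alone.\<close>

lemma K_avg_eq_integral_ellK:
  assumes \<alpha>: "0 \<le> \<alpha>" and t: "0 \<le> t" "t \<le> 1" and r: "0 < r"
  shows "K_avg \<alpha> t r = (LINT s|lborel. K_kernel H t s * ellK \<alpha> s r)"
proof -
  have fin: "(\<integral>\<^sup>+x. ennreal \<bar>indicator {..t} x * \<theta>K \<alpha> r x\<bar> \<partial>lborel) < \<infinity>"
    by (rule nn_integral_\<theta>K_finite[OF \<alpha>])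
  have "(LINT s|lborel. K_kernel H t s * ellK \<alpha> s r) = (LINT s|lborel. LINT x|lborel. \<theta>K \<alpha> r x * (K_kernel H t s * wK x s)) / (cH * B\<^sub>0)"
  proof -
    have "K_kernel H t s * ellK \<alpha> s r = (LINT x|lborel. K_kernel H t s * (\<theta>K \<alpha> r x * wK x s)) / (cH * B\<^sub>0)" for s
      by (simp add: ellK_def)
    then have "(LINT s|lborel. K_kernel H t s * ellK \<alpha> s r) = (LINT s|lborel. (LINT x|lborel. K_kernel H t s * (\<theta>K \<alpha> r x * wK x s)) / (cH * B\<^sub>0))" by simp
    also have "\<dots> = (LINT s|lborel. (LINT x|lborel. K_kernel H t s * (\<theta>K \<alpha> r x * wK x s))) / (cH * B\<^sub>0)"
      by (rule integral_divide_zero)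
    finally show ?thesis by (simp add: mult_ac)
  qed
  also have "(LINT s|lborel. LINT x|lborel. \<theta>K \<alpha> r x * (K_kernel H t s * wK x s)) = (LINT x|lborel. LINT s|lborel. \<theta>K \<alpha> r x * (K_kernel H t s * wK x s))"
  proof (rule lborel_integral_swap[symmetric])
    show "(\<lambda>z. \<theta>K \<alpha> r (fst z) * (K_kernel H t (snd z) * wK (fst z) (snd z))) \<in> borel_measurable (borel \<Otimes>\<^sub>M borel)"
      by measurable
    have "(\<integral>\<^sup>+s. ennreal \<bar>\<theta>K \<alpha> r x * (K_kernel H t s * wK x s)\<bar> \<partial>lborel) \<le> ennreal (cH * B\<^sub>0) * ennreal \<bar>indicator {..t} x * \<theta>K \<alpha> r x\<bar>" for x
    proof (cases "r < x \<and> x \<le> t")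
      case True
      then have x: "0 < x" using r by simp
      have "(\<integral>\<^sup>+s. ennreal \<bar>\<theta>K \<alpha> r x * (K_kernel H t s * wK x s)\<bar> \<partial>lborel) = (\<integral>\<^sup>+s. ennreal \<bar>\<theta>K \<alpha> r x\<bar> * ennreal (K_kernel H t s * wK x s) \<partial>lborel)"
        using K_nonneg wK_nonneg by (simp add: abs_mult abs_of_nonneg ennreal_mult')
      also have "\<dots> = ennreal \<bar>\<theta>K \<alpha> r x\<bar> * (ennreal (cH * B\<^sub>0) * (\<integral>\<^sup>+u. ennreal (u powr \<beta> * indicator {x<..t} u) \<partial>lborel))"
        by (simp add: nn_integral_cmult nn_integral_K_wK[OF x])
      also have "\<dots> \<le> ennreal \<bar>\<theta>K \<alpha> r x\<bar> * (ennreal (cH * B\<^sub>0) * 1)"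
        by (intro mult_left_mono nn_integral_powr_\<beta>_le t x) auto
      finally show ?thesis using True by (simp add: mult.commute)
    next
      case False
      have z: "\<theta>K \<alpha> r x * (K_kernel H t s * wK x s) = 0" for s
        using False by (cases "s \<le> x") (auto simp: \<theta>K_zero wK_def K_zero indicator_def not_less)
      show ?thesis unfolding z by simp
    qed
    then have "(\<integral>\<^sup>+x. \<integral>\<^sup>+s. ennreal \<bar>\<theta>K \<alpha> r x * (K_kernel H t s * wK x s)\<bar> \<partial>lborel \<partial>lborel) \<le> (\<integral>\<^sup>+x. ennreal (cH * B\<^sub>0) * ennreal \<bar>indicator {..t} x * \<theta>K \<alpha> r x\<bar> \<partial>lborel)"
      by (rule nn_integral_mono)
    also have "\<dots> = ennreal (cH * B\<^sub>0) * (\<integral>\<^sup>+x. ennreal \<bar>indicator {..t} x * \<theta>K \<alpha> r x\<bar> \<partial>lborel)"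
      by (rule nn_integral_cmult) measurable
    also have "\<dots> < \<infinity>" using fin by (simp add: ennreal_mult_less_top)
    finally show "(\<integral>\<^sup>+x. \<integral>\<^sup>+s. ennreal \<bar>\<theta>K \<alpha> r x * (K_kernel H t s * wK x s)\<bar> \<partial>lborel \<partial>lborel) < \<infinity>" .
  qed
  also have "(LINT x|lborel. LINT s|lborel. \<theta>K \<alpha> r x * (K_kernel H t s * wK x s)) = (LINT x|lborel. cH * B\<^sub>0 * (LINT u|lborel. \<theta>K \<alpha> r x * (u powr \<beta> * indicator {x<..t} u)))"
  proof (rule Bochner_Integration.integral_cong[OF refl])
    fix x
    show "(LINT s|lborel. \<theta>K \<alpha> r x * (K_kernel H t s * wK x s)) = cH * B\<^sub>0 * (LINT u|lborel. \<theta>K \<alpha> r x * (u powr \<beta> * indicator {x<..t} u))"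
    proof (cases "r < x")
      case True
      then show ?thesis using integral_K_wK[of x t] r t by simp
    qed (simp add: \<theta>K_zero)
  qed
  also have "\<dots> / (cH * B\<^sub>0) = (LINT x|lborel. (LINT u|lborel. \<theta>K \<alpha> r x * (u powr \<beta> * indicator {x<..t} u)))"
    using cH_pos B0_pos by simp
  also have "\<dots> = (LINT u|lborel. LINT x|lborel. \<theta>K \<alpha> r x * (u powr \<beta> * indicator {x<..t} u))"
  proof (rule lborel_integral_swap)
    have "(\<lambda>z. \<theta>K \<alpha> r (fst z) * (snd z powr \<beta> * (if fst z < snd z \<and> snd z \<le> t then 1 else 0))) \<in> borel_measurable (borel \<Otimes>\<^sub>M borel)"
      by measurable
    then show "(\<lambda>z. \<theta>K \<alpha> r (fst z) * (snd z powr \<beta> * indicator {fst z<..t} (snd z))) \<in> borel_measurable (borel \<Otimes>\<^sub>M borel)"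
      by (simp add: indicator_def)
    have "(\<integral>\<^sup>+u. ennreal \<bar>\<theta>K \<alpha> r x * (u powr \<beta> * indicator {x<..t} u)\<bar> \<partial>lborel) \<le> ennreal \<bar>indicator {..t} x * \<theta>K \<alpha> r x\<bar>" for x
    proof (cases "r < x \<and> x \<le> t")
      case True
      have "(\<integral>\<^sup>+u. ennreal \<bar>\<theta>K \<alpha> r x * (u powr \<beta> * indicator {x<..t} u)\<bar> \<partial>lborel) = (\<integral>\<^sup>+u. ennreal \<bar>\<theta>K \<alpha> r x\<bar> * ennreal (u powr \<beta> * indicator {x<..t} u) \<partial>lborel)"
        by (simp add: abs_mult ennreal_mult')
      also have "\<dots> \<le> ennreal \<bar>\<theta>K \<alpha> r x\<bar> * 1"
      proof -
        have le: "(\<integral>\<^sup>+u. ennreal (u powr \<beta> * indicator {x<..t} u) \<partial>lborel) \<le> 1"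
          by (rule nn_integral_powr_\<beta>_le) (use True r t in auto)
        show ?thesis using mult_left_mono[OF le, of "ennreal \<bar>\<theta>K \<alpha> r x\<bar>"] by (subst nn_integral_cmult) simp_all
      qed
      finally show ?thesis using True by simp
    next
      case False
      then have z: "\<theta>K \<alpha> r x * (u powr \<beta> * indicator {x<..t} u) = 0" for u by (auto simp: \<theta>K_zero indicator_def)
      show ?thesis unfolding z by simp
    qed
    then have "(\<integral>\<^sup>+x. \<integral>\<^sup>+u. ennreal \<bar>\<theta>K \<alpha> r x * (u powr \<beta> * indicator {x<..t} u)\<bar> \<partial>lborel \<partial>lborel) \<le> (\<integral>\<^sup>+x. ennreal \<bar>indicator {..t} x * \<theta>K \<alpha> r x\<bar> \<partial>lborel)"
      by (rule nn_integral_mono)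
    then show "(\<integral>\<^sup>+x. \<integral>\<^sup>+u. ennreal \<bar>\<theta>K \<alpha> r x * (u powr \<beta> * indicator {x<..t} u)\<bar> \<partial>lborel \<partial>lborel) < \<infinity>"
      using fin by (rule le_less_trans)
  qed
  also have "\<dots> = (LINT u|lborel. indicator {..t} u * gK \<alpha> r u)"
  proof (rule integral_cong_AE)
    show "(\<lambda>u. LINT x|lborel. \<theta>K \<alpha> r x * (u powr \<beta> * indicator {x<..t} u)) \<in> borel_measurable lborel"
    proof -
      have "(\<lambda>z. \<theta>K \<alpha> r (snd z) * (fst z powr \<beta> * (if snd z < fst z \<and> fst z \<le> t then 1 else 0))) \<in> borel_measurable (lborel \<Otimes>\<^sub>M lborel)"
        by measurable
      then show ?thesis by (intro lborel.borel_measurable_lebesgue_integral) (simp add: case_prod_beta' indicator_def)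
    qed
    show "AE u in lborel. (LINT x|lborel. \<theta>K \<alpha> r x * (u powr \<beta> * indicator {x<..t} u)) = indicator {..t} u * gK \<alpha> r u"
    proof (rule AE_I2)
      fix u
      have "(LINT x|lborel. \<theta>K \<alpha> r x * (u powr \<beta> * indicator {x<..t} u)) = (LINT x|lborel. (indicator {..t} u * u powr \<beta>) * (indicator {..u} x * \<theta>K \<alpha> r x))"
      proof (rule integral_cong_AE)
        show "AE x in lborel. \<theta>K \<alpha> r x * (u powr \<beta> * indicator {x<..t} u) = indicator {..t} u * u powr \<beta> * (indicator {..u} x * \<theta>K \<alpha> r x)"
          using AE_lborel_singleton[of u] by eventually_elim (auto simp: indicator_def)
        have "(\<lambda>x. \<theta>K \<alpha> r x * (u powr \<beta> * (if x < u \<and> u \<le> t then 1 else 0))) \<in> borel_measurable lborel" by measurable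
        then show "(\<lambda>x. \<theta>K \<alpha> r x * (u powr \<beta> * indicator {x<..t} u)) \<in> borel_measurable lborel" by (simp add: indicator_def)
      qed measurable
      also have "\<dots> = indicator {..t} u * gK \<alpha> r u"
      proof (cases "r < u")
        case True
        then have "u powr \<beta> * u powr (- \<beta>) = 1" using r by (simp add: powr_add[symmetric])
        then show ?thesis using integral_\<theta>K[OF \<alpha> r True] by simp
      next
        case False
        then have z: "indicator {..u} x * \<theta>K \<alpha> r x = 0" for x by (auto simp: indicator_def \<theta>K_zero)
        have zz: "gK \<alpha> r u = 0" using False by (simp add: gK_zero)
        show ?thesis unfolding z zz by simp
      qed
      finally show "(LINT x|lborel. \<theta>K \<alpha> r x * (u powr \<beta> * indicator {x<..t} u)) = indicator {..t} u * gK \<alpha> r u" .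
    qed
  qed measurable
  also have "\<dots> = K_avg \<alpha> t r" by (rule K_avg_eq_integral_gK'[OF \<alpha> t, symmetric])
  finally show ?thesis by simp
qed

text \<open>Integrating the majorant of \<open>\<theta>K\<close> against \<open>wK\<close> gives two
  Beta integrals. In the first the power of s - r vanishes, in the second it is 1, so no singularity
  at s = r survives and only r^(-\<beta>) is left.\<close>

lemma abs_ellK_le:
  assumes \<alpha>: "0 \<le> \<alpha>" and r: "0 < r" "r < s" and s: "s \<le> 1"
  shows "\<bar>ellK \<alpha> s r\<bar> \<le> (1 + \<alpha>) * r powr (- \<beta>)"
proof -
  have cB: "0 < cH * B\<^sub>0" using cH_pos B0_pos by simp
  have "ennreal \<bar>LINT x|lborel. \<theta>K \<alpha> r x * wK x s\<bar> \<le> (\<integral>\<^sup>+x. ennreal \<bar>\<theta>K \<alpha> r x * wK x s\<bar> \<partial>lborel)"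
    by (rule ennreal_abs_integral_le)
  also have "\<dots> \<le> (\<integral>\<^sup>+x. ennreal (cH * r powr (- \<beta>) * s powr \<beta>) * (ennreal ((x - r) powr (\<beta> - 1) * (s - x) powr ((1 - \<beta>) - 1)) * indicator {r<..<s} x)
      + ennreal (cH * r powr (- \<beta>) * s powr \<beta> * (\<alpha> / \<beta>)) * (ennreal ((x - r) powr ((\<beta> + 1) - 1) * (s - x) powr ((1 - \<beta>) - 1)) * indicator {r<..<s} x) \<partial>lborel)"
  proof (rule nn_integral_mono)
    fix x
    show "ennreal \<bar>\<theta>K \<alpha> r x * wK x s\<bar> \<le> ennreal (cH * r powr (- \<beta>) * s powr \<beta>) * (ennreal ((x - r) powr (\<beta> - 1) * (s - x) powr ((1 - \<beta>) - 1)) * indicator {r<..<s} x)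
      + ennreal (cH * r powr (- \<beta>) * s powr \<beta> * (\<alpha> / \<beta>)) * (ennreal ((x - r) powr ((\<beta> + 1) - 1) * (s - x) powr ((1 - \<beta>) - 1)) * indicator {r<..<s} x)"
    proof (cases "r < x \<and> x < s")
      case True
      have "\<bar>\<theta>K \<alpha> r x * wK x s\<bar> \<le> \<Theta>K \<alpha> r x * wK x s"
        using abs_\<theta>K_le[OF \<alpha> r(1), of x] True wK_nonneg by (simp add: abs_mult mult_right_mono)
      also have "\<dots> = cH * r powr (- \<beta>) * s powr \<beta> * ((x - r) powr (\<beta> - 1) * (s - x) powr (- \<beta>))
         + cH * r powr (- \<beta>) * s powr \<beta> * (\<alpha> / \<beta>) * ((x - r) powr \<beta> * (s - x) powr (- \<beta>))"
        using True r by (simp add: \<Theta>K_def wK_def algebra_simps)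
      finally have F0: "\<bar>\<theta>K \<alpha> r x * wK x s\<bar> \<le> cH * r powr (- \<beta>) * s powr \<beta> * ((x - r) powr (\<beta> - 1) * (s - x) powr (- \<beta>))
         + cH * r powr (- \<beta>) * s powr \<beta> * (\<alpha> / \<beta>) * ((x - r) powr \<beta> * (s - x) powr (- \<beta>))" .
      have nn: "0 \<le> cH * r powr (- \<beta>) * s powr \<beta> * ((x - r) powr (\<beta> - 1) * (s - x) powr (- \<beta>))"
        "0 \<le> cH * r powr (- \<beta>) * s powr \<beta> * (\<alpha> / \<beta>) * ((x - r) powr \<beta> * (s - x) powr (- \<beta>))"
        using cH_pos \<beta>_pos \<alpha> by simp_all
      have F: "ennreal \<bar>\<theta>K \<alpha> r x * wK x s\<bar> \<le> ennreal (cH * r powr (- \<beta>) * s powr \<beta> * ((x - r) powr (\<beta> - 1) * (s - x) powr (- \<beta>)))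
         + ennreal (cH * r powr (- \<beta>) * s powr \<beta> * (\<alpha> / \<beta>) * ((x - r) powr \<beta> * (s - x) powr (- \<beta>)))"
        unfolding ennreal_plus[OF nn, symmetric] by (rule ennreal_leI[OF F0])
      have i1: "indicator {r<..<s} x = (1::ennreal)" using True by simp
      have e: "(1 - \<beta>) - 1 = - \<beta>" "(\<beta> + 1) - 1 = \<beta>" by simp_all
      have m: "ennreal (cH * r powr (- \<beta>) * s powr \<beta>) * ennreal y = ennreal (cH * r powr (- \<beta>) * s powr \<beta> * y)"
        "ennreal (cH * r powr (- \<beta>) * s powr \<beta> * (\<alpha> / \<beta>)) * ennreal y = ennreal (cH * r powr (- \<beta>) * s powr \<beta> * (\<alpha> / \<beta>) * y)" for y
        by (rule ennreal_mult'[symmetric], use cH_pos \<beta>_pos \<alpha> in simp)+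
      show ?thesis unfolding i1 e m mult_1_right by (rule F)
    next
      case False
      then have z: "\<theta>K \<alpha> r x * wK x s = 0" by (auto simp: \<theta>K_def wK_def indicator_def)
      show ?thesis unfolding z by simp
    qed
  qed
  also have "\<dots> = ennreal (cH * r powr (- \<beta>) * s powr \<beta>) * ennreal ((s - r) powr (\<beta> + (1 - \<beta>) - 1) * Beta \<beta> (1 - \<beta>))
      + ennreal (cH * r powr (- \<beta>) * s powr \<beta> * (\<alpha> / \<beta>)) * ennreal ((s - r) powr ((\<beta> + 1) + (1 - \<beta>) - 1) * Beta (\<beta> + 1) (1 - \<beta>))"
  proof -
    have k1: "(\<integral>\<^sup>+x. ennreal ((x - r) powr (\<beta> - 1) * (s - x) powr ((1 - \<beta>) - 1)) * indicator {r<..<s} x \<partial>lborel)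
        = ennreal ((s - r) powr (\<beta> + (1 - \<beta>) - 1) * Beta \<beta> (1 - \<beta>))"
      by (rule nn_integral_beta_kernel) (use r \<beta>_pos \<beta>_lt in auto)
    have k2: "(\<integral>\<^sup>+x. ennreal ((x - r) powr ((\<beta> + 1) - 1) * (s - x) powr ((1 - \<beta>) - 1)) * indicator {r<..<s} x \<partial>lborel)
        = ennreal ((s - r) powr ((\<beta> + 1) + (1 - \<beta>) - 1) * Beta (\<beta> + 1) (1 - \<beta>))"
      by (rule nn_integral_beta_kernel) (use r \<beta>_pos \<beta>_lt in auto)
    have c: "(\<integral>\<^sup>+x. ennreal y * (ennreal ((x - r) powr p * (s - x) powr q) * indicator {r<..<s} x) \<partial>lborel)
       = ennreal y * (\<integral>\<^sup>+x. ennreal ((x - r) powr p * (s - x) powr q) * indicator {r<..<s} x \<partial>lborel)" for y p q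
      by (rule nn_integral_cmult) measurable
    show ?thesis by (subst nn_integral_add, measurable, simp only: c k1 k2)
  qed
  also have "\<dots> = ennreal (cH * r powr (- \<beta>) * s powr \<beta> * B\<^sub>0 + cH * r powr (- \<beta>) * s powr \<beta> * (\<alpha> / \<beta>) * ((s - r) * (\<beta> * B\<^sub>0)))"
  proof -
    \<comment> \<open>The factor \<beta> gained here cancels the 1 / \<beta> in front of \<alpha>,
      so the bound stays uniform in H.\<close>
    have "(\<beta> + (1 - \<beta>)) * Beta (\<beta> + 1) (1 - \<beta>) = \<beta> * Beta \<beta> (1 - \<beta>)"
      using \<beta>_pos by (intro Beta_plus1_left) (auto simp: nonpos_Ints_def)
    then have B: "Beta (\<beta> + 1) (1 - \<beta>) = \<beta> * B\<^sub>0" by (simp add: B\<^sub>0_def)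
    show ?thesis using r cH_pos \<beta>_pos \<alpha> B0_pos unfolding B
      by (simp add: B\<^sub>0_def[symmetric] ennreal_mult'[symmetric] ennreal_plus[symmetric] del: ennreal_plus)
  qed
  also have "cH * r powr (- \<beta>) * s powr \<beta> * B\<^sub>0 + cH * r powr (- \<beta>) * s powr \<beta> * (\<alpha> / \<beta>) * ((s - r) * (\<beta> * B\<^sub>0))
     = (cH * B\<^sub>0) * (r powr (- \<beta>) * (s powr \<beta> * (1 + \<alpha> * (s - r))))"
    using \<beta>_pos by (simp add: field_simps)
  finally have "ennreal \<bar>LINT x|lborel. \<theta>K \<alpha> r x * wK x s\<bar> \<le> ennreal ((cH * B\<^sub>0) * (r powr (- \<beta>) * (s powr \<beta> * (1 + \<alpha> * (s - r)))))" .
  then have "\<bar>LINT x|lborel. \<theta>K \<alpha> r x * wK x s\<bar> \<le> (cH * B\<^sub>0) * (r powr (- \<beta>) * (s powr \<beta> * (1 + \<alpha> * (s - r))))"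
    using cB r \<alpha> by (subst (asm) ennreal_le_iff) (auto intro!: mult_nonneg_nonneg add_nonneg_nonneg)
  then have "\<bar>ellK \<alpha> s r\<bar> \<le> r powr (- \<beta>) * (s powr \<beta> * (1 + \<alpha> * (s - r)))"
    unfolding ellK_def using cB by (simp add: abs_divide divide_le_eq mult.commute)
  also have "\<dots> \<le> r powr (- \<beta>) * (1 * (1 + \<alpha> * 1))"
    using r s \<alpha> \<beta>_pos by (intro mult_left_mono mult_mono powr_le1 add_left_mono) auto
  finally show ?thesis by (simp add: mult.commute)
qed

lemma ellK_zero: "s \<le> r \<or> r \<le> 0 \<Longrightarrow> ellK \<alpha> s r = 0"
proof -
  assume "s \<le> r \<or> r \<le> 0"
  then have z: "\<theta>K \<alpha> r x * wK x s = 0" for x by (auto simp: \<theta>K_def wK_def indicator_def)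
  show ?thesis unfolding ellK_def z by simp
qed

text \<open>\<open>K_avg \<alpha> t r\<close> is the inner product of \<open>K(t, \<cdot>)\<close> and \<open>ellK \<alpha> \<cdot> r\<close>, and the constant bounds the squared
  Hilbert-Schmidt norm of \<open>ellK \<alpha>\<close>.\<close>

lemma K_avg_norm_le:
  assumes \<alpha>: "0 \<le> \<alpha>" and t: "\<And>i. i < m \<Longrightarrow> 0 \<le> t i \<and> t i \<le> 1"
  shows "(LINT r|lborel. (\<Sum>i<m. a i * K_avg \<alpha> (t i) r)\<^sup>2)
    \<le> (1 + \<alpha>)\<^sup>2 / (1 - 2 * \<beta>) * (LINT r|lborel. (\<Sum>i<m. a i * K_kernel H (t i) r)\<^sup>2)"
proof -
  define k where "k s = (\<Sum>i<m. a i * K_kernel H (t i) s)" for s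
  have k_meas[measurable]: "k \<in> borel_measurable borel" unfolding k_def by measurable
  have int_sq: "integrable lborel (\<lambda>s. (k s)\<^sup>2)"
    unfolding k_def power2_eq_square sum_product
    using K_sq_integrable t by (auto intro!: Bochner_Integration.integrable_sum simp: mult_ac)
  \<comment> \<open>Cauchy-Schwarz in s for fixed r. Integrating r^(-2 \<beta>) over (0, 1)
    afterwards is where 1 / (2 - 2 H) comes from.\<close>
  have bound: "ennreal ((\<Sum>i<m. a i * K_avg \<alpha> (t i) r)\<^sup>2) \<le> ennreal (LINT s|lborel. (k s)\<^sup>2) * ennreal ((1 + \<alpha>)\<^sup>2 * (indicator {0<..<1} r * r powr (- 2 * \<beta>)))" for r
  proof (cases "0 < r \<and> r < 1")
    case True
    have ki: "integrable lborel (\<lambda>s. K_kernel H (t i) s * ellK \<alpha> s r)" if "i < m" for i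
    proof (rule Bochner_Integration.integrable_bound[where f="\<lambda>s. (cH / \<beta> * r powr (- \<beta>)) * ((1 + \<alpha>) * r powr (- \<beta>)) * indicator {0..1} s"])
      show "AE s in lborel. norm (K_kernel H (t i) s * ellK \<alpha> s r) \<le> norm ((cH / \<beta> * r powr (- \<beta>)) * ((1 + \<alpha>) * r powr (- \<beta>)) * indicator {0..1} s :: real)"
      proof (rule AE_I2)
        fix s
        show "norm (K_kernel H (t i) s * ellK \<alpha> s r) \<le> norm ((cH / \<beta> * r powr (- \<beta>)) * ((1 + \<alpha>) * r powr (- \<beta>)) * indicator {0..1} s :: real)"
        proof (cases "r < s \<and> s < t i")
          case T: True
          then have s1: "s < 1" using t[OF that] by simp
          have "K_kernel H (t i) s \<le> cH / \<beta> * s powr (- \<beta>)"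
            using K_le[of "t i" s] t[OF that] True T s1 by simp
          also have "\<dots> \<le> cH / \<beta> * r powr (- \<beta>)"
            using True T cH_pos \<beta>_pos by (intro mult_left_mono powr_mono2') auto
          finally have "\<bar>K_kernel H (t i) s * ellK \<alpha> s r\<bar> \<le> (cH / \<beta> * r powr (- \<beta>)) * ((1 + \<alpha>) * r powr (- \<beta>))"
            unfolding abs_mult using abs_ellK_le[OF \<alpha>, of r s] T True s1 K_nonneg cH_pos \<beta>_pos \<alpha>
            by (intro mult_mono) auto
          then show ?thesis using T True s1 cH_pos \<beta>_pos \<alpha> by (simp add: abs_mult)
        next
          case False
          then have z: "K_kernel H (t i) s * ellK \<alpha> s r = 0" by (auto simp: K_zero ellK_zero not_less)
          show ?thesis unfolding z by simp
        qed
      qed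
    qed auto
    \<comment> \<open>\<open>ellK\<close> is controlled only for s <= 1; the kernels vanish beyond,
      so the cut does not change the integral.\<close>
    define e where "e s = ellK \<alpha> s r * indicator {..1} s" for s
    have "(\<Sum>i<m. a i * K_avg \<alpha> (t i) r) = (\<Sum>i<m. a i * (LINT s|lborel. K_kernel H (t i) s * ellK \<alpha> s r))"
      using K_avg_eq_integral_ellK[OF \<alpha>] t True by simp
    also have "\<dots> = (LINT s|lborel. (\<Sum>i<m. a i * (K_kernel H (t i) s * ellK \<alpha> s r)))"
      using ki by (subst Bochner_Integration.integral_sum) auto
    also have "\<dots> = (LINT s|lborel. k s * e s)"
    proof (rule Bochner_Integration.integral_cong[OF refl])
      fix s
      have h: "a i * (K_kernel H (t i) s * ellK \<alpha> s r) = a i * K_kernel H (t i) s * e s" if "i < m" for i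
        using t[OF that] K_zero[of s "t i"] by (cases "s \<le> 1") (auto simp: e_def)
      show "(\<Sum>i<m. a i * (K_kernel H (t i) s * ellK \<alpha> s r)) = k s * e s"
        unfolding k_def sum_distrib_right by (rule sum.cong[OF refl], rule h) simp
    qed
    finally have eqn: "(\<Sum>i<m. a i * K_avg \<alpha> (t i) r) = (LINT s|lborel. k s * e s)" .
    have e_meas: "e \<in> borel_measurable lborel" unfolding e_def by measurable
    have "ennreal ((\<Sum>i<m. a i * K_avg \<alpha> (t i) r)\<^sup>2) \<le> (\<integral>\<^sup>+s. ennreal ((k s)\<^sup>2) \<partial>lborel) * (\<integral>\<^sup>+s. ennreal ((e s)\<^sup>2) \<partial>lborel)"
      unfolding eqn by (rule integral_Cauchy_Schwarz_ennreal[OF _ e_meas]) simp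
    also have "(\<integral>\<^sup>+s. ennreal ((k s)\<^sup>2) \<partial>lborel) = ennreal (LINT s|lborel. (k s)\<^sup>2)"
      using int_sq by (intro nn_integral_eq_integral) auto
    also have "(\<integral>\<^sup>+s. ennreal ((e s)\<^sup>2) \<partial>lborel) \<le> (\<integral>\<^sup>+s. ennreal ((1 + \<alpha>)\<^sup>2 * r powr (- 2 * \<beta>)) * indicator {0..1::real} s \<partial>lborel)"
    proof (rule nn_integral_mono)
      fix s
      show "ennreal ((e s)\<^sup>2) \<le> ennreal ((1 + \<alpha>)\<^sup>2 * r powr (- 2 * \<beta>)) * indicator {0..1} s"
      proof (cases "r < s \<and> s \<le> 1")
        case T: True
        have "(e s)\<^sup>2 = \<bar>ellK \<alpha> s r\<bar>\<^sup>2" using T by (simp add: e_def)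
        also have "\<dots> \<le> ((1 + \<alpha>) * r powr (- \<beta>))\<^sup>2"
          using abs_ellK_le[OF \<alpha>, of r s] T True by (intro power_mono) auto
        also have "\<dots> = (1 + \<alpha>)\<^sup>2 * r powr (- 2 * \<beta>)"
          by (simp add: power_mult_distrib power2_eq_square powr_add[symmetric])
        finally show ?thesis using T True by (simp add: ennreal_leI)
      next
        case False
        then have "e s = 0" by (auto simp: e_def ellK_zero indicator_def not_less)
        then show ?thesis by simp
      qed
    qed
    also have "\<dots> = ennreal ((1 + \<alpha>)\<^sup>2 * r powr (- 2 * \<beta>))" by (simp add: nn_integral_cmult)
    finally show ?thesis using True by (simp add: mult_left_mono)
  next
    case False
    then have "K_avg \<alpha> (t i) r = 0" if "i < m" for i
      using K_avg_bounds(2,3)[OF \<alpha>, of "t i" r] t[OF that] by (auto simp: indicator_def)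
    then show ?thesis by simp
  qed
  have "(\<integral>\<^sup>+r. ennreal ((\<Sum>i<m. a i * K_avg \<alpha> (t i) r)\<^sup>2) \<partial>lborel)
    \<le> (\<integral>\<^sup>+r. ennreal (LINT s|lborel. (k s)\<^sup>2) * (ennreal ((1 + \<alpha>)\<^sup>2) * ennreal (indicator {0<..<1} r * r powr (- 2 * \<beta>))) \<partial>lborel)"
    using bound by (intro nn_integral_mono) (simp add: ennreal_mult')
  also have "\<dots> = ennreal (LINT s|lborel. (k s)\<^sup>2) * (\<integral>\<^sup>+r. ennreal ((1 + \<alpha>)\<^sup>2) * ennreal (indicator {0<..<1} r * r powr (- 2 * \<beta>)) \<partial>lborel)"
    by (rule nn_integral_cmult) measurable
  also have "(\<integral>\<^sup>+r. ennreal ((1 + \<alpha>)\<^sup>2) * ennreal (indicator {0<..<1} r * r powr (- 2 * \<beta>)) \<partial>lborel)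
     = ennreal ((1 + \<alpha>)\<^sup>2) * (\<integral>\<^sup>+r. ennreal (indicator {0<..<1} r * r powr (- 2 * \<beta>)) \<partial>lborel)"
    by (rule nn_integral_cmult) measurable
  also have "(\<integral>\<^sup>+r. ennreal (indicator {0<..<1} r * r powr (- 2 * \<beta>)) \<partial>lborel) = ennreal (1 / (1 - 2 * \<beta>))"
    by (rule nn_integral_powr_2\<beta>)
  also have "ennreal (LINT s|lborel. (k s)\<^sup>2) * (ennreal ((1 + \<alpha>)\<^sup>2) * ennreal (1 / (1 - 2 * \<beta>)))
     = ennreal ((1 + \<alpha>)\<^sup>2 / (1 - 2 * \<beta>) * (LINT s|lborel. (k s)\<^sup>2))"
    using \<beta>_lt by (simp add: ennreal_mult'[symmetric] ennreal_mult''[symmetric] mult.commute)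
  finally have le: "(\<integral>\<^sup>+r. ennreal ((\<Sum>i<m. a i * K_avg \<alpha> (t i) r)\<^sup>2) \<partial>lborel) \<le> ennreal ((1 + \<alpha>)\<^sup>2 / (1 - 2 * \<beta>) * (LINT s|lborel. (k s)\<^sup>2))" .
  have "(LINT r|lborel. (\<Sum>i<m. a i * K_avg \<alpha> (t i) r)\<^sup>2) = enn2real (\<integral>\<^sup>+r. ennreal ((\<Sum>i<m. a i * K_avg \<alpha> (t i) r)\<^sup>2) \<partial>lborel)"
    by (intro integral_eq_nn_integral) auto
  also have "\<dots> \<le> (1 + \<alpha>)\<^sup>2 / (1 - 2 * \<beta>) * (LINT s|lborel. (k s)\<^sup>2)"
    by (rule enn2real_leI[OF _ le]) (use \<beta>_lt in \<open>auto intro!: mult_nonneg_nonneg\<close>)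
  finally show ?thesis unfolding k_def .
qed

end

section \<open>The characteristic function of the Ornstein-Uhlenbeck measure\<close>

text \<open>Turns the exponential average of a path into finite linear combinations, the functionals
  whose law \<open>fractional_BM\<close> prescribes. Counting from \<open>Suc N\<close> keeps the
  partition nonempty.\<close>

lemma riemann_sum_tendsto:
  fixes g :: "real \<Rightarrow> real"
  assumes t: "0 \<le> t" and g: "continuous_on {0..t} g"
  shows "(\<lambda>N. t / real (Suc N) * (\<Sum>q<Suc N. g (t * real q / real (Suc N)))) \<longlonglongrightarrow> integral {0..t} g"
proof (cases "t = 0")
  case True
  then show ?thesis by simp
next
  case False
  with t have t: "0 < t" by simp
  define G where "G x = integral {0..x} g" for x
  have G_deriv: "(G has_real_derivative g x) (at x within {0..t})" if "x \<in> {0..t}" for x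
    unfolding G_def has_real_derivative_iff_has_vector_derivative
    by (rule integral_has_vector_derivative[OF g that])
  have uc: "uniformly_continuous_on {0..t} g"
    by (rule compact_uniformly_continuous[OF g]) simp
  show ?thesis
  proof (rule LIMSEQ_I)
    fix e :: real assume e: "0 < e"
    define e' where "e' = e / (2 * t)"
    have e': "0 < e'" using e t by (simp add: e'_def)
    obtain d where d: "0 < d" "\<And>x y. x \<in> {0..t} \<Longrightarrow> y \<in> {0..t} \<Longrightarrow> dist y x < d \<Longrightarrow> dist (g y) (g x) < e'"
      using uc e' unfolding uniformly_continuous_on_def by metis
    obtain N0 :: nat where N0: "t / d < real N0" using reals_Archimedean2 by blast
    have "norm (t / real (Suc N) * (\<Sum>q<Suc N. g (t * real q / real (Suc N))) - integral {0..t} g) < e" if N: "N0 \<le> N" for N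
    proof -
      let ?n = "Suc N"
      define p where "p q = t * real q / real ?n" for q
      have small: "t / real ?n < d"
      proof -
        have "t / d < real ?n" using N0 N by linarith
        then show ?thesis using d(1) t by (simp add: field_simps)
      qed
      have step: "p (Suc q) - p q = t / real ?n" for q by (simp add: p_def diff_divide_distrib[symmetric] algebra_simps)
      have pr: "p q \<in> {0..t}" if "q \<le> ?n" for q
        using that t by (auto simp: p_def divide_le_eq)
      have "G t = G (p ?n) - G (p 0)" by (simp add: p_def G_def)
      also have "\<dots> = (\<Sum>q<?n. G (p (Suc q)) - G (p q))" by (rule sum_lessThan_telescope[symmetric])
      finally have tele: "G t = (\<Sum>q<?n. G (p (Suc q)) - G (p q))" .
      have piece: "\<bar>(G (p (Suc q)) - G (p q)) - t / real ?n * g (p q)\<bar> \<le> t / real ?n * e'" if q: "q < ?n" for q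
      proof -
        have lt: "p q < p (Suc q)" using step[of q] t by (smt (verit) divide_pos_pos of_nat_0_less_iff zero_less_Suc)
        have sub: "{p q..p (Suc q)} \<subseteq> {0..t}" using pr[of q] pr[of "Suc q"] q by auto
        have "\<exists>x\<in>{p q..p (Suc q)}. G (p (Suc q)) - G (p q) = (\<lambda>h. g x * h) (p (Suc q) - p q)"
        proof (rule mvt_very_simple[where f=G and f'="\<lambda>x h. g x * h"])
          show "p q \<le> p (Suc q)" using lt by simp
          fix x assume "p q \<le> x" "x \<le> p (Suc q)"
          then have "x \<in> {0..t}" using sub by auto
          then show "(G has_derivative (\<lambda>h. g x * h)) (at x within {p q..p (Suc q)})"
            using G_deriv[of x] has_derivative_subset[OF _ sub] by (auto simp: has_field_derivative_def)
        qed
        then obtain z where z: "z \<in> {p q..p (Suc q)}" "G (p (Suc q)) - G (p q) = g z * (t / real ?n)"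
          using step[of q] by auto
        have zt: "z \<in> {0..t}" using z(1) sub by blast
        have pq: "p q \<in> {0..t}" using pr[of q] q by simp
        have "dist z (p q) \<le> t / real ?n" using z step[of q] by (auto simp: dist_real_def)
        then have "dist (g z) (g (p q)) < e'" using small by (intro d(2)[OF pq zt]) linarith
        then have "\<bar>g z - g (p q)\<bar> \<le> e'" by (simp add: dist_real_def)
        moreover have "(G (p (Suc q)) - G (p q)) - t / real ?n * g (p q) = t / real ?n * (g z - g (p q))"
          unfolding z(2) right_diff_distrib by (simp only: mult.commute)
        ultimately show ?thesis using t by (simp add: abs_mult divide_right_mono mult_left_mono)
      qed
      have "\<bar>G t - t / real ?n * (\<Sum>q<?n. g (p q))\<bar> = \<bar>\<Sum>q<?n. (G (p (Suc q)) - G (p q)) - t / real ?n * g (p q)\<bar>"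
        unfolding tele by (simp only: sum_subtractf sum_distrib_left)
      also have "\<dots> \<le> (\<Sum>q<?n. t / real ?n * e')"
        using piece by (intro order_trans[OF sum_abs] sum_mono) auto
      also have "\<dots> = t * e'" by simp
      also have "\<dots> < e" using e t by (simp add: e'_def)
      finally show ?thesis by (simp add: G_def p_def abs_minus_commute)
    qed
    then show "\<exists>no. \<forall>n\<ge>no. norm (t / real (Suc n) * (\<Sum>q<Suc n. g (t * real q / real (Suc n))) - integral {0..t} g) < e"
      by blast
  qed
qed

text \<open>Both moments have to be derived, as \<open>gaussian_rv\<close> mentions only the density
  or an almost sure constant. The degenerate case fits the formula: a constant of mean 0 is
  0.\<close>

lemma gaussian_rv_cos:
  assumes "prob_space M" and g: "gaussian_rv M X"
  shows "integrable M X" and "integrable M (\<lambda>\<omega>. (X \<omega>)\<^sup>2)"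
    and "(LINT \<omega>|M. X \<omega>) = 0 \<Longrightarrow> (LINT \<omega>|M. cos (X \<omega> + b)) = exp (- (LINT \<omega>|M. (X \<omega>)\<^sup>2) / 2) * cos b"
proof -
  interpret prob_space M by fact
  have X[measurable]: "X \<in> borel_measurable M" using g by (simp add: gaussian_rv_def)
  consider \<mu> where "AE \<omega> in M. X \<omega> = \<mu>" | \<mu> \<sigma> where "0 < \<sigma>" "distributed M lborel X (normal_density \<mu> \<sigma>)"
    using g by (auto simp: gaussian_rv_def)
  then have "integrable M X \<and> integrable M (\<lambda>\<omega>. (X \<omega>)\<^sup>2) \<and> ((LINT \<omega>|M. X \<omega>) = 0 \<longrightarrow> (LINT \<omega>|M. cos (X \<omega> + b)) = exp (- (LINT \<omega>|M. (X \<omega>)\<^sup>2) / 2) * cos b)"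
  proof cases
    case 1
    have c: "(LINT \<omega>|M. h (X \<omega>)) = h \<mu>" "integrable M (\<lambda>\<omega>. h (X \<omega>))" if [measurable]: "h \<in> borel_measurable borel" for h :: "real \<Rightarrow> real"
    proof -
      have ae: "AE \<omega> in M. h (X \<omega>) = h \<mu>" using 1 by eventually_elim simp
      have "(LINT \<omega>|M. h (X \<omega>)) = (LINT \<omega>|M. h \<mu>)" by (rule integral_cong_AE) (use ae in auto)
      then show "(LINT \<omega>|M. h (X \<omega>)) = h \<mu>" by (simp add: prob_space)
      have "integrable M (\<lambda>\<omega>. h \<mu>)" by simp
      then show "integrable M (\<lambda>\<omega>. h (X \<omega>))"
        by (rule integrable_cong_AE_imp) (use ae in \<open>auto elim: eventually_mono\<close>)
    qed
    show ?thesis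
      using c[of "\<lambda>x. x"] c[of "\<lambda>x. x\<^sup>2"] c[of "\<lambda>x. cos (x + b)"] by auto
  next
    case 2
    let ?N = std_normal_distribution
    define Z where "Z \<omega> = (X \<omega> - \<mu>) / \<sigma>" for \<omega>
    have Z: "distributed M lborel Z std_normal_density"
      using 2 unfolding Z_def by (simp add: normal_standard_normal_convert[symmetric])
    have Zm[measurable]: "Z \<in> borel_measurable M" unfolding Z_def by measurable
    have D: "distr M borel Z = ?N"
      using distributed_distr_eq_density[OF Z] by (simp cong: distr_cong)
    have XZ: "X \<omega> = \<mu> + \<sigma> * Z \<omega>" for \<omega> using 2 by (simp add: Z_def)
    have iN: "integrable ?N (\<lambda>x. x ^ k)" for k by (rule integrable_std_normal_distribution_moment)
    have iZk: "integrable M (\<lambda>\<omega>. Z \<omega> ^ k)" for k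
      using iN[of k] unfolding D[symmetric] by (subst (asm) integrable_distr_eq) auto
    have EZk: "(LINT \<omega>|M. Z \<omega> ^ k) = (LINT x|?N. x ^ k)" for k
      unfolding D[symmetric] by (subst integral_distr) auto
    have iZ: "integrable M Z" using iZk[of 1] by simp
    have iZ2: "integrable M (\<lambda>\<omega>. (Z \<omega>)\<^sup>2)" by (rule iZk)
    have EZ: "(LINT \<omega>|M. Z \<omega>) = 0"
      using EZk[of 1] integral_std_normal_distribution_moment_odd[of 1] by simp
    have EZ2: "(LINT \<omega>|M. (Z \<omega>)\<^sup>2) = 1"
      using EZk[of 2] std_normal_distribution_even_moments(1)[of 1] by (simp add: fact_numeral)
    have iX: "integrable M X" unfolding XZ using iZ by auto
    have iX2: "integrable M (\<lambda>\<omega>. (X \<omega>)\<^sup>2)" unfolding XZ power2_sum using iZ iZ2 by (auto simp: power_mult_distrib mult_ac)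
    have EX: "(LINT \<omega>|M. X \<omega>) = \<mu>" unfolding XZ using iZ EZ by (simp add: prob_space)
    have "(LINT \<omega>|M. cos (X \<omega> + b)) = exp (- (LINT \<omega>|M. (X \<omega>)\<^sup>2) / 2) * cos b" if "(LINT \<omega>|M. X \<omega>) = 0"
    proof -
      have \<mu>: "\<mu> = 0" using that EX by simp
      have V: "(LINT \<omega>|M. (X \<omega>)\<^sup>2) = \<sigma>\<^sup>2" unfolding XZ \<mu> by (simp add: power_mult_distrib EZ2)
      interpret D: prob_space ?N by (rule real_distribution.axioms(1)[OF real_dist_normal_dist])
      have i: "complex_integrable ?N (\<lambda>x. iexp (\<sigma> * x))"
        by (rule D.integrable_const_bound[where B=1]) auto
      have "char ?N \<sigma> = complex_of_real (exp (- \<sigma>\<^sup>2 / 2))" by (simp add: char_std_normal_distribution)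
      then have ch: "(CLINT x|?N. iexp b * iexp (\<sigma> * x)) = iexp b * complex_of_real (exp (- \<sigma>\<^sup>2 / 2))"
        using i unfolding char_def by simp
      have i': "complex_integrable ?N (\<lambda>x. iexp b * iexp (\<sigma> * x))" using i by simp
      have "(LINT \<omega>|M. cos (X \<omega> + b)) = (LINT x|distr M borel Z. cos (\<sigma> * x + b))"
        by (subst integral_distr[OF Zm]) (auto simp: XZ \<mu>)
      also have "\<dots> = (LINT x|?N. Re (iexp b * iexp (\<sigma> * x)))"
        unfolding D cis_conv_exp[symmetric] cis_mult cis.sel by (simp only: add.commute)
      also have "\<dots> = Re (CLINT x|?N. iexp b * iexp (\<sigma> * x))"
        by (rule integral_Re[OF i'])
      also have "\<dots> = exp (- (LINT \<omega>|M. (X \<omega>)\<^sup>2) / 2) * cos b"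
        unfolding ch V by (simp add: Re_exp mult.commute)
      finally show ?thesis .
    qed
    then show ?thesis using iX iX2 by blast
  qed
  then show "integrable M X" and "integrable M (\<lambda>\<omega>. (X \<omega>)\<^sup>2)"
    and "(LINT \<omega>|M. X \<omega>) = 0 \<Longrightarrow> (LINT \<omega>|M. cos (X \<omega> + b)) = exp (- (LINT \<omega>|M. (X \<omega>)\<^sup>2) / 2) * cos b" by auto
qed

lemma abs_mult_le_squares: "\<bar>a * b\<bar> \<le> a\<^sup>2 + b\<^sup>2" for a b :: real
proof -
  have "2 * \<bar>a * b\<bar> \<le> a\<^sup>2 + b\<^sup>2"
    using sum_squares_bound[of "\<bar>a\<bar>" "\<bar>b\<bar>"] by (simp add: abs_mult mult.assoc)
  then show ?thesis using abs_ge_zero[of "a * b"] by linarith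
qed

lemma integrable_mult_of_square:
  fixes f g :: "'a \<Rightarrow> real"
  assumes [measurable]: "f \<in> borel_measurable M" "g \<in> borel_measurable M"
    and "integrable M (\<lambda>x. (f x)\<^sup>2)" "integrable M (\<lambda>x. (g x)\<^sup>2)"
  shows "integrable M (\<lambda>x. f x * g x)"
proof (rule Bochner_Integration.integrable_bound[where f="\<lambda>x. (f x)\<^sup>2 + (g x)\<^sup>2"])
  show "AE x in M. norm (f x * g x) \<le> norm ((f x)\<^sup>2 + (g x)\<^sup>2)"
    using abs_mult_le_squares by simp
qed (use assms in auto)

lemma eval_measurable:
  fixes \<nu> :: "(real \<Rightarrow>\<^sub>C (real^'n)) measure"
  assumes sets: "sets \<nu> = sets (restrict_space borel path_space)"
  shows "(\<lambda>\<omega>. apply_bcontfun \<omega> s) \<in> borel_measurable \<nu>"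
proof -
  have "continuous_on UNIV (\<lambda>\<omega> :: real \<Rightarrow>\<^sub>C (real^'n). apply_bcontfun \<omega> s)"
  proof (rule continuous_onI)
    fix \<omega> :: "real \<Rightarrow>\<^sub>C (real^'n)" and e :: real assume "0 < e"
    then show "\<exists>d>0. \<forall>\<omega>'\<in>UNIV. dist \<omega>' \<omega> < d \<longrightarrow> dist (apply_bcontfun \<omega>' s) (apply_bcontfun \<omega> s) \<le> e"
      by (intro exI[of _ e]) (auto intro: order_trans[OF dist_bounded])
  qed
  then have "(\<lambda>\<omega> :: real \<Rightarrow>\<^sub>C (real^'n). apply_bcontfun \<omega> s) \<in> borel_measurable borel"
    by (rule borel_measurable_continuous_onI)
  then have "(\<lambda>\<omega> :: real \<Rightarrow>\<^sub>C (real^'n). apply_bcontfun \<omega> s) \<in> borel_measurable (restrict_space borel path_space)"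
    by (rule measurable_restrict_space1)
  then show ?thesis by (simp cong: measurable_cong_sets add: sets)
qed

context hurst_parameter
begin

text \<open>Different components are uncorrelated, so the variance splits over j, and each part is a
  squared norm of kernels because their Gram matrix is the covariance. The index set is arbitrary
  since it is used with pairs of a time and a Riemann node.\<close>

lemma fBM_cos:
  fixes B :: "real \<Rightarrow> 'w \<Rightarrow> real^'n" and v :: "'s \<Rightarrow> real^'n"
  assumes "prob_space M" and B: "fractional_BM M H B"
    and S: "finite S" and t: "\<And>s. s \<in> S \<Longrightarrow> t s \<in> {0..1}"
  shows "(LINT \<omega>|M. cos ((\<Sum>s\<in>S. v s \<bullet> B (t s) \<omega>) + b))
    = exp (- (\<Sum>j\<in>UNIV. LINT r|lborel. (\<Sum>s\<in>S. v s $ j * K_kernel H (t s) r)\<^sup>2) / 2) * cos b"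
proof -
  interpret prob_space M by fact
  have Bm[measurable]: "B u \<in> borel_measurable M" if "u \<in> {0..1}" for u
    using B that unfolding fractional_BM_def by blast
  have gauss: "gaussian_rv M (\<lambda>\<omega>. \<Sum>i<m. a i \<bullet> B (u i) \<omega>)" if "\<And>i. i < m \<Longrightarrow> u i \<in> {0..1}" for m and a :: "nat \<Rightarrow> real^'n" and u
    using B that unfolding fractional_BM_def by blast
  have comp: "gaussian_rv M (\<lambda>\<omega>. B u \<omega> $ j)" if "u \<in> {0..1}" for u j
    using gauss[of 1 "\<lambda>_. u" "\<lambda>_. axis j 1"] that by (simp add: inner_axis')
  have compm[measurable]: "(\<lambda>\<omega>. B u \<omega> $ j) \<in> borel_measurable M" if "u \<in> {0..1}" for u j
    using comp[OF that] by (simp add: gaussian_rv_def)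
  note comp_int = gaussian_rv_cos(1)[OF prob_space_axioms comp] and comp_sq = gaussian_rv_cos(2)[OF prob_space_axioms comp]
  have mean: "(LINT \<omega>|M. B u \<omega> $ j) = 0" if u: "u \<in> {0..1}" for u j
  proof -
    \<comment> \<open>The mean is prescribed as a vector integral, which is 0 by default for
      non-integrable functions as well; integrability lets the components inherit it.\<close>
    have "integrable M (B u)"
    proof -
      have "integrable M (\<lambda>\<omega>. \<Sum>j\<in>UNIV. B u \<omega> $ j *\<^sub>R axis j (1::real))"
        using comp_int[OF u] by (intro Bochner_Integration.integrable_sum integrable_scaleR_left) auto
      moreover have "(\<Sum>j\<in>UNIV. B u \<omega> $ j *\<^sub>R axis j (1::real)) = B u \<omega>" for \<omega>
        using basis_expansion[of "B u \<omega>"] by (simp add: scalar_mult_eq_scaleR)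
      ultimately show ?thesis by simp
    qed
    then have "(LINT \<omega>|M. B u \<omega> $ j) = (LINT \<omega>|M. B u \<omega>) $ j"
      by (intro integral_bounded_linear[OF bounded_linear_vec_nth])
    moreover have "(LINT \<omega>|M. B u \<omega>) = 0" using B u unfolding fractional_BM_def by blast
    ultimately show ?thesis by simp
  qed
  have cov0: "(LINT \<omega>|M. B s \<omega> $ i * B u \<omega> $ j) = (if i = j then (s powr (2*H) + u powr (2*H) - \<bar>u - s\<bar> powr (2*H)) / 2 else 0)"
    if "s \<in> {0..1}" "u \<in> {0..1}" for s u i j
    using B that unfolding fractional_BM_def by blast
  define Y where "Y \<omega> = (\<Sum>s\<in>S. v s \<bullet> B (t s) \<omega>)" for \<omega>
  have Y_eq: "Y \<omega> = (\<Sum>s\<in>S. \<Sum>j\<in>UNIV. v s $ j * B (t s) \<omega> $ j)" for \<omega>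
    by (simp add: Y_def inner_vec_def)
  have "gaussian_rv M Y"
  proof -
    \<comment> \<open>The Gaussian hypothesis is stated for initial segments of the naturals, so S
      is enumerated.\<close>
    obtain e where e: "bij_betw e {..<card S} S" using ex_bij_betw_nat_finite[OF S] by (auto simp: atLeast0LessThan)
    have "Y \<omega> = (\<Sum>i<card S. v (e i) \<bullet> B (t (e i)) \<omega>)" for \<omega>
      unfolding Y_def by (rule sum.reindex_bij_betw[OF e, symmetric])
    moreover have "gaussian_rv M (\<lambda>\<omega>. \<Sum>i<card S. v (e i) \<bullet> B (t (e i)) \<omega>)"
      by (rule gauss) (use e t in \<open>auto simp: bij_betw_def\<close>)
    ultimately show ?thesis by presburger
  qed
  note Yg = gaussian_rv_cos[OF prob_space_axioms this]
  have EY: "(LINT \<omega>|M. Y \<omega>) = 0"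
    unfolding Y_eq using comp_int[OF t] mean[OF t]
    by (subst Bochner_Integration.integral_sum) (auto intro!: sum.neutral simp: Bochner_Integration.integral_sum)
  have prod_int: "integrable M (\<lambda>\<omega>. B (t s) \<omega> $ i * B (t s') \<omega> $ j)" if "s \<in> S" "s' \<in> S" for s s' i j
    by (intro integrable_mult_of_square compm comp_sq t that)
  have cov: "(LINT \<omega>|M. B (t s) \<omega> $ i * B (t s') \<omega> $ j) = (if i = j then (LINT r|lborel. K_kernel H (t s) r * K_kernel H (t s') r) else 0)"
    if "s \<in> S" "s' \<in> S" for s s' i j
    using cov0[OF t[OF that(1)] t[OF that(2)], of i j] integral_K_K[of "t s" "t s'"] t[OF that(1)] t[OF that(2)]
    by (simp add: add.commute abs_minus_commute)
  have Y2: "(Y \<omega>)\<^sup>2 = (\<Sum>s\<in>S. \<Sum>s'\<in>S. \<Sum>i\<in>UNIV. \<Sum>j\<in>UNIV. v s $ i * v s' $ j * (B (t s) \<omega> $ i * B (t s') \<omega> $ j))" for \<omega>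
  proof -
    have "v s $ i * B (t s) \<omega> $ i * (v s' $ j * B (t s') \<omega> $ j) = v s $ i * v s' $ j * (B (t s) \<omega> $ i * B (t s') \<omega> $ j)" for s s' i j
      by (simp only: mult_ac)
    then show ?thesis unfolding Y_eq power2_eq_square sum_product by (simp only:)
  qed
  have "(LINT \<omega>|M. (Y \<omega>)\<^sup>2) = (\<Sum>s\<in>S. \<Sum>s'\<in>S. \<Sum>i\<in>UNIV. \<Sum>j\<in>UNIV. v s $ i * v s' $ j * (LINT \<omega>|M. B (t s) \<omega> $ i * B (t s') \<omega> $ j))"
  proof -
    have "(LINT \<omega>|M. (\<Sum>s\<in>S. \<Sum>s'\<in>S. \<Sum>i\<in>UNIV. \<Sum>j\<in>UNIV. v s $ i * v s' $ j * (B (t s) \<omega> $ i * B (t s') \<omega> $ j)))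
      = (\<Sum>s\<in>S. LINT \<omega>|M. (\<Sum>s'\<in>S. \<Sum>i\<in>UNIV. \<Sum>j\<in>UNIV. v s $ i * v s' $ j * (B (t s) \<omega> $ i * B (t s') \<omega> $ j)))"
      by (rule Bochner_Integration.integral_sum) (intro Bochner_Integration.integrable_sum integrable_mult_right prod_int)
    also have "\<dots> = (\<Sum>s\<in>S. \<Sum>s'\<in>S. LINT \<omega>|M. (\<Sum>i\<in>UNIV. \<Sum>j\<in>UNIV. v s $ i * v s' $ j * (B (t s) \<omega> $ i * B (t s') \<omega> $ j)))"
      by (rule sum.cong[OF refl], rule Bochner_Integration.integral_sum) (intro Bochner_Integration.integrable_sum integrable_mult_right prod_int)
    also have "\<dots> = (\<Sum>s\<in>S. \<Sum>s'\<in>S. \<Sum>i\<in>UNIV. LINT \<omega>|M. (\<Sum>j\<in>UNIV. v s $ i * v s' $ j * (B (t s) \<omega> $ i * B (t s') \<omega> $ j)))"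
      by (rule sum.cong[OF refl], rule sum.cong[OF refl], rule Bochner_Integration.integral_sum) (intro Bochner_Integration.integrable_sum integrable_mult_right prod_int)
    also have "\<dots> = (\<Sum>s\<in>S. \<Sum>s'\<in>S. \<Sum>i\<in>UNIV. \<Sum>j\<in>UNIV. LINT \<omega>|M. v s $ i * v s' $ j * (B (t s) \<omega> $ i * B (t s') \<omega> $ j))"
      by (rule sum.cong[OF refl], rule sum.cong[OF refl], rule sum.cong[OF refl], rule Bochner_Integration.integral_sum) (intro integrable_mult_right prod_int)
    finally show ?thesis unfolding Y2 by (simp only: integral_mult_right_zero)
  qed
  also have "\<dots> = (\<Sum>s\<in>S. \<Sum>s'\<in>S. \<Sum>i\<in>UNIV. v s $ i * v s' $ i * (LINT r|lborel. K_kernel H (t s) r * K_kernel H (t s') r))"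
    by (intro sum.cong refl) (simp add: cov if_distrib[of "\<lambda>x. _ * x"] sum.delta' cong: if_cong)
  also have "\<dots> = (\<Sum>s\<in>S. \<Sum>i\<in>UNIV. \<Sum>s'\<in>S. v s $ i * v s' $ i * (LINT r|lborel. K_kernel H (t s) r * K_kernel H (t s') r))"
    by (intro sum.cong refl) (rule sum.swap)
  also have "\<dots> = (\<Sum>i\<in>UNIV. \<Sum>s\<in>S. \<Sum>s'\<in>S. v s $ i * v s' $ i * (LINT r|lborel. K_kernel H (t s) r * K_kernel H (t s') r))"
    by (rule sum.swap)
  also have "\<dots> = (\<Sum>i\<in>UNIV. LINT r|lborel. (\<Sum>s\<in>S. v s $ i * K_kernel H (t s) r)\<^sup>2)"
  proof (intro sum.cong refl)
    fix i :: 'n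
    have eq: "(\<Sum>s\<in>S. v s $ i * K_kernel H (t s) r)\<^sup>2 = (\<Sum>s\<in>S. \<Sum>s'\<in>S. v s $ i * v s' $ i * (K_kernel H (t s) r * K_kernel H (t s') r))" for r
      unfolding power2_eq_square sum_product by (simp add: mult_ac)
    show "(\<Sum>s\<in>S. \<Sum>s'\<in>S. v s $ i * v s' $ i * (LINT r|lborel. K_kernel H (t s) r * K_kernel H (t s') r)) = (LINT r|lborel. (\<Sum>s\<in>S. v s $ i * K_kernel H (t s) r)\<^sup>2)"
    proof -
      have i: "integrable lborel (\<lambda>r. v s $ i * v s' $ i * (K_kernel H (t s) r * K_kernel H (t s') r))" if "s \<in> S" "s' \<in> S" for s s'
        using K_sq_integrable[of "t s" "t s'"] t[OF that(1)] t[OF that(2)] by (intro integrable_mult_right) auto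
      have "(LINT r|lborel. (\<Sum>s\<in>S. \<Sum>s'\<in>S. v s $ i * v s' $ i * (K_kernel H (t s) r * K_kernel H (t s') r)))
        = (\<Sum>s\<in>S. LINT r|lborel. (\<Sum>s'\<in>S. v s $ i * v s' $ i * (K_kernel H (t s) r * K_kernel H (t s') r)))"
        by (rule Bochner_Integration.integral_sum) (intro Bochner_Integration.integrable_sum i)
      also have "\<dots> = (\<Sum>s\<in>S. \<Sum>s'\<in>S. LINT r|lborel. v s $ i * v s' $ i * (K_kernel H (t s) r * K_kernel H (t s') r))"
        by (rule sum.cong[OF refl], rule Bochner_Integration.integral_sum) (rule i)
      finally show ?thesis unfolding eq by (simp only: integral_mult_right_zero)
    qed
  qed
  finally show ?thesis using Yg(3)[OF EY, of b] by (simp add: Y_def)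
qed

text \<open>Formally \<open>\<omega>\<^sub>t = \<integral> OU_kernel \<alpha> t r dW\<^sub>r\<close> for a Brownian motion \<open>W\<close> with \<open>B\<^sup>H\<^sub>t = \<integral> K(t, r) dW\<^sub>r\<close>.\<close>

definition OU_kernel :: "real \<Rightarrow> real \<Rightarrow> real \<Rightarrow> real" where
  "OU_kernel \<alpha> t r = K_kernel H t r - \<alpha> * K_avg \<alpha> t r"

lemma OU_kernel_measurable[measurable]: "OU_kernel \<alpha> t \<in> borel_measurable borel"
  unfolding OU_kernel_def by measurable

lemma K_avg_eq_integral:
  assumes "0 \<le> \<alpha>" "0 \<le> t" "t \<le> 1"
  shows "K_avg \<alpha> t r = integral {0..t} (\<lambda>s. exp (- \<alpha> * (t - s)) * K_kernel H s r)"
  using set_borel_integral_eq_integral(2)[of "{0..t}" "\<lambda>s. exp (- \<alpha> * (t - s)) * K_kernel H s r"] K_avg_bounds(1)[OF assms, of r]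
  by (simp add: set_integrable_def set_lebesgue_integral_def K_avg_def)

text \<open>Variation of constants: W = \<integral> y satisfies W' = z - \<alpha> W, hence
  (exp(\<alpha> s) W)' = exp(\<alpha> s) z. Only z and its integral occur, so no differentiability
  of the noise is involved.\<close>

lemma OU_path_integral:
  fixes y :: "real \<Rightarrow> real"
  assumes t: "0 \<le> t" and y: "continuous_on {0..t} y"
    and z: "\<And>s. s \<in> {0..t} \<Longrightarrow> z s = y s + \<alpha> * integral {0..s} y"
  shows "continuous_on {0..t} z" and "y t = z t - \<alpha> * integral {0..t} (\<lambda>s. exp (- \<alpha> * (t - s)) * z s)"
proof -
  define W where "W s = integral {0..s} y" for s
  have W_deriv: "(W has_real_derivative y s) (at s within {0..t})" if "s \<in> {0..t}" for s
    unfolding W_def has_real_derivative_iff_has_vector_derivative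
    by (rule integral_has_vector_derivative[OF y that])
  have W_cont: "continuous_on {0..t} W" by (rule DERIV_continuous_on) (erule W_deriv)
  have "continuous_on {0..t} (\<lambda>s. y s + \<alpha> * W s)" by (intro continuous_intros y W_cont)
  then show "continuous_on {0..t} z"
    by (rule continuous_on_cong[THEN iffD1, rotated -1]) (auto simp: z W_def)
  have "((\<lambda>s. exp (\<alpha> * s) * z s) has_integral (exp (\<alpha> * t) * W t - exp (\<alpha> * 0) * W 0)) {0..t}"
  proof (rule fundamental_theorem_of_calculus[OF t])
    fix s assume s: "s \<in> {0..t}"
    have "((\<lambda>s. exp (\<alpha> * s) * W s) has_real_derivative (\<alpha> * exp (\<alpha> * s)) * W s + y s * exp (\<alpha> * s)) (at s within {0..t})"
      by (intro DERIV_mult W_deriv[OF s]) (auto intro!: derivative_eq_intros)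
    moreover have "(\<alpha> * exp (\<alpha> * s)) * W s + y s * exp (\<alpha> * s) = exp (\<alpha> * s) * z s"
      using z[OF s] by (simp add: W_def algebra_simps)
    ultimately show "((\<lambda>s. exp (\<alpha> * s) * W s) has_vector_derivative exp (\<alpha> * s) * z s) (at s within {0..t})"
      by (simp add: has_real_derivative_iff_has_vector_derivative)
  qed
  then have "((\<lambda>s. exp (\<alpha> * s) * z s) has_integral (exp (\<alpha> * t) * W t)) {0..t}" by (simp add: W_def)
  from has_integral_mult_right[OF this, of "exp (- \<alpha> * t)"]
  have "((\<lambda>s. exp (- \<alpha> * t) * (exp (\<alpha> * s) * z s)) has_integral W t) {0..t}"
    by (simp add: mult.assoc[symmetric] mult_exp_exp)
  moreover have e: "(\<lambda>s. exp (- \<alpha> * t) * (exp (\<alpha> * s) * z s)) = (\<lambda>s. exp (- \<alpha> * (t - s)) * z s)"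
  proof
    fix s
    have "- \<alpha> * (t - s) = - \<alpha> * t + \<alpha> * s" by (simp add: algebra_simps)
    then show "exp (- \<alpha> * t) * (exp (\<alpha> * s) * z s) = exp (- \<alpha> * (t - s)) * z s" by (simp only: exp_add mult.assoc)
  qed
  ultimately have "integral {0..t} (\<lambda>s. exp (- \<alpha> * (t - s)) * z s) = W t"
    unfolding e by (intro integral_unique)
  then show "y t = z t - \<alpha> * integral {0..t} (\<lambda>s. exp (- \<alpha> * (t - s)) * z s)"
    using z[of t] t by (simp add: W_def)
qed

text \<open>The same nodes and weights approximate the path, for fixed \<omega>, and the kernel, for
  fixed r; both limits are the variation of constants formula. Before the limit the two sides are
  linked by \<open>fBM_cos\<close>.\<close>

lemma OU_cos:
  fixes \<nu> :: "(real \<Rightarrow>\<^sub>C (real^'n)) measure" and v :: "nat \<Rightarrow> real^'n"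
  assumes \<alpha>: "0 \<le> \<alpha>" and OU: "fractional_OU_measure \<alpha> H \<nu>" and t: "\<And>i. i < m \<Longrightarrow> t i \<in> {0..1}"
  shows "(LINT \<omega>|\<nu>. cos ((\<Sum>i<m. v i \<bullet> apply_bcontfun \<omega> (t i)) + b))
    = exp (- (\<Sum>j\<in>UNIV. LINT r|lborel. (\<Sum>i<m. v i $ j * OU_kernel \<alpha> (t i) r)\<^sup>2) / 2) * cos b"
proof -
  from OU obtain B where "prob_space \<nu>" and sets: "sets \<nu> = sets (restrict_space borel path_space)"
    and B: "fractional_BM \<nu> H B"
    and eq: "AE \<omega> in \<nu>. \<forall>t\<in>{0..1}. apply_bcontfun \<omega> t = - \<alpha> *\<^sub>R (LINT s:{0..t}|lebesgue. apply_bcontfun \<omega> s) + B t \<omega>"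
    by (auto simp: fractional_OU_measure_def)
  interpret prob_space \<nu> by fact
  \<comment> \<open>Index \<open>Suc N\<close> stands for the value at t_i itself, with weight 1;
    the smaller indices are the left end points of the Riemann sum for the exponential
    average.\<close>
  define c where "c N i q = (if q = Suc N then 1 else - \<alpha> * (t i / real (Suc N)) * exp (- \<alpha> * (t i - t i * real q / real (Suc N))))" for N i q
  define \<tau> where "\<tau> N i q = (if q = Suc N then t i else t i * real q / real (Suc N))" for N i q
  have \<tau>: "\<tau> N i q \<in> {0..1}" if "i < m" "q \<le> Suc N" for N i q
  proof -
    have "t i * (real q / real (Suc N)) \<le> 1 * 1" using t[OF \<open>i < m\<close>] that by (intro mult_mono) auto
    then show ?thesis using t[OF \<open>i < m\<close>] by (auto simp: \<tau>_def)
  qed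
  have riemann: "(\<lambda>N. \<Sum>q\<le>Suc N. c N i q * g (\<tau> N i q)) \<longlonglongrightarrow> g (t i) - \<alpha> * integral {0..t i} (\<lambda>s. exp (- \<alpha> * (t i - s)) * g s)"
    if i: "i < m" and g: "continuous_on {0..t i} g" for i and g :: "real \<Rightarrow> real"
  proof -
    have ti: "0 \<le> t i" using t[OF i] by simp
    have e: "(\<Sum>q\<le>Suc N. c N i q * g (\<tau> N i q)) = g (t i) - \<alpha> * (t i / real (Suc N) * (\<Sum>q<Suc N. exp (- \<alpha> * (t i - t i * real q / real (Suc N))) * g (t i * real q / real (Suc N))))" for N
    proof -
      have "(\<Sum>q\<le>Suc N. c N i q * g (\<tau> N i q)) = (\<Sum>q<Suc N. c N i q * g (\<tau> N i q)) + g (t i)"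
        unfolding lessThan_Suc_atMost[symmetric] by (subst sum.lessThan_Suc) (simp add: c_def \<tau>_def)
      also have "(\<Sum>q<Suc N. c N i q * g (\<tau> N i q)) = (\<Sum>q<Suc N. - \<alpha> * (t i / real (Suc N)) * (exp (- \<alpha> * (t i - t i * real q / real (Suc N))) * g (t i * real q / real (Suc N))))"
        by (intro sum.cong) (auto simp: c_def \<tau>_def)
      also have "\<dots> = - \<alpha> * (t i / real (Suc N)) * (\<Sum>q<Suc N. exp (- \<alpha> * (t i - t i * real q / real (Suc N))) * g (t i * real q / real (Suc N)))"
        by (rule sum_distrib_left[symmetric])
      finally show ?thesis by (simp add: mult.assoc)
    qed
    have r: "(\<lambda>N. t i / real (Suc N) * (\<Sum>q<Suc N. exp (- \<alpha> * (t i - t i * real q / real (Suc N))) * g (t i * real q / real (Suc N)))) \<longlonglongrightarrow> integral {0..t i} (\<lambda>s. exp (- \<alpha> * (t i - s)) * g s)"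
      by (rule riemann_sum_tendsto[OF ti, of "\<lambda>s. exp (- \<alpha> * (t i - s)) * g s"]) (intro continuous_intros g)
    show ?thesis unfolding e by (rule tendsto_diff[OF tendsto_const tendsto_mult[OF tendsto_const r]])
  qed
  define Y where "Y N \<omega> = (\<Sum>(i, q)\<in>{..<m} \<times> {..Suc N}. (c N i q *\<^sub>R v i) \<bullet> B (\<tau> N i q) \<omega>)" for N \<omega>
  define k where "k N j r = (\<Sum>(i, q)\<in>{..<m} \<times> {..Suc N}. (c N i q *\<^sub>R v i) $ j * K_kernel H (\<tau> N i q) r)" for N j r
  have Y_eq: "Y N \<omega> = (\<Sum>i<m. \<Sum>q\<le>Suc N. c N i q * (v i \<bullet> B (\<tau> N i q) \<omega>))" for N \<omega>
    unfolding Y_def by (subst sum.cartesian_product[symmetric]) (simp del: sum.atMost_Suc)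
  have k_eq: "k N j r = (\<Sum>i<m. v i $ j * (\<Sum>q\<le>Suc N. c N i q * K_kernel H (\<tau> N i q) r))" for N j r
    unfolding k_def by (subst sum.cartesian_product[symmetric]) (simp add: sum_distrib_left mult_ac del: sum.atMost_Suc)
  have cosY: "(LINT \<omega>|\<nu>. cos (Y N \<omega> + b)) = exp (- (\<Sum>j\<in>UNIV. LINT r|lborel. (k N j r)\<^sup>2) / 2) * cos b" for N
    unfolding Y_def k_def case_prod_unfold
    by (rule fBM_cos[OF prob_space_axioms B, of "{..<m} \<times> {..Suc N}" "\<lambda>p. \<tau> N (fst p) (snd p)" "\<lambda>p. c N (fst p) (snd p) *\<^sub>R v (fst p)" b])
      (use \<tau> in \<open>auto simp del: atMost_Suc\<close>)
  have k_lim: "(\<lambda>N. k N j r) \<longlonglongrightarrow> (\<Sum>i<m. v i $ j * OU_kernel \<alpha> (t i) r)" for j r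
    unfolding k_eq
  proof (intro tendsto_sum tendsto_mult tendsto_const)
    fix i assume "i \<in> {..<m}"
    then have i: "i < m" by simp
    have "continuous_on {0..t i} (\<lambda>s. K_kernel H s r)"
      by (rule continuous_on_subset[OF K_continuous]) (use t[OF i] in auto)
    from riemann[OF i this] show "(\<lambda>N. \<Sum>q\<le>Suc N. c N i q * K_kernel H (\<tau> N i q) r) \<longlonglongrightarrow> OU_kernel \<alpha> (t i) r"
      using t[OF i] by (simp add: OU_kernel_def K_avg_eq_integral[OF \<alpha>] del: sum.atMost_Suc)
  qed
  \<comment> \<open>The weights have uniformly bounded total size, which makes a multiple of
    \<open>K_dom\<close> a majorant for all N.\<close>
  have c_sum: "(\<Sum>q\<le>Suc N. \<bar>c N i q\<bar>) \<le> 1 + \<alpha>" if i: "i < m" for N i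
  proof -
    have "(\<Sum>q\<le>Suc N. \<bar>c N i q\<bar>) = (\<Sum>q<Suc N. \<bar>c N i q\<bar>) + 1"
      unfolding lessThan_Suc_atMost[symmetric] by (subst sum.lessThan_Suc) (simp add: c_def)
    also have "(\<Sum>q<Suc N. \<bar>c N i q\<bar>) \<le> (\<Sum>q<Suc N. \<alpha> / real (Suc N))"
    proof (rule sum_mono)
      fix q assume q: "q \<in> {..<Suc N}"
      have ti: "0 \<le> t i" "t i \<le> 1" using t[OF i] by auto
      have "t i * real q / real (Suc N) \<le> t i"
        using q ti by (simp add: divide_le_eq mult_left_mono)
      then have "exp (- \<alpha> * (t i - t i * real q / real (Suc N))) \<le> 1" using \<alpha> by simp
      then have "\<alpha> * (t i / real (Suc N)) * exp (- \<alpha> * (t i - t i * real q / real (Suc N))) \<le> \<alpha> * (1 / real (Suc N)) * 1"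
        using \<alpha> ti by (intro mult_mono divide_right_mono) auto
      moreover have "\<bar>c N i q\<bar> = \<alpha> * (t i / real (Suc N)) * exp (- \<alpha> * (t i - t i * real q / real (Suc N)))"
        using q \<alpha> ti by (simp add: c_def abs_mult)
      ultimately show "\<bar>c N i q\<bar> \<le> \<alpha> / real (Suc N)" by simp
    qed
    also have "(\<Sum>q<Suc N. \<alpha> / real (Suc N)) = \<alpha>" by simp
    finally show ?thesis by simp
  qed
  have k_bound: "\<bar>k N j r\<bar> \<le> (\<Sum>i<m. \<bar>v i $ j\<bar>) * (1 + \<alpha>) * K_dom r" for N j r
  proof -
    have "\<bar>k N j r\<bar> \<le> (\<Sum>i<m. \<bar>v i $ j\<bar> * ((1 + \<alpha>) * K_dom r))"
      unfolding k_eq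
    proof (rule order_trans[OF sum_abs], rule sum_mono)
      fix i assume "i \<in> {..<m}"
      then have i: "i < m" by simp
      have "\<bar>\<Sum>q\<le>Suc N. c N i q * K_kernel H (\<tau> N i q) r\<bar> \<le> (\<Sum>q\<le>Suc N. \<bar>c N i q\<bar> * K_dom r)"
      proof (rule order_trans[OF sum_abs], rule sum_mono)
        fix q assume "q \<in> {..Suc N}"
        then have "K_kernel H (\<tau> N i q) r \<le> K_dom r" using \<tau>[OF i, of q N] by (intro K_le_K_dom) auto
        then show "\<bar>c N i q * K_kernel H (\<tau> N i q) r\<bar> \<le> \<bar>c N i q\<bar> * K_dom r"
          using K_nonneg by (simp add: abs_mult abs_of_nonneg mult_left_mono)
      qed
      also have "\<dots> = (\<Sum>q\<le>Suc N. \<bar>c N i q\<bar>) * K_dom r" by (rule sum_distrib_right[symmetric])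
      also have "\<dots> \<le> (1 + \<alpha>) * K_dom r" using c_sum[OF i] K_dom_nonneg by (intro mult_right_mono) auto
      finally show "\<bar>v i $ j * (\<Sum>q\<le>Suc N. c N i q * K_kernel H (\<tau> N i q) r)\<bar> \<le> \<bar>v i $ j\<bar> * ((1 + \<alpha>) * K_dom r)"
        by (simp add: abs_mult mult_left_mono del: sum.atMost_Suc)
    qed
    then show ?thesis by (simp add: sum_distrib_right mult.assoc)
  qed
  have k_meas: "k N j \<in> borel_measurable borel" for N j
    unfolding k_def by (auto intro!: borel_measurable_sum simp: split_beta)
  have V_lim: "(\<lambda>N. LINT r|lborel. (k N j r)\<^sup>2) \<longlonglongrightarrow> (LINT r|lborel. (\<Sum>i<m. v i $ j * OU_kernel \<alpha> (t i) r)\<^sup>2)" for j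
  proof (rule integral_dominated_convergence[where w="\<lambda>r. ((\<Sum>i<m. \<bar>v i $ j\<bar>) * (1 + \<alpha>))\<^sup>2 * (K_dom r)\<^sup>2"])
    show "AE r in lborel. (\<lambda>N. (k N j r)\<^sup>2) \<longlonglongrightarrow> (\<Sum>i<m. v i $ j * OU_kernel \<alpha> (t i) r)\<^sup>2"
      using k_lim by (auto intro!: tendsto_power)
    show "AE r in lborel. norm ((k N j r)\<^sup>2) \<le> ((\<Sum>i<m. \<bar>v i $ j\<bar>) * (1 + \<alpha>))\<^sup>2 * (K_dom r)\<^sup>2" for N
    proof (rule AE_I2)
      fix r
      have "\<bar>k N j r\<bar>\<^sup>2 \<le> ((\<Sum>i<m. \<bar>v i $ j\<bar>) * (1 + \<alpha>) * K_dom r)\<^sup>2"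
        by (rule power_mono[OF k_bound]) simp
      then show "norm ((k N j r)\<^sup>2) \<le> ((\<Sum>i<m. \<bar>v i $ j\<bar>) * (1 + \<alpha>))\<^sup>2 * (K_dom r)\<^sup>2" by (simp add: power_mult_distrib)
    qed
    have k'[measurable]: "k N j \<in> borel_measurable borel" for N j by (rule k_meas)
    have l: "(\<lambda>r. \<Sum>i<m. v i $ j * OU_kernel \<alpha> (t i) r) \<in> borel_measurable borel"
      by (rule borel_measurable_LIMSEQ_real[OF k_lim]) simp
    show "(\<lambda>r. (k N j r)\<^sup>2) \<in> borel_measurable lborel" for N by measurable
    show "(\<lambda>r. (\<Sum>i<m. v i $ j * OU_kernel \<alpha> (t i) r)\<^sup>2) \<in> borel_measurable lborel" using borel_measurable_power[OF l, of 2] by simp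
    show "integrable lborel (\<lambda>r. ((\<Sum>i<m. \<bar>v i $ j\<bar>) * (1 + \<alpha>))\<^sup>2 * (K_dom r)\<^sup>2)" using K_dom_sq_integrable by (rule integrable_mult_right)
  qed
  have eval: "(\<lambda>\<omega>. apply_bcontfun \<omega> s) \<in> borel_measurable \<nu>" for s
    by (rule eval_measurable[OF sets])
  have Y_lim: "AE \<omega> in \<nu>. (\<lambda>N. Y N \<omega>) \<longlonglongrightarrow> (\<Sum>i<m. v i \<bullet> apply_bcontfun \<omega> (t i))"
    using eq
  proof eventually_elim
    fix \<omega> assume eq: "\<forall>t\<in>{0..1}. apply_bcontfun \<omega> t = - \<alpha> *\<^sub>R (LINT s:{0..t}|lebesgue. apply_bcontfun \<omega> s) + B t \<omega>"
    show "(\<lambda>N. Y N \<omega>) \<longlonglongrightarrow> (\<Sum>i<m. v i \<bullet> apply_bcontfun \<omega> (t i))"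
      unfolding Y_eq
    proof (rule tendsto_sum)
      fix i assume "i \<in> {..<m}"
      then have i: "i < m" by simp
      have ti: "0 \<le> t i" "t i \<le> 1" using t[OF i] by auto
      let ?y = "\<lambda>s. v i \<bullet> apply_bcontfun \<omega> s"
      have wc: "continuous_on S (apply_bcontfun \<omega>)" for S
        by (rule continuous_on_apply_bcontfun)
      have bs: "v i \<bullet> B s \<omega> = ?y s + \<alpha> * integral {0..s} ?y" if s: "s \<in> {0..t i}" for s
      proof -
        have ai: "apply_bcontfun \<omega> absolutely_integrable_on {0..s}"
          by (rule absolutely_integrable_continuous_real[OF wc])
        have "(LINT u:{0..s}|lebesgue. apply_bcontfun \<omega> u) = integral {0..s} (apply_bcontfun \<omega>)"
          by (rule set_lebesgue_integral_eq_integral(2)[OF ai])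
        moreover have "integral {0..s} ?y = v i \<bullet> integral {0..s} (apply_bcontfun \<omega>)"
          using integral_linear[OF integrable_continuous_real[OF wc] bounded_linear_inner_right[of "v i"], of 0 s]
          by (simp add: o_def)
        moreover have "B s \<omega> = apply_bcontfun \<omega> s + \<alpha> *\<^sub>R (LINT u:{0..s}|lebesgue. apply_bcontfun \<omega> u)"
        proof -
          have "s \<in> {0..1}" using s ti by auto
          from bspec[OF eq this] show ?thesis by simp
        qed
        ultimately show ?thesis by (simp add: inner_add_right)
      qed
      have yc: "continuous_on {0..t i} ?y" by (intro continuous_intros wc)
      have z1: "continuous_on {0..t i} (\<lambda>s. v i \<bullet> B s \<omega>)"
        by (rule OU_path_integral(1)[OF ti(1) yc]) (rule bs)
      have z2: "?y (t i) = v i \<bullet> B (t i) \<omega> - \<alpha> * integral {0..t i} (\<lambda>s. exp (- \<alpha> * (t i - s)) * (v i \<bullet> B s \<omega>))"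
        by (rule OU_path_integral(2)[OF ti(1) yc]) (rule bs)
      show "(\<lambda>N. \<Sum>q\<le>Suc N. c N i q * (v i \<bullet> B (\<tau> N i q) \<omega>)) \<longlonglongrightarrow> v i \<bullet> apply_bcontfun \<omega> (t i)"
        using riemann[OF i z1] unfolding z2 .
    qed
  qed
  have Y_meas: "Y N \<in> borel_measurable \<nu>" for N
  proof -
    have "B u \<in> borel_measurable \<nu>" if "u \<in> {0..1}" for u
      using B that unfolding fractional_BM_def by blast
    then have "(\<lambda>\<omega>. (c N i q *\<^sub>R v i) \<bullet> B (\<tau> N i q) \<omega>) \<in> borel_measurable \<nu>" if "i < m" "q \<le> Suc N" for i q
      using \<tau>[OF that] by (intro borel_measurable_inner borel_measurable_const) auto
    then show ?thesis unfolding Y_def case_prod_unfold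
      by (intro borel_measurable_sum) (simp add: mem_Times_iff del: atMost_Suc)
  qed
  have "(\<lambda>N. LINT \<omega>|\<nu>. cos (Y N \<omega> + b)) \<longlonglongrightarrow> (LINT \<omega>|\<nu>. cos ((\<Sum>i<m. v i \<bullet> apply_bcontfun \<omega> (t i)) + b))"
  proof (rule integral_dominated_convergence[where w="\<lambda>_. 1"])
    show "AE \<omega> in \<nu>. (\<lambda>N. cos (Y N \<omega> + b)) \<longlonglongrightarrow> cos ((\<Sum>i<m. v i \<bullet> apply_bcontfun \<omega> (t i)) + b)"
      using Y_lim by eventually_elim (intro tendsto_intros)
    have Y_meas'[measurable]: "Y N \<in> borel_measurable \<nu>" for N by (rule Y_meas)
    have eval'[measurable]: "(\<lambda>\<omega>. apply_bcontfun \<omega> s) \<in> borel_measurable \<nu>" for s by (rule eval)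
    show "(\<lambda>\<omega>. cos (Y N \<omega> + b)) \<in> borel_measurable \<nu>" for N by measurable
    show "(\<lambda>\<omega>. cos ((\<Sum>i<m. v i \<bullet> apply_bcontfun \<omega> (t i)) + b)) \<in> borel_measurable \<nu>" by measurable
    show "integrable \<nu> (\<lambda>_. 1::real)" by simp
  qed auto
  moreover have "(\<lambda>N. LINT \<omega>|\<nu>. cos (Y N \<omega> + b)) \<longlonglongrightarrow> exp (- (\<Sum>j\<in>UNIV. LINT r|lborel. (\<Sum>i<m. v i $ j * OU_kernel \<alpha> (t i) r)\<^sup>2) / 2) * cos b"
    unfolding cosY by (intro tendsto_intros V_lim) simp
  ultimately show ?thesis by (rule LIMSEQ_unique)
qed

end

section \<open>Smooth functions of Gaussian vectors\<close>

text \<open>Sequences carry only the product topology here, so there is no norm and no total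
  derivative to appeal to. The increment is assembled one scalar coordinate at a time, each step by
  the mean value theorem and continuity of the partial derivative.\<close>

lemma directional_derivative:
  fixes f :: "(nat \<Rightarrow> real^'n) \<Rightarrow> real" and \<delta>f :: "nat \<Rightarrow> 'n \<Rightarrow> (nat \<Rightarrow> real^'n) \<Rightarrow> real" and x y :: "nat \<Rightarrow> real^'n"
  assumes deriv: "\<And>i j x. i < m \<Longrightarrow> ((\<lambda>r. f (x(i := x i + r *\<^sub>R axis j 1))) has_real_derivative \<delta>f i j x) (at 0)"
    and cont: "\<And>i j. i < m \<Longrightarrow> continuous_on UNIV (\<delta>f i j)"
    and local: "\<And>x y. (\<And>i. i < m \<Longrightarrow> x i = y i) \<Longrightarrow> f x = f y"
  shows "((\<lambda>\<epsilon>. f (\<lambda>i. x i + \<epsilon> *\<^sub>R y i)) has_real_derivative (\<Sum>i<m. \<Sum>j\<in>UNIV. \<delta>f i j x * y i $ j)) (at 0)"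
proof -
  have deriv': "((\<lambda>r. f (u(i := u i + r *\<^sub>R axis j 1))) has_real_derivative \<delta>f i j (u(i := u i + r *\<^sub>R axis j 1))) (at r)"
    if "i < m" for i j u r
  proof -
    let ?u = "u(i := u i + r *\<^sub>R axis j 1)"
    have "((\<lambda>s. f (?u(i := ?u i + s *\<^sub>R axis j 1))) has_real_derivative \<delta>f i j ?u) (at 0)"
      by (rule deriv[OF that])
    moreover have "?u(i := ?u i + s *\<^sub>R axis j 1) = u(i := u i + (s + r) *\<^sub>R axis j 1)" for s
      by (simp add: algebra_simps)
    ultimately have "((\<lambda>s. f (u(i := u i + (s + r) *\<^sub>R axis j 1))) has_real_derivative \<delta>f i j ?u) (at 0)" by simp
    then show ?thesis using DERIV_shift[of "\<lambda>r. f (u(i := u i + r *\<^sub>R axis j 1))" "\<delta>f i j ?u" 0 r] by simp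
  qed
  \<comment> \<open>The direction y with every scalar coordinate outside S set to 0.\<close>
  define yS where "yS S i = (\<Sum>j\<in>UNIV. if (i, j) \<in> S then y i $ j *\<^sub>R axis j (1::real) else 0)" for S :: "(nat \<times> 'n) set" and i
  have "((\<lambda>\<epsilon>. f (\<lambda>i. x i + \<epsilon> *\<^sub>R yS S i)) has_real_derivative (\<Sum>(i, j)\<in>S. \<delta>f i j x * y i $ j)) (at 0)"
    if "finite S" "S \<subseteq> {..<m} \<times> UNIV" for S
    using that
  proof (induction S rule: finite_induct)
    case empty
    show ?case by (simp add: yS_def)
  next
    case (insert p S)
    obtain i0 j0 where p: "p = (i0, j0)" by (cases p)
    have i0: "i0 < m" using insert.prems p by auto
    have yS_ins: "yS (insert p S) = (yS S)(i0 := yS S i0 + y i0 $ j0 *\<^sub>R axis j0 1)"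
    proof
      fix i
      show "yS (insert p S) i = ((yS S)(i0 := yS S i0 + y i0 $ j0 *\<^sub>R axis j0 1)) i"
      proof (cases "i = i0")
        case True
        have "yS (insert p S) i0 = (\<Sum>j\<in>UNIV. (if (i0, j) \<in> S then y i0 $ j *\<^sub>R axis j (1::real) else 0) + (if j = j0 then y i0 $ j *\<^sub>R axis j 1 else 0))"
          unfolding yS_def using insert.hyps(2) p by (intro sum.cong) auto
        also have "\<dots> = yS S i0 + y i0 $ j0 *\<^sub>R axis j0 1"
          by (simp add: sum.distrib yS_def)
        finally show ?thesis using True by simp
      next
        case False
        then show ?thesis using p by (simp add: yS_def)
      qed
    qed
    define u where "u \<epsilon> i = x i + \<epsilon> *\<^sub>R yS S i" for \<epsilon> i
    have path: "(\<lambda>i. x i + \<epsilon> *\<^sub>R yS (insert p S) i) = (u \<epsilon>)(i0 := u \<epsilon> i0 + (\<epsilon> * y i0 $ j0) *\<^sub>R axis j0 1)" for \<epsilon>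
      by (auto simp: yS_ins u_def fun_eq_iff algebra_simps)
    \<comment> \<open>Mean value theorem in the new coordinate, starting from the point already
      moved along S; the three cases are the signs of the step.\<close>
    have "\<exists>\<xi>. \<bar>\<xi>\<bar> \<le> \<bar>\<epsilon> * y i0 $ j0\<bar> \<and> f ((u \<epsilon>)(i0 := u \<epsilon> i0 + (\<epsilon> * y i0 $ j0) *\<^sub>R axis j0 1)) - f (u \<epsilon>)
        = \<epsilon> * y i0 $ j0 * \<delta>f i0 j0 ((u \<epsilon>)(i0 := u \<epsilon> i0 + \<xi> *\<^sub>R axis j0 1))" for \<epsilon>
    proof -
      let ?g = "\<lambda>r. f ((u \<epsilon>)(i0 := u \<epsilon> i0 + r *\<^sub>R axis j0 1))"
      let ?g' = "\<lambda>r. \<delta>f i0 j0 ((u \<epsilon>)(i0 := u \<epsilon> i0 + r *\<^sub>R axis j0 1))"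
      let ?r = "\<epsilon> * y i0 $ j0"
      have g0: "?g 0 = f (u \<epsilon>)" by simp
      consider "?r = 0" | "0 < ?r" | "?r < 0" by linarith
      then show ?thesis
      proof cases
        case 1
        show ?thesis unfolding 1 by (intro exI[of _ 0]) simp
      next
        case 2
        obtain z where "0 < z" "z < ?r" "?g ?r - ?g 0 = (?r - 0) * ?g' z"
          using MVT2[OF 2, of ?g ?g'] deriv'[OF i0] by blast
        then show ?thesis using g0 by (intro exI[of _ z]) simp
      next
        case 3
        obtain z where "?r < z" "z < 0" "?g 0 - ?g ?r = (0 - ?r) * ?g' z"
          using MVT2[OF 3, of ?g ?g'] deriv'[OF i0] by blast
        then show ?thesis using g0 by (intro exI[of _ z]) (simp add: algebra_simps)
      qed
    qed
    then obtain \<xi> where \<xi>: "\<And>\<epsilon>. \<bar>\<xi> \<epsilon>\<bar> \<le> \<bar>\<epsilon> * y i0 $ j0\<bar>"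
      "\<And>\<epsilon>. f ((u \<epsilon>)(i0 := u \<epsilon> i0 + (\<epsilon> * y i0 $ j0) *\<^sub>R axis j0 1)) - f (u \<epsilon>) = \<epsilon> * y i0 $ j0 * \<delta>f i0 j0 ((u \<epsilon>)(i0 := u \<epsilon> i0 + \<xi> \<epsilon> *\<^sub>R axis j0 1))"
      by metis
    \<comment> \<open>The partial derivative as a function of the step and of the intermediate point
      jointly. Its continuity at (0, 0) handles both limits together.\<close>
    define G where "G z = \<delta>f i0 j0 ((u (fst z))(i0 := u (fst z) i0 + snd z *\<^sub>R axis j0 1))" for z :: "real \<times> real"
    have "continuous_on UNIV G"
      unfolding G_def
    proof (rule continuous_on_compose2[OF cont[OF i0]])
      show "continuous_on UNIV (\<lambda>z::real \<times> real. (u (fst z))(i0 := u (fst z) i0 + snd z *\<^sub>R axis j0 1))"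
      proof (rule continuous_on_coordinatewise_then_product)
        fix i
        show "continuous_on UNIV (\<lambda>z::real \<times> real. ((u (fst z))(i0 := u (fst z) i0 + snd z *\<^sub>R axis j0 1)) i)"
          by (cases "i = i0") (auto simp: u_def intro!: continuous_intros)
      qed
    qed simp
    then have G_cont: "isCont G (0, 0)" by (simp add: continuous_on_eq_continuous_at)
    have \<xi>0: "(\<xi> \<longlongrightarrow> 0) (at 0)"
    proof (rule Lim_null_comparison)
      show "\<forall>\<^sub>F \<epsilon> in at 0. norm (\<xi> \<epsilon>) \<le> \<bar>\<epsilon> * y i0 $ j0\<bar>" using \<xi>(1) by simp
      show "((\<lambda>\<epsilon>. \<bar>\<epsilon> * y i0 $ j0\<bar>) \<longlongrightarrow> 0) (at 0)" by (auto intro!: tendsto_eq_intros)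
    qed
    have "((\<lambda>\<epsilon>. G (\<epsilon>, \<xi> \<epsilon>)) \<longlongrightarrow> G (0, 0)) (at 0)"
      by (rule isCont_tendsto_compose[OF G_cont]) (intro tendsto_Pair \<xi>0 tendsto_ident_at)
    moreover have "G (0, 0) = \<delta>f i0 j0 x" by (simp add: G_def u_def[abs_def])
    ultimately have lim: "((\<lambda>\<epsilon>. y i0 $ j0 * G (\<epsilon>, \<xi> \<epsilon>)) \<longlongrightarrow> y i0 $ j0 * \<delta>f i0 j0 x) (at 0)"
      by (intro tendsto_mult tendsto_const) simp
    have "((\<lambda>\<epsilon>. f ((u \<epsilon>)(i0 := u \<epsilon> i0 + (\<epsilon> * y i0 $ j0) *\<^sub>R axis j0 1)) - f (u \<epsilon>)) has_real_derivative y i0 $ j0 * \<delta>f i0 j0 x) (at 0)"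
      unfolding DERIV_def
    proof (rule Lim_transform_eventually[OF lim])
      show "\<forall>\<^sub>F h in at 0. y i0 $ j0 * G (h, \<xi> h) =
        (f ((u (0 + h))(i0 := u (0 + h) i0 + ((0 + h) * y i0 $ j0) *\<^sub>R axis j0 1)) - f (u (0 + h)) - (f ((u 0)(i0 := u 0 i0 + (0 * y i0 $ j0) *\<^sub>R axis j0 1)) - f (u 0))) / h"
        unfolding eventually_at using \<xi>(2) by (intro exI[of _ 1]) (simp add: G_def)
    qed
    moreover have "((\<lambda>\<epsilon>. f (u \<epsilon>)) has_real_derivative (\<Sum>(i, j)\<in>S. \<delta>f i j x * y i $ j)) (at 0)"
      using insert.IH insert.prems by (simp add: u_def[abs_def])
    ultimately have "((\<lambda>\<epsilon>. (f ((u \<epsilon>)(i0 := u \<epsilon> i0 + (\<epsilon> * y i0 $ j0) *\<^sub>R axis j0 1)) - f (u \<epsilon>)) + f (u \<epsilon>)) has_real_derivative y i0 $ j0 * \<delta>f i0 j0 x + (\<Sum>(i, j)\<in>S. \<delta>f i j x * y i $ j)) (at 0)"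
      by (rule DERIV_add)
    then show ?case unfolding path using insert.hyps p by (simp add: mult.commute)
  qed
  from this[of "{..<m} \<times> UNIV"]
  have "((\<lambda>\<epsilon>. f (\<lambda>i. x i + \<epsilon> *\<^sub>R yS ({..<m} \<times> UNIV) i)) has_real_derivative (\<Sum>i<m. \<Sum>j\<in>UNIV. \<delta>f i j x * y i $ j)) (at 0)"
    by (simp add: sum.cartesian_product)
  \<comment> \<open>From m on the two directions may differ, but f does not depend on those
    entries.\<close>
  moreover have "yS ({..<m} \<times> UNIV) i = y i" if "i < m" for i
    using that basis_expansion[of "y i"] by (simp add: yS_def scalar_mult_eq_scaleR)
  then have "f (\<lambda>i. x i + \<epsilon> *\<^sub>R yS ({..<m} \<times> UNIV) i) = f (\<lambda>i. x i + \<epsilon> *\<^sub>R y i)" for \<epsilon>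
    by (intro local) simp
  ultimately show ?thesis by simp
qed

section \<open>A bounded positive substitute for the square\<close>

definition sq_trunc :: "real \<Rightarrow> real \<Rightarrow> real" where
  "sq_trunc \<eta> y = (y\<^sup>2 + \<eta>) / (1 + \<eta> * y\<^sup>2)"

definition sq_trunc' :: "real \<Rightarrow> real \<Rightarrow> real" where
  "sq_trunc' \<eta> y = 2 * y * (1 - \<eta>\<^sup>2) / (1 + \<eta> * y\<^sup>2)\<^sup>2"

text \<open>The last bound is the reason for this choice: for y^2 itself the quotient (phi')^2 / (2
  phi) is equal to 2, so the substitution does not enlarge the constant. The two-sided bounds make
  entropies finite and stable under limits.\<close>

lemma sq_trunc:
  assumes \<eta>: "0 < \<eta>" "\<eta> < 1"
  shows "\<eta> \<le> sq_trunc \<eta> y" "sq_trunc \<eta> y \<le> 1 / \<eta>" "sq_trunc \<eta> y \<le> y\<^sup>2 + 1"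
    "(sq_trunc \<eta> has_real_derivative sq_trunc' \<eta> y) (at y)"
    "(sq_trunc' \<eta> y)\<^sup>2 / (2 * sq_trunc \<eta> y) \<le> 2"
proof -
  have D: "0 < 1 + \<eta> * y\<^sup>2" using \<eta> by (simp add: add_pos_nonneg)
  have \<eta>2: "\<eta>\<^sup>2 \<le> 1" using \<eta> by (simp add: power_le_one)
  have "\<eta> * (1 + \<eta> * y\<^sup>2) \<le> y\<^sup>2 + \<eta>"
    using mult_right_mono[OF \<eta>2, of "y\<^sup>2"] by (simp add: algebra_simps power2_eq_square)
  then show 1: "\<eta> \<le> sq_trunc \<eta> y" unfolding sq_trunc_def using D by (simp add: le_divide_eq)
  have "\<eta> * (y\<^sup>2 + \<eta>) \<le> 1 + \<eta> * y\<^sup>2"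
    using \<eta>2 by (simp add: algebra_simps power2_eq_square)
  then show "sq_trunc \<eta> y \<le> 1 / \<eta>" unfolding sq_trunc_def using D \<eta> by (simp add: divide_le_eq le_divide_eq mult.commute)
  have "y\<^sup>2 + \<eta> \<le> (y\<^sup>2 + 1) * (1 + \<eta> * y\<^sup>2)"
  proof -
    have "(y\<^sup>2 + 1) * 1 \<le> (y\<^sup>2 + 1) * (1 + \<eta> * y\<^sup>2)" using \<eta> by (intro mult_left_mono) auto
    then show ?thesis using \<eta> by simp
  qed
  then show "sq_trunc \<eta> y \<le> y\<^sup>2 + 1" unfolding sq_trunc_def using D by (simp add: divide_le_eq)
  show "(sq_trunc \<eta> has_real_derivative sq_trunc' \<eta> y) (at y)"
    unfolding sq_trunc_def sq_trunc'_def using D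
    by (auto intro!: derivative_eq_intros simp: power2_eq_square field_simps)
  have num: "0 < y\<^sup>2 + \<eta>" using \<eta> by (simp add: add_nonneg_pos)
  \<comment> \<open>Factored so that each factor after the 2 is visibly at most 1.\<close>
  have "(sq_trunc' \<eta> y)\<^sup>2 / (2 * sq_trunc \<eta> y) = 2 * (y\<^sup>2 / (y\<^sup>2 + \<eta>)) * ((1 - \<eta>\<^sup>2)\<^sup>2 / (1 + \<eta> * y\<^sup>2) ^ 3)"
  proof -
    have "(2 * y * e / d\<^sup>2)\<^sup>2 / (2 * (q / d)) = 2 * (y\<^sup>2 / q) * (e\<^sup>2 / d ^ 3)" if "d \<noteq> 0" "q \<noteq> 0" for d e q :: real
      using that by (simp add: field_simps power2_eq_square power3_eq_cube)
    from this[of "1 + \<eta> * y\<^sup>2" "y\<^sup>2 + \<eta>" "1 - \<eta>\<^sup>2"] show ?thesis using num D by (simp add: sq_trunc_def sq_trunc'_def)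
  qed
  also have "\<dots> \<le> 2 * 1 * 1"
  proof (intro mult_mono)
    show "y\<^sup>2 / (y\<^sup>2 + \<eta>) \<le> 1" using num \<eta> by (simp add: divide_le_eq)
    have "(1 - \<eta>\<^sup>2)\<^sup>2 \<le> 1" using \<eta>2 by (intro power_le_one) auto
    also have "1 \<le> (1 + \<eta> * y\<^sup>2) ^ 3" using \<eta> by (intro one_le_power) auto
    finally show "(1 - \<eta>\<^sup>2)\<^sup>2 / (1 + \<eta> * y\<^sup>2) ^ 3 \<le> 1" using D by (simp add: divide_le_eq)
  qed (use num D in auto)
  finally show "(sq_trunc' \<eta> y)\<^sup>2 / (2 * sq_trunc \<eta> y) \<le> 2" by simp
qed

text \<open>Equality of characteristic functions identifies the law with a linear image of
  independent standard normals. The matrix c acts on the time index only and is the same for all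
  components. Restricting to I places the vectors in the product space, whose elements are
  \<open>undefined\<close> off I.\<close>

lemma gaussian_vector_distr:
  fixes X :: "nat \<times> 'n::finite \<Rightarrow> 'w \<Rightarrow> real" and c :: "nat \<Rightarrow> nat \<Rightarrow> real" and m :: nat
  defines "I \<equiv> {..<m} \<times> (UNIV :: 'n set)"
  assumes "prob_space M" and X: "\<And>p. p \<in> I \<Longrightarrow> X p \<in> borel_measurable M"
    and char: "\<And>a b. (LINT \<omega>|M. cos ((\<Sum>p\<in>I. a p * X p \<omega>) + b))
      = exp (- (\<Sum>j\<in>UNIV. \<Sum>k<m. (\<Sum>i<m. a (i, j) * c i k)\<^sup>2) / 2) * cos b"
  shows "distr M (PiM I (\<lambda>_. borel)) (\<lambda>\<omega>. \<lambda>p\<in>I. X p \<omega>)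
    = distr (PiM I (\<lambda>_. std_normal_distribution)) (PiM I (\<lambda>_. borel)) (\<lambda>z. \<lambda>p\<in>I. \<Sum>k<m. c (fst p) k * z (k, snd p))"
proof -
  interpret prob_space M by fact
  let ?P = "PiM I (\<lambda>_. std_normal_distribution)"
  interpret P: prob_space ?P
    by (intro prob_space_PiM) (rule real_distribution.axioms(1)[OF real_dist_normal_dist])
  have I: "finite I" by (simp add: I_def)
  have coord: "(\<lambda>z. z p) \<in> borel_measurable ?P" if "p \<in> I" for p
    using measurable_component_singleton[OF that, of "\<lambda>_. std_normal_distribution"] by simp
  have Xm: "(\<lambda>\<omega>. \<lambda>p\<in>I. X p \<omega>) \<in> M \<rightarrow>\<^sub>M PiM I (\<lambda>_. borel)"
    by (rule measurable_restrict) (rule X)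
  have Cm: "(\<lambda>z. \<lambda>p\<in>I. \<Sum>k<m. c (fst p) k * z (k, snd p)) \<in> ?P \<rightarrow>\<^sub>M PiM I (\<lambda>_. borel)"
    by (rule measurable_restrict) (auto intro!: borel_measurable_sum borel_measurable_times coord simp: I_def)
  have cosm: "(\<lambda>x. cos ((\<Sum>p\<in>I. a p * x p) + b)) \<in> borel_measurable (PiM I (\<lambda>_. borel))" for a :: "nat \<times> 'n \<Rightarrow> real" and b
    by measurable
  show ?thesis
  proof (rule PiM_char_unique[OF I])
    show "prob_space (distr M (PiM I (\<lambda>_. borel)) (\<lambda>\<omega>. \<lambda>p\<in>I. X p \<omega>))" by (rule prob_space_distr[OF Xm])
    show "prob_space (distr ?P (PiM I (\<lambda>_. borel)) (\<lambda>z. \<lambda>p\<in>I. \<Sum>k<m. c (fst p) k * z (k, snd p)))" by (rule P.prob_space_distr[OF Cm])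
    fix a :: "nat \<times> 'n \<Rightarrow> real" and b
    let ?\<beta> = "\<lambda>q. \<Sum>i<m. a (i, snd q) * c i (fst q)"
    have lin: "(\<Sum>p\<in>I. a p * (\<Sum>k<m. c (fst p) k * z (k, snd p))) = (\<Sum>q\<in>I. ?\<beta> q * z q)" for z :: "nat \<times> 'n \<Rightarrow> real"
    proof -
      have "(\<Sum>p\<in>I. a p * (\<Sum>k<m. c (fst p) k * z (k, snd p))) = (\<Sum>i<m. \<Sum>j\<in>UNIV. \<Sum>k<m. a (i, j) * c i k * z (k, j))"
        unfolding I_def by (subst sum.cartesian_product') (simp add: sum_distrib_left mult.assoc)
      also have "\<dots> = (\<Sum>i<m. \<Sum>k<m. \<Sum>j\<in>UNIV. a (i, j) * c i k * z (k, j))"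
        by (intro sum.cong refl sum.swap)
      also have "\<dots> = (\<Sum>k<m. \<Sum>i<m. \<Sum>j\<in>UNIV. a (i, j) * c i k * z (k, j))" by (rule sum.swap)
      also have "\<dots> = (\<Sum>k<m. \<Sum>j\<in>UNIV. \<Sum>i<m. a (i, j) * c i k * z (k, j))"
        by (intro sum.cong refl sum.swap)
      also have "\<dots> = (\<Sum>q\<in>I. ?\<beta> q * z q)"
        unfolding I_def by (subst sum.cartesian_product') (simp add: sum_distrib_right)
      finally show ?thesis .
    qed
    have "(LINT x|distr M (PiM I (\<lambda>_. borel)) (\<lambda>\<omega>. \<lambda>p\<in>I. X p \<omega>). cos ((\<Sum>p\<in>I. a p * x p) + b)) = (LINT \<omega>|M. cos ((\<Sum>p\<in>I. a p * X p \<omega>) + b))"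
      by (subst integral_distr[OF Xm cosm]) simp
    also have "\<dots> = exp (- (\<Sum>j\<in>UNIV. \<Sum>k<m. (\<Sum>i<m. a (i, j) * c i k)\<^sup>2) / 2) * cos b" by (rule char)
    also have "(\<Sum>j\<in>UNIV. \<Sum>k<m. (\<Sum>i<m. a (i, j) * c i k)\<^sup>2) = (\<Sum>q\<in>I. (?\<beta> q)\<^sup>2)"
      unfolding I_def by (subst sum.swap) (simp add: sum.cartesian_product')
    also have "exp (- (\<Sum>q\<in>I. (?\<beta> q)\<^sup>2) / 2) * cos b = (LINT z|?P. cos ((\<Sum>q\<in>I. ?\<beta> q * z q) + b))"
      by (rule PiM_std_normal_cos[OF I, symmetric])
    also have "\<dots> = (LINT z|?P. cos ((\<Sum>p\<in>I. a p * (\<Sum>k<m. c (fst p) k * z (k, snd p))) + b))" by (simp only: lin)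
    also have "\<dots> = (LINT x|distr ?P (PiM I (\<lambda>_. borel)) (\<lambda>z. \<lambda>p\<in>I. \<Sum>k<m. c (fst p) k * z (k, snd p)). cos ((\<Sum>p\<in>I. a p * x p) + b))"
      by (subst integral_distr[OF Cm cosm]) simp
    finally show "(LINT x|distr M (PiM I (\<lambda>_. borel)) (\<lambda>\<omega>. \<lambda>p\<in>I. X p \<omega>). cos ((\<Sum>p\<in>I. a p * x p) + b))
       = (LINT x|distr ?P (PiM I (\<lambda>_. borel)) (\<lambda>z. \<lambda>p\<in>I. \<Sum>k<m. c (fst p) k * z (k, snd p)). cos ((\<Sum>p\<in>I. a p * x p) + b))" .
  qed simp_all
qed

text \<open>The Gram matrix of \<rho> is factored as c c^T and X is replaced by c applied to
  standard normals. By the chain rule the squared partial derivatives in those normals add up to the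
  Gram form again, so c disappears from the result.\<close>

lemma gaussian_vector_log_sobolev:
  fixes X :: "nat \<Rightarrow> 'w \<Rightarrow> real^'n" and f :: "(nat \<Rightarrow> real^'n) \<Rightarrow> real" and \<rho> :: "nat \<Rightarrow> real \<Rightarrow> real"
  assumes "prob_space M" and X: "\<And>i. i < m \<Longrightarrow> X i \<in> borel_measurable M"
    and \<rho>_int: "\<And>i i'. i < m \<Longrightarrow> i' < m \<Longrightarrow> integrable L (\<lambda>r. \<rho> i r * \<rho> i' r)"
    and char: "\<And>(v :: nat \<Rightarrow> real^'n) b. (LINT \<omega>|M. cos ((\<Sum>i<m. v i \<bullet> X i \<omega>) + b))
      = exp (- (\<Sum>j\<in>UNIV. LINT r|L. (\<Sum>i<m. v i $ j * \<rho> i r)\<^sup>2) / 2) * cos b"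
    and f_cont: "continuous_on UNIV f"
    and deriv: "\<And>i j x. i < m \<Longrightarrow> ((\<lambda>r. f (x(i := x i + r *\<^sub>R axis j 1))) has_real_derivative \<delta>f i j x) (at 0)"
    and cont: "\<And>i j. i < m \<Longrightarrow> continuous_on UNIV (\<delta>f i j)"
    and local: "\<And>x y. (\<And>i. i < m \<Longrightarrow> x i = y i) \<Longrightarrow> f x = f y"
    and \<eta>: "0 < \<eta>" "\<eta> < 1"
  shows "ennreal (ent M (\<lambda>\<omega>. sq_trunc \<eta> (f (\<lambda>i. X i \<omega>))))
    \<le> (\<integral>\<^sup>+\<omega>. ennreal (2 * (\<Sum>j\<in>UNIV. LINT r|L. (\<Sum>i<m. \<delta>f i j (\<lambda>i. if i < m then X i \<omega> else 0) * \<rho> i r)\<^sup>2)) \<partial>M)"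
proof -
  interpret prob_space M by fact
  let ?I = "{..<m} \<times> (UNIV :: 'n set)"
  let ?N = std_normal_distribution
  let ?P = "PiM ?I (\<lambda>_. ?N)"
  interpret P: prob_space ?P
    by (intro prob_space_PiM) (rule real_distribution.axioms(1)[OF real_dist_normal_dist])
  \<comment> \<open>Set to 0 off the first m indices, where integrability is unknown; the
    factorization asks for symmetry at all indices.\<close>
  define G where "G i i' = (if i < m \<and> i' < m then LINT r|L. \<rho> i r * \<rho> i' r else 0)" for i i'
  have gram: "(LINT r|L. (\<Sum>i<m. a i * \<rho> i r)\<^sup>2) = (\<Sum>i<m. \<Sum>i'<m. a i * a i' * G i i')" for a
  proof -
    have eq: "(\<Sum>i<m. a i * \<rho> i r)\<^sup>2 = (\<Sum>i<m. \<Sum>i'<m. a i * a i' * (\<rho> i r * \<rho> i' r))" for r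
      unfolding power2_eq_square sum_product by (simp add: mult_ac)
    have "(LINT r|L. (\<Sum>i<m. \<Sum>i'<m. a i * a i' * (\<rho> i r * \<rho> i' r))) = (\<Sum>i<m. LINT r|L. (\<Sum>i'<m. a i * a i' * (\<rho> i r * \<rho> i' r)))"
      by (rule Bochner_Integration.integral_sum) (auto intro!: Bochner_Integration.integrable_sum \<rho>_int)
    also have "\<dots> = (\<Sum>i<m. \<Sum>i'<m. LINT r|L. a i * a i' * (\<rho> i r * \<rho> i' r))"
      by (intro sum.cong refl Bochner_Integration.integral_sum) (auto intro!: \<rho>_int)
    also have "\<dots> = (\<Sum>i<m. \<Sum>i'<m. a i * a i' * G i i')"
      by (intro sum.cong refl) (simp add: G_def)
    finally show ?thesis unfolding eq .
  qed
  have "\<exists>c. \<forall>i<m. \<forall>j<m. G i j = (\<Sum>k<m. c i k * c j k)"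
  proof (rule psd_gram_factorization)
    show "G i j = G j i" for i j by (auto simp: G_def mult.commute)
    show "0 \<le> (\<Sum>i<m. \<Sum>j<m. a i * a j * G i j)" for a
      unfolding gram[symmetric] by simp
  qed
  then obtain c where c: "\<And>i j. i < m \<Longrightarrow> j < m \<Longrightarrow> G i j = (\<Sum>k<m. c i k * c j k)" by blast
  have gram_c: "(LINT r|L. (\<Sum>i<m. a i * \<rho> i r)\<^sup>2) = (\<Sum>k<m. (\<Sum>i<m. a i * c i k)\<^sup>2)" for a
  proof -
    have "(\<Sum>k<m. (\<Sum>i<m. a i * c i k)\<^sup>2) = (\<Sum>k<m. \<Sum>i<m. \<Sum>i'<m. a i * a i' * (c i k * c i' k))"
      unfolding power2_eq_square sum_product by (simp add: mult_ac)
    also have "\<dots> = (\<Sum>i<m. \<Sum>k<m. \<Sum>i'<m. a i * a i' * (c i k * c i' k))" by (rule sum.swap)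
    also have "\<dots> = (\<Sum>i<m. \<Sum>i'<m. \<Sum>k<m. a i * a i' * (c i k * c i' k))" by (intro sum.cong refl sum.swap)
    also have "\<dots> = (\<Sum>i<m. \<Sum>i'<m. a i * a i' * G i i')"
      by (intro sum.cong refl) (simp add: c sum_distrib_left)
    finally show ?thesis by (simp add: gram)
  qed
  \<comment> \<open>Converts between families of scalars indexed by pairs and sequences of vectors.
    The padding by 0 is invisible to f.\<close>
  define vec where "vec y i = (if i < m then (\<chi> j. y (i, j)) else 0)" for y :: "nat \<times> 'n \<Rightarrow> real" and i
  define XX where "XX \<omega> = (\<lambda>p\<in>?I. X (fst p) \<omega> $ snd p)" for \<omega>
  define CC where "CC z = (\<lambda>p\<in>?I. \<Sum>k<m. c (fst p) k * z (k, snd p))" for z :: "nat \<times> 'n \<Rightarrow> real"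
  have Xc: "(\<lambda>\<omega>. X (fst p) \<omega> $ snd p) \<in> borel_measurable M" if "p \<in> ?I" for p
  proof (rule measurable_compose[OF X])
    show "(\<lambda>x. x $ snd p) \<in> borel_measurable (borel :: (real^'n) measure)"
      by (intro borel_measurable_continuous_onI continuous_intros)
  qed (use that in auto)
  have XXm: "XX \<in> M \<rightarrow>\<^sub>M PiM ?I (\<lambda>_. borel)"
    unfolding XX_def by (rule measurable_restrict) (rule Xc)
  have coord: "(\<lambda>z. z p) \<in> borel_measurable ?P" if "p \<in> ?I" for p
    using measurable_component_singleton[OF that, of "\<lambda>_. ?N"] by simp
  have CCm: "CC \<in> ?P \<rightarrow>\<^sub>M PiM ?I (\<lambda>_. borel)"
    unfolding CC_def by (rule measurable_restrict) (auto intro!: borel_measurable_sum borel_measurable_times coord)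
  have law: "distr M (PiM ?I (\<lambda>_. borel)) XX = distr ?P (PiM ?I (\<lambda>_. borel)) CC"
    unfolding XX_def[abs_def] CC_def[abs_def]
  proof (rule gaussian_vector_distr[where X="\<lambda>p \<omega>. X (fst p) \<omega> $ snd p"])
    show "(\<lambda>\<omega>. X (fst p) \<omega> $ snd p) \<in> borel_measurable M" if "p \<in> ?I" for p by (rule Xc[OF that])
    fix a :: "nat \<times> 'n \<Rightarrow> real" and b
    have "(\<Sum>p\<in>?I. a p * X (fst p) \<omega> $ snd p) = (\<Sum>i<m. (\<chi> j. a (i, j)) \<bullet> X i \<omega>)" for \<omega>
      by (simp add: sum.cartesian_product' inner_vec_def)
    then show "(LINT \<omega>|M. cos ((\<Sum>p\<in>?I. a p * X (fst p) \<omega> $ snd p) + b)) = exp (- (\<Sum>j\<in>UNIV. \<Sum>k<m. (\<Sum>i<m. a (i, j) * c i k)\<^sup>2) / 2) * cos b"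
      using char[of "\<lambda>i. \<chi> j. a (i, j)" b] by (simp add: gram_c)
  qed (rule prob_space_axioms)
  have vec_meas: "vec \<in> borel_measurable (PiM ?I (\<lambda>_. borel))"
  proof (rule measurable_coordinatewise_then_product)
    fix i
    show "(\<lambda>y. vec y i) \<in> borel_measurable (PiM ?I (\<lambda>_. borel))"
    proof (cases "i < m")
      case True
      have "(\<lambda>y. (\<chi> j. y (i, j)) :: real^'n) \<in> borel_measurable (PiM ?I (\<lambda>_. borel))"
      proof -
        have "(\<lambda>y. y (i, j)) \<in> borel_measurable (PiM ?I (\<lambda>_. borel :: real measure))" for j
          using True by (intro measurable_component_singleton) auto
        then show ?thesis
          unfolding borel_measurable_euclidean_space[where f="\<lambda>y. (\<chi> j. y (i, j)) :: real^'n"]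
          by (auto simp: Basis_vec_def inner_axis)
      qed
      then show ?thesis using True by (simp add: vec_def)
    qed (simp add: vec_def)
  qed
  define \<Psi> where "\<Psi> y = sq_trunc \<eta> (f (vec y))" for y
  have f_meas: "f \<in> borel_measurable borel" by (rule borel_measurable_continuous_onI[OF f_cont])
  have \<delta>f_meas: "\<delta>f i j \<in> borel_measurable borel" if "i < m" for i j
    by (rule borel_measurable_continuous_onI[OF cont[OF that]])
  have st_meas: "sq_trunc \<eta> \<in> borel_measurable borel" "sq_trunc' \<eta> \<in> borel_measurable borel"
    unfolding sq_trunc_def[abs_def] sq_trunc'_def[abs_def] by measurable
  have \<Psi>_meas: "\<Psi> \<in> borel_measurable (PiM ?I (\<lambda>_. borel))"
    unfolding \<Psi>_def[abs_def] by (intro measurable_compose[OF _ st_meas(1)] measurable_compose[OF _ f_meas] vec_meas)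
  define Q where "Q y = (\<Sum>j\<in>UNIV. \<Sum>k<m. (\<Sum>i<m. \<delta>f i j (vec y) * c i k)\<^sup>2)" for y
  have Q_meas: "Q \<in> borel_measurable (PiM ?I (\<lambda>_. borel))"
    unfolding Q_def[abs_def]
    by (intro borel_measurable_sum borel_measurable_power borel_measurable_times measurable_compose[OF vec_meas \<delta>f_meas]) auto
  have vecX: "vec (XX \<omega>) = (\<lambda>i. if i < m then X i \<omega> else 0)" for \<omega>
    by (auto simp: vec_def XX_def fun_eq_iff vec_eq_iff)
  have "ent M (\<lambda>\<omega>. sq_trunc \<eta> (f (\<lambda>i. X i \<omega>))) = ent M (\<lambda>\<omega>. \<Psi> (XX \<omega>))"
  proof -
    have "f (\<lambda>i. X i \<omega>) = f (vec (XX \<omega>))" for \<omega> by (rule local) (simp add: vecX)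
    then show ?thesis by (simp add: \<Psi>_def)
  qed
  also have "\<dots> = ent (distr M (PiM ?I (\<lambda>_. borel)) XX) \<Psi>"
    by (rule ent_distr[OF XXm \<Psi>_meas, symmetric])
  also have "\<dots> = ent ?P (\<lambda>z. \<Psi> (CC z))"
    unfolding law by (rule ent_distr[OF CCm \<Psi>_meas])
  also have "ennreal \<dots> \<le> (\<integral>\<^sup>+z. ennreal (2 * Q (CC z)) \<partial>?P)"
  proof -
    define cc where "cc z i = (if i < m then (\<chi> j. \<Sum>k<m. c i k * z (k, j)) else 0)" for z :: "nat \<times> 'n \<Rightarrow> real" and i
    have vcc: "vec (CC z) = cc z" for z by (auto simp: vec_def CC_def cc_def fun_eq_iff vec_eq_iff)
    define dd where "dd p z = (\<Sum>i<m. \<delta>f i (snd p) (cc z) * c i (fst p))" for p z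
    define D where "D p z = sq_trunc' \<eta> (f (cc z)) * dd p z" for p z
    have cc_meas: "cc \<in> borel_measurable ?P"
      using measurable_compose[OF CCm vec_meas] by (simp add: vcc)
    have dd_meas: "dd p \<in> borel_measurable ?P" for p
      unfolding dd_def[abs_def] by (intro borel_measurable_sum borel_measurable_times measurable_compose[OF cc_meas \<delta>f_meas]) auto
    \<comment> \<open>Moving the single coordinate p of the normals moves the vector along a fixed
      direction, so \<open>directional_derivative\<close> yields the partial derivatives.\<close>
    have upd: "cc (z(p := r + s)) = (\<lambda>i. cc (z(p := r)) i + s *\<^sub>R (if i < m then c i (fst p) *\<^sub>R axis (snd p) 1 else 0))" if p: "p \<in> ?I" for z p r s
    proof (rule ext)
      fix i
      show "cc (z(p := r + s)) i = cc (z(p := r)) i + s *\<^sub>R (if i < m then c i (fst p) *\<^sub>R axis (snd p) 1 else 0)"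
      proof (cases "i < m")
        case True
        have "(\<Sum>k<m. c i k * (z(p := r + s)) (k, j)) = (\<Sum>k<m. c i k * (z(p := r)) (k, j)) + s * (c i (fst p) * (if j = snd p then 1 else 0))" for j
        proof -
          have "(\<Sum>k<m. c i k * (z(p := r + s)) (k, j)) = (\<Sum>k<m. c i k * (z(p := r)) (k, j) + (if k = fst p then s * (c i k * (if j = snd p then 1 else 0)) else 0))"
            by (intro sum.cong refl, cases p) (auto simp: algebra_simps)
          also have "\<dots> = (\<Sum>k<m. c i k * (z(p := r)) (k, j)) + s * (c i (fst p) * (if j = snd p then 1 else 0))"
            using p by (subst sum.distrib) (auto simp: sum.delta)
          finally show ?thesis .
        qed
        then show ?thesis using True by (simp add: cc_def vec_eq_iff axis_def)
      qed (simp add: cc_def)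
    qed
    have fderiv: "((\<lambda>r. f (cc (z(p := r)))) has_real_derivative dd p (z(p := r))) (at r)" if p: "p \<in> ?I" for z p r
    proof -
      have "((\<lambda>s. f (cc (z(p := r + s)))) has_real_derivative (\<Sum>i<m. \<Sum>j\<in>UNIV. \<delta>f i j (cc (z(p := r))) * (if i < m then c i (fst p) *\<^sub>R axis (snd p) 1 else 0) $ j)) (at 0)"
        unfolding upd[OF p] by (rule directional_derivative[OF deriv cont local])
      also have "(\<Sum>i<m. \<Sum>j\<in>UNIV. \<delta>f i j (cc (z(p := r))) * (if i < m then c i (fst p) *\<^sub>R axis (snd p) 1 else 0) $ j) = dd p (z(p := r))"
        unfolding dd_def by (intro sum.cong refl) (auto simp: axis_def if_distrib[of "\<lambda>x. _ * x"] sum.delta cong: if_cong)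
      finally have "((\<lambda>s. f (cc (z(p := s + r)))) has_real_derivative dd p (z(p := r))) (at 0)"
        by (simp only: add.commute[of r])
      then show ?thesis
        using DERIV_shift[of "\<lambda>r. f (cc (z(p := r)))" "dd p (z(p := r))" 0 r] by (simp only: add_0_left)
    qed
    have f_line: "continuous_on UNIV (\<lambda>r. cc (z(p := r)))" for z p
    proof (rule continuous_on_coordinatewise_then_product)
      fix i
      have "continuous_on UNIV (\<lambda>r::real. (z(p := r)) q)" for q
        by (cases "q = p") (auto intro: continuous_intros)
      then show "continuous_on UNIV (\<lambda>r. cc (z(p := r)) i)"
        unfolding cc_def by (cases "i < m") (auto intro!: continuous_intros simp del: fun_upd_apply)
    qed
    have st'_cont: "continuous_on UNIV (sq_trunc' \<eta>)"
    proof -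
      have "1 + \<eta> * y\<^sup>2 \<noteq> 0" for y :: real using \<eta> by (metis add_pos_nonneg less_irrefl mult_nonneg_nonneg order_less_imp_le zero_le_power2 zero_less_one)
      then show ?thesis unfolding sq_trunc'_def[abs_def] by (intro continuous_intros) auto
    qed
    have "ennreal (ent ?P (\<lambda>z. \<Psi> (CC z))) \<le> (\<integral>\<^sup>+z. (\<Sum>p\<in>?I. ennreal ((D p z)\<^sup>2 / (2 * \<Psi> (CC z)))) \<partial>?P)"
    proof (rule PiM_std_normal_log_sobolev[where c=\<eta> and C="1 / \<eta>"])
      show "(\<lambda>z. \<Psi> (CC z)) \<in> borel_measurable ?P" by (rule measurable_compose[OF CCm \<Psi>_meas])
      show "D p \<in> borel_measurable ?P" for p
        unfolding D_def[abs_def] by (intro borel_measurable_times dd_meas measurable_compose[OF _ st_meas(2)] measurable_compose[OF cc_meas f_meas])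
      show "((\<lambda>r. \<Psi> (CC (z(p := r)))) has_real_derivative D p (z(p := r))) (at r)" if "p \<in> ?I" for p z r
        unfolding \<Psi>_def vcc D_def by (rule DERIV_chain2[OF sq_trunc(4)[OF \<eta>] fderiv[OF that]])
      show "continuous_on UNIV (\<lambda>r. D p (z(p := r)))" for p z
        unfolding D_def dd_def
        by (intro continuous_intros continuous_on_compose2[OF st'_cont] continuous_on_compose2[OF f_cont f_line] continuous_on_compose2[OF cont f_line]) auto
    qed (use sq_trunc[OF \<eta>] \<eta> in \<open>auto simp: \<Psi>_def\<close>)
    also have "\<dots> \<le> (\<integral>\<^sup>+z. ennreal (2 * Q (CC z)) \<partial>?P)"
    proof (rule nn_integral_mono)
      fix z
      \<comment> \<open>Here the truncation leaves the Fisher term, by the bound 2 of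
        \<open>sq_trunc\<close>.\<close>
      have "(D p z)\<^sup>2 / (2 * \<Psi> (CC z)) \<le> 2 * (dd p z)\<^sup>2" for p
      proof -
        have "(D p z)\<^sup>2 / (2 * \<Psi> (CC z)) = (sq_trunc' \<eta> (f (cc z)))\<^sup>2 / (2 * sq_trunc \<eta> (f (cc z))) * (dd p z)\<^sup>2"
          by (simp add: D_def \<Psi>_def vcc power_mult_distrib)
        also have "\<dots> \<le> 2 * (dd p z)\<^sup>2" by (intro mult_right_mono sq_trunc(5)[OF \<eta>]) simp
        finally show ?thesis .
      qed
      then have "(\<Sum>p\<in>?I. ennreal ((D p z)\<^sup>2 / (2 * \<Psi> (CC z)))) \<le> (\<Sum>p\<in>?I. ennreal (2 * (dd p z)\<^sup>2))"
        by (intro sum_mono ennreal_leI)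
      also have "\<dots> = ennreal (\<Sum>p\<in>?I. 2 * (dd p z)\<^sup>2)" by (rule sum_ennreal) simp
      also have "(\<Sum>p\<in>?I. 2 * (dd p z)\<^sup>2) = 2 * Q (CC z)"
        unfolding Q_def vcc by (subst sum.swap) (simp add: sum.cartesian_product' dd_def sum_distrib_left)
      finally show "(\<Sum>p\<in>?I. ennreal ((D p z)\<^sup>2 / (2 * \<Psi> (CC z)))) \<le> ennreal (2 * Q (CC z))" .
    qed
    finally show ?thesis .
  qed
  also have "\<dots> = (\<integral>\<^sup>+y. ennreal (2 * Q y) \<partial>distr ?P (PiM ?I (\<lambda>_. borel)) CC)"
    using Q_meas by (subst nn_integral_distr[OF CCm]) auto
  also have "\<dots> = (\<integral>\<^sup>+\<omega>. ennreal (2 * Q (XX \<omega>)) \<partial>M)"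
    unfolding law[symmetric] using Q_meas by (subst nn_integral_distr[OF XXm]) auto
  finally show ?thesis by (simp add: Q_def vecX gram_c)
qed

section \<open>Injectivity of the Volterra operator\<close>

abbreviation L01 :: "real measure" where "L01 \<equiv> lebesgue_on {0..1}"

lemma finite_measure_L01: "finite_measure L01"
  by (intro finite_measure_lebesgue_on) simp

lemma borel_imp_L01_measurable:
  "f \<in> borel_measurable borel \<Longrightarrow> f \<in> borel_measurable L01" for f :: "real \<Rightarrow> 'b::topological_space"
  by (rule measurable_restrict_space1) (simp add: measurable_completion)

lemma L01_borel:
  fixes f :: "real \<Rightarrow> real"
  assumes f[measurable]: "f \<in> borel_measurable borel"
  shows "(LINT r|L01. f r) = (LINT r|lborel. indicator {0..1} r * f r)"
    and "integrable L01 f \<longleftrightarrow> integrable lborel (\<lambda>r. indicator {0..1} r * f r)"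
proof -
  have m: "(\<lambda>r. indicator {0..1} r * f r) \<in> borel_measurable lborel" by measurable
  have "(LINT r|L01. f r) = (LINT r|lebesgue. indicator {0..1} r * f r)"
    by (subst integral_restrict_space) auto
  also have "\<dots> = (LINT r|lborel. indicator {0..1} r * f r)" by (rule integral_completion[OF m])
  finally show "(LINT r|L01. f r) = (LINT r|lborel. indicator {0..1} r * f r)" .
  have "integrable L01 f \<longleftrightarrow> integrable lebesgue (\<lambda>r. indicator {0..1} r *\<^sub>R f r)"
    by (rule integrable_restrict_space) simp
  also have "\<dots> \<longleftrightarrow> integrable lborel (\<lambda>r. indicator {0..1} r * f r)"
    using integrable_completion[OF m] by simp
  finally show "integrable L01 f \<longleftrightarrow> integrable lborel (\<lambda>r. indicator {0..1} r * f r)" .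
qed

text \<open>The positive and the negative part of f are densities of two finite measures with the
  same distribution function, hence of the same measure.\<close>

lemma integrable_AE_zero_of_integrals_atMost:
  fixes f :: "real \<Rightarrow> real"
  assumes f: "integrable lborel f" and zero: "\<And>t. (LINT u|lborel. indicator {..t} u * f u) = 0"
  shows "AE u in lborel. f u = 0"
proof -
  have [measurable]: "f \<in> borel_measurable borel" using f by simp
  define p n where "p u = max 0 (f u)" and "n u = max 0 (- f u)" for u
  have [measurable]: "p \<in> borel_measurable borel" "n \<in> borel_measurable borel" unfolding p_def n_def by measurable
  have ip: "integrable lborel p" and in': "integrable lborel n" unfolding p_def n_def using f by auto
  have nn: "0 \<le> p u" "0 \<le> n u" for u by (simp_all add: p_def n_def)
  define P N where "P = density lborel (\<lambda>u. ennreal (p u))" and "N = density lborel (\<lambda>u. ennreal (n u))"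
  have fin: "finite_measure (density lborel (\<lambda>u. ennreal (q u)))"
    if "integrable lborel q" "\<And>u. 0 \<le> q u" for q :: "real \<Rightarrow> real"
  proof
    have [measurable]: "q \<in> borel_measurable borel" using that(1) by simp
    have "emeasure (density lborel (\<lambda>u. ennreal (q u))) UNIV = ennreal (integral\<^sup>L lborel q)"
      using that by (subst emeasure_density) (auto simp: nn_integral_eq_integral)
    then show "emeasure (density lborel (\<lambda>u. ennreal (q u))) (space (density lborel (\<lambda>u. ennreal (q u)))) \<noteq> \<infinity>" by simp
  qed
  have meas: "measure (density lborel (\<lambda>u. ennreal (q u))) {..t} = (LINT u|lborel. indicator {..t} u * q u)"
    if "integrable lborel q" "\<And>u. 0 \<le> q u" for q :: "real \<Rightarrow> real" and t
  proof -
    have [measurable]: "q \<in> borel_measurable borel" using that(1) by simp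
    have "emeasure (density lborel (\<lambda>u. ennreal (q u))) {..t} = (\<integral>\<^sup>+u. ennreal (indicator {..t} u * q u) \<partial>lborel)"
      by (subst emeasure_density) (auto intro!: nn_integral_cong simp: indicator_def)
    also have "\<dots> = ennreal (LINT u|lborel. indicator {..t} u * q u)"
    proof (rule nn_integral_eq_integral)
      show "integrable lborel (\<lambda>u. indicator {..t} u * q u)"
        using integrable_mult_indicator[OF _ that(1), of "{..t}"] by simp
    qed (use that in auto)
    finally show ?thesis using that(2) unfolding measure_def
      by (simp add: enn2real_ennreal Bochner_Integration.integral_nonneg)
  qed
  interpret P: finite_measure P unfolding P_def by (rule fin[OF ip nn(1)])
  interpret N: finite_measure N unfolding N_def by (rule fin[OF in' nn(2)])
  have "P = N"
  proof (rule cdf_unique')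
    show "finite_borel_measure P" by standard (simp add: P_def)
    show "finite_borel_measure N" by standard (simp add: N_def)
    show "cdf P = cdf N"
    proof
      fix t
      have i: "integrable lborel (\<lambda>u. indicator {..t} u * p u)" "integrable lborel (\<lambda>u. indicator {..t} u * n u)"
        using integrable_mult_indicator[OF _ ip, of "{..t}"] integrable_mult_indicator[OF _ in', of "{..t}"] by simp_all
      have "indicator {..t} u * f u = indicator {..t} u * p u - indicator {..t} u * n u" for u
        by (auto simp: p_def n_def indicator_def)
      then have "(LINT u|lborel. indicator {..t} u * p u) - (LINT u|lborel. indicator {..t} u * n u) = 0"
        using zero[of t] i by simp
      then show "cdf P t = cdf N t"
        unfolding cdf_def P_def N_def by (simp add: meas[OF ip nn(1)] meas[OF in' nn(2)])
    qed
  qed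
  then have "AE u in lborel. ennreal (p u) = ennreal (n u)"
    unfolding P_def N_def by (subst (asm) sigma_finite_measure.density_unique_iff[OF sigma_finite_lborel]) auto
  then show ?thesis
    by eventually_elim (auto simp: p_def n_def max_def split: if_splits)
qed

section \<open>The operator K on square integrable functions\<close>

lemma L2_time_iff: "h \<in> L2_time \<longleftrightarrow> h \<in> borel_measurable L01 \<and> integrable L01 (\<lambda>t. (norm (h t))\<^sup>2)"
  by (simp add: L2_time_def)

lemma L2_time_diff:
  fixes h k :: "real \<Rightarrow> real^'n"
  assumes "h \<in> L2_time" "k \<in> L2_time" shows "(\<lambda>t. h t - k t) \<in> L2_time"
  unfolding L2_time_iff
proof
  have [measurable]: "h \<in> borel_measurable L01" "k \<in> borel_measurable L01" using assms by (auto simp: L2_time_iff)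
  show "(\<lambda>t. h t - k t) \<in> borel_measurable L01" by measurable
  show "integrable L01 (\<lambda>t. (norm (h t - k t))\<^sup>2)"
  proof (rule Bochner_Integration.integrable_bound[where f="\<lambda>t. 2 * (norm (h t))\<^sup>2 + 2 * (norm (k t))\<^sup>2"])
    have "(norm (x - y))\<^sup>2 \<le> 2 * (norm x)\<^sup>2 + 2 * (norm y)\<^sup>2" for x y :: "real^'n"
    proof -
      have "(norm (x - y))\<^sup>2 \<le> (norm x + norm y)\<^sup>2" by (intro power_mono norm_triangle_ineq4) simp
      also have "\<dots> \<le> 2 * (norm x)\<^sup>2 + 2 * (norm y)\<^sup>2"
        using sum_squares_bound[of "norm x" "norm y"] by (simp add: power2_sum)
      finally show ?thesis .
    qed
    then show "AE t in L01. norm ((norm (h t - k t))\<^sup>2) \<le> norm (2 * (norm (h t))\<^sup>2 + 2 * (norm (k t))\<^sup>2)" by simp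
  qed (use assms in \<open>auto simp: L2_time_iff\<close>)
qed

context hurst_parameter
begin

lemma K_dom_sq_integrable_L01: "integrable L01 (\<lambda>r. (K_dom r)\<^sup>2)"
proof (subst L01_borel(2))
  show "integrable lborel (\<lambda>r. indicator {0..1} r * (K_dom r)\<^sup>2)"
    by (rule Bochner_Integration.integrable_bound[OF K_dom_sq_integrable]) (auto simp: indicator_def)
qed measurable

lemma K_dom_mult_integrable:
  assumes "h \<in> L2_time" shows "integrable L01 (\<lambda>s. K_dom s * norm (h s))"
proof (rule Bochner_Integration.integrable_bound[where f="\<lambda>s. (K_dom s)\<^sup>2 + (norm (h s))\<^sup>2"])
  show "AE s in L01. norm (K_dom s * norm (h s)) \<le> norm ((K_dom s)\<^sup>2 + (norm (h s))\<^sup>2)"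
    using abs_mult_le_squares by simp
qed (use assms K_dom_sq_integrable_L01 borel_imp_L01_measurable[OF K_dom_measurable] in \<open>auto simp: L2_time_iff\<close>)

lemma K_L01_measurable: "K_kernel H t \<in> borel_measurable L01"
  by (rule borel_imp_L01_measurable) measurable

lemma K_h_bound:
  assumes "t \<le> 1" shows "norm (K_kernel H t s *\<^sub>R h s) \<le> K_dom s * norm (h s)"
  using K_le_K_dom[OF assms, of s] K_nonneg[of t s] by (simp add: mult_right_mono)

lemma K_h_integrable:
  assumes "h \<in> L2_time" "t \<le> 1" shows "integrable L01 (\<lambda>s. K_kernel H t s *\<^sub>R h s)"
  by (rule Bochner_Integration.integrable_bound[OF K_dom_mult_integrable[OF assms(1)]])
    (use assms K_h_bound K_dom_nonneg K_L01_measurable in \<open>auto simp: L2_time_iff\<close>)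

lemma K_path_continuous:
  assumes h: "h \<in> L2_time" shows "continuous_on {0..1} (\<lambda>t. LINT s|L01. K_kernel H t s *\<^sub>R h s)"
  unfolding continuous_on_sequentially
proof (intro ballI allI impI)
  fix x and t :: real assume t: "t \<in> {0..1}" and x: "(\<forall>n. x n \<in> {0..1}) \<and> x \<longlonglongrightarrow> t"
  have hm: "h \<in> borel_measurable L01" using h by (simp add: L2_time_iff)
  have "(\<lambda>n. LINT s|L01. K_kernel H (x n) s *\<^sub>R h s) \<longlonglongrightarrow> (LINT s|L01. K_kernel H t s *\<^sub>R h s)"
  proof (rule integral_dominated_convergence[where w="\<lambda>s. K_dom s * norm (h s)"])
    show "AE s in L01. (\<lambda>n. K_kernel H (x n) s *\<^sub>R h s) \<longlonglongrightarrow> K_kernel H t s *\<^sub>R h s"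
    proof (rule AE_I2)
      fix s
      have "(\<lambda>n. K_kernel H (x n) s) \<longlonglongrightarrow> K_kernel H t s"
        using K_continuous[of s] t x unfolding continuous_on_sequentially by (auto simp: o_def)
      then show "(\<lambda>n. K_kernel H (x n) s *\<^sub>R h s) \<longlonglongrightarrow> K_kernel H t s *\<^sub>R h s" by (intro tendsto_intros)
    qed
    show "AE s in L01. norm (K_kernel H (x n) s *\<^sub>R h s) \<le> K_dom s * norm (h s)" for n
      using x by (intro AE_I2 K_h_bound) auto
  qed (use K_dom_mult_integrable[OF h] hm K_L01_measurable in auto)
  then show "((\<lambda>t. LINT s|L01. K_kernel H t s *\<^sub>R h s) \<circ> x) \<longlonglongrightarrow> (LINT s|L01. K_kernel H t s *\<^sub>R h s)"
    by (simp add: o_def)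
qed

lemma clamp01: "clamp 0 1 t \<in> {0..1}" for t :: real
  using clamp_in_interval[of "0::real" 1 t] by simp

text \<open>Continuity of the path puts the argument of \<open>Bcontfun\<close> in its domain; this
  is what allows \<open>K_op\<close> to be evaluated. The kernel vanishes for s >= t, so the domain
  of integration can be fixed to [0, 1].\<close>

lemma K_op_apply:
  assumes h: "h \<in> L2_time"
  shows "apply_bcontfun (K_op H h) t = (LINT s|L01. K_kernel H (clamp 0 1 t) s *\<^sub>R h s)"
proof -
  define q where "q t = (LINT s:{0..t}|lebesgue. K_kernel H t s *\<^sub>R h s)" for t
  have q: "q t = (LINT s|L01. K_kernel H t s *\<^sub>R h s)" if t: "t \<in> {0..1}" for t
  proof -
    have "(LINT s|L01. K_kernel H t s *\<^sub>R h s) = (LINT s|lebesgue. indicator {0..1} s *\<^sub>R K_kernel H t s *\<^sub>R h s)"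
      by (subst integral_restrict_space) auto
    also have "\<dots> = q t" unfolding q_def set_lebesgue_integral_def
    proof (rule Bochner_Integration.integral_cong[OF refl])
      fix s
      show "indicator {0..1} s *\<^sub>R K_kernel H t s *\<^sub>R h s = indicator {0..t} s *\<^sub>R K_kernel H t s *\<^sub>R h s"
        using K_zero[of s t] t by (cases "0 < s \<and> s < t") (auto simp: not_less)
    qed
    finally show ?thesis by simp
  qed
  have "continuous_on {0..1} q"
    using K_path_continuous[OF h] by (rule continuous_on_eq) (simp add: q)
  then have "continuous_on (cbox 0 1) q" by simp
  from continuous_on_cbox_bcontfunE[OF this] obtain g :: "real \<Rightarrow>\<^sub>C (real^'a)"
    where g: "\<And>x. apply_bcontfun g x = q (clamp 0 1 x)" by metis
  have "ext_cont q 0 1 = apply_bcontfun g" unfolding ext_cont_def by (simp add: g fun_eq_iff)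
  then have "K_op H h = g" unfolding K_op_def q_def[symmetric, abs_def] by (simp add: apply_bcontfun_inverse)
  then show ?thesis using g q[OF clamp01] by simp
qed

lemma K_op_apply01:
  assumes "h \<in> L2_time" "t \<in> {0..1}"
  shows "apply_bcontfun (K_op H h) t = (LINT s|L01. K_kernel H t s *\<^sub>R h s)"
  using K_op_apply[OF assms(1), of t] assms(2) by simp

text \<open>A cylindrical function is prescribed on \<open>path_space\<close> only; its difference
  quotients along K h stay there.\<close>

lemma path_space_add_K_op:
  assumes "\<omega> \<in> path_space" "h \<in> L2_time" shows "\<omega> + \<delta> *\<^sub>R K_op H h \<in> path_space"
proof -
  have cc: "clamp 0 1 (clamp 0 1 t) = clamp 0 1 t" for t :: real
    using clamp01[of t] by simp
  have c0: "clamp 0 1 (0::real) = 0" by simp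
  have "apply_bcontfun (K_op H h) 0 = 0"
  proof -
    have "K_kernel H 0 s = 0" for s by (rule K_zero) linarith
    then show ?thesis unfolding K_op_apply[OF assms(2)] c0 by simp
  qed
  moreover have "apply_bcontfun (K_op H h) t = apply_bcontfun (K_op H h) (clamp 0 1 t)" for t
    unfolding K_op_apply[OF assms(2)] cc ..
  ultimately show ?thesis using assms(1)
    unfolding path_space_def mem_Collect_eq plus_bcontfun.rep_eq scaleR_bcontfun.rep_eq by fastforce
qed

lemma K_op_diff:
  assumes "h \<in> L2_time" "k \<in> L2_time" shows "K_op H h - K_op H k = K_op H (\<lambda>t. h t - k t)"
proof (rule bcontfun_eqI)
  fix t :: real
  have c: "clamp 0 1 t \<le> 1" using clamp01[of t] by simp
  show "apply_bcontfun (K_op H h - K_op H k) t = apply_bcontfun (K_op H (\<lambda>t. h t - k t)) t"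
    unfolding minus_bcontfun.rep_eq K_op_apply[OF assms(1)] K_op_apply[OF assms(2)] K_op_apply[OF L2_time_diff[OF assms]]
    using K_h_integrable[OF assms(1) c] K_h_integrable[OF assms(2) c] by (simp add: scaleR_right_diff_distrib)
qed

text \<open>The counterpart of \<open>nn_integral_K_wK\<close> in the other variable: u is
  integrated out, the exponents \<beta> and 1 - \<beta> add up to 1 again, and w - s drops
  out.\<close>

lemma nn_integral_abel:
  assumes s: "0 < s" "s < w"
  shows "(\<integral>\<^sup>+u. ennreal (indicator {0<..<w} u * ((w - u) powr (- \<beta>) * u powr (- \<beta>)) * dK s u) \<partial>lborel) = ennreal (cH * B\<^sub>0 * s powr (- \<beta>))"
proof -
  have "(\<integral>\<^sup>+u. ennreal (indicator {0<..<w} u * ((w - u) powr (- \<beta>) * u powr (- \<beta>)) * dK s u) \<partial>lborel)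
     = (\<integral>\<^sup>+u. ennreal (cH * s powr (- \<beta>)) * (ennreal ((u - s) powr (\<beta> - 1) * (w - u) powr ((1 - \<beta>) - 1)) * indicator {s<..<w} u) \<partial>lborel)"
  proof (rule nn_integral_cong)
    fix u
    show "ennreal (indicator {0<..<w} u * ((w - u) powr (- \<beta>) * u powr (- \<beta>)) * dK s u)
      = ennreal (cH * s powr (- \<beta>)) * (ennreal ((u - s) powr (\<beta> - 1) * (w - u) powr ((1 - \<beta>) - 1)) * indicator {s<..<w} u)"
    proof (cases "s < u \<and> u < w")
      case True
      then have one: "u powr (- \<beta>) * u powr \<beta> = 1" using s by (simp add: powr_add[symmetric])
      have "(w - u) powr (- \<beta>) * u powr (- \<beta>) * (cH * s powr (- \<beta>) * u powr \<beta> * (u - s) powr (\<beta> - 1))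
          = (u powr (- \<beta>) * u powr \<beta>) * (cH * s powr (- \<beta>) * ((u - s) powr (\<beta> - 1) * (w - u) powr (- \<beta>)))"
        by (simp only: mult_ac)
      then have e: "(w - u) powr (- \<beta>) * u powr (- \<beta>) * dK s u = cH * s powr (- \<beta>) * ((u - s) powr (\<beta> - 1) * (w - u) powr (- \<beta>))"
        unfolding one using True s by (simp add: dK_def)
      have i1: "indicator {0<..<w} u = (1::real)" "indicator {s<..<w} u = (1::ennreal)" using True s by auto
      show ?thesis unfolding i1 mult_1_left mult_1_right e using cH_pos by (simp add: ennreal_mult'[symmetric])
    next
      case False
      then show ?thesis by (auto simp: indicator_def dK_zero)
    qed
  qed
  also have "\<dots> = ennreal (cH * s powr (- \<beta>)) * (\<integral>\<^sup>+u. ennreal ((u - s) powr (\<beta> - 1) * (w - u) powr ((1 - \<beta>) - 1)) * indicator {s<..<w} u \<partial>lborel)"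
    by (rule nn_integral_cmult) measurable
  also have "(\<integral>\<^sup>+u. ennreal ((u - s) powr (\<beta> - 1) * (w - u) powr ((1 - \<beta>) - 1)) * indicator {s<..<w} u \<partial>lborel) = ennreal ((w - s) powr (\<beta> + (1 - \<beta>) - 1) * Beta \<beta> (1 - \<beta>))"
    by (rule nn_integral_beta_kernel) (use s \<beta>_pos \<beta>_lt in auto)
  also have "ennreal (cH * s powr (- \<beta>)) * ennreal ((w - s) powr (\<beta> + (1 - \<beta>) - 1) * Beta \<beta> (1 - \<beta>)) = ennreal (cH * B\<^sub>0 * s powr (- \<beta>))"
    using s cH_pos B0_pos by (simp add: B\<^sub>0_def ennreal_mult'[symmetric] mult_ac)
  finally show ?thesis .
qed

text \<open>An Abel equation solved in two stages. First the time derivative of K h vanishes almost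
  everywhere. Its Abel transform is a multiple of the integral of s^(-\<beta>) h over [0, w], which
  therefore vanishes for all w in (0, 1].\<close>

lemma K_injective_borel:
  fixes h :: "real \<Rightarrow> real"
  assumes h[measurable]: "h \<in> borel_measurable borel" and h2: "integrable lborel (\<lambda>s. (h s)\<^sup>2)"
    and zero: "\<And>t. t \<in> {0..1} \<Longrightarrow> (LINT s|lborel. K_kernel H t s * h s) = 0"
  shows "AE s in lborel. s \<in> {0<..<1} \<longrightarrow> h s = 0"
proof -
  have K_domh: "integrable lborel (\<lambda>s. K_dom s * h s)"
  proof (rule Bochner_Integration.integrable_bound[where f="\<lambda>s. (K_dom s)\<^sup>2 + (h s)\<^sup>2"])
    show "AE s in lborel. norm (K_dom s * h s) \<le> norm ((K_dom s)\<^sup>2 + (h s)\<^sup>2)" using abs_mult_le_squares by simp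
  qed (use h2 K_dom_sq_integrable in auto)
  have fin: "(\<integral>\<^sup>+s. ennreal (K_dom s * \<bar>h s\<bar>) \<partial>lborel) < \<infinity>"
    using K_domh K_dom_nonneg unfolding integrable_iff_bounded by (simp add: abs_mult)
  \<comment> \<open>The time derivative of K h, cut off beyond time 1, up to which K h is
    known.\<close>
  define \<phi> where "\<phi> u = indicator {..1} u * (LINT s|lborel. dK s u * h s)" for u
  have \<phi>_meas[measurable]: "\<phi> \<in> borel_measurable borel"
  proof -
    have "(\<lambda>z. dK (snd z) (fst z) * h (snd z)) \<in> borel_measurable (borel \<Otimes>\<^sub>M lborel)" by measurable
    then have "(\<lambda>u. LINT s|lborel. dK s u * h s) \<in> borel_measurable borel"
      by (intro lborel.borel_measurable_lebesgue_integral) (simp add: case_prod_beta')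
    then show ?thesis unfolding \<phi>_def by measurable
  qed
  have abs1: "(\<integral>\<^sup>+s. \<integral>\<^sup>+u. ennreal \<bar>indicator {..t} u * (dK s u * h s)\<bar> \<partial>lborel \<partial>lborel) < \<infinity>" if "t \<le> 1" for t
  proof -
    have "(\<integral>\<^sup>+u. ennreal \<bar>indicator {..t} u * (dK s u * h s)\<bar> \<partial>lborel) = ennreal (K_kernel H t s * \<bar>h s\<bar>)" for s
    proof -
      have "(\<integral>\<^sup>+u. ennreal \<bar>indicator {..t} u * (dK s u * h s)\<bar> \<partial>lborel) = (\<integral>\<^sup>+u. ennreal (indicator {..t} u * dK s u) * ennreal \<bar>h s\<bar> \<partial>lborel)"
        using dK_nonneg by (intro nn_integral_cong) (simp add: abs_mult ennreal_mult''[symmetric] mult.assoc)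
      also have "\<dots> = ennreal (K_kernel H t s) * ennreal \<bar>h s\<bar>"
        unfolding K_nn by (rule nn_integral_multc) measurable
      finally show ?thesis by (simp add: ennreal_mult'')
    qed
    then have "(\<integral>\<^sup>+s. \<integral>\<^sup>+u. ennreal \<bar>indicator {..t} u * (dK s u * h s)\<bar> \<partial>lborel \<partial>lborel) = (\<integral>\<^sup>+s. ennreal (K_kernel H t s * \<bar>h s\<bar>) \<partial>lborel)" by simp
    also have "\<dots> \<le> (\<integral>\<^sup>+s. ennreal (K_dom s * \<bar>h s\<bar>) \<partial>lborel)"
      using K_le_K_dom[OF that] by (intro nn_integral_mono ennreal_leI mult_right_mono) auto
    finally show ?thesis using fin by (rule le_less_trans)
  qed
  have swap: "(LINT u|lborel. indicator {..t} u * \<phi> u) = 0" if t: "t \<in> {0..1}" for t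
  proof -
    have "(LINT u|lborel. indicator {..t} u * \<phi> u) = (LINT u|lborel. LINT s|lborel. indicator {..t} u * (dK s u * h s))"
      using t by (intro Bochner_Integration.integral_cong) (auto simp: \<phi>_def indicator_def)
    also have "\<dots> = (LINT s|lborel. LINT u|lborel. indicator {..t} u * (dK s u * h s))"
    proof (rule lborel_integral_swap[symmetric])
      have "(\<lambda>z. (if snd z \<le> t then 1 else 0) * (dK (fst z) (snd z) * h (fst z))) \<in> borel_measurable (borel \<Otimes>\<^sub>M borel)" by measurable
      then show "(\<lambda>z. indicator {..t} (snd z) * (dK (fst z) (snd z) * h (fst z))) \<in> borel_measurable (borel \<Otimes>\<^sub>M borel)" by (simp add: indicator_def)
    qed (use abs1 t in simp)
    also have "\<dots> = (LINT s|lborel. K_kernel H t s * h s)"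
    proof (rule Bochner_Integration.integral_cong[OF refl])
      fix s
      have "(LINT u|lborel. indicator {..t} u * (dK s u * h s)) = (LINT u|lborel. (indicator {..t} u * dK s u) * h s)"
        by (simp add: mult.assoc)
      also have "\<dots> = K_kernel H t s * h s" unfolding K_kernel_eq by (rule integral_mult_left_zero)
      finally show "(LINT u|lborel. indicator {..t} u * (dK s u * h s)) = K_kernel H t s * h s" .
    qed
    finally show ?thesis using zero[OF t] by simp
  qed
  have \<phi>_int: "integrable lborel \<phi>"
  proof (rule integrableI_bounded)
    have "(\<integral>\<^sup>+u. ennreal (norm (\<phi> u)) \<partial>lborel) \<le> (\<integral>\<^sup>+u. \<integral>\<^sup>+s. ennreal \<bar>indicator {..1} u * (dK s u * h s)\<bar> \<partial>lborel \<partial>lborel)"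
    proof (rule nn_integral_mono)
      fix u
      have "ennreal (norm (\<phi> u)) = ennreal \<bar>LINT s|lborel. indicator {..1} u * (dK s u * h s)\<bar>" by (simp add: \<phi>_def)
      also have "\<dots> \<le> (\<integral>\<^sup>+s. ennreal \<bar>indicator {..1} u * (dK s u * h s)\<bar> \<partial>lborel)" by (rule ennreal_abs_integral_le)
      finally show "ennreal (norm (\<phi> u)) \<le> (\<integral>\<^sup>+s. ennreal \<bar>indicator {..1} u * (dK s u * h s)\<bar> \<partial>lborel)" .
    qed
    also have "\<dots> = (\<integral>\<^sup>+s. \<integral>\<^sup>+u. ennreal \<bar>indicator {..1} u * (dK s u * h s)\<bar> \<partial>lborel \<partial>lborel)"
    proof (rule lborel_pair.Fubini')
      have "(\<lambda>z. ennreal \<bar>(if snd z \<le> 1 then 1 else 0) * (dK (fst z) (snd z) * h (fst z))\<bar>) \<in> borel_measurable (lborel \<Otimes>\<^sub>M lborel)" by measurable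
      then show "(\<lambda>(s, u). ennreal \<bar>indicator {..1} u * (dK s u * h s)\<bar>) \<in> borel_measurable (lborel \<Otimes>\<^sub>M lborel)"
        by (simp add: indicator_def case_prod_beta')
    qed
    also have "\<dots> < \<infinity>" using abs1[of 1] by simp
    finally show "(\<integral>\<^sup>+u. ennreal (norm (\<phi> u)) \<partial>lborel) < \<infinity>" .
  qed measurable
  have \<phi>0: "AE u in lborel. \<phi> u = 0"
  proof (rule integrable_AE_zero_of_integrals_atMost[OF \<phi>_int])
    fix t :: real
    have neg: "\<phi> u = 0" if "u \<le> 0" for u
    proof -
      have "dK s u = 0" for s using that by (auto simp: dK_def indicator_def)
      then show ?thesis by (simp add: \<phi>_def)
    qed
    consider "t < 0" | "t \<in> {0..1}" | "1 < t" by fastforce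
    then show "(LINT u|lborel. indicator {..t} u * \<phi> u) = 0"
    proof cases
      case 1
      then have z: "indicator {..t} u * \<phi> u = 0" for u using neg[of u] by (auto simp: indicator_def)
      show ?thesis unfolding z by simp
    next
      case 2
      then show ?thesis by (rule swap)
    next
      case 3
      then have z: "indicator {..t} u * \<phi> u = indicator {..1} u * \<phi> u" for u by (auto simp: \<phi>_def indicator_def)
      show ?thesis unfolding z using swap[of 1] by simp
    qed
  qed
  \<comment> \<open>The function that the Abel transform detects. It is a multiple of
    \<open>K_dom\<close> times h, hence integrable, and on (0, 1) it vanishes exactly where h
    does.\<close>
  define f where "f s = indicator {0<..<1} s * s powr (- \<beta>) * h s" for s
  have f_eq: "f s = K_dom s * h s * (\<beta> / cH)" for s
    using cH_pos \<beta>_pos by (simp add: f_def K_dom_def)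
  have f_int: "integrable lborel f" unfolding f_eq using K_domh by simp
  have f_zero: "(LINT s|lborel. indicator {..w} s * f s) = 0" if w: "0 < w" "w \<le> 1" for w
  proof -
    \<comment> \<open>The Abel weight: the power of w - u complements the exponent \<beta> - 1 in
      \<open>dK\<close>, and u^(-\<beta>) cancels its factor u^\<beta>.\<close>
    let ?q = "\<lambda>u. indicator {0<..<w} u * ((w - u) powr (- \<beta>) * u powr (- \<beta>))"
    have inner: "(\<integral>\<^sup>+u. ennreal (?q u * dK s u) \<partial>lborel) = ennreal (cH * B\<^sub>0 * (indicator {0<..<w} s * s powr (- \<beta>)))" for s
    proof (cases "0 < s \<and> s < w")
      case True
      then show ?thesis using nn_integral_abel[of s w] by simp
    next
      case False
      then have z: "?q u * dK s u = 0" for u by (auto simp: indicator_def dK_zero)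
      show ?thesis unfolding z using False by auto
    qed
    have q0: "0 \<le> ?q u * dK s u" for u s using dK_nonneg by (simp add: indicator_def)
    have innerL: "(LINT u|lborel. ?q u * dK s u) = cH * B\<^sub>0 * (indicator {0<..<w} s * s powr (- \<beta>))" for s
    proof -
      have "(LINT u|lborel. ?q u * dK s u) = enn2real (\<integral>\<^sup>+u. ennreal (?q u * dK s u) \<partial>lborel)"
        using q0 by (intro integral_eq_nn_integral) auto
      then show ?thesis unfolding inner using cH_pos B0_pos by (simp add: indicator_def)
    qed
    have "0 = (LINT u|lborel. ?q u * \<phi> u)"
      by (rule integral_eq_zero_AE[symmetric]) (use \<phi>0 in \<open>auto elim: eventually_mono\<close>)
    also have "\<dots> = (LINT u|lborel. LINT s|lborel. ?q u * dK s u * h s)"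
    proof (rule Bochner_Integration.integral_cong[OF refl])
      fix u
      have "?q u * \<phi> u = ?q u * (LINT s|lborel. dK s u * h s)" using w by (auto simp: \<phi>_def indicator_def)
      also have "\<dots> = (LINT s|lborel. ?q u * (dK s u * h s))" by (rule integral_mult_right_zero[symmetric])
      finally show "?q u * \<phi> u = (LINT s|lborel. ?q u * dK s u * h s)" by (simp only: mult.assoc)
    qed
    also have "\<dots> = (LINT s|lborel. LINT u|lborel. ?q u * dK s u * h s)"
    proof (rule lborel_integral_swap[symmetric])
      have "(\<lambda>z. (if 0 < snd z \<and> snd z < w then 1 else 0) * ((w - snd z) powr (- \<beta>) * snd z powr (- \<beta>)) * dK (fst z) (snd z) * h (fst z)) \<in> borel_measurable (borel \<Otimes>\<^sub>M borel)" by measurable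
      then show "(\<lambda>z. ?q (snd z) * dK (fst z) (snd z) * h (fst z)) \<in> borel_measurable (borel \<Otimes>\<^sub>M borel)" by (simp add: indicator_def)
      have "(\<integral>\<^sup>+u. ennreal \<bar>?q u * dK s u * h s\<bar> \<partial>lborel) = ennreal (cH * B\<^sub>0) * ennreal \<bar>indicator {..w} s * f s\<bar>" if "s \<noteq> w" for s
      proof -
        have "(\<integral>\<^sup>+u. ennreal \<bar>?q u * dK s u * h s\<bar> \<partial>lborel) = (\<integral>\<^sup>+u. ennreal (?q u * dK s u) * ennreal \<bar>h s\<bar> \<partial>lborel)"
        proof (rule nn_integral_cong)
          fix u
          have "\<bar>?q u * dK s u * h s\<bar> = (?q u * dK s u) * \<bar>h s\<bar>" unfolding abs_mult[of "?q u * dK s u"] abs_of_nonneg[OF q0] ..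
          then show "ennreal \<bar>?q u * dK s u * h s\<bar> = ennreal (?q u * dK s u) * ennreal \<bar>h s\<bar>" by (simp add: ennreal_mult'')
        qed
        also have "\<dots> = ennreal (cH * B\<^sub>0 * (indicator {0<..<w} s * s powr (- \<beta>))) * ennreal \<bar>h s\<bar>"
          unfolding inner[symmetric] by (rule nn_integral_multc) measurable
        also have "\<dots> = ennreal (cH * B\<^sub>0) * ennreal \<bar>indicator {..w} s * f s\<bar>"
          using cH_pos B0_pos w that by (auto simp: f_def indicator_def ennreal_mult'[symmetric] ennreal_mult''[symmetric] abs_mult mult_ac)
        finally show ?thesis .
      qed
      then have "(\<integral>\<^sup>+s. \<integral>\<^sup>+u. ennreal \<bar>?q u * dK s u * h s\<bar> \<partial>lborel \<partial>lborel) = (\<integral>\<^sup>+s. ennreal (cH * B\<^sub>0) * ennreal \<bar>indicator {..w} s * f s\<bar> \<partial>lborel)"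
        using AE_lborel_singleton[of w] by (intro nn_integral_cong_AE) (auto elim: eventually_mono)
      also have "\<dots> \<le> (\<integral>\<^sup>+s. ennreal (cH * B\<^sub>0) * ennreal (norm (f s)) \<partial>lborel)"
        by (intro nn_integral_mono mult_left_mono ennreal_leI) (auto simp: indicator_def)
      also have "\<dots> < \<infinity>"
        using f_int unfolding integrable_iff_bounded by (subst nn_integral_cmult) (auto simp: ennreal_mult_less_top)
      finally show "(\<integral>\<^sup>+s. \<integral>\<^sup>+u. ennreal \<bar>?q u * dK s u * h s\<bar> \<partial>lborel \<partial>lborel) < \<infinity>" .
    qed
    also have "\<dots> = (LINT s|lborel. cH * B\<^sub>0 * (indicator {..w} s * f s))"
    proof (rule integral_cong_AE)
      show "AE s in lborel. (LINT u|lborel. ?q u * dK s u * h s) = cH * B\<^sub>0 * (indicator {..w} s * f s)"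
        using AE_lborel_singleton[of w]
      proof eventually_elim
        fix s assume "s \<noteq> w"
        have "(LINT u|lborel. ?q u * dK s u * h s) = (LINT u|lborel. ?q u * dK s u) * h s" by (rule integral_mult_left_zero)
        also have "\<dots> = cH * B\<^sub>0 * (indicator {..w} s * f s)"
          unfolding innerL using w \<open>s \<noteq> w\<close> by (auto simp: f_def indicator_def)
        finally show "(LINT u|lborel. ?q u * dK s u * h s) = cH * B\<^sub>0 * (indicator {..w} s * f s)" .
      qed
      have "(\<lambda>z. (if 0 < snd z \<and> snd z < w then 1 else 0) * ((w - snd z) powr (- \<beta>) * snd z powr (- \<beta>)) * dK (fst z) (snd z) * h (fst z)) \<in> borel_measurable (lborel \<Otimes>\<^sub>M lborel)" by measurable
      then show "(\<lambda>s. LINT u|lborel. ?q u * dK s u * h s) \<in> borel_measurable lborel"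
        by (intro lborel.borel_measurable_lebesgue_integral) (simp add: indicator_def case_prod_beta')
      show "(\<lambda>s. cH * B\<^sub>0 * (indicator {..w} s * f s)) \<in> borel_measurable lborel" using f_int by measurable
    qed
    finally show ?thesis using cH_pos B0_pos by simp
  qed
  have "AE s in lborel. f s = 0"
  proof (rule integrable_AE_zero_of_integrals_atMost[OF f_int])
    fix t :: real
    consider "t \<le> 0" | "0 < t" "t \<le> 1" | "1 < t" by linarith
    then show "(LINT u|lborel. indicator {..t} u * f u) = 0"
    proof cases
      case 1
      then have z: "indicator {..t} u * f u = 0" for u by (auto simp: indicator_def f_def)
      show ?thesis unfolding z by simp
    next
      case 2
      then show ?thesis by (rule f_zero)
    next
      case 3
      then have z: "indicator {..t} u * f u = indicator {..1} u * f u" for u by (auto simp: f_def indicator_def)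
      show ?thesis unfolding z using f_zero[of 1] by simp
    qed
  qed
  then show ?thesis by eventually_elim (auto simp: f_def)
qed

text \<open>Members of \<open>L2_time\<close> are only Lebesgue measurable. A Borel function equal
  almost everywhere, cut to [0, 1], has the same integrals against the kernels.\<close>

lemma K_injective:
  fixes g :: "real \<Rightarrow> real"
  assumes g: "g \<in> borel_measurable L01" "integrable L01 (\<lambda>s. (g s)\<^sup>2)"
    and zero: "\<And>t. t \<in> {0..1} \<Longrightarrow> (LINT s|L01. K_kernel H t s * g s) = 0"
  shows "AE s in L01. g s = 0"
proof -
  have gl: "(\<lambda>s. indicator {0..1} s * g s) \<in> borel_measurable lebesgue"
    using g(1) by (subst (asm) borel_measurable_restrict_space_iff) auto
  from completion_ex_borel_measurable_real[OF this]
  obtain h0 where h0: "h0 \<in> borel_measurable lborel" "AE s in lborel. indicator {0..1} s * g s = h0 s" by blast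
  define h where "h s = indicator {0..1} s * h0 s" for s
  have h[measurable]: "h \<in> borel_measurable borel" unfolding h_def using h0(1) by measurable
  have hg: "AE s in lebesgue. indicator {0..1} s * g s = h s"
    using AE_completion[OF h0(2)]
  proof eventually_elim
    case (elim s)
    then show ?case by (cases "s \<in> {0..1}") (auto simp: h_def)
  qed
  have tr: "(LINT s|L01. k s * g s) = (LINT s|lborel. k s * h s)" if k[measurable]: "k \<in> borel_measurable borel" for k
  proof -
    have kl: "k \<in> borel_measurable lebesgue" using k by (simp add: measurable_completion)
    have hl: "h \<in> borel_measurable lebesgue" using h by (simp add: measurable_completion)
    have "(LINT s|L01. k s * g s) = (LINT s|lebesgue. k s * (indicator {0..1} s * g s))"
      by (subst integral_restrict_space) (auto simp: mult_ac)
    also have "\<dots> = (LINT s|lebesgue. k s * h s)"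
      by (rule integral_cong_AE) (use kl hl gl hg in \<open>auto elim: eventually_mono\<close>)
    also have "\<dots> = (LINT s|lborel. k s * h s)" by (rule integral_completion) measurable
    finally show ?thesis .
  qed
  have h2: "integrable lborel (\<lambda>s. (h s)\<^sup>2)"
  proof -
    have "integrable lebesgue (\<lambda>s. indicator {0..1} s *\<^sub>R (g s)\<^sup>2)"
      using g(2) by (subst (asm) integrable_restrict_space) auto
    then have "integrable lebesgue (\<lambda>s. (h s)\<^sup>2)"
    proof (rule integrable_cong_AE_imp)
      show "(\<lambda>s. (h s)\<^sup>2) \<in> borel_measurable lebesgue" using h by (simp add: measurable_completion)
      show "AE s in lebesgue. indicator {0..1} s *\<^sub>R (g s)\<^sup>2 = (h s)\<^sup>2"
        using hg by eventually_elim (auto simp: indicator_def)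
    qed
    then show ?thesis by (subst (asm) integrable_completion) auto
  qed
  have "AE s in lborel. s \<in> {0<..<1} \<longrightarrow> h s = 0"
  proof (rule K_injective_borel[OF h h2])
    fix t :: real assume t: "t \<in> {0..1}"
    have "K_kernel H t \<in> borel_measurable borel" by measurable
    from tr[OF this] zero[OF t] show "(LINT s|lborel. K_kernel H t s * h s) = 0" by simp
  qed
  then have "AE s in lborel. s \<in> {0..1} \<longrightarrow> h s = 0"
    using AE_lborel_singleton[of 0] AE_lborel_singleton[of 1] by eventually_elim auto
  from AE_completion[OF this] hg have "AE s in lebesgue. s \<in> {0..1} \<longrightarrow> g s = 0"
    by eventually_elim (auto simp: indicator_def)
  then show ?thesis by (subst AE_restrict_space_iff) auto
qed

lemma K_op_injective:
  fixes h k :: "real \<Rightarrow> real^'n"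
  assumes h: "h \<in> L2_time" and k: "k \<in> L2_time" and eq: "K_op H h = K_op H k"
  shows "AE s in L01. h s = k s"
proof -
  have d: "(\<lambda>s. h s - k s) \<in> L2_time" by (rule L2_time_diff[OF h k])
  have comp: "AE s in L01. (h s - k s) $ j = 0" for j
  proof (rule K_injective)
    have m: "(\<lambda>s. h s - k s) \<in> borel_measurable L01" using d by (simp add: L2_time_iff)
    have vm: "(\<lambda>x. x $ j) \<in> borel_measurable (borel :: (real^'n) measure)"
      by (intro borel_measurable_continuous_onI continuous_intros)
    show m': "(\<lambda>s. (h s - k s) $ j) \<in> borel_measurable L01" by (rule measurable_compose[OF m vm])
    show "integrable L01 (\<lambda>s. ((h s - k s) $ j)\<^sup>2)"
    proof (rule Bochner_Integration.integrable_bound)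
      show "integrable L01 (\<lambda>s. (norm (h s - k s))\<^sup>2)" using d by (simp add: L2_time_iff)
      have "\<bar>(h s - k s) $ j\<bar>\<^sup>2 \<le> (norm (h s - k s))\<^sup>2" for s by (intro power_mono component_le_norm_cart) simp
      then show "AE s in L01. norm (((h s - k s) $ j)\<^sup>2) \<le> norm ((norm (h s - k s))\<^sup>2)" by simp
    qed (use m' in measurable)
    fix t :: real assume t: "t \<in> {0..1}"
    have "(LINT s|L01. K_kernel H t s *\<^sub>R (h s - k s)) = 0"
      using K_op_apply01[OF h t] K_op_apply01[OF k t] eq K_h_integrable[OF h, of t] K_h_integrable[OF k, of t] t
      by (simp add: scaleR_right_diff_distrib)
    moreover have "(LINT s|L01. (K_kernel H t s *\<^sub>R (h s - k s)) $ j) = (LINT s|L01. K_kernel H t s *\<^sub>R (h s - k s)) $ j"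
      using K_h_integrable[OF d, of t] t by (intro integral_bounded_linear[OF bounded_linear_vec_nth]) auto
    ultimately show "(LINT s|L01. K_kernel H t s * (h s - k s) $ j) = 0" by simp
  qed
  then have "AE s in L01. \<forall>j. (h s - k s) $ j = 0" by (subst AE_all_countable) simp
  then show ?thesis by eventually_elim (simp add: vec_eq_iff)
qed

text \<open>Injectivity makes the arbitrary choice in \<open>K_inv\<close> harmless: it returns the
  given preimage up to a null set.\<close>

lemma K_inv_L2:
  assumes "h \<in> L2_time"
  shows "K_inv H (K_op H h) \<in> L2_time" and "AE s in L01. K_inv H (K_op H h) s = h s"
proof -
  have *: "K_inv H (K_op H h) \<in> L2_time \<and> K_op H (K_inv H (K_op H h)) = K_op H h"
    unfolding K_inv_def by (rule someI[of "\<lambda>k. k \<in> L2_time \<and> K_op H k = K_op H h" h]) (simp add: assms)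
  then show "K_inv H (K_op H h) \<in> L2_time" by simp
  show "AE s in L01. K_inv H (K_op H h) s = h s"
    using * assms by (intro K_op_injective) auto
qed

lemma K_inv_energy:
  assumes h: "h \<in> L2_time"
  shows "(LINT s|L01. K_inv H (K_op H h) s \<bullet> K_inv H (K_op H h) s) = (LINT s|L01. (norm (h s))\<^sup>2)"
proof (rule integral_cong_AE)
  have "K_inv H (K_op H h) \<in> borel_measurable L01" "h \<in> borel_measurable L01"
    using K_inv_L2(1)[OF h] h by (simp_all add: L2_time_iff)
  then show "(\<lambda>s. K_inv H (K_op H h) s \<bullet> K_inv H (K_op H h) s) \<in> borel_measurable L01" "(\<lambda>s. (norm (h s))\<^sup>2) \<in> borel_measurable L01"
    by measurable
  show "AE s in L01. K_inv H (K_op H h) s \<bullet> K_inv H (K_op H h) s = (norm (h s))\<^sup>2"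
    using K_inv_L2(2)[OF h] by eventually_elim (simp add: power2_norm_eq_inner)
qed

end

section \<open>The constant\<close>

text \<open>Gamma is log-convex and takes the value 1 at both 1 and 2.\<close>

lemma Gamma_le_1:
  fixes x :: real
  assumes "1 \<le> x" "x \<le> 2" shows "Gamma x \<le> 1"
proof -
  have "(ln \<circ> Gamma) ((1 - (x - 1)) *\<^sub>R 1 + (x - 1) *\<^sub>R 2) \<le> (1 - (x - 1)) * (ln \<circ> Gamma) 1 + (x - 1) * (ln \<circ> Gamma) (2 :: real)"
    by (rule convex_onD[OF log_convex_Gamma_real]) (use assms in auto)
  moreover have "Gamma (2 :: real) = 1" using Gamma_plus1[of "1::real"] by simp
  ultimately have "ln (Gamma x) \<le> 0" by simp
  moreover have "0 < Gamma x" using assms by (intro Gamma_real_pos) simp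
  ultimately show ?thesis by (simp add: ln_le_zero_iff)
qed

lemma mult_Gamma_le_1:
  fixes x :: real
  assumes "0 < x" "x \<le> 1" shows "x * Gamma x \<le> 1"
proof -
  have "x \<notin> \<int>\<^sub>\<le>\<^sub>0" using assms(1) by (auto dest: nonpos_Ints_nonpos)
  then show ?thesis using Gamma_plus1[of x] Gamma_le_1[of "x + 1"] assms by simp
qed

text \<open>The bound is tested at s = 1 and a small t, where K(1, t) is close to c_H t^(-\<beta>) /
  (2 \<beta>). This bounds \<open>C\<^sub>1\<close> below by a multiple of c_H / \<beta>, and x
  Gamma(x) <= 1 on (0, 1] removes the Gamma functions contained in c_H.\<close>

lemma (in hurst_parameter) kernel_bound_constant:
  assumes bound: "\<And>s t. 0 < t \<Longrightarrow> t \<le> s \<Longrightarrow> s \<le> 1 \<Longrightarrow> \<bar>K_kernel H s t\<bar> \<le> C\<^sub>1 * t powr (- \<beta>)"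
  shows "(Gamma (1 - \<beta>))\<^sup>2 * (1 - 2 * \<beta>) \<le> 5 * C\<^sub>1\<^sup>2"
proof -
  \<comment> \<open>Since q >= 1 - r, any r in (0, 1) with 5 (1 - r)^2 / 4 >= 1 serves; 1/10 gives
    81/80.\<close>
  define r where "r = (1/10 :: real)"
  define q where "q = (9/10 :: real) powr (2 * \<beta>)"
  have q: "9/10 \<le> q"
  proof -
    have "(9/10 :: real) powr 1 \<le> q" unfolding q_def using \<beta>_lt by (intro powr_mono') auto
    then show ?thesis by simp
  qed
  have "ennreal (cH * r powr (- \<beta>) * (q / (2 * \<beta>)))
    = ennreal (cH * r powr (- \<beta>)) * (\<integral>\<^sup>+u. ennreal ((u - r) powr (2 * \<beta> - 1)) * indicator {r<..<1} u \<partial>lborel)"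
    using cH_pos \<beta>_pos by (subst nn_integral_powr_left) (auto simp: r_def q_def ennreal_mult'[symmetric])
  also have "\<dots> = (\<integral>\<^sup>+u. ennreal (cH * r powr (- \<beta>)) * (ennreal ((u - r) powr (2 * \<beta> - 1)) * indicator {r<..<1} u) \<partial>lborel)"
    by (rule nn_integral_cmult[symmetric]) measurable
  also have "\<dots> \<le> (\<integral>\<^sup>+u. ennreal (indicator {..1} u * dK r u) \<partial>lborel)"
  proof (rule nn_integral_mono)
    fix u
    show "ennreal (cH * r powr (- \<beta>)) * (ennreal ((u - r) powr (2 * \<beta> - 1)) * indicator {r<..<1} u) \<le> ennreal (indicator {..1} u * dK r u)"
    proof (cases "r < u \<and> u < 1")
      case True
      \<comment> \<open>Lowering u^\<beta> to (u - r)^\<beta> makes the integral an explicit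
        power.\<close>
      have "(u - r) powr (2 * \<beta> - 1) = (u - r) powr \<beta> * (u - r) powr (\<beta> - 1)"
        by (simp add: powr_add[symmetric])
      also have "\<dots> \<le> u powr \<beta> * (u - r) powr (\<beta> - 1)"
        using True \<beta>_pos by (intro mult_right_mono powr_mono2) (auto simp: r_def)
      finally have "cH * r powr (- \<beta>) * (u - r) powr (2 * \<beta> - 1) \<le> dK r u"
        using True cH_pos by (simp add: dK_def r_def mult.assoc mult_left_mono)
      then show ?thesis using True cH_pos by (simp add: ennreal_mult'[symmetric] ennreal_leI)
    qed auto
  qed
  also have "\<dots> = ennreal (K_kernel H 1 r)" by (rule K_nn[symmetric])
  finally have "cH * r powr (- \<beta>) * (q / (2 * \<beta>)) \<le> K_kernel H 1 r"
    using K_nonneg by (simp add: ennreal_le_iff)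
  also have "\<dots> \<le> C\<^sub>1 * r powr (- \<beta>)" using bound[of r 1] by (simp add: r_def)
  finally have "r powr (- \<beta>) * (cH * (q / (2 * \<beta>))) \<le> r powr (- \<beta>) * C\<^sub>1" by (simp add: mult_ac)
  then have C1: "cH * (q / (2 * \<beta>)) \<le> C\<^sub>1" by (rule mult_left_le_imp_le) (simp add: r_def)
  have "cH\<^sup>2 * (q\<^sup>2 / (2 * \<beta>)\<^sup>2) \<le> C\<^sub>1\<^sup>2"
    using power_mono[OF C1, of 2] cH_pos \<beta>_pos q by (simp add: power_mult_distrib power_divide)
  moreover have "cH\<^sup>2 * ((9/10)\<^sup>2 / (2 * \<beta>)\<^sup>2) \<le> cH\<^sup>2 * (q\<^sup>2 / (2 * \<beta>)\<^sup>2)"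
    using q by (intro mult_left_mono divide_right_mono power_mono) auto
  ultimately have C1_sq: "cH\<^sup>2 * ((81/100) / (2 * \<beta>)\<^sup>2) \<le> C\<^sub>1\<^sup>2" by (simp add: power2_eq_square)
  define a where "a = Gamma (1 - 2 * \<beta>)"
  define b where "b = Gamma \<beta>"
  define c where "c = Gamma (1 - \<beta>)"
  have pos: "0 < a" "0 < b" "0 < c" using \<beta>_pos \<beta>_lt by (auto simp: a_def b_def c_def intro!: Gamma_real_pos)
  have a: "(1 - 2 * \<beta>) * a \<le> 1" and b: "\<beta> * b \<le> 1" and c: "(1 - \<beta>) * c \<le> 1"
    unfolding a_def b_def c_def using \<beta>_pos \<beta>_lt by (auto intro!: mult_Gamma_le_1)
  have Bt: "Beta (1 - 2 * \<beta>) \<beta> = a * b / c"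
    by (simp add: Beta_def a_def b_def c_def)
  have cH': "cH\<^sup>2 = (\<beta> + 1/2) * (2 * \<beta>) * c / (a * b)" unfolding cH_sq Bt by simp
  have p: "1 - \<beta> > 0" "1 - 2 * \<beta> > 0" using \<beta>_lt by auto
  have "c * ((1 - 2 * \<beta>) * a) * (\<beta> * b) \<le> c * 1 * 1"
    using a b pos p \<beta>_pos by (intro mult_mono) auto
  also have "c \<le> 1 / (1 - \<beta>)" using c p by (simp add: field_simps)
  then have "c * 1 * 1 \<le> 1 / (1 - \<beta>)" by simp
  \<comment> \<open>The factor 81/80 is what the last identity offers and exceeds 1; moreover (1 -
    \<beta>) (1 + 2 \<beta>) = 1 + \<beta> (1 - 2 \<beta>) >= 1.\<close>
  also have "\<dots> \<le> (1 + 2 * \<beta>) * (81 / 80)"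
  proof -
    have "1 \<le> (1 - \<beta>) * (1 + 2 * \<beta>)" using \<beta>_pos \<beta>_lt mult_nonneg_nonneg[of \<beta> "1 - 2 * \<beta>"] by (simp add: algebra_simps)
    also have "\<dots> \<le> (1 - \<beta>) * ((1 + 2 * \<beta>) * (81 / 80))" using p \<beta>_pos by (intro mult_left_mono) auto
    finally show ?thesis using p by (simp add: field_simps)
  qed
  finally have key: "c * ((1 - 2 * \<beta>) * a) * (\<beta> * b) \<le> (1 + 2 * \<beta>) * (81 / 80)" .
  have "c\<^sup>2 * (1 - 2 * \<beta>) = (c * ((1 - 2 * \<beta>) * a) * (\<beta> * b)) * (c / (a * b * \<beta>))"
    using pos \<beta>_pos by (simp add: field_simps power2_eq_square)
  also have "\<dots> \<le> ((1 + 2 * \<beta>) * (81 / 80)) * (c / (a * b * \<beta>))"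
    using key pos \<beta>_pos by (intro mult_right_mono) auto
  also have "\<dots> = 5 * (cH\<^sup>2 * ((81/100) / (2 * \<beta>)\<^sup>2))"
    unfolding cH' using pos \<beta>_pos by (simp add: field_simps power2_eq_square)
  also have "\<dots> \<le> 5 * C\<^sub>1\<^sup>2" using C1_sq by simp
  finally show ?thesis by (simp add: c_def)
qed

text \<open>The terms with numerators 1 and 4 combine to 5 / D in \<open>C\<close> and to 5
  \<open>C\<^sub>1\<close>^2 / D in \<open>Chat\<close>. The lower bound on \<open>C\<^sub>1\<close>
  thus makes both \<open>C\<^sub>1\<close>^2 \<open>C\<close> and \<open>Chat\<close> at least
  1.\<close>

lemma (in hurst_parameter) constant_le:
  fixes C\<^sub>1 C\<^sub>2 :: real
  assumes bound: "\<And>s t. 0 < t \<Longrightarrow> t \<le> s \<Longrightarrow> s \<le> 1 \<Longrightarrow> \<bar>K_kernel H s t\<bar> \<le> C\<^sub>1 * t powr (1/2 - H)"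
    and \<alpha>: "0 < \<alpha>"
    and C: "C = 1 / ((Gamma (3/2 - H))\<^sup>2 * (2 - 2*H)) + 4 / ((Gamma (3/2 - H))\<^sup>2 * (2 - 2*H))
      + C\<^sub>2\<^sup>2 * (H - 1/2)\<^sup>2 / ((Gamma (3/2 - H))\<^sup>2 * (2 - 2*H))"
    and Chat: "Chat = C\<^sub>1\<^sup>2 / ((Gamma (3/2 - H))\<^sup>2 * (2 - 2*H)) + 4 * C\<^sub>1\<^sup>2 / ((Gamma (3/2 - H))\<^sup>2 * (2 - 2*H))
      + 2 * (c_const H)\<^sup>2 * ((Beta (H - 1/2) (3/2 - H))\<^sup>2 + 1 / (H - 1/2)\<^sup>2) / (Gamma (3/2 - H))\<^sup>2
      + C\<^sub>1\<^sup>2 * C\<^sub>2\<^sup>2 * (H - 1/2)\<^sup>2 / ((Gamma (3/2 - H))\<^sup>2 * (2 - 2*H))"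
  shows "1 + \<alpha>\<^sup>2 * (1 + \<alpha>)\<^sup>2 / (1 - 2 * \<beta>)
    \<le> 1 + 4 * \<alpha>^4 * exp (2*\<alpha>) * C\<^sub>1\<^sup>2 * (1 + \<alpha>\<^sup>2) * C / (2 - 2*H) + 2 * \<alpha>\<^sup>2 * Chat / (2 - 2*H)"
proof -
  define D where "D = (Gamma (3/2 - H))\<^sup>2 * (2 - 2*H)"
  have eqs: "3/2 - H = 1 - \<beta>" "2 - 2 * H = 1 - 2 * \<beta>" "1/2 - H = - \<beta>" by (simp_all add: \<beta>_def field_simps)
  have b: "0 < 1 - 2 * \<beta>" using \<beta>_lt by simp
  have "0 < Gamma (1 - \<beta>)" using \<beta>_lt by (intro Gamma_real_pos) simp
  then have D: "0 < D" unfolding D_def eqs using b by (intro mult_pos_pos zero_less_power)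
  have "D \<le> 5 * C\<^sub>1\<^sup>2" unfolding D_def eqs using bound unfolding eqs by (rule kernel_bound_constant)
  then have D5: "1 \<le> 5 * C\<^sub>1\<^sup>2 / D" using D by simp
  have "1 \<le> Chat"
  proof -
    have "0 \<le> 2 * (c_const H)\<^sup>2 * ((Beta (H - 1/2) (3/2 - H))\<^sup>2 + 1 / (H - 1/2)\<^sup>2) / (Gamma (3/2 - H))\<^sup>2" by simp
    moreover have "0 \<le> C\<^sub>1\<^sup>2 * C\<^sub>2\<^sup>2 * (H - 1/2)\<^sup>2 / D" using D by simp
    moreover have "C\<^sub>1\<^sup>2 / D + 4 * C\<^sub>1\<^sup>2 / D = 5 * C\<^sub>1\<^sup>2 / D" by (simp add: field_simps)
    ultimately show ?thesis unfolding Chat D_def[symmetric] using D5 by linarith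
  qed
  then have "2 * \<alpha>\<^sup>2 * 1 \<le> 2 * \<alpha>\<^sup>2 * Chat" by (intro mult_left_mono) auto
  moreover have "1 \<le> C\<^sub>1\<^sup>2 * C"
  proof -
    have "C = 5 / D + C\<^sub>2\<^sup>2 * (H - 1/2)\<^sup>2 / D" unfolding C D_def[symmetric] by (simp add: field_simps)
    then have "C\<^sub>1\<^sup>2 * C = 5 * C\<^sub>1\<^sup>2 / D + C\<^sub>1\<^sup>2 * (C\<^sub>2\<^sup>2 * (H - 1/2)\<^sup>2 / D)" by (simp add: algebra_simps)
    moreover have "0 \<le> C\<^sub>1\<^sup>2 * (C\<^sub>2\<^sup>2 * (H - 1/2)\<^sup>2 / D)" using D by simp
    ultimately show ?thesis using D5 by linarith
  qed
  then have "4 * \<alpha>^4 * 1 * 1 * 1 \<le> 4 * \<alpha>^4 * exp (2*\<alpha>) * (C\<^sub>1\<^sup>2 * C) * (1 + \<alpha>\<^sup>2)"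
    using \<alpha> by (intro mult_mono) auto
  \<comment> \<open>By (1 + \<alpha>)^2 <= 2 + 2 \<alpha>^2 the factor splits into 2 \<alpha>^2,
    absorbed by the term with \<open>Chat\<close>, and 2 \<alpha>^4, absorbed by the term with
    \<open>C\<close>.\<close>
  moreover have "\<alpha>\<^sup>2 * (1 + \<alpha>)\<^sup>2 \<le> 2 * \<alpha>\<^sup>2 + 2 * \<alpha>^4"
  proof -
    have "(1 + \<alpha>)\<^sup>2 \<le> 2 + 2 * \<alpha>\<^sup>2" using zero_le_power2[of "1 - \<alpha>"] by (simp add: power2_eq_square algebra_simps)
    then have "\<alpha>\<^sup>2 * (1 + \<alpha>)\<^sup>2 \<le> \<alpha>\<^sup>2 * (2 + 2 * \<alpha>\<^sup>2)" by (rule mult_left_mono) simp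
    then show ?thesis by (simp add: algebra_simps power2_eq_square power4_eq_xxxx)
  qed
  moreover have "0 \<le> \<alpha>^4" by simp
  moreover have "4 * \<alpha>^4 * exp (2*\<alpha>) * C\<^sub>1\<^sup>2 * (1 + \<alpha>\<^sup>2) * C = 4 * \<alpha>^4 * exp (2*\<alpha>) * (C\<^sub>1\<^sup>2 * C) * (1 + \<alpha>\<^sup>2)" by (simp only: mult_ac)
  ultimately have "\<alpha>\<^sup>2 * (1 + \<alpha>)\<^sup>2 \<le> 4 * \<alpha>^4 * exp (2*\<alpha>) * C\<^sub>1\<^sup>2 * (1 + \<alpha>\<^sup>2) * C + 2 * \<alpha>\<^sup>2 * Chat"
    by linarith
  from divide_right_mono[OF this, of "1 - 2 * \<beta>"] b
  show ?thesis unfolding eqs by (simp add: add_divide_distrib)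
qed

section \<open>Energy of gradients\<close>

text \<open>Members of \<open>gradient_space\<close> are known only almost everywhere, so
  measurability of their energies has to pass through a null set, which completeness
  permits.\<close>

lemma borel_measurable_completion_AE:
  fixes f g :: "'a \<Rightarrow> 'b::topological_space"
  assumes f: "f \<in> borel_measurable (completion M)" and eq: "AE x in completion M. f x = g x"
  shows "g \<in> borel_measurable (completion M)"
proof (rule measurableI)
  fix A :: "'b set" assume A: "A \<in> sets borel"
  show "g -` A \<inter> space (completion M) \<in> sets (completion M)"
  proof (rule completion.in_sets_AE)
    show "f -` A \<inter> space (completion M) \<in> sets (completion M)" using f A by (rule measurable_sets)
    show "AE x in completion M. x \<in> f -` A \<inter> space (completion M) \<longleftrightarrow> x \<in> g -` A \<inter> space (completion M)"
      using eq by eventually_elim auto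
  qed auto
qed simp

lemma integrable_completion_AE:
  fixes f g :: "'a \<Rightarrow> 'b::{banach, second_countable_topology}"
  assumes f: "integrable (completion M) f" and eq: "AE x in completion M. f x = g x"
  shows "integrable (completion M) g"
  using f borel_measurable_completion_AE[OF borel_measurable_integrable[OF f] eq] eq
  by (rule integrable_cong_AE_imp)

text \<open>Young's inequality with a free weight: it replaces the triangle inequality for the norm
  of \<open>HH_inner\<close>, and e is sent to 0 after the approximation.\<close>

lemma norm_sq_le_eps:
  fixes x y :: "'a::real_inner"
  assumes "0 < e"
  shows "(norm x)\<^sup>2 \<le> (1 + e) * (norm y)\<^sup>2 + (1 + 1 / e) * (norm (x - y))\<^sup>2"
proof -
  define a b where "a = norm y" and "b = norm (x - y)"
  have "norm x \<le> a + b" unfolding a_def b_def using norm_triangle_ineq[of y "x - y"] by simp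
  then have "(norm x)\<^sup>2 \<le> (a + b)\<^sup>2" by (intro power_mono) auto
  moreover have "2 * a * b \<le> e * a\<^sup>2 + b\<^sup>2 / e"
  proof -
    have "0 \<le> (e * a - b)\<^sup>2 / e" using assms by simp
    also have "\<dots> = e * a\<^sup>2 - 2 * a * b + b\<^sup>2 / e" using assms by (simp add: power2_eq_square field_simps)
    finally show ?thesis by simp
  qed
  ultimately show ?thesis unfolding a_def[symmetric] b_def[symmetric] by (simp add: power2_sum algebra_simps)
qed

definition energy :: "real \<Rightarrow> (real \<Rightarrow>\<^sub>C (real^'n)) \<Rightarrow> real" where
  "energy H g = (LINT t|L01. K_inv H g t \<bullet> K_inv H g t)"

lemma energy_nonneg: "0 \<le> energy H g"
  unfolding energy_def by (intro Bochner_Integration.integral_nonneg) simp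

lemma HH_inner_energy: "HH_inner H \<nu> G G = (LINT \<omega>|completion \<nu>. energy H (G \<omega>))"
  unfolding HH_inner_def energy_def ..

lemma HH_inner_nonneg: "0 \<le> HH_inner H \<nu> G G"
  unfolding HH_inner_energy by (intro Bochner_Integration.integral_nonneg energy_nonneg)

lemma L2_process_energy:
  assumes "prob_space \<nu>" and u: "u \<in> L2_process \<nu>"
  shows "AE \<omega> in completion \<nu>. u \<omega> \<in> L2_time"
    and "integrable (completion \<nu>) (\<lambda>\<omega>. LINT t|L01. (norm (u \<omega> t))\<^sup>2)"
proof -
  interpret N: prob_space "completion \<nu>" by (rule prob_space.prob_space_completion) fact
  interpret L: finite_measure L01 by (rule finite_measure_L01)
  interpret P: pair_sigma_finite "completion \<nu>" L01 ..
  have m: "case_prod u \<in> borel_measurable (completion \<nu> \<Otimes>\<^sub>M L01)"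
    and i: "integrable (completion \<nu> \<Otimes>\<^sub>M L01) (\<lambda>z. (norm (u (fst z) (snd z)))\<^sup>2)"
    using u by (auto simp: L2_process_def case_prod_beta')
  show "integrable (completion \<nu>) (\<lambda>\<omega>. LINT t|L01. (norm (u \<omega> t))\<^sup>2)"
    using P.integrable_fst'[OF i] by simp
  from P.AE_integrable_fst'[OF i] AE_space
  show "AE \<omega> in completion \<nu>. u \<omega> \<in> L2_time"
  proof eventually_elim
    case (elim \<omega>)
    have "u \<omega> \<in> borel_measurable L01" using measurable_Pair2[OF m elim(2)] by simp
    then show ?case using elim(1) by (simp add: L2_time_iff)
  qed
qed

lemma gradient_space_diff:
  assumes G: "G \<in> gradient_space H \<nu>" and G': "G' \<in> gradient_space H \<nu>"
    and "prob_space \<nu>" "hurst_parameter H"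
  shows "(\<lambda>\<omega>. G \<omega> - G' \<omega>) \<in> gradient_space H \<nu>"
proof -
  interpret hurst_parameter H by fact
  obtain u where u: "u \<in> L2_process \<nu>" "AE \<omega> in completion \<nu>. G \<omega> = K_op H (u \<omega>)"
    using G by (auto simp: gradient_space_def)
  obtain v where v: "v \<in> L2_process \<nu>" "AE \<omega> in completion \<nu>. G' \<omega> = K_op H (v \<omega>)"
    using G' by (auto simp: gradient_space_def)
  have m[measurable]: "(\<lambda>z. u (fst z) (snd z)) \<in> borel_measurable (completion \<nu> \<Otimes>\<^sub>M L01)" "(\<lambda>z. v (fst z) (snd z)) \<in> borel_measurable (completion \<nu> \<Otimes>\<^sub>M L01)"
    and i: "integrable (completion \<nu> \<Otimes>\<^sub>M L01) (\<lambda>z. (norm (u (fst z) (snd z)))\<^sup>2)" "integrable (completion \<nu> \<Otimes>\<^sub>M L01) (\<lambda>z. (norm (v (fst z) (snd z)))\<^sup>2)"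
    using u(1) v(1) by (auto simp: L2_process_def case_prod_beta')
  have "integrable (completion \<nu> \<Otimes>\<^sub>M L01) (\<lambda>z. (norm (u (fst z) (snd z) - v (fst z) (snd z)))\<^sup>2)"
  proof (rule Bochner_Integration.integrable_bound[where f="\<lambda>z. 2 * (norm (u (fst z) (snd z)))\<^sup>2 + 2 * (norm (v (fst z) (snd z)))\<^sup>2"])
    show "AE z in completion \<nu> \<Otimes>\<^sub>M L01. norm ((norm (u (fst z) (snd z) - v (fst z) (snd z)))\<^sup>2)
      \<le> norm (2 * (norm (u (fst z) (snd z)))\<^sup>2 + 2 * (norm (v (fst z) (snd z)))\<^sup>2)"
    proof (rule AE_I2)
      fix z
      show "norm ((norm (u (fst z) (snd z) - v (fst z) (snd z)))\<^sup>2)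
      \<le> norm (2 * (norm (u (fst z) (snd z)))\<^sup>2 + 2 * (norm (v (fst z) (snd z)))\<^sup>2)"
        using norm_sq_le_eps[of 1 "u (fst z) (snd z) - v (fst z) (snd z)" "- v (fst z) (snd z)"] by simp
    qed
    show "integrable (completion \<nu> \<Otimes>\<^sub>M L01) (\<lambda>z. 2 * (norm (u (fst z) (snd z)))\<^sup>2 + 2 * (norm (v (fst z) (snd z)))\<^sup>2)"
      using i by simp
    show "(\<lambda>z. (norm (u (fst z) (snd z) - v (fst z) (snd z)))\<^sup>2) \<in> borel_measurable (completion \<nu> \<Otimes>\<^sub>M L01)"
      by measurable
  qed
  then have "(\<lambda>\<omega> t. u \<omega> t - v \<omega> t) \<in> L2_process \<nu>"
    unfolding L2_process_def case_prod_beta' by simp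
  moreover have "AE \<omega> in completion \<nu>. G \<omega> - G' \<omega> = K_op H (\<lambda>t. u \<omega> t - v \<omega> t)"
    using u(2) v(2) L2_process_energy(1)[OF assms(3) u(1)] L2_process_energy(1)[OF assms(3) v(1)]
    by eventually_elim (simp add: K_op_diff)
  ultimately show ?thesis unfolding gradient_space_def mem_Collect_eq by (intro bexI)
qed

context hurst_parameter
begin

text \<open>The representatives picked by \<open>K_inv\<close> need not be jointly measurable, but
  their energy agrees almost surely with that of the process u, which is.\<close>

lemma gradient_space_energy:
  fixes G :: "(real \<Rightarrow>\<^sub>C (real^'n)) \<Rightarrow> (real \<Rightarrow>\<^sub>C (real^'n))"
  assumes "prob_space \<nu>" and G: "G \<in> gradient_space H \<nu>"
  shows "AE \<omega> in completion \<nu>. G \<omega> \<in> K_op H ` L2_time"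
    and "integrable (completion \<nu>) (\<lambda>\<omega>. energy H (G \<omega>))"
proof -
  obtain u where u: "u \<in> L2_process \<nu>" "AE \<omega> in completion \<nu>. G \<omega> = K_op H (u \<omega>)"
    using G by (auto simp: gradient_space_def)
  note e = L2_process_energy[OF assms(1) u(1)]
  show "AE \<omega> in completion \<nu>. G \<omega> \<in> K_op H ` L2_time"
    using u(2) e(1) by eventually_elim auto
  have "AE \<omega> in completion \<nu>. (LINT t|L01. (norm (u \<omega> t))\<^sup>2) = energy H (G \<omega>)"
    using u(2) e(1) by eventually_elim (simp add: energy_def K_inv_energy)
  from integrable_completion_AE[OF e(2) this] show "integrable (completion \<nu>) (\<lambda>\<omega>. energy H (G \<omega>))" .
qed

lemma energy_le:
  assumes h: "h \<in> L2_time" and k: "k \<in> L2_time" and e: "0 < e"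
  shows "energy H (K_op H h) \<le> (1 + e) * energy H (K_op H k) + (1 + 1 / e) * energy H (K_op H h - K_op H k)"
proof -
  have d: "(\<lambda>t. h t - k t) \<in> L2_time" by (rule L2_time_diff[OF h k])
  have i: "integrable L01 (\<lambda>t. (norm (h t))\<^sup>2)" "integrable L01 (\<lambda>t. (norm (k t))\<^sup>2)" "integrable L01 (\<lambda>t. (norm (h t - k t))\<^sup>2)"
    using h k d by (auto simp: L2_time_iff)
  have "(LINT t|L01. (norm (h t))\<^sup>2) \<le> (LINT t|L01. (1 + e) * (norm (k t))\<^sup>2 + (1 + 1 / e) * (norm (h t - k t))\<^sup>2)"
    using norm_sq_le_eps[OF e] i by (intro integral_mono) auto
  also have "\<dots> = (1 + e) * (LINT t|L01. (norm (k t))\<^sup>2) + (1 + 1 / e) * (LINT t|L01. (norm (h t - k t))\<^sup>2)"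
    using i by simp
  finally show ?thesis unfolding energy_def K_op_diff[OF h k] K_inv_energy[OF h] K_inv_energy[OF k] K_inv_energy[OF d] .
qed

lemma HH_inner_le:
  assumes \<nu>: "prob_space \<nu>" and G: "G \<in> gradient_space H \<nu>" and G': "G' \<in> gradient_space H \<nu>" and e: "0 < e"
  shows "HH_inner H \<nu> G G \<le> (1 + e) * HH_inner H \<nu> G' G' + (1 + 1 / e) * HH_inner H \<nu> (\<lambda>\<omega>. G \<omega> - G' \<omega>) (\<lambda>\<omega>. G \<omega> - G' \<omega>)"
proof -
  have D: "(\<lambda>\<omega>. G \<omega> - G' \<omega>) \<in> gradient_space H \<nu>"
    by (rule gradient_space_diff[OF G G' \<nu>]) (rule hurst_parameter_axioms)
  note i = gradient_space_energy(2)[OF \<nu> G] gradient_space_energy(2)[OF \<nu> G'] gradient_space_energy(2)[OF \<nu> D]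
  have "(LINT \<omega>|completion \<nu>. energy H (G \<omega>))
    \<le> (LINT \<omega>|completion \<nu>. (1 + e) * energy H (G' \<omega>) + (1 + 1 / e) * energy H (G \<omega> - G' \<omega>))"
  proof (rule integral_mono_AE)
    show "AE \<omega> in completion \<nu>. energy H (G \<omega>) \<le> (1 + e) * energy H (G' \<omega>) + (1 + 1 / e) * energy H (G \<omega> - G' \<omega>)"
      using gradient_space_energy(1)[OF \<nu> G] gradient_space_energy(1)[OF \<nu> G']
      by eventually_elim (use energy_le e in auto)
  qed (use i in auto)
  also have "\<dots> = (1 + e) * HH_inner H \<nu> G' G' + (1 + 1 / e) * HH_inner H \<nu> (\<lambda>\<omega>. G \<omega> - G' \<omega>) (\<lambda>\<omega>. G \<omega> - G' \<omega>)"
    using i unfolding HH_inner_energy by simp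
  finally show ?thesis unfolding HH_inner_energy .
qed

section \<open>Cylindrical functions\<close>

lemma OU_kernel_integrable:
  assumes \<alpha>: "0 \<le> \<alpha>" and s: "s \<in> {0..1}" and t: "t \<in> {0..1}"
  shows "integrable lborel (\<lambda>r. OU_kernel \<alpha> s r * OU_kernel \<alpha> t r)"
proof -
  have sq: "integrable lborel (\<lambda>r. (OU_kernel \<alpha> t r)\<^sup>2)" if t: "t \<in> {0..1}" for t
  proof (rule Bochner_Integration.integrable_bound[where f="\<lambda>r. (1 + \<alpha>)\<^sup>2 * (K_dom r)\<^sup>2"])
    show "AE r in lborel. norm ((OU_kernel \<alpha> t r)\<^sup>2) \<le> norm ((1 + \<alpha>)\<^sup>2 * (K_dom r)\<^sup>2)"
    proof (rule AE_I2)
      fix r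
      have k: "0 \<le> K_kernel H t r" "K_kernel H t r \<le> K_dom r" "0 \<le> K_avg \<alpha> t r" "K_avg \<alpha> t r \<le> K_dom r"
        using K_nonneg[of t r] K_le_K_dom[of t r] K_avg_bounds(2,3)[OF \<alpha>, of t r] t by (auto simp: K_dom_def)
      have "0 \<le> \<alpha> * K_avg \<alpha> t r" "\<alpha> * K_avg \<alpha> t r \<le> \<alpha> * K_dom r" using \<alpha> k by (auto intro!: mult_left_mono)
      then have "\<bar>OU_kernel \<alpha> t r\<bar> \<le> (1 + \<alpha>) * K_dom r"
        using k unfolding OU_kernel_def by (simp add: algebra_simps)
      then have "\<bar>OU_kernel \<alpha> t r\<bar>\<^sup>2 \<le> ((1 + \<alpha>) * K_dom r)\<^sup>2" by (intro power_mono) auto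
      then show "norm ((OU_kernel \<alpha> t r)\<^sup>2) \<le> norm ((1 + \<alpha>)\<^sup>2 * (K_dom r)\<^sup>2)" by (simp add: power_mult_distrib)
    qed
  qed (use K_dom_sq_integrable in auto)
  show ?thesis by (rule integrable_mult_of_square) (use sq s t in auto)
qed

text \<open>With P and Q the combinations of K and of its average, (P - \<alpha> Q)^2 <= 2 P^2 + 2
  \<alpha>^2 Q^2, and the Hilbert-Schmidt bound returns Q to P.\<close>

lemma OU_kernel_norm_le:
  assumes \<alpha>: "0 \<le> \<alpha>" and t: "\<And>i. i < m \<Longrightarrow> 0 \<le> t i \<and> t i \<le> 1"
  shows "(LINT r|lborel. (\<Sum>i<m. a i * OU_kernel \<alpha> (t i) r)\<^sup>2)
    \<le> 2 * (1 + \<alpha>\<^sup>2 * (1 + \<alpha>)\<^sup>2 / (1 - 2 * \<beta>)) * (LINT r|lborel. (\<Sum>i<m. a i * K_kernel H (t i) r)\<^sup>2)"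
proof -
  define P where "P r = (\<Sum>i<m. a i * K_kernel H (t i) r)" for r
  define Q where "Q r = (\<Sum>i<m. a i * K_avg \<alpha> (t i) r)" for r
  have [measurable]: "P \<in> borel_measurable borel" "Q \<in> borel_measurable borel" unfolding P_def Q_def by measurable
  have bound: "\<bar>P r\<bar> \<le> (\<Sum>i<m. \<bar>a i\<bar>) * K_dom r" "\<bar>Q r\<bar> \<le> (\<Sum>i<m. \<bar>a i\<bar>) * K_dom r" for r
  proof -
    have k: "0 \<le> K_kernel H (t i) r" "K_kernel H (t i) r \<le> K_dom r" "0 \<le> K_avg \<alpha> (t i) r" "K_avg \<alpha> (t i) r \<le> K_dom r" if "i < m" for i
      using K_nonneg[of "t i" r] K_le_K_dom[of "t i" r] K_avg_bounds(2,3)[OF \<alpha>, of "t i" r] t[OF that] by (auto simp: K_dom_def)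
    show "\<bar>P r\<bar> \<le> (\<Sum>i<m. \<bar>a i\<bar>) * K_dom r" "\<bar>Q r\<bar> \<le> (\<Sum>i<m. \<bar>a i\<bar>) * K_dom r"
      unfolding P_def Q_def sum_distrib_right
      by (rule order_trans[OF sum_abs], rule sum_mono, use k in \<open>simp add: abs_mult mult_left_mono\<close>)+
  qed
  have dom: "integrable lborel (\<lambda>r. ((\<Sum>i<m. \<bar>a i\<bar>) * K_dom r)\<^sup>2)"
    unfolding power_mult_distrib using K_dom_sq_integrable by simp
  have iP: "integrable lborel (\<lambda>r. (P r)\<^sup>2)" and iQ: "integrable lborel (\<lambda>r. (Q r)\<^sup>2)"
  proof -
    have b: "(P r)\<^sup>2 \<le> ((\<Sum>i<m. \<bar>a i\<bar>) * K_dom r)\<^sup>2" "(Q r)\<^sup>2 \<le> ((\<Sum>i<m. \<bar>a i\<bar>) * K_dom r)\<^sup>2" for r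
      using power_mono[OF bound(1)[of r] abs_ge_zero, of 2] power_mono[OF bound(2)[of r] abs_ge_zero, of 2] by simp_all
    show "integrable lborel (\<lambda>r. (P r)\<^sup>2)" "integrable lborel (\<lambda>r. (Q r)\<^sup>2)"
      by (rule Bochner_Integration.integrable_bound[OF dom]; use b in simp)+
  qed
  have le: "(P r - \<alpha> * Q r)\<^sup>2 \<le> 2 * (P r)\<^sup>2 + 2 * \<alpha>\<^sup>2 * (Q r)\<^sup>2" for r
    using zero_le_power2[of "P r + \<alpha> * Q r"] by (simp add: power2_eq_square algebra_simps)
  have "(LINT r|lborel. (P r - \<alpha> * Q r)\<^sup>2) \<le> (LINT r|lborel. 2 * (P r)\<^sup>2 + 2 * \<alpha>\<^sup>2 * (Q r)\<^sup>2)"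
  proof (rule integral_mono)
    show i: "integrable lborel (\<lambda>r. 2 * (P r)\<^sup>2 + 2 * \<alpha>\<^sup>2 * (Q r)\<^sup>2)" using iP iQ by simp
    show "integrable lborel (\<lambda>r. (P r - \<alpha> * Q r)\<^sup>2)"
    proof (rule Bochner_Integration.integrable_bound[OF i])
      show "AE r in lborel. norm ((P r - \<alpha> * Q r)\<^sup>2) \<le> norm (2 * (P r)\<^sup>2 + 2 * \<alpha>\<^sup>2 * (Q r)\<^sup>2)"
        by (intro AE_I2) (use le in \<open>fastforce intro: order_trans[OF _ abs_ge_self]\<close>)
    qed measurable
  qed (rule le)
  also have "\<dots> = 2 * (LINT r|lborel. (P r)\<^sup>2) + 2 * \<alpha>\<^sup>2 * (LINT r|lborel. (Q r)\<^sup>2)" using iP iQ by simp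
  also have "\<dots> \<le> 2 * (LINT r|lborel. (P r)\<^sup>2) + 2 * \<alpha>\<^sup>2 * ((1 + \<alpha>)\<^sup>2 / (1 - 2 * \<beta>) * (LINT r|lborel. (P r)\<^sup>2))"
    unfolding P_def Q_def by (intro add_left_mono mult_left_mono K_avg_norm_le[OF \<alpha> t]) auto
  also have "\<dots> = 2 * (1 + \<alpha>\<^sup>2 * (1 + \<alpha>)\<^sup>2 / (1 - 2 * \<beta>)) * (LINT r|lborel. (P r)\<^sup>2)"
    by (simp add: algebra_simps)
  also have "(\<lambda>r. P r - \<alpha> * Q r) = (\<lambda>r. \<Sum>i<m. a i * OU_kernel \<alpha> (t i) r)"
    unfolding P_def Q_def OU_kernel_def by (simp add: sum_distrib_left sum_subtractf[symmetric] algebra_simps)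
  then have "(LINT r|lborel. (P r - \<alpha> * Q r)\<^sup>2) = (LINT r|lborel. (\<Sum>i<m. a i * OU_kernel \<alpha> (t i) r)\<^sup>2)"
    by metis
  finally show ?thesis unfolding P_def .
qed

text \<open>The gradient of a cylindrical function is \<open>K\<close> applied to \<open>\<Sum>i. K(t\<^sub>i, \<cdot>) \<nabla>\<^sub>i f\<close>.\<close>

lemma cylindrical_energy:
  fixes f :: "(nat \<Rightarrow> real^'n) \<Rightarrow> real" and \<delta>f :: "nat \<Rightarrow> 'n \<Rightarrow> (nat \<Rightarrow> real^'n) \<Rightarrow> real"
  assumes deriv: "\<And>i j x. i < m \<Longrightarrow> ((\<lambda>r. f (x(i := x i + r *\<^sub>R axis j 1))) has_real_derivative \<delta>f i j x) (at 0)"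
    and cont: "\<And>i j. i < m \<Longrightarrow> continuous_on UNIV (\<delta>f i j)"
    and local: "\<And>x y. (\<And>i. i < m \<Longrightarrow> x i = y i) \<Longrightarrow> f x = f y"
    and t: "\<And>i. i < m \<Longrightarrow> 0 < t i \<and> t i \<le> 1"
    and F: "\<And>\<omega>. \<omega> \<in> path_space \<Longrightarrow> F \<omega> = f (\<lambda>i. apply_bcontfun \<omega> (t i))"
    and grad: "is_gradient H F DF" and \<omega>: "\<omega> \<in> path_space"
  shows "energy H (DF \<omega>)
    = (\<Sum>j\<in>UNIV. LINT r|lborel. (\<Sum>i<m. \<delta>f i j (\<lambda>i. if i < m then apply_bcontfun \<omega> (t i) else 0) * K_kernel H (t i) r)\<^sup>2)"
proof -
  define x where "x = (\<lambda>i. if i < m then apply_bcontfun \<omega> (t i) else 0)"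
  define d where "d i = (\<chi> j. \<delta>f i j x)" for i
  \<comment> \<open>The expected preimage under K of the gradient.\<close>
  define w where "w s = (\<Sum>i<m. K_kernel H (t i) s *\<^sub>R d i)" for s
  define g where "g = K_inv H (DF \<omega>)"
  have Km[measurable]: "K_kernel H u \<in> borel_measurable L01" for u by (rule K_L01_measurable)
  have wm: "w \<in> borel_measurable L01" unfolding w_def by measurable
  have w: "w \<in> L2_time" unfolding L2_time_iff
  proof
    show "integrable L01 (\<lambda>s. (norm (w s))\<^sup>2)"
    proof (rule Bochner_Integration.integrable_bound[where f="\<lambda>s. (\<Sum>i<m. norm (d i))\<^sup>2 * (K_dom s)\<^sup>2"])
      show "AE s in L01. norm ((norm (w s))\<^sup>2) \<le> norm ((\<Sum>i<m. norm (d i))\<^sup>2 * (K_dom s)\<^sup>2)"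
      proof (rule AE_I2)
        fix s
        have "norm (w s) \<le> (\<Sum>i<m. norm (d i)) * K_dom s"
          unfolding w_def sum_distrib_right
        proof (rule sum_norm_le)
          fix i assume "i \<in> {..<m}"
          then show "norm (K_kernel H (t i) s *\<^sub>R d i) \<le> norm (d i) * K_dom s"
            using K_nonneg[of "t i" s] K_le_K_dom[of "t i" s] t[of i] by (simp add: mult.commute[of "norm (d i)"] mult_right_mono)
        qed
        then have "(norm (w s))\<^sup>2 \<le> ((\<Sum>i<m. norm (d i)) * K_dom s)\<^sup>2" by (rule power_mono) simp
        then show "norm ((norm (w s))\<^sup>2) \<le> norm ((\<Sum>i<m. norm (d i))\<^sup>2 * (K_dom s)\<^sup>2)" by (simp add: power_mult_distrib)
      qed
    qed (use K_dom_sq_integrable_L01 wm in auto)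
  qed (rule wm)
  have "DF \<omega> \<in> K_op H ` L2_time" using grad \<omega> unfolding is_gradient_def by blast
  then have g: "g \<in> L2_time" unfolding g_def by (auto intro: K_inv_L2(1))
  \<comment> \<open>The limit defining the gradient and the chain rule for f are limits of the same
    difference quotients; uniqueness identifies the two pairings with h.\<close>
  have pair: "(LINT s|L01. g s \<bullet> h s) = (LINT s|L01. w s \<bullet> h s)" if h: "h \<in> L2_time" for h
  proof -
    define y where "y i = apply_bcontfun (K_op H h) (t i)" for i
    have Fe: "F (\<omega> + \<delta> *\<^sub>R K_op H h) = f (\<lambda>i. x i + \<delta> *\<^sub>R y i)" for \<delta>
      unfolding F[OF path_space_add_K_op[OF \<omega> h]]
      by (rule local) (simp add: x_def y_def plus_bcontfun.rep_eq scaleR_bcontfun.rep_eq)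
    have F0: "F \<omega> = f x" unfolding F[OF \<omega>] by (rule local) (simp add: x_def)
    have "((\<lambda>\<delta>. (F (\<omega> + \<delta> *\<^sub>R K_op H h) - F \<omega>) / \<delta>) \<longlongrightarrow> (LINT s|L01. g s \<bullet> h s)) (at 0)"
      using grad \<omega> h unfolding is_gradient_def g_def by blast
    moreover have "((\<lambda>\<delta>. (F (\<omega> + \<delta> *\<^sub>R K_op H h) - F \<omega>) / \<delta>) \<longlongrightarrow> (\<Sum>i<m. \<Sum>j\<in>UNIV. \<delta>f i j x * y i $ j)) (at 0)"
      using directional_derivative[where x=x and y=y, OF deriv cont local] unfolding Fe F0 DERIV_def by simp
    ultimately have "(LINT s|L01. g s \<bullet> h s) = (\<Sum>i<m. \<Sum>j\<in>UNIV. \<delta>f i j x * y i $ j)"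
      by (rule LIM_unique)
    also have "\<dots> = (\<Sum>i<m. d i \<bullet> y i)" by (simp add: d_def inner_vec_def)
    also have "\<dots> = (\<Sum>i<m. LINT s|L01. d i \<bullet> (K_kernel H (t i) s *\<^sub>R h s))"
    proof (rule sum.cong[OF refl])
      fix i assume "i \<in> {..<m}"
      then have ti: "t i \<in> {0..1}" "t i \<le> 1" using t[of i] by auto
      show "d i \<bullet> y i = (LINT s|L01. d i \<bullet> (K_kernel H (t i) s *\<^sub>R h s))"
        unfolding y_def K_op_apply01[OF h ti(1)] by (rule integral_inner_right[symmetric]) (rule K_h_integrable[OF h ti(2)])
    qed
    also have "\<dots> = (LINT s|L01. (\<Sum>i<m. d i \<bullet> (K_kernel H (t i) s *\<^sub>R h s)))"
      using K_h_integrable[OF h] t by (intro Bochner_Integration.integral_sum[symmetric] integrable_inner_right) auto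
    also have "\<dots> = (LINT s|L01. w s \<bullet> h s)" by (simp add: w_def inner_sum_left)
    finally show ?thesis .
  qed
  \<comment> \<open>Testing the pairing with g and then with w turns one energy into the other
    directly, without first showing g = w almost everywhere.\<close>
  have "energy H (DF \<omega>) = (LINT s|L01. g s \<bullet> g s)" by (simp add: energy_def g_def)
  also have "\<dots> = (LINT s|L01. w s \<bullet> g s)" by (rule pair[OF g])
  also have "\<dots> = (LINT s|L01. g s \<bullet> w s)" by (simp only: inner_commute)
  also have "\<dots> = (LINT s|L01. w s \<bullet> w s)" by (rule pair[OF w])
  also have "\<dots> = (LINT s|L01. (\<Sum>j\<in>UNIV. (\<Sum>i<m. \<delta>f i j x * K_kernel H (t i) s)\<^sup>2))"
    by (simp add: inner_vec_def w_def d_def power2_eq_square mult.commute)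
  also have "\<dots> = (LINT s|lborel. indicator {0..1} s * (\<Sum>j\<in>UNIV. (\<Sum>i<m. \<delta>f i j x * K_kernel H (t i) s)\<^sup>2))"
    by (rule L01_borel) measurable
  also have "\<dots> = (LINT s|lborel. (\<Sum>j\<in>UNIV. (\<Sum>i<m. \<delta>f i j x * K_kernel H (t i) s)\<^sup>2))"
  proof (rule Bochner_Integration.integral_cong[OF refl])
    fix s :: real
    have "K_kernel H (t i) s = 0" if "i < m" "s \<notin> {0..1}" for i
      using that t[of i] by (intro K_zero) auto
    then show "indicator {0..1} s * (\<Sum>j\<in>UNIV. (\<Sum>i<m. \<delta>f i j x * K_kernel H (t i) s)\<^sup>2) = (\<Sum>j\<in>UNIV. (\<Sum>i<m. \<delta>f i j x * K_kernel H (t i) s)\<^sup>2)"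
      by (cases "s \<in> {0..1}") auto
  qed
  also have "\<dots> = (\<Sum>j\<in>UNIV. LINT s|lborel. (\<Sum>i<m. \<delta>f i j x * K_kernel H (t i) s)\<^sup>2)"
  proof (rule Bochner_Integration.integral_sum)
    fix j
    show "integrable lborel (\<lambda>s. (\<Sum>i<m. \<delta>f i j x * K_kernel H (t i) s)\<^sup>2)"
    proof -
      have "(\<Sum>i<m. \<delta>f i j x * K_kernel H (t i) s)\<^sup>2 = (\<Sum>i<m. \<Sum>i'<m. (\<delta>f i j x * \<delta>f i' j x) * (K_kernel H (t i) s * K_kernel H (t i') s))" for s
        unfolding power2_eq_square sum_product by (simp only: mult_ac)
      then show ?thesis
        using t by (auto intro!: Bochner_Integration.integrable_sum integrable_mult_right K_sq_integrable)
    qed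
  qed
  finally show ?thesis unfolding x_def .
qed

text \<open>Entropy bound and energy are quadratic forms in the same partial derivatives, one with
  \<open>OU_kernel\<close> and one with \<open>K_kernel\<close>, so they can be compared for each
  \<omega> and each component separately.\<close>

lemma cylindrical_log_sobolev:
  fixes \<nu> :: "(real \<Rightarrow>\<^sub>C (real^'n)) measure"
  assumes \<alpha>: "0 \<le> \<alpha>" and OU: "fractional_OU_measure \<alpha> H \<nu>" and G: "(F, DF) \<in> gradient_graph H \<nu>"
    and \<eta>: "0 < \<eta>" "\<eta> < 1"
  shows "ent (completion \<nu>) (\<lambda>\<omega>. sq_trunc \<eta> (F \<omega>)) \<le> 4 * (1 + \<alpha>\<^sup>2 * (1 + \<alpha>)\<^sup>2 / (1 - 2 * \<beta>)) * HH_inner H \<nu> DF DF"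
proof -
  define A where "A = 1 + \<alpha>\<^sup>2 * (1 + \<alpha>)\<^sup>2 / (1 - 2 * \<beta>)"
  have A: "0 \<le> A" using \<beta>_lt unfolding A_def by (intro add_nonneg_nonneg divide_nonneg_pos) auto
  have \<nu>: "prob_space \<nu>" and sets: "sets \<nu> = sets (restrict_space borel path_space)"
    using OU by (auto simp: fractional_OU_measure_def)
  have space: "space \<nu> = path_space"
    using sets_eq_imp_space_eq[OF sets] by (simp add: space_restrict_space)
  have grad: "is_gradient H F DF" and DF: "DF \<in> gradient_space H \<nu>" and cyl: "smooth_cylindrical F"
    using G by (auto simp: gradient_graph_def)
  obtain m t f where t: "\<forall>i<m. 0 < t i \<and> t i \<le> 1" and f: "C_infinity m f"
    and F: "\<forall>\<omega>\<in>path_space. F \<omega> = f (\<lambda>i. apply_bcontfun \<omega> (t i))"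
    using cyl unfolding smooth_cylindrical_def by blast
  have local: "f x = f y" if "\<And>i. i < m \<Longrightarrow> x i = y i" for x y
    using f that unfolding C_infinity_def by blast
  have "C_k m (Suc 0) f" using f unfolding C_infinity_def by blast
  then have f_cont: "continuous_on UNIV f"
    and "\<forall>i j. \<exists>g. i < m \<longrightarrow> (\<forall>x. ((\<lambda>r. f (x(i := x i + r *\<^sub>R axis j 1))) has_real_derivative g x) (at 0)) \<and> continuous_on UNIV g"
    unfolding C_k.simps by blast+
  then obtain \<delta>f where \<delta>f: "\<forall>i j. i < m \<longrightarrow> (\<forall>x. ((\<lambda>r. f (x(i := x i + r *\<^sub>R axis j 1))) has_real_derivative \<delta>f i j x) (at 0)) \<and> continuous_on UNIV (\<delta>f i j)"
    by metis
  have deriv: "((\<lambda>r. f (x(i := x i + r *\<^sub>R axis j 1))) has_real_derivative \<delta>f i j x) (at 0)" if "i < m" for i j x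
    using \<delta>f that by blast
  have cont: "continuous_on UNIV (\<delta>f i j)" if "i < m" for i j
    using \<delta>f that by blast
  have ti: "0 < t i \<and> t i \<le> 1" if "i < m" for i using t that by blast
  have eval: "(\<lambda>\<omega>. apply_bcontfun \<omega> s) \<in> borel_measurable \<nu>" for s by (rule eval_measurable[OF sets])
  let ?x = "\<lambda>\<omega> i. if i < m then apply_bcontfun \<omega> (t i) else 0"
  have e: "energy H (DF \<omega>) = (\<Sum>j\<in>UNIV. LINT r|lborel. (\<Sum>i<m. \<delta>f i j (?x \<omega>) * K_kernel H (t i) r)\<^sup>2)"
    if "\<omega> \<in> space \<nu>" for \<omega>
    by (rule cylindrical_energy[OF deriv cont local ti _ grad]) (use F that space in auto)
  have int: "integrable (completion \<nu>) (\<lambda>\<omega>. 4 * A * energy H (DF \<omega>))"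
    using gradient_space_energy(2)[OF \<nu> DF] by simp
  have "ennreal (ent \<nu> (\<lambda>\<omega>. sq_trunc \<eta> (f (\<lambda>i. apply_bcontfun \<omega> (t i)))))
    \<le> (\<integral>\<^sup>+\<omega>. ennreal (2 * (\<Sum>j\<in>UNIV. LINT r|lborel. (\<Sum>i<m. \<delta>f i j (?x \<omega>) * OU_kernel \<alpha> (t i) r)\<^sup>2)) \<partial>\<nu>)"
  proof (rule gaussian_vector_log_sobolev[where X="\<lambda>i \<omega>. apply_bcontfun \<omega> (t i)" and f=f and m=m, OF \<nu> eval _ _ f_cont deriv cont local \<eta>])
    show "integrable lborel (\<lambda>r. OU_kernel \<alpha> (t i) r * OU_kernel \<alpha> (t i') r)" if "i < m" "i' < m" for i i'
      by (rule OU_kernel_integrable[OF \<alpha>]) (use ti that in force)+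
    show "(LINT \<omega>|\<nu>. cos ((\<Sum>i<m. v i \<bullet> apply_bcontfun \<omega> (t i)) + b))
      = exp (- (\<Sum>j\<in>UNIV. LINT r|lborel. (\<Sum>i<m. v i $ j * OU_kernel \<alpha> (t i) r)\<^sup>2) / 2) * cos b" for v b
      by (rule OU_cos[OF \<alpha> OU]) (use ti in force)
  qed
  also have "\<dots> \<le> (\<integral>\<^sup>+\<omega>. ennreal (4 * A * energy H (DF \<omega>)) \<partial>\<nu>)"
  proof (intro nn_integral_mono ennreal_leI)
    fix \<omega> assume \<omega>: "\<omega> \<in> space \<nu>"
    have "(\<Sum>j\<in>UNIV. LINT r|lborel. (\<Sum>i<m. \<delta>f i j (?x \<omega>) * OU_kernel \<alpha> (t i) r)\<^sup>2)
      \<le> (\<Sum>j\<in>UNIV. 2 * A * (LINT r|lborel. (\<Sum>i<m. \<delta>f i j (?x \<omega>) * K_kernel H (t i) r)\<^sup>2))"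
      unfolding A_def by (intro sum_mono OU_kernel_norm_le[OF \<alpha>]) (use ti in force)
    then show "2 * (\<Sum>j\<in>UNIV. LINT r|lborel. (\<Sum>i<m. \<delta>f i j (?x \<omega>) * OU_kernel \<alpha> (t i) r)\<^sup>2) \<le> 4 * A * energy H (DF \<omega>)"
      unfolding e[OF \<omega>] by (simp add: sum_distrib_left[symmetric])
  qed
  also have "\<dots> = (\<integral>\<^sup>+\<omega>. ennreal (4 * A * energy H (DF \<omega>)) \<partial>completion \<nu>)" by (rule nn_integral_completion[symmetric])
  also have "\<dots> = ennreal (LINT \<omega>|completion \<nu>. 4 * A * energy H (DF \<omega>))"
    by (rule nn_integral_eq_integral[OF int]) (intro AE_I2 mult_nonneg_nonneg A energy_nonneg, simp)
  also have "(LINT \<omega>|completion \<nu>. 4 * A * energy H (DF \<omega>)) = 4 * A * HH_inner H \<nu> DF DF"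
    by (simp add: HH_inner_energy)
  finally have le: "ent \<nu> (\<lambda>\<omega>. sq_trunc \<eta> (f (\<lambda>i. apply_bcontfun \<omega> (t i)))) \<le> 4 * A * HH_inner H \<nu> DF DF"
    using A HH_inner_nonneg[of H \<nu> DF] by (simp add: ennreal_le_iff)
  \<comment> \<open>To move the entropy from the completion to \<nu> itself, the integrand must be
    measurable for \<nu>; this is clear for f of the evaluations, which agrees with F on
    \<open>path_space\<close>.\<close>
  have fm[measurable]: "(\<lambda>\<omega>. f (\<lambda>i. apply_bcontfun \<omega> (t i))) \<in> borel_measurable \<nu>"
  proof (rule measurable_compose[OF _ borel_measurable_continuous_onI[OF f_cont]])
    show "(\<lambda>\<omega> i. apply_bcontfun \<omega> (t i)) \<in> borel_measurable \<nu>"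
      by (rule measurable_coordinatewise_then_product) (rule eval)
  qed
  have [measurable]: "(\<lambda>\<omega>. sq_trunc \<eta> (f (\<lambda>i. apply_bcontfun \<omega> (t i)))) \<in> borel_measurable \<nu>"
    unfolding sq_trunc_def by measurable
  have "ent (completion \<nu>) (\<lambda>\<omega>. sq_trunc \<eta> (F \<omega>)) = ent (completion \<nu>) (\<lambda>\<omega>. sq_trunc \<eta> (f (\<lambda>i. apply_bcontfun \<omega> (t i))))"
    unfolding ent_def
    by (intro arg_cong2[where f="(-)"] arg_cong2[where f="(*)"] arg_cong[where f=ln] Bochner_Integration.integral_cong refl)
      (use F space in auto)
  also have "\<dots> = ent \<nu> (\<lambda>\<omega>. sq_trunc \<eta> (f (\<lambda>i. apply_bcontfun \<omega> (t i))))"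
    unfolding ent_def by (intro arg_cong2[where f="(-)"] arg_cong2[where f="(*)"] arg_cong[where f=ln] integral_completion) measurable
  finally show ?thesis using le unfolding A_def by simp
qed

end

section \<open>Passage to the closure\<close>

lemma mult_ln_ge:
  fixes x :: real
  assumes "0 \<le> x" shows "- 1 \<le> x * ln x"
proof (cases "x = 0")
  case False
  then have x: "0 < x" using assms by simp
  have "ln (1 / x) \<le> 1 / x - 1" using x by (intro ln_le_minus_one) simp
  then have "x * (- ln x) \<le> x * (1 / x - 1)" using x by (intro mult_left_mono) (auto simp: ln_div)
  then show ?thesis using x by (simp add: algebra_simps)
qed simp

text \<open>Continuity of x ln x at 0, where \<open>ln 0 = 0\<close> gives it the value 0; this is
  the convention 0 ln 0 = 0 of the statement.\<close>

lemma tendsto_mult_ln: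
  fixes l :: real
  assumes lim: "u \<longlonglongrightarrow> l" and pos: "\<And>n. 0 < u n"
  shows "(\<lambda>n. u n * ln (u n)) \<longlonglongrightarrow> l * ln l"
proof (cases "l = 0")
  case False
  then show ?thesis using lim by (intro tendsto_intros)
next
  case True
  have "(\<lambda>n. 2 * sqrt (u n)) \<longlonglongrightarrow> 2 * sqrt l" by (intro tendsto_intros lim)
  then have "(\<lambda>n. 2 * sqrt (u n)) \<longlonglongrightarrow> 0" by (simp add: True)
  moreover have "\<forall>\<^sub>F n in sequentially. norm (u n * ln (u n)) \<le> 2 * sqrt (u n)"
  proof -
    have "\<forall>\<^sub>F n in sequentially. u n < 1" using order_tendstoD(2)[OF lim, of 1] True by simp
    then show ?thesis
    proof eventually_elim
      case (elim n)
      have s: "0 < sqrt (u n)" using pos[of n] by simp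
      \<comment> \<open>Applied to 1 / sqrt x, the bound ln y <= y - 1 gives - x ln x <= 2 sqrt x,
        which tends to 0.\<close>
      have "ln (1 / sqrt (u n)) \<le> 1 / sqrt (u n) - 1" using s by (intro ln_le_minus_one) simp
      moreover have "ln (u n) = - 2 * ln (1 / sqrt (u n))"
        using pos[of n] by (simp add: ln_div ln_sqrt)
      ultimately have "- ln (u n) \<le> 2 / sqrt (u n)" by simp
      then have "u n * (- ln (u n)) \<le> u n * (2 / sqrt (u n))" using pos[of n] by (intro mult_left_mono) auto
      also have "u n * (2 / sqrt (u n)) = 2 * sqrt (u n)"
        using pos[of n] s by (simp add: field_simps)
      finally show ?case using elim pos[of n] by (simp add: abs_mult abs_of_pos abs_of_neg ln_less_zero)
    qed
  qed
  ultimately have "(\<lambda>n. u n * ln (u n)) \<longlonglongrightarrow> 0" by (rule Lim_null_comparison[rotated])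
  then show ?thesis using True by simp
qed

lemma sq_trunc_tendsto:
  assumes "u \<longlonglongrightarrow> l" "0 < \<eta>" shows "(\<lambda>n. sq_trunc \<eta> (u n)) \<longlonglongrightarrow> sq_trunc \<eta> l"
proof -
  have "0 < 1 + \<eta> * l\<^sup>2" using assms(2) by (simp add: add_pos_nonneg)
  then show ?thesis unfolding sq_trunc_def by (intro tendsto_intros assms) auto
qed

lemma sq_trunc_tendsto_0:
  assumes "\<eta> \<longlonglongrightarrow> 0" shows "(\<lambda>n. sq_trunc (\<eta> n) y) \<longlonglongrightarrow> y\<^sup>2"
proof -
  have "(\<lambda>n. sq_trunc (\<eta> n) y) \<longlonglongrightarrow> (y\<^sup>2 + 0) / (1 + 0 * y\<^sup>2)"
    unfolding sq_trunc_def by (intro tendsto_intros assms) auto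
  then show ?thesis by simp
qed

lemma (in prob_space) ent_tendsto:
  assumes u[measurable]: "\<And>n. u n \<in> borel_measurable M" and w[measurable]: "w \<in> borel_measurable M"
    and c: "0 < c" and b: "\<And>n x. c \<le> u n x" "\<And>n x. u n x \<le> C"
    and lim: "AE x in M. (\<lambda>n. u n x) \<longlonglongrightarrow> w x"
  shows "(\<lambda>n. ent M (u n)) \<longlonglongrightarrow> ent M w"
proof -
  have ub: "norm (u n x) \<le> C" for n x using b(1)[of n x] b(2)[of n x] c by simp
  have m: "(\<lambda>n. LINT x|M. u n x) \<longlonglongrightarrow> (LINT x|M. w x)"
    by (rule integral_dominated_convergence[where w="\<lambda>_. C"]) (use lim ub in auto)
  have "(\<lambda>n. LINT x|M. u n x * ln (u n x)) \<longlonglongrightarrow> (LINT x|M. w x * ln (w x))"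
  proof (rule integral_dominated_convergence[where w="\<lambda>_. C * (\<bar>ln c\<bar> + \<bar>ln C\<bar>)"])
    show "AE x in M. (\<lambda>n. u n x * ln (u n x)) \<longlonglongrightarrow> w x * ln (w x)"
      using lim by eventually_elim (rule tendsto_mult_ln[OF _ less_le_trans[OF c b(1)]])
    show "AE x in M. norm (u n x * ln (u n x)) \<le> C * (\<bar>ln c\<bar> + \<bar>ln C\<bar>)" for n
      using abs_mult_ln_le[OF c b] by simp
  qed auto
  moreover have "(\<lambda>n. (LINT x|M. u n x) * ln (LINT x|M. u n x)) \<longlonglongrightarrow> (LINT x|M. w x) * ln (LINT x|M. w x)"
  proof (rule tendsto_mult_ln[OF m])
    fix n
    have "c \<le> (LINT x|M. u n x)" using bounds_integral(2)[OF u b(1) b(2)] by simp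
    then show "0 < (LINT x|M. u n x)" using c by simp
  qed
  ultimately show ?thesis unfolding ent_def by (rule tendsto_diff)
qed

context hurst_parameter
begin

text \<open>A subsequence converges almost everywhere, and its truncations lie in
  [\<eta>, 1/\<eta>], so their entropies converge by dominated convergence. For F^2 ln F^2 itself
  L^2 convergence provides no such bound, which is why the truncation comes before the
  closure.\<close>

lemma closed_gradient_log_sobolev:
  fixes \<nu> :: "(real \<Rightarrow>\<^sub>C (real^'n)) measure"
  assumes \<alpha>: "0 \<le> \<alpha>" and OU: "fractional_OU_measure \<alpha> H \<nu>" and G: "(F, DF) \<in> closed_gradient_graph H \<nu>"
    and \<eta>: "0 < \<eta>" "\<eta> < 1"
  shows "ent (completion \<nu>) (\<lambda>\<omega>. sq_trunc \<eta> (F \<omega>)) \<le> 4 * (1 + \<alpha>\<^sup>2 * (1 + \<alpha>)\<^sup>2 / (1 - 2 * \<beta>)) * HH_inner H \<nu> DF DF"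
proof -
  define A where "A = 4 * (1 + \<alpha>\<^sup>2 * (1 + \<alpha>)\<^sup>2 / (1 - 2 * \<beta>))"
  have A: "0 \<le> A" using \<beta>_lt unfolding A_def by (intro mult_nonneg_nonneg add_nonneg_nonneg divide_nonneg_pos) auto
  have \<nu>: "prob_space \<nu>" using OU by (auto simp: fractional_OU_measure_def)
  interpret N: prob_space "completion \<nu>" by (rule prob_space.prob_space_completion[OF \<nu>])
  obtain Fk DFk where k: "\<forall>k. (Fk k, DFk k) \<in> gradient_graph H \<nu>"
    and L2: "(\<lambda>k. LINT \<omega>|completion \<nu>. (Fk k \<omega> - F \<omega>)\<^sup>2) \<longlonglongrightarrow> 0"
    and D: "(\<lambda>k::nat. HH_inner H \<nu> (\<lambda>\<omega>. DFk k \<omega> - DF \<omega>) (\<lambda>\<omega>. DFk k \<omega> - DF \<omega>)) \<longlonglongrightarrow> 0"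
    and F: "F \<in> L2_fun \<nu>" and DF: "DF \<in> gradient_space H \<nu>"
    using G unfolding closed_gradient_graph_def by blast
  have DFk: "DFk n \<in> gradient_space H \<nu>" and Fk: "Fk n \<in> L2_fun \<nu>" for n
    using k by (auto simp: gradient_graph_def)
  have Fm[measurable]: "F \<in> borel_measurable (completion \<nu>)" and Fi: "integrable (completion \<nu>) (\<lambda>\<omega>. (F \<omega>)\<^sup>2)"
    using F by (auto simp: L2_fun_def)
  have Fkm[measurable]: "Fk n \<in> borel_measurable (completion \<nu>)" and Fki: "integrable (completion \<nu>) (\<lambda>\<omega>. (Fk n \<omega>)\<^sup>2)" for n
    using Fk[of n] by (auto simp: L2_fun_def)
  have i: "integrable (completion \<nu>) (\<lambda>\<omega>. (Fk n \<omega> - F \<omega>)\<^sup>2)" for n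
    unfolding power2_diff using Fki[of n] Fi integrable_mult_of_square[OF Fkm Fm Fki Fi, of n] by (simp add: mult.assoc)
  obtain s :: "nat \<Rightarrow> nat" where s: "strict_mono s" and ae: "AE \<omega> in completion \<nu>. (\<lambda>n. (Fk (s n) \<omega> - F \<omega>)\<^sup>2) \<longlonglongrightarrow> 0"
    using tendsto_L1_AE_subseq[where u="\<lambda>n \<omega>. (Fk n \<omega> - F \<omega>)\<^sup>2", OF i] L2 unfolding real_norm_def abs_power2 by blast
  have lim: "AE \<omega> in completion \<nu>. (\<lambda>n. sq_trunc \<eta> (Fk (s n) \<omega>)) \<longlonglongrightarrow> sq_trunc \<eta> (F \<omega>)"
    using ae
  proof eventually_elim
    case (elim \<omega>)
    from tendsto_real_sqrt[OF elim] have "(\<lambda>n. Fk (s n) \<omega> - F \<omega>) \<longlonglongrightarrow> 0"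
      by (simp add: tendsto_rabs_zero_iff)
    then have "(\<lambda>n. Fk (s n) \<omega>) \<longlonglongrightarrow> F \<omega>" by (simp add: LIM_zero_iff)
    then show ?case by (rule sq_trunc_tendsto) (rule \<eta>)
  qed
  have stm[measurable]: "sq_trunc \<eta> \<in> borel_measurable borel" unfolding sq_trunc_def by measurable
  have ent_lim: "(\<lambda>n. ent (completion \<nu>) (\<lambda>\<omega>. sq_trunc \<eta> (Fk (s n) \<omega>))) \<longlonglongrightarrow> ent (completion \<nu>) (\<lambda>\<omega>. sq_trunc \<eta> (F \<omega>))"
    by (rule N.ent_tendsto[OF _ _ \<eta>(1) sq_trunc(1)[OF \<eta>] sq_trunc(2)[OF \<eta>] lim]) measurable
  \<comment> \<open>The index n goes to infinity with e fixed, since 1 + 1 / e is unbounded; e goes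
    to 0 only afterwards.\<close>
  have "ent (completion \<nu>) (\<lambda>\<omega>. sq_trunc \<eta> (F \<omega>)) \<le> A * ((1 + e) * HH_inner H \<nu> DF DF)" if e: "0 < e" for e
  proof (rule LIMSEQ_le[OF ent_lim])
    let ?D = "\<lambda>n. HH_inner H \<nu> (\<lambda>\<omega>. DFk (s n) \<omega> - DF \<omega>) (\<lambda>\<omega>. DFk (s n) \<omega> - DF \<omega>)"
    have "?D \<longlonglongrightarrow> 0" using LIMSEQ_subseq_LIMSEQ[OF D s] by (simp add: o_def)
    then have "(\<lambda>n. A * ((1 + e) * HH_inner H \<nu> DF DF + (1 + 1 / e) * ?D n)) \<longlonglongrightarrow> A * ((1 + e) * HH_inner H \<nu> DF DF + (1 + 1 / e) * 0)"
      by (intro tendsto_intros)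
    then show "(\<lambda>n. A * ((1 + e) * HH_inner H \<nu> DF DF + (1 + 1 / e) * ?D n)) \<longlonglongrightarrow> A * ((1 + e) * HH_inner H \<nu> DF DF)" by simp
    have "ent (completion \<nu>) (\<lambda>\<omega>. sq_trunc \<eta> (Fk (s n) \<omega>)) \<le> A * ((1 + e) * HH_inner H \<nu> DF DF + (1 + 1 / e) * ?D n)" for n
    proof -
      have "(Fk (s n), DFk (s n)) \<in> gradient_graph H \<nu>" using k by blast
      then have "ent (completion \<nu>) (\<lambda>\<omega>. sq_trunc \<eta> (Fk (s n) \<omega>)) \<le> A * HH_inner H \<nu> (DFk (s n)) (DFk (s n))"
        unfolding A_def by (rule cylindrical_log_sobolev[OF \<alpha> OU _ \<eta>])
      also have "\<dots> \<le> A * ((1 + e) * HH_inner H \<nu> DF DF + (1 + 1 / e) * ?D n)"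
        by (rule mult_left_mono[OF HH_inner_le[OF \<nu> DFk DF e] A])
      finally show ?thesis .
    qed
    then show "\<exists>n0. \<forall>n\<ge>n0. ent (completion \<nu>) (\<lambda>\<omega>. sq_trunc \<eta> (Fk (s n) \<omega>)) \<le> A * ((1 + e) * HH_inner H \<nu> DF DF + (1 + 1 / e) * ?D n)"
      by blast
  qed
  note bound = this
  have "ent (completion \<nu>) (\<lambda>\<omega>. sq_trunc \<eta> (F \<omega>)) \<le> A * HH_inner H \<nu> DF DF"
  proof (rule LIMSEQ_le_const)
    have "(\<lambda>n. A * ((1 + inverse (real (Suc n))) * HH_inner H \<nu> DF DF)) \<longlonglongrightarrow> A * ((1 + 0) * HH_inner H \<nu> DF DF)"
      by (intro tendsto_intros LIMSEQ_inverse_real_of_nat)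
    then show "(\<lambda>n. A * ((1 + inverse (real (Suc n))) * HH_inner H \<nu> DF DF)) \<longlonglongrightarrow> A * HH_inner H \<nu> DF DF" by simp
    show "\<exists>N. \<forall>n\<ge>N. ent (completion \<nu>) (\<lambda>\<omega>. sq_trunc \<eta> (F \<omega>)) \<le> A * ((1 + inverse (real (Suc n))) * HH_inner H \<nu> DF DF)"
      using bound by (intro exI[of _ 0] allI impI) simp
  qed
  then show ?thesis unfolding A_def .
qed

end

text \<open>As \<eta> tends to 0 the means converge, being dominated by F^2 + 1, while for the
  logarithmic term Fatou's lemma is enough because only an upper bound is wanted. It also yields the
  integrability of F^2 ln F^2.\<close>

lemma (in prob_space) log_sobolev_of_sq_trunc:
  fixes F :: "'a \<Rightarrow> real"
  assumes Fm[measurable]: "F \<in> borel_measurable M" and Fi: "integrable M (\<lambda>x. (F x)\<^sup>2)"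
    and bound: "\<And>\<eta>. 0 < \<eta> \<Longrightarrow> \<eta> < 1 \<Longrightarrow> ent M (\<lambda>x. sq_trunc \<eta> (F x)) \<le> R"
  shows "integrable M (\<lambda>x. (F x)\<^sup>2 * ln ((F x)\<^sup>2))"
    and "(LINT x|M. (F x)\<^sup>2 * ln ((F x)\<^sup>2)) \<le> R + (LINT x|M. (F x)\<^sup>2) * ln (LINT x|M. (F x)\<^sup>2)"
proof -
  define \<eta> where "\<eta> n = 1 / (real n + 2)" for n
  have \<eta>: "0 < \<eta> n" "\<eta> n < 1" for n by (auto simp: \<eta>_def)
  have "(\<lambda>n. 1 / real (n + 2)) \<longlonglongrightarrow> 0" by (rule LIMSEQ_ignore_initial_segment[OF lim_1_over_n])
  then have \<eta>0: "\<eta> \<longlonglongrightarrow> 0" by (simp add: \<eta>_def[abs_def] add.commute)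
  define w where "w n x = sq_trunc (\<eta> n) (F x)" for n x
  have wm[measurable]: "w n \<in> borel_measurable M" for n unfolding w_def sq_trunc_def by measurable
  have w: "\<eta> n \<le> w n x" "w n x \<le> 1 / \<eta> n" "w n x \<le> (F x)\<^sup>2 + 1" "0 < w n x" for n x
    using sq_trunc[OF \<eta>, of n "F x"] \<eta>(1)[of n] unfolding w_def by linarith+
  have wlim: "(\<lambda>n. w n x) \<longlonglongrightarrow> (F x)\<^sup>2" for x unfolding w_def by (rule sq_trunc_tendsto_0[OF \<eta>0])
  have m: "(\<lambda>n. LINT x|M. w n x) \<longlonglongrightarrow> (LINT x|M. (F x)\<^sup>2)"
  proof (rule integral_dominated_convergence[where w="\<lambda>x. (F x)\<^sup>2 + 1"])
    show "AE x in M. norm (w n x) \<le> (F x)\<^sup>2 + 1" for n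
    proof (rule AE_I2)
      fix x show "norm (w n x) \<le> (F x)\<^sup>2 + 1" using w(3,4)[of n x] by simp
    qed
  qed (use wlim Fi in auto)
  have mpos: "0 < (LINT x|M. w n x)" for n
    using bounds_integral(2)[OF wm w(1) w(2), of n] \<eta>(1)[of n] by simp
  have mlim: "(\<lambda>n. (LINT x|M. w n x) * ln (LINT x|M. w n x)) \<longlonglongrightarrow> (LINT x|M. (F x)\<^sup>2) * ln (LINT x|M. (F x)\<^sup>2)"
    by (rule tendsto_mult_ln[OF m mpos])
  \<comment> \<open>The shift by 1 makes the integrand nonnegative, as x ln x >= -1; on a
    probability space it cancels at the end.\<close>
  define g where "g x = (F x)\<^sup>2 * ln ((F x)\<^sup>2) + 1" for x
  have [measurable]: "g \<in> borel_measurable M" unfolding g_def by measurable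
  have g0: "0 \<le> g x" for x using mult_ln_ge[of "(F x)\<^sup>2"] by (simp add: g_def)
  have wl: "0 \<le> w n x * ln (w n x) + 1" for n x using mult_ln_ge[of "w n x"] w(4)[of n x] by simp
  have wi: "integrable M (\<lambda>x. w n x * ln (w n x))" for n by (rule integrable_mult_ln[OF wm \<eta>(1) w(1) w(2)])
  define B where "B n = R + (LINT x|M. w n x) * ln (LINT x|M. w n x) + 1" for n
  define B0 where "B0 = R + (LINT x|M. (F x)\<^sup>2) * ln (LINT x|M. (F x)\<^sup>2) + 1"
  have Blim: "B \<longlonglongrightarrow> B0" unfolding B_def[abs_def] B0_def by (intro tendsto_intros mlim)
  have wB: "(\<integral>\<^sup>+x. ennreal (w n x * ln (w n x) + 1) \<partial>M) \<le> ennreal (B n)" for n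
  proof -
    have "(\<integral>\<^sup>+x. ennreal (w n x * ln (w n x) + 1) \<partial>M) = ennreal (LINT x|M. w n x * ln (w n x) + 1)"
      by (rule nn_integral_eq_integral) (use wi wl in auto)
    also have "(LINT x|M. w n x * ln (w n x) + 1) = (LINT x|M. w n x * ln (w n x)) + 1"
      using wi by (simp add: prob_space)
    also have "\<dots> \<le> B n" using bound[OF \<eta>, of n] unfolding ent_def w_def[symmetric] B_def by simp
    finally show ?thesis by (simp add: ennreal_leI)
  qed
  \<comment> \<open>Nonnegativity of the bound allows the return from extended reals, where negative
    numbers would have been cut to 0.\<close>
  have B0: "0 \<le> B0"
  proof (rule LIMSEQ_le_const[OF Blim], intro exI[of _ 0] allI impI)
    fix n
    have "0 \<le> (LINT x|M. w n x * ln (w n x) + 1)" using wl by (intro Bochner_Integration.integral_nonneg) auto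
    also have "\<dots> = (LINT x|M. w n x * ln (w n x)) + 1" using wi by (simp add: prob_space)
    also have "\<dots> \<le> B n" using bound[OF \<eta>, of n] unfolding ent_def w_def[symmetric] B_def by simp
    finally show "0 \<le> B n" .
  qed
  have "(\<integral>\<^sup>+x. ennreal (g x) \<partial>M) = (\<integral>\<^sup>+x. liminf (\<lambda>n. ennreal (w n x * ln (w n x) + 1)) \<partial>M)"
  proof (rule nn_integral_cong)
    fix x
    have "(\<lambda>n. ennreal (w n x * ln (w n x) + 1)) \<longlonglongrightarrow> ennreal (g x)"
      unfolding g_def by (intro tendsto_ennrealI tendsto_intros tendsto_mult_ln[OF wlim w(4)])
    then show "ennreal (g x) = liminf (\<lambda>n. ennreal (w n x * ln (w n x) + 1))"
      by (rule lim_imp_Liminf[OF sequentially_bot, symmetric])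
  qed
  also have "\<dots> \<le> liminf (\<lambda>n. \<integral>\<^sup>+x. ennreal (w n x * ln (w n x) + 1) \<partial>M)"
    by (rule nn_integral_liminf) measurable
  also have "\<dots> \<le> liminf (\<lambda>n. ennreal (B n))" by (rule Liminf_mono) (use wB in auto)
  also have "\<dots> = ennreal B0" by (rule lim_imp_Liminf[OF sequentially_bot tendsto_ennrealI[OF Blim]])
  finally have gB: "(\<integral>\<^sup>+x. ennreal (g x) \<partial>M) \<le> ennreal B0" .
  have gi: "integrable M g"
    by (rule integrableI_nonneg) (use g0 le_less_trans[OF gB ennreal_less_top] in auto)
  then have "integrable M (\<lambda>x. g x - 1)" by simp
  then show I: "integrable M (\<lambda>x. (F x)\<^sup>2 * ln ((F x)\<^sup>2))" by (simp add: g_def)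
  have "ennreal (LINT x|M. g x) \<le> ennreal B0"
    using gB nn_integral_eq_integral[OF gi] g0 by simp
  then have "(LINT x|M. g x) \<le> B0" using B0 by (simp add: ennreal_le_iff)
  moreover have "(LINT x|M. g x) = (LINT x|M. (F x)\<^sup>2 * ln ((F x)\<^sup>2)) + 1"
    unfolding g_def using I by (simp add: prob_space)
  ultimately show "(LINT x|M. (F x)\<^sup>2 * ln ((F x)\<^sup>2)) \<le> R + (LINT x|M. (F x)\<^sup>2) * ln (LINT x|M. (F x)\<^sup>2)"
    unfolding B0_def by simp
qed

theorem theorem4p2:
  fixes \<alpha> H C\<^sub>1 C\<^sub>2 C Chat :: real
    and \<nu> :: "(real \<Rightarrow>\<^sub>C (real^'n)) measure"
    and F :: "(real \<Rightarrow>\<^sub>C (real^'n)) \<Rightarrow> real"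
    and DF :: "(real \<Rightarrow>\<^sub>C (real^'n)) \<Rightarrow> (real \<Rightarrow>\<^sub>C (real^'n))"
  assumes "\<alpha> > 0" and "1/2 < H" and "H < 1"
    and "fractional_OU_measure \<alpha> H \<nu>"
    and "\<And>s t. 0 < t \<Longrightarrow> t \<le> s \<Longrightarrow> s \<le> 1 \<Longrightarrow> \<bar>K_kernel H s t\<bar> \<le> C\<^sub>1 * t powr (1/2 - H)"
    and "\<And>s. 0 < s \<Longrightarrow> s \<le> 1 \<Longrightarrow>
      (LINT u:{0..s}|lebesgue. (s powr (1/2 - H) - u powr (1/2 - H)) / (s - u) powr (1/2 + H))
        = C\<^sub>2 * s powr (1 - 2*H)"
    and "C = 1 / ((Gamma (3/2 - H))\<^sup>2 * (2 - 2*H)) + 4 / ((Gamma (3/2 - H))\<^sup>2 * (2 - 2*H))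
      + C\<^sub>2\<^sup>2 * (H - 1/2)\<^sup>2 / ((Gamma (3/2 - H))\<^sup>2 * (2 - 2*H))"
    and "Chat = C\<^sub>1\<^sup>2 / ((Gamma (3/2 - H))\<^sup>2 * (2 - 2*H)) + 4 * C\<^sub>1\<^sup>2 / ((Gamma (3/2 - H))\<^sup>2 * (2 - 2*H))
      + 2 * (c_const H)\<^sup>2 * ((Beta (H - 1/2) (3/2 - H))\<^sup>2 + 1 / (H - 1/2)\<^sup>2) / (Gamma (3/2 - H))\<^sup>2
      + C\<^sub>1\<^sup>2 * C\<^sub>2\<^sup>2 * (H - 1/2)\<^sup>2 / ((Gamma (3/2 - H))\<^sup>2 * (2 - 2*H))"
    and "(F, DF) \<in> closed_gradient_graph H \<nu>"
  shows "integrable (completion \<nu>) (\<lambda>\<omega>. (F \<omega>)\<^sup>2 * ln ((F \<omega>)\<^sup>2)) \<and>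
    (LINT \<omega>|completion \<nu>. (F \<omega>)\<^sup>2 * ln ((F \<omega>)\<^sup>2))
      \<le> 4 * (1 + 4 * \<alpha>^4 * exp (2*\<alpha>) * C\<^sub>1\<^sup>2 * (1 + \<alpha>\<^sup>2) * C / (2 - 2*H) + 2 * \<alpha>\<^sup>2 * Chat / (2 - 2*H))
          * HH_inner H \<nu> DF DF
        + (LINT \<omega>|completion \<nu>. (F \<omega>)\<^sup>2) * ln (LINT \<omega>|completion \<nu>. (F \<omega>)\<^sup>2)"
proof -
  interpret hurst_parameter H by unfold_locales (rule assms)+
  have \<alpha>: "0 \<le> \<alpha>" using assms(1) by simp
  interpret N: prob_space "completion \<nu>"
    using assms(4) by (intro prob_space.prob_space_completion) (simp add: fractional_OU_measure_def)
  let ?R = "4 * (1 + 4 * \<alpha>^4 * exp (2*\<alpha>) * C\<^sub>1\<^sup>2 * (1 + \<alpha>\<^sup>2) * C / (2 - 2*H) + 2 * \<alpha>\<^sup>2 * Chat / (2 - 2*H)) * HH_inner H \<nu> DF DF"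
  have F: "F \<in> borel_measurable (completion \<nu>)" "integrable (completion \<nu>) (\<lambda>\<omega>. (F \<omega>)\<^sup>2)"
    using assms(9) by (auto simp: closed_gradient_graph_def L2_fun_def)
  have "ent (completion \<nu>) (\<lambda>\<omega>. sq_trunc \<eta> (F \<omega>)) \<le> ?R" if "0 < \<eta>" "\<eta> < 1" for \<eta>
  proof -
    have "ent (completion \<nu>) (\<lambda>\<omega>. sq_trunc \<eta> (F \<omega>)) \<le> 4 * (1 + \<alpha>\<^sup>2 * (1 + \<alpha>)\<^sup>2 / (1 - 2 * \<beta>)) * HH_inner H \<nu> DF DF"
      by (rule closed_gradient_log_sobolev[OF \<alpha> assms(4,9) that])
    \<comment> \<open>The comparison of constants is multiplied by the energy of DF, which is
      nonnegative.\<close>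
    also have "\<dots> \<le> ?R"
      using constant_le[OF assms(5) assms(1) assms(7,8)] by (intro mult_right_mono HH_inner_nonneg) simp
    finally show ?thesis .
  qed
  from N.log_sobolev_of_sq_trunc[OF F this] show ?thesis by blast
qed

end
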